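(* Let $\mu,\sigma>0$ and $f\in H^3(\mathbb{R})$. With the notation of the context, the two-phase boundary value problem $$\left.\begin{array}{rcll} \mu\Delta v^\pm-\nabla q^\pm&=&0&\text{in }\Omega^\pm,\\ \operatorname{div} v^\pm&=&0&\text{in }\Omega^\pm,\\ v^+&=&v^-&\text{on }\Gamma,\\ {}[T(v,q)](\nu\circ\Xi^{-1})&=&-\sigma(\kappa\nu)\circ\Xi^{-1}&\text{on }\Gamma,\\ (v^\pm,q^\pm)(x)&\to&0&\text{for }|x|\to\infty \end{array}\right\}$$ has a unique solution $$(v^\pm,q^\pm)\in\big(\mathrm{C}^2(\Omega^\pm,\mathbb{R}^2)\cap \mathrm{C}^1(\overline{\Omega^\pm},\mathbb{R}^2)\big)\times\big(\mathrm{C}^1(\Omega^\pm)\cap \mathrm{C}(\overline{\Omega^\pm})\big),$$ and it is given by $(v^\pm,q^\pm)=(v,q)|_{\Omega^\pm}$, where for $x\in\mathbb{R}^2\setminus\Gamma$ $$v(x):=\sigma\sum_{k=1}^2\int_{\mathbb{R}}\partial_s\big(\mathcal{U}^k(x-(s,f(s)))\big)g_k(s)\,ds,\qquad q(x):=-\sigma\sum_{k=1}^2\int_{\mathbb{R}}\mathcal{P}^k(x-(s,f(s)))\,g_k'(s)\,ds.$$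
   Context: Geometry: $\Omega^\pm:=\{(x_1,x_2)\in\mathbb{R}^2: x_2\gtrless f(x_1)\}$, $\Gamma:=\partial\Omega^\pm=\{(\xi,f(\xi)):\xi\in\mathbb{R}\}$, $\Xi:\mathbb{R}\to\Gamma$, $\Xi(\xi)=(\xi,f(\xi))$. Put $\omega:=(1+f'^2)^{1/2}$, $\nu:=\omega^{-1}(-f',1)^\top$ (pull-back under $\Xi$ of the unit normal on $\Gamma$ exterior to $\Omega^-$), $\kappa:=\omega^{-3}f''$ (pull-back of the curvature), and $g=(g_1,g_2)^\top:=(\omega^{-1}-1,\ \omega^{-1}f')^\top$ (so that $\kappa\nu=\omega^{-1}g'$ and $g_1,g_2\in H^2(\mathbb{R})$). Jump: for functions $z^\pm$ on $\Omega^\pm$ having limits at a point $p\in\Gamma$, $[z](p):=\lim_{\Omega^+\ni x\to p}z^+(x)-\lim_{\Omega^-\ni x\to p}z^-(x)$. Stress tensor: $T(v,q)=(T_{ij}(v,q))_{1\le i,j\le2}$ with $T_{ij}(v,q):=-q\delta_{ij}+\mu(\partial_iv_j+\partial_jv_i)$. Fundamental solutions of the Stokes equations: for $k=1,2$ and $y\in\mathbb{R}^2\setminus\{0\}$, $\mathcal{U}^k=(\mathcal{U}^k_1,\mathcal{U}^k_2)^\top$, $$\mathcal{U}^k_j(y)=-\frac{1}{4\pi\mu}\Big(\delta_{jk}\ln\frac1{|y|}+\frac{y_jy_k}{|y|^2}\Big),\qquad \mathcal{P}^k(y)=-\frac1{2\pi}\frac{y_k}{|y|^2}.$$ *)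

theory Defs
  imports "HOL-Analysis.Analysis"
begin

definition square_integrable :: "(real \<Rightarrow> real) \<Rightarrow> bool" where
  "square_integrable h \<longleftrightarrow>
     h \<in> borel_measurable lebesgue \<and> integrable lebesgue (\<lambda>x. (h x)\<^sup>2)"

definition test_function :: "(real \<Rightarrow> real) \<Rightarrow> bool" where
  "test_function \<phi> \<longleftrightarrow>
     (\<forall>n::nat. (deriv ^^ n) \<phi> differentiable_on UNIV) \<and> compact (closure {x. \<phi> x \<noteq> 0})"

text \<open>For square integrable functions all integrands below are integrable.\<close>

definition weak_derivative :: "nat \<Rightarrow> (real \<Rightarrow> real) \<Rightarrow> (real \<Rightarrow> real) \<Rightarrow> bool" where
  "weak_derivative n f h \<longleftrightarrow>
     (\<forall>\<phi>. test_function \<phi> \<longrightarrow>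
        (LINT x|lebesgue. f x * (deriv ^^ n) \<phi> x) = (- 1) ^ n * (LINT x|lebesgue. h x * \<phi> x))"

text \<open>Members of this set are functions, not classes modulo null sets; a pointwise use of a
  Sobolev function has to single out its continuous representative.\<close>

definition sobolev_H :: "nat \<Rightarrow> (real \<Rightarrow> real) set" where
  "sobolev_H m =
     {f. square_integrable f \<and>
         (\<forall>n\<in>{1..m}. \<exists>h. square_integrable h \<and> weak_derivative n f h)}"

definition partial :: "'n::finite \<Rightarrow> (real ^ 'n \<Rightarrow> real) \<Rightarrow> real ^ 'n \<Rightarrow> real" where
  "partial i h x = deriv (\<lambda>t. h (x + t *\<^sub>R axis i 1)) 0"

text \<open>The following is meant for open sets \<open>S\<close>.\<close>

primrec C_k :: "nat \<Rightarrow> (real ^ 'n::finite) set \<Rightarrow> (real ^ 'n \<Rightarrow> real) \<Rightarrow> bool" where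
  "C_k 0 S h \<longleftrightarrow> continuous_on S h"
| "C_k (Suc k) S h \<longleftrightarrow>
     continuous_on S h \<and>
     (\<forall>i. (\<forall>x\<in>S. (\<lambda>t. h (x + t *\<^sub>R axis i 1)) differentiable (at 0)) \<and> C_k k S (partial i h))"

text \<open>Membership in \<open>C\<^sup>1\<close> of the closure of the open set \<open>S\<close>: the function is continuous on the
  closure, and the first order partial derivatives taken in \<open>S\<close> extend continuously to the
  closure. Neither boundedness nor uniform continuity is demanded.\<close>

definition C1_closure :: "(real ^ 'n::finite) set \<Rightarrow> (real ^ 'n \<Rightarrow> real) \<Rightarrow> bool" where
  "C1_closure S h \<longleftrightarrow>
     C_k 1 S h \<and> continuous_on (closure S) h \<and>
     (\<forall>i. \<exists>d. continuous_on (closure S) d \<and> (\<forall>x\<in>S. d x = partial i h x))"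

definition laplacian :: "(real ^ 'n::finite \<Rightarrow> real) \<Rightarrow> real ^ 'n \<Rightarrow> real" where
  "laplacian h x = (\<Sum>i\<in>UNIV. partial i (partial i h) x)"

definition divergence :: "(real ^ 'n::finite \<Rightarrow> real ^ 'n) \<Rightarrow> real ^ 'n \<Rightarrow> real" where
  "divergence v x = (\<Sum>i\<in>UNIV. partial i (\<lambda>y. v y $ i) x)"

definition upper_domain :: "(real \<Rightarrow> real) \<Rightarrow> (real ^ 2) set" where
  "upper_domain f = {x. x $ 2 > f (x $ 1)}"

definition lower_domain :: "(real \<Rightarrow> real) \<Rightarrow> (real ^ 2) set" where
  "lower_domain f = {x. x $ 2 < f (x $ 1)}"

definition Xi :: "(real \<Rightarrow> real) \<Rightarrow> real \<Rightarrow> real ^ 2" where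
  "Xi f \<xi> = vector [\<xi>, f \<xi>]"

definition interface :: "(real \<Rightarrow> real) \<Rightarrow> (real ^ 2) set" where
  "interface f = range (Xi f)"

definition omega :: "(real \<Rightarrow> real) \<Rightarrow> real \<Rightarrow> real" where
  "omega f \<xi> = sqrt (1 + (deriv f \<xi>)\<^sup>2)"

text \<open>Unit normal pointing from the lower into the upper domain.\<close>

definition normal :: "(real \<Rightarrow> real) \<Rightarrow> real \<Rightarrow> real ^ 2" where
  "normal f \<xi> = (1 / omega f \<xi>) *\<^sub>R vector [- deriv f \<xi>, 1]"

definition curvature :: "(real \<Rightarrow> real) \<Rightarrow> real \<Rightarrow> real" where
  "curvature f \<xi> = deriv (deriv f) \<xi> / omega f \<xi> ^ 3"

definition g_vec :: "(real \<Rightarrow> real) \<Rightarrow> real \<Rightarrow> real ^ 2" where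
  "g_vec f \<xi> = vector [1 / omega f \<xi> - 1, deriv f \<xi> / omega f \<xi>]"

text \<open>Here \<open>Lim\<close> is an unspecified value if the one-sided limit does not exist; the regularity
  demanded of solutions below guarantees existence wherever the jump is used.\<close>

definition jump ::
    "(real \<Rightarrow> real) \<Rightarrow> (real ^ 2 \<Rightarrow> 'a) \<Rightarrow> (real ^ 2 \<Rightarrow> 'a) \<Rightarrow> real ^ 2 \<Rightarrow> 'a::real_normed_vector" where
  "jump f zp zm p = Lim (at p within upper_domain f) zp - Lim (at p within lower_domain f) zm"

definition stress ::
    "real \<Rightarrow> (real ^ 2 \<Rightarrow> real ^ 2) \<Rightarrow> (real ^ 2 \<Rightarrow> real) \<Rightarrow> real ^ 2 \<Rightarrow> real ^ 2 ^ 2" where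
  "stress \<mu> v q x =
     (\<chi> i j. - q x * (if i = j then 1 else 0)
        + \<mu> * (partial i (\<lambda>y. v y $ j) x + partial j (\<lambda>y. v y $ i) x))"

definition stokes_regular ::
    "(real ^ 2) set \<Rightarrow> (real ^ 2 \<Rightarrow> real ^ 2) \<Rightarrow> (real ^ 2 \<Rightarrow> real) \<Rightarrow> bool" where
  "stokes_regular S v q \<longleftrightarrow>
     (\<forall>j. C_k 2 S (\<lambda>x. v x $ j) \<and> C1_closure S (\<lambda>x. v x $ j)) \<and>
     C_k 1 S q \<and> continuous_on (closure S) q"

definition stokes_equations ::
    "real \<Rightarrow> (real ^ 2) set \<Rightarrow> (real ^ 2 \<Rightarrow> real ^ 2) \<Rightarrow> (real ^ 2 \<Rightarrow> real) \<Rightarrow> bool" where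
  "stokes_equations \<mu> S v q \<longleftrightarrow>
     (\<forall>x\<in>S. (\<forall>j. \<mu> * laplacian (\<lambda>y. v y $ j) x - partial j q x = 0) \<and> divergence v x = 0)"

definition vanishes_at_infinity ::
    "(real ^ 2) set \<Rightarrow> (real ^ 2 \<Rightarrow> 'a::real_normed_vector) \<Rightarrow> bool" where
  "vanishes_at_infinity S z \<longleftrightarrow> (z \<longlongrightarrow> 0) (inf at_infinity (principal S))"

text \<open>The functions with suffix \<open>p\<close> live on the closure of the upper domain, those with suffix
  \<open>m\<close> on the closure of the lower domain; their values elsewhere are irrelevant.\<close>

definition two_phase_stokes_solution ::
    "real \<Rightarrow> real \<Rightarrow> (real \<Rightarrow> real) \<Rightarrow>
     (real ^ 2 \<Rightarrow> real ^ 2) \<Rightarrow> (real ^ 2 \<Rightarrow> real) \<Rightarrow>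
     (real ^ 2 \<Rightarrow> real ^ 2) \<Rightarrow> (real ^ 2 \<Rightarrow> real) \<Rightarrow> bool" where
  "two_phase_stokes_solution \<mu> \<sigma> f vp qp vm qm \<longleftrightarrow>
     stokes_regular (upper_domain f) vp qp \<and>
     stokes_regular (lower_domain f) vm qm \<and>
     stokes_equations \<mu> (upper_domain f) vp qp \<and>
     stokes_equations \<mu> (lower_domain f) vm qm \<and>
     (\<forall>p\<in>interface f. vp p = vm p) \<and>
     (\<forall>p\<in>interface f.
        jump f (stress \<mu> vp qp) (stress \<mu> vm qm) p *v (normal f \<circ> inv (Xi f)) p
          = - \<sigma> *\<^sub>R ((\<lambda>\<xi>. curvature f \<xi> *\<^sub>R normal f \<xi>) \<circ> inv (Xi f)) p) \<and>
     vanishes_at_infinity (closure (upper_domain f)) vp \<and>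
     vanishes_at_infinity (closure (upper_domain f)) qp \<and>
     vanishes_at_infinity (closure (lower_domain f)) vm \<and>
     vanishes_at_infinity (closure (lower_domain f)) qm"

definition stokes_U :: "real \<Rightarrow> 2 \<Rightarrow> real ^ 2 \<Rightarrow> real ^ 2" where
  "stokes_U \<mu> k y =
     (\<chi> j. - (1 / (4 * pi * \<mu>)) *
        ((if j = k then 1 else 0) * ln (1 / norm y) + y $ j * y $ k / (norm y)\<^sup>2))"

definition stokes_P :: "2 \<Rightarrow> real ^ 2 \<Rightarrow> real" where
  "stokes_P k y = - (1 / (2 * pi)) * (y $ k / (norm y)\<^sup>2)"

definition velocity_integrand ::
    "real \<Rightarrow> (real \<Rightarrow> real) \<Rightarrow> real ^ 2 \<Rightarrow> 2 \<Rightarrow> real \<Rightarrow> real ^ 2" where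
  "velocity_integrand \<mu> f x k s =
     (g_vec f s $ k) *\<^sub>R vector_derivative (\<lambda>r. stokes_U \<mu> k (x - Xi f r)) (at s)"

definition pressure_integrand ::
    "(real \<Rightarrow> real) \<Rightarrow> real ^ 2 \<Rightarrow> 2 \<Rightarrow> real \<Rightarrow> real" where
  "pressure_integrand f x k s = stokes_P k (x - Xi f s) * deriv (\<lambda>r. g_vec f r $ k) s"

definition velocity_potential :: "real \<Rightarrow> real \<Rightarrow> (real \<Rightarrow> real) \<Rightarrow> real ^ 2 \<Rightarrow> real ^ 2" where
  "velocity_potential \<mu> \<sigma> f x =
     \<sigma> *\<^sub>R (\<Sum>k\<in>UNIV. LINT s|lborel. velocity_integrand \<mu> f x k s)"

definition pressure_potential :: "real \<Rightarrow> (real \<Rightarrow> real) \<Rightarrow> real ^ 2 \<Rightarrow> real" where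
  "pressure_potential \<sigma> f x =
     - \<sigma> * (\<Sum>k\<in>UNIV. LINT s|lborel. pressure_integrand f x k s)"

end

(*
  The plane is identified with the complex numbers. By Goursat's formula, v is locally
  A + cnj B - z * cnj A' and q is proportional to Re A', with A, B holomorphic. The layer potentials
  of the theorem have this form: A' and the conjugate derivative of v are Cauchy-type integrals over
  the graph with the kernels 1/w and cnj w / w^2 and the density g'. The function f is twice
  differentiable with f', f'' in L^2 and Hoelder continuous of exponent 1/2 (Morrey's embedding,
  obtained by mollification), and for such densities the Cauchy-type integrals extend continuously to
  the graph from either side and decay at infinity. Their explicit jumps (Plemelj) yield the continuity
  of the velocity and the prescribed jump of the stress.

  For uniqueness, consider the difference of two solutions. Differentiating the continuity of v along
  the graph and combining it with the stress condition and div v = 0 shows that the velocity gradient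
  and the pressure are continuous across the graph. So q - 2 mu d_z v, which is holomorphic off the
  graph, is entire. Its real part is q since d_z v is imaginary, and q vanishes at infinity, so
  Liouville's theorem gives q = 0 and d_z v = k for a constant k. Then cnj (v - k z) is entire as well,
  and the decay of v forces k = 0 and v = 0.
*)
theory Submission
  imports Defs "HOL-Complex_Analysis.Complex_Analysis"
begin

text \<open>Kernels of size 1/|w| are not absolutely integrable along the graph, and the densities,
  merely Hoelder and square integrable on an unbounded curve, give no rate of decay. Both obstacles
  are met by integrating in t with curve point \<open>Z (Re z + t)\<close>: the horizontal distance
  |t| bounds the kernel whatever the height of z. For |t| \<le> 1 the only singular remainder is the
  kernel integrated against dZ, which a logarithm evaluates; for large |t|, weighted AM-GM and
  translation invariance make the tails small uniformly in z. The same estimates give boundary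
  values and decay, and since each one-sided extension is a formula on the whole plane, jumps become
  algebra.

  A sign \<sigma> = 1 or -1 selects the side, so each one-sided fact has a single proof; the surface
  tension is then written \<open>\<sigma>0\<close>.

  In the uniqueness part only v and q are known to vanish at infinity, not the gradient, so the
  boundary terms of an energy identity could not be controlled; Liouville's theorem works with these
  limits alone. A curved interface offers no reflection principle, so holomorphy across it is
  obtained by gluing primitives.\<close>

section \<open>Integration tools\<close>

lemma has_field_derivative_lebesgue_integral:
  fixes h :: "'a::{real_normed_field, euclidean_space} \<Rightarrow> 'b \<Rightarrow> 'a"
  assumes r: "r > 0"
    and der: "\<And>z s. z \<in> ball z0 r \<Longrightarrow> ((\<lambda>z. h z s) has_field_derivative h' z s) (at z)"
    and int: "\<And>z. z \<in> ball z0 r \<Longrightarrow> integrable M (h z)"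
    and bound: "\<And>z s. z \<in> ball z0 r \<Longrightarrow> norm (h' z s) \<le> m s"
    and m: "integrable M m"
  shows "((\<lambda>z. LINT s|M. h z s) has_field_derivative (LINT s|M. h' z0 s)) (at z0)" (is ?A)
    and "integrable M (h' z0)" (is ?B)
proof -
  have quot: "(\<lambda>n. (h (X n) s - h z0 s) / (X n - z0)) \<longlonglongrightarrow> h' z0 s"
    if "\<And>n. X n \<noteq> z0" "X \<longlonglongrightarrow> z0" for X :: "nat \<Rightarrow> 'a" and s
  proof -
    have "((\<lambda>z. (h z s - h z0 s) / (z - z0)) \<longlongrightarrow> h' z0 s) (at z0)"
      using der[of z0 s] r by (simp add: has_field_derivative_iff)
    thus ?thesis using that by (auto simp: tendsto_at_iff_sequentially o_def)
  qed
  \<comment> \<open>An explicit sequence in the ball; its difference quotients exhibit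
    \<open>h' z0\<close> as a pointwise limit of measurable functions.\<close>
  define Y :: "nat \<Rightarrow> 'a" where "Y n = z0 + of_real (r / 2 * inverse (real (Suc n)))" for n
  have Yne: "Y n \<noteq> z0" for n
  proof -
    have "r / 2 * inverse (real (Suc n)) \<noteq> 0" using r by simp
    thus ?thesis unfolding Y_def by (metis add_cancel_left_right of_real_eq_0_iff)
  qed
  have Yl: "Y \<longlonglongrightarrow> z0"
  proof -
    have "(\<lambda>n. z0 + of_real (r / 2 * inverse (real (Suc n)))) \<longlonglongrightarrow> z0 + of_real (r / 2 * 0)"
      by (intro tendsto_add tendsto_const tendsto_of_real tendsto_mult LIMSEQ_inverse_real_of_nat)
    thus ?thesis by (simp add: Y_def[abs_def])
  qed
  have Yb: "Y n \<in> ball z0 r" for n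
  proof -
    have "inverse (real (Suc n)) \<le> 1" by (simp add: inverse_le_1_iff)
    hence "r / 2 * inverse (real (Suc n)) \<le> r / 2 * 1" using r by (intro mult_left_mono) auto
    moreover have "0 \<le> r / 2 * inverse (real (Suc n))" using r by simp
    ultimately show ?thesis using r unfolding Y_def mem_ball dist_norm
      by (simp only: norm_minus_commute[of z0] add_diff_cancel_left' norm_of_real)
  qed
  have meas: "h' z0 \<in> borel_measurable M"
  proof (rule borel_measurable_LIMSEQ_metric)
    show "(\<lambda>n. (h (Y n) s - h z0 s) / (Y n - z0)) \<longlonglongrightarrow> h' z0 s" for s
      using quot[OF Yne Yl] .
    show "(\<lambda>s. (h (Y n) s - h z0 s) / (Y n - z0)) \<in> borel_measurable M" for n
    proof -
      have "integrable M (\<lambda>s. (h (Y n) s - h z0 s) / (Y n - z0))"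
        using int[OF Yb] int[of z0] r by auto
      thus ?thesis by simp
    qed
  qed
  \<comment> \<open>The mean value inequality on the convex ball turns the bound on
    \<open>h'\<close> into a dominating function for all difference quotients.\<close>
  have lip: "norm ((h z s - h z0 s) / (z - z0)) \<le> m s" if "z \<in> ball z0 r" "z \<noteq> z0" for z s
  proof -
    have "norm (h z s - h z0 s) \<le> m s * norm (z - z0)"
    proof (rule field_differentiable_bound[of "ball z0 r" _ "\<lambda>z. h' z s"])
      show "((\<lambda>z. h z s) has_field_derivative h' z s) (at z within ball z0 r)" if "z \<in> ball z0 r" for z
        using der[OF that] by (rule has_field_derivative_at_within)
    qed (use that r bound in auto)
    thus ?thesis using that by (simp add: norm_divide field_simps)
  qed
  show ?B
  proof (rule Bochner_Integration.integrable_bound[OF m meas])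
    show "AE s in M. norm (h' z0 s) \<le> norm (m s)"
      using order_trans[OF bound[of z0] abs_ge_self] r by auto
  qed
  show ?A unfolding has_field_derivative_iff tendsto_at_iff_sequentially o_def
  proof safe
    fix X :: "nat \<Rightarrow> 'a" assume X: "\<forall>i. X i \<in> UNIV - {z0}" "X \<longlonglongrightarrow> z0"
    obtain N where N: "\<And>n. n \<ge> N \<Longrightarrow> X n \<in> ball z0 r"
      using metric_LIMSEQ_D[OF X(2) r] by (auto simp: dist_commute)
    have Xn: "X (n + N) \<in> ball z0 r" "X (n+N) \<noteq> z0" for n using N X by auto
    have "(\<lambda>n. LINT s|M. (h (X (n+N)) s - h z0 s) / (X (n+N) - z0)) \<longlonglongrightarrow> (LINT s|M. h' z0 s)"
    proof (rule integral_dominated_convergence[OF meas _ m])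
      show "(\<lambda>s. (h (X (n+N)) s - h z0 s) / (X (n+N) - z0)) \<in> borel_measurable M" for n
      proof -
        have "integrable M (\<lambda>s. (h (X (n+N)) s - h z0 s) / (X (n+N) - z0))"
          using int[OF Xn(1)] int[of z0] r by auto
        thus ?thesis by simp
      qed
      show "AE s in M. (\<lambda>n. (h (X (n+N)) s - h z0 s) / (X (n+N) - z0)) \<longlonglongrightarrow> h' z0 s"
        using X by (intro AE_I2 quot LIMSEQ_ignore_initial_segment) auto
      show "AE s in M. norm ((h (X (n+N)) s - h z0 s) / (X (n+N) - z0)) \<le> m s" for n
        using lip Xn by auto
    qed
    moreover have "(LINT s|M. (h (X (n+N)) s - h z0 s) / (X (n+N) - z0))
       = ((LINT s|M. h (X (n+N)) s) - (LINT s|M. h z0 s)) / (X (n+N) - z0)" for n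
      using int[OF Xn(1)] int[of z0] r by simp
    ultimately have "(\<lambda>n. ((LINT s|M. h (X (n+N)) s) - (LINT s|M. h z0 s)) / (X (n+N) - z0))
        \<longlonglongrightarrow> (LINT s|M. h' z0 s)" by (simp only:)
    thus "(\<lambda>n. ((LINT s|M. h (X n) s) - (LINT s|M. h z0 s)) / (X n - z0))
        \<longlonglongrightarrow> (LINT s|M. h' z0 s)"
      by (rule LIMSEQ_offset[where k = N])
  qed
qed

lemma integrable_inverse_square_line: "integrable lborel (\<lambda>x::real. 1 / (1 + x\<^sup>2))"
proof -
  have "set_integrable lborel (einterval (-\<infinity>) \<infinity>) (\<lambda>x::real. 1 / (1 + x\<^sup>2))"
  proof (rule interval_integral_FTC_nonneg[where F = arctan and A = "- pi/2" and B = "pi/2"])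
    show "DERIV arctan x :> 1 / (1 + x\<^sup>2)" for x :: real
      using DERIV_arctan[of x] by (simp add: inverse_eq_divide)
    show "isCont (\<lambda>x. 1 / (1 + x\<^sup>2)) x" for x :: real
      by (intro continuous_intros) (smt (verit) zero_le_power2)
    show "((arctan \<circ> real_of_ereal) \<longlongrightarrow> - pi / 2) (at_right (- \<infinity>))"
      unfolding ereal_tendsto_simps1 using tendsto_arctan_at_bot by simp
    show "((arctan \<circ> real_of_ereal) \<longlongrightarrow> pi / 2) (at_left \<infinity>)"
      unfolding ereal_tendsto_simps1 using tendsto_arctan_at_top by simp
  qed auto
  thus ?thesis by (simp add: set_integrable_def)
qed

lemma integrable_mult_L2:
  fixes u v :: "'b \<Rightarrow> 'a::{real_normed_field, euclidean_space}"
  assumes [measurable]: "u \<in> borel_measurable M" "v \<in> borel_measurable M"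
    and "integrable M (\<lambda>s. (norm (u s))\<^sup>2)" "integrable M (\<lambda>s. (norm (v s))\<^sup>2)"
  shows "integrable M (\<lambda>s. u s * v s)"
proof (rule Bochner_Integration.integrable_bound)
  show "integrable M (\<lambda>s. (norm (u s))\<^sup>2 + (norm (v s))\<^sup>2)" using assms by auto
  show "AE s in M. norm (u s * v s) \<le> norm ((norm (u s))\<^sup>2 + (norm (v s))\<^sup>2)"
  proof (intro AE_I2)
    fix s
    have "norm (u s) * norm (v s) \<le> (norm (u s))\<^sup>2 + (norm (v s))\<^sup>2"
      using sum_squares_bound[of "norm (u s)" "norm (v s)"]
        mult_nonneg_nonneg[OF norm_ge_zero[of "u s"] norm_ge_zero[of "v s"]] by linarith
    thus "norm (u s * v s) \<le> norm ((norm (u s))\<^sup>2 + (norm (v s))\<^sup>2)"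
      by (simp add: norm_mult)
  qed
qed simp

section \<open>Regularity of Sobolev functions\<close>

text \<open>Peeling derivatives off at the inner end lets closure properties go by induction with
  the function generalised; \<open>ndiff_imp_differentiable\<close> converts to the iterates of
  \<open>deriv\<close> that \<open>test_function\<close> speaks of.\<close>

primrec ndiff :: "nat \<Rightarrow> (real \<Rightarrow> real) \<Rightarrow> bool" where
  "ndiff 0 f \<longleftrightarrow> True"
| "ndiff (Suc n) f \<longleftrightarrow> f differentiable_on UNIV \<and> ndiff n (deriv f)"

lemma ndiff_Suc_imp: "ndiff (Suc n) f \<Longrightarrow> ndiff n f"
  by (induction n arbitrary: f) auto

lemma differentiable_deriv:
  fixes f :: "real \<Rightarrow> real"
  assumes "f differentiable_on UNIV"
  shows "(f has_real_derivative deriv f x) (at x)"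
  using assms unfolding differentiable_on_def
  by (meson DERIV_deriv_iff_real_differentiable UNIV_I)

lemma ndiffI:
  assumes "\<And>x. (f has_real_derivative f' x) (at x)" "ndiff n f'"
  shows "ndiff (Suc n) f"
proof -
  have "deriv f = f'" using assms(1) DERIV_imp_deriv by blast
  moreover have "f differentiable_on UNIV"
    unfolding differentiable_on_def using assms(1) real_differentiable_def by blast
  ultimately show ?thesis using assms(2) by simp
qed

lemma ndiff_add: "ndiff n f \<Longrightarrow> ndiff n g \<Longrightarrow> ndiff n (\<lambda>x. f x + g x)"
proof (induction n arbitrary: f g)
  case (Suc n)
  show ?case
  proof (rule ndiffI)
    show "((\<lambda>x. f x + g x) has_real_derivative deriv f x + deriv g x) (at x)" for x
      using Suc.prems by (intro DERIV_add differentiable_deriv) auto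
  qed (use Suc in auto)
qed auto

lemma ndiff_mult: "ndiff n f \<Longrightarrow> ndiff n g \<Longrightarrow> ndiff n (\<lambda>x. f x * g x)"
proof (induction n arbitrary: f g)
  case (Suc n)
  show ?case
  proof (rule ndiffI)
    show "((\<lambda>x. f x * g x) has_real_derivative deriv f x * g x + deriv g x * f x) (at x)" for x
      using Suc.prems by (intro DERIV_mult differentiable_deriv) auto
    show "ndiff n (\<lambda>x. deriv f x * g x + deriv g x * f x)"
      using Suc.prems by (intro ndiff_add Suc.IH) (auto intro: ndiff_Suc_imp)
  qed
qed auto

lemma ndiff_const: "ndiff n (\<lambda>x. c)"
proof (induction n arbitrary: c)
  case (Suc n)
  show ?case by (rule ndiffI[where f' = "\<lambda>_. 0"]) (use Suc in auto)
qed auto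

lemma ndiff_compose_affine: "ndiff n f \<Longrightarrow> ndiff n (\<lambda>x. f (a * x + b))"
proof (induction n arbitrary: f)
  case (Suc n)
  show ?case
  proof (rule ndiffI)
    show "((\<lambda>x. f (a * x + b)) has_real_derivative deriv f (a * x + b) * a) (at x)" for x
      using Suc.prems
      by (intro DERIV_chain2[OF differentiable_deriv]) (auto intro!: derivative_eq_intros)
    show "ndiff n (\<lambda>x. deriv f (a * x + b) * a)"
      using Suc.prems by (intro ndiff_mult ndiff_const Suc.IH) auto
  qed
qed auto

lemma ndiff_imp_differentiable: "ndiff (Suc n) f \<Longrightarrow> (deriv ^^ n) f differentiable_on UNIV"
proof (induction n arbitrary: f)
  case (Suc n)
  hence "(deriv ^^ n) (deriv f) differentiable_on UNIV" by simp
  thus ?case by (simp add: funpow_swap1)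
qed simp

text \<open>The classical functions flat at the origin. The polynomial parameter makes the family
  closed under differentiation, so a single derivative computation yields smoothness of every
  order.\<close>

definition flat :: "real poly \<Rightarrow> real \<Rightarrow> real" where
  "flat p x = (if x > 0 then poly p (1 / x) * exp (- (1 / x)) else 0)"

lemma poly_exp_tendsto_0: "((\<lambda>y. poly p y * exp (- y)) \<longlongrightarrow> (0::real)) at_top"
proof -
  have "((\<lambda>y. \<Sum>i\<le>degree p. coeff p i * (y ^ i / exp y)) \<longlongrightarrow> (\<Sum>i\<le>degree p. coeff p i * 0)) at_top"
    by (intro tendsto_sum tendsto_mult tendsto_const tendsto_power_div_exp_0)
  thus ?thesis by (simp add: poly_altdef sum_distrib_right exp_minus divide_inverse mult.assoc)
qed

text \<open>In y = 1/x the chain rule contributes the factor y^2, which is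
  \<open>[:0, 0, 1:]\<close>. At the origin the right difference quotient is y p(y) exp (-y), which
  tends to 0 as y grows.\<close>

lemma flat_derivative: "(flat p has_real_derivative flat ((p - pderiv p) * [:0, 0, 1:]) x) (at x)"
proof (cases x "0::real" rule: linorder_cases)
  case less
  have "((\<lambda>_. 0) has_real_derivative 0) (at x)" by simp
  moreover have "eventually (\<lambda>y. (0::real) = flat p y) (nhds x)"
    using eventually_nhds_in_open[of "{..<0}" x] less
    by (auto elim!: eventually_mono simp: flat_def)
  ultimately have "(flat p has_real_derivative 0) (at x)"
    using DERIV_cong_ev[OF refl _ refl, of "\<lambda>_. 0" "flat p" x 0] by simp
  thus ?thesis using less by (simp add: flat_def)
next
  case equal
  have "((\<lambda>h. flat p h / h) \<longlongrightarrow> 0) (at_right 0)"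
  proof -
    have "((\<lambda>h. poly (p * [:0, 1:]) (inverse h) * exp (- inverse h)) \<longlongrightarrow> 0) (at_right (0::real))"
      using filterlim_compose[OF poly_exp_tendsto_0 filterlim_inverse_at_top_right] .
    thus ?thesis
      by (rule Lim_transform_eventually)
         (auto simp: eventually_at_filter flat_def field_simps)
  qed
  moreover have "((\<lambda>h. flat p h / h) \<longlongrightarrow> 0) (at_left 0)"
    by (rule Lim_transform_eventually[of "\<lambda>_. 0"]) (auto simp: eventually_at_filter flat_def)
  ultimately have "((\<lambda>h. flat p h / h) \<longlongrightarrow> 0) (at 0)"
    by (simp add: filterlim_split_at)
  thus ?thesis using equal by (simp add: has_field_derivative_iff flat_def)
next
  case greater
  have "((\<lambda>x. poly p (1 / x) * exp (- (1 / x))) has_real_derivative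
      poly ((p - pderiv p) * [:0, 0, 1:]) (1 / x) * exp (- (1 / x))) (at x)"
    using greater
    by (auto intro!: derivative_eq_intros DERIV_chain2[OF poly_DERIV] simp: field_simps power2_eq_square)
  moreover have "eventually (\<lambda>y. poly p (1 / y) * exp (- (1 / y)) = flat p y) (nhds x)"
    using eventually_nhds_in_open[of "{0<..}" x] greater
    by (auto elim!: eventually_mono simp: flat_def)
  ultimately have "(flat p has_real_derivative
      poly ((p - pderiv p) * [:0, 0, 1:]) (1 / x) * exp (- (1 / x))) (at x)"
    using DERIV_cong_ev[OF refl _ refl, of "\<lambda>y. poly p (1 / y) * exp (- (1 / y))" "flat p" x] by blast
  thus ?thesis using greater by (simp add: flat_def)
qed

lemma ndiff_flat: "ndiff n (flat p)"
proof (induction n arbitrary: p)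
  case (Suc n)
  show ?case by (rule ndiffI[OF flat_derivative Suc.IH])
qed auto

lemma flat_1_mono: "x \<le> y \<Longrightarrow> flat 1 x \<le> flat 1 y"
  by (auto simp: flat_def field_simps)

text \<open>A shifted flat function times its mirror image is supported in [-\<delta>, \<delta>];
  dividing by the integral normalises it.\<close>

lemma mollifier_exists:
  fixes \<delta> :: real
  assumes "\<delta> > 0"
  obtains \<rho> where "\<And>n. ndiff n \<rho>" "\<And>x. \<rho> x \<ge> 0" "\<And>x. \<bar>x\<bar> \<ge> \<delta> \<Longrightarrow> \<rho> x = 0"
    "integrable lborel \<rho>" "(LINT x|lborel. \<rho> x) = 1"
proof -
  define \<phi> where "\<phi> x = flat 1 (1 * x + \<delta>) * flat 1 (- 1 * x + \<delta>)" for x :: real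
  have nd: "ndiff n \<phi>" for n
    unfolding \<phi>_def by (intro ndiff_mult ndiff_compose_affine ndiff_flat)
  have nn: "\<phi> x \<ge> 0" for x by (simp add: \<phi>_def flat_def)
  have supp: "\<phi> x = 0" if "\<bar>x\<bar> \<ge> \<delta>" for x
    using that assms by (auto simp: \<phi>_def flat_def)
  have cont: "continuous_on UNIV \<phi>"
    using nd[of 1] by (simp add: differentiable_imp_continuous_on)
  have int: "integrable lborel \<phi>"
  proof -
    have "integrable lborel (\<lambda>x. indicator {-\<delta>..\<delta>} x *\<^sub>R \<phi> x)"
      using borel_integrable_compact[of "{-\<delta>..\<delta>}" \<phi>] continuous_on_subset[OF cont]
      by (simp add: set_integrable_def)
    moreover have "indicator {-\<delta>..\<delta>} x *\<^sub>R \<phi> x = \<phi> x" for x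
      using supp[of x] by (cases "\<bar>x\<bar> \<ge> \<delta>") (auto simp: indicator_def)
    ultimately show ?thesis by (simp only:)
  qed
  \<comment> \<open>For |x| \<le> \<delta>/2 both arguments are at least \<delta>/2, so monotonicity
    of \<open>flat 1\<close> makes m a lower bound. This is what keeps the integral
    positive.\<close>
  define m where "m = flat 1 (\<delta>/2) * flat 1 (\<delta>/2)"
  have m: "m > 0" using assms by (simp add: m_def flat_def)
  have "(LINT x|lborel. indicator {-\<delta>/2..\<delta>/2} x * m) \<le> (LINT x|lborel. \<phi> x)"
  proof (rule integral_mono)
    show "integrable lborel (\<lambda>x. indicator {-\<delta>/2..\<delta>/2} x * m)" using assms by simp
    show "indicator {-\<delta>/2..\<delta>/2} x * m \<le> \<phi> x" for x
      using nn[of x] by (auto simp: indicator_def m_def \<phi>_def flat_1_mono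
          intro!: mult_mono) (auto simp: flat_def)
  qed (rule int)
  moreover have "(LINT x|lborel. indicator {-\<delta>/2..\<delta>/2} x * m) = \<delta> * m"
    using assms by simp
  ultimately have pos: "(LINT x|lborel. \<phi> x) > 0" using m assms by (smt (verit) mult_pos_pos)
  define \<rho> where "\<rho> x = \<phi> x * (1 / (LINT x|lborel. \<phi> x))" for x
  show ?thesis
  proof (rule that[of \<rho>])
    show "ndiff n \<rho>" for n unfolding \<rho>_def by (intro ndiff_mult ndiff_const nd)
    show "\<rho> x \<ge> 0" for x using nn pos by (simp add: \<rho>_def)
    show "\<rho> x = 0" if "\<bar>x\<bar> \<ge> \<delta>" for x using supp[OF that] by (simp add: \<rho>_def)
    show "integrable lborel \<rho>" unfolding \<rho>_def using int by simp
    show "(LINT x|lborel. \<rho> x) = 1" unfolding \<rho>_def using pos by simp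
  qed
qed


lemma deriv_pow_reflect:
  assumes "\<And>n. ndiff n \<rho>"
  shows "(deriv ^^ k) (\<lambda>y. \<rho> (x - y)) = (\<lambda>y. (-1) ^ k * (deriv ^^ k) \<rho> (x - y))"
proof (induction k)
  case (Suc k)
  have "((\<lambda>y. (-1) ^ k * (deriv ^^ k) \<rho> (x - y)) has_real_derivative
      (-1) ^ Suc k * (deriv ^^ Suc k) \<rho> (x - y)) (at y)" for y
  proof -
    have "((\<lambda>y. (deriv ^^ k) \<rho> (x - y)) has_real_derivative deriv ((deriv ^^ k) \<rho>) (x - y) * (-1)) (at y)"
      by (rule DERIV_chain2[OF differentiable_deriv[OF ndiff_imp_differentiable[OF assms]]])
         (auto intro!: derivative_eq_intros)
    from DERIV_cmult[OF this, of "(-1) ^ k"] show ?thesis by simp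
  qed
  thus ?case using Suc by (auto intro!: DERIV_imp_deriv)
qed simp

text \<open>The strict inequality describes an open set, on which vanishing passes from a function
  to its derivative.\<close>

lemma deriv_pow_support:
  assumes "\<And>x. \<bar>x\<bar> \<ge> \<delta> \<Longrightarrow> \<rho> x = (0::real)" "\<bar>x\<bar> > \<delta>"
  shows "(deriv ^^ k) \<rho> x = 0"
  using assms(2)
proof (induction k arbitrary: x)
  case 0
  thus ?case using assms(1) by simp
next
  case (Suc k)
  have "open {x::real. \<bar>x\<bar> > \<delta>}"
    by (intro open_Collect_less continuous_intros)
  hence "eventually (\<lambda>y. (deriv ^^ k) \<rho> y = 0) (nhds x)"
    using Suc by (intro eventually_mono[OF eventually_nhds_in_open[of "{x. \<bar>x\<bar> > \<delta>}" x]]) auto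
  hence "((deriv ^^ k) \<rho> has_real_derivative 0) (at x)"
    using DERIV_cong_ev[OF refl _ refl, of "(deriv ^^ k) \<rho>" "\<lambda>_. 0" x 0] by simp
  thus ?case by (simp add: DERIV_imp_deriv)
qed

text \<open>With the reflected mollifier as test function, the weak derivative identity becomes a
  statement about convolutions.\<close>

lemma test_function_reflect:
  assumes "\<And>n. ndiff n \<rho>" "\<And>x. \<bar>x\<bar> \<ge> \<delta> \<Longrightarrow> \<rho> x = 0"
  shows "test_function (\<lambda>y. \<rho> (x - y))"
  unfolding test_function_def
proof (intro conjI allI)
  show "(deriv ^^ n) (\<lambda>y. \<rho> (x - y)) differentiable_on UNIV" for n
    using ndiff_imp_differentiable[OF ndiff_compose_affine[OF assms(1)], of n "-1" x] by simp
  have "{y. \<rho> (x - y) \<noteq> 0} \<subseteq> {x - \<delta>..x + \<delta>}"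
  proof
    fix y assume "y \<in> {y. \<rho> (x - y) \<noteq> 0}"
    hence "\<not> \<bar>x - y\<bar> \<ge> \<delta>" using assms(2) by auto
    thus "y \<in> {x - \<delta>..x + \<delta>}" by auto
  qed
  thus "compact (closure {y. \<rho> (x - y) \<noteq> 0})"
    using bounded_subset[OF bounded_closed_interval] by (simp add: compact_closure)
qed

section \<open>Convolution and the one-dimensional Morrey embedding\<close>

text \<open>Weak derivatives come as Lebesgue measurable functions, while Tonelli and affine
  substitutions are applied to Borel functions. A Borel representative with the same pairings
  mediates.\<close>

lemma square_integrable_borel:
  assumes "square_integrable h"
  obtains h' where "h' \<in> borel_measurable lborel" "integrable lborel (\<lambda>x. (h' x)\<^sup>2)"
    "\<And>\<phi>. \<phi> \<in> borel_measurable lborel \<Longrightarrow> (LINT x|lebesgue. h x * \<phi> x) = (LINT x|lborel. h' x * \<phi> x)"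
proof -
  have h: "h \<in> borel_measurable lebesgue" "integrable lebesgue (\<lambda>x. (h x)\<^sup>2)"
    using assms by (auto simp: square_integrable_def)
  obtain h' where h': "h' \<in> borel_measurable lborel" "AE x in lborel. h x = h' x"
    using completion_ex_borel_measurable_real[OF h(1)] by blast
  have ae: "AE x in lebesgue. h x = h' x" using h'(2) by (rule AE_completion)
  have m: "h' \<in> borel_measurable lebesgue" using h'(1) by (rule measurable_completion)
  show ?thesis
  proof (rule that[OF h'(1)])
    have "integrable lebesgue (\<lambda>x. (h' x)\<^sup>2)"
      using h(2) by (rule Bochner_Integration.integrable_cong_AE_imp) (use ae m in auto)
    thus "integrable lborel (\<lambda>x. (h' x)\<^sup>2)" using h'(1) by (simp add: integrable_completion)
    fix \<phi> :: "real \<Rightarrow> real" assume p: "\<phi> \<in> borel_measurable lborel"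
    have pm: "\<phi> \<in> borel_measurable lebesgue" using p by (rule measurable_completion)
    have "(LINT x|lebesgue. h x * \<phi> x) = (LINT x|lebesgue. h' x * \<phi> x)"
      by (rule integral_cong_AE) (use ae m h pm in auto)
    also have "\<dots> = (LINT x|lborel. h' x * \<phi> x)"
      using h'(1) p by (intro integral_completion) auto
    finally show "(LINT x|lebesgue. h x * \<phi> x) = (LINT x|lborel. h' x * \<phi> x)" .
  qed
qed

text \<open>Jensen for the probability density \<open>\<rho> (x - y)\<close> in y, followed by
  Tonelli. The bound \<open>B\<close> makes \<open>(u y)\<^sup>2 * \<rho> (x - y)\<close> integrable
  for every x.\<close>

lemma convolution_L2_bound:
  fixes u \<rho> :: "real \<Rightarrow> real"
  assumes [measurable]: "u \<in> borel_measurable lborel" "\<rho> \<in> borel_measurable lborel"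
    and u: "integrable lborel (\<lambda>x. (u x)\<^sup>2)"
    and \<rho>: "\<And>x. \<rho> x \<ge> 0" "\<And>x. \<rho> x \<le> B" "integrable lborel \<rho>" "(LINT x|lborel. \<rho> x) = 1"
  shows "(\<integral>\<^sup>+ x. ennreal ((LINT y|lborel. u y * \<rho> (x - y))\<^sup>2) \<partial>lborel) \<le> ennreal (LINT x|lborel. (u x)\<^sup>2)"
proof -
  have rint: "integrable lborel (\<lambda>y. \<rho> (x - y))" for x
    using lborel_integrable_real_affine_iff[of "-1" \<rho> x] \<rho>(3) by simp
  have rint1: "(LINT y|lborel. \<rho> (x - y)) = 1" for x
    using lborel_integral_real_affine[of "-1" \<rho> x] \<rho>(4) by simp
  have i2: "integrable lborel (\<lambda>y. (u y)\<^sup>2 * \<rho> (x - y))" for x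
  proof (rule Bochner_Integration.integrable_bound)
    show "integrable lborel (\<lambda>y. (u y)\<^sup>2 * B)" using u by simp
    show "AE y in lborel. norm ((u y)\<^sup>2 * \<rho> (x - y)) \<le> norm ((u y)\<^sup>2 * B)"
      using \<rho>(1,2) by (intro AE_I2) (auto simp: abs_mult intro!: mult_left_mono order_trans[OF \<rho>(2) abs_ge_self])
  qed measurable
  have i1: "integrable lborel (\<lambda>y. u y * \<rho> (x - y))" for x
  proof (rule Bochner_Integration.integrable_bound)
    show "integrable lborel (\<lambda>y. (u y)\<^sup>2 * \<rho> (x - y) + \<rho> (x - y))" using i2 rint by simp
    show "AE y in lborel. norm (u y * \<rho> (x - y)) \<le> norm ((u y)\<^sup>2 * \<rho> (x - y) + \<rho> (x - y))"
    proof (intro AE_I2)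
      fix y
      have "\<bar>u y\<bar> \<le> (u y)\<^sup>2 + 1"
        using sum_squares_bound[of "\<bar>u y\<bar>" 1] by auto
      hence "\<bar>u y\<bar> * \<rho> (x - y) \<le> ((u y)\<^sup>2 + 1) * \<rho> (x - y)" using \<rho>(1) by (intro mult_right_mono) auto
      thus "norm (u y * \<rho> (x - y)) \<le> norm ((u y)\<^sup>2 * \<rho> (x - y) + \<rho> (x - y))"
        using \<rho>(1)[of "x - y"] by (auto simp: abs_mult algebra_simps)
    qed
  qed measurable
  have jensen: "(LINT y|lborel. u y * \<rho> (x - y))\<^sup>2 \<le> (LINT y|lborel. (u y)\<^sup>2 * \<rho> (x - y))" for x
  proof -
    define m where "m = (LINT y|lborel. u y * \<rho> (x - y))"
    \<comment> \<open>Jensen's inequality for the square is the nonnegativity of the variance,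
      expanded.\<close>
    have "0 \<le> (LINT y|lborel. (u y - m)\<^sup>2 * \<rho> (x - y))"
      using \<rho>(1) by (intro integral_nonneg_AE AE_I2) auto
    also have "\<dots> = (LINT y|lborel. (u y)\<^sup>2 * \<rho> (x - y) - 2 * m * (u y * \<rho> (x - y)) + m\<^sup>2 * \<rho> (x - y))"
      by (intro Bochner_Integration.integral_cong) (auto simp: power2_eq_square algebra_simps)
    also have "\<dots> = (LINT y|lborel. (u y)\<^sup>2 * \<rho> (x - y)) - 2 * m * m + m\<^sup>2 * 1"
      using i1[of x] i2[of x] rint[of x] by (simp add: rint1 m_def)
    finally show ?thesis by (simp add: m_def power2_eq_square)
  qed
  have "(\<integral>\<^sup>+ x. ennreal ((LINT y|lborel. u y * \<rho> (x - y))\<^sup>2) \<partial>lborel)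
      \<le> (\<integral>\<^sup>+ x. ennreal (LINT y|lborel. (u y)\<^sup>2 * \<rho> (x - y)) \<partial>lborel)"
    by (intro nn_integral_mono ennreal_leI jensen)
  also have "\<dots> = (\<integral>\<^sup>+ x. (\<integral>\<^sup>+ y. ennreal ((u y)\<^sup>2 * \<rho> (x - y)) \<partial>lborel) \<partial>lborel)"
    using i2 \<rho>(1) by (intro nn_integral_cong nn_integral_eq_integral[symmetric]) auto
  also have "\<dots> = (\<integral>\<^sup>+ y. (\<integral>\<^sup>+ x. ennreal ((u y)\<^sup>2 * \<rho> (x - y)) \<partial>lborel) \<partial>lborel)"
    by (intro lborel_pair.Fubini'[symmetric]) measurable
  also have "\<dots> = (\<integral>\<^sup>+ y. ennreal ((u y)\<^sup>2) \<partial>lborel)"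
  proof (intro nn_integral_cong)
    fix y
    have "(\<integral>\<^sup>+ x. ennreal ((u y)\<^sup>2 * \<rho> (x - y)) \<partial>lborel) = ennreal ((u y)\<^sup>2) * (\<integral>\<^sup>+ x. ennreal (\<rho> (x - y)) \<partial>lborel)"
      using \<rho>(1) by (simp add: ennreal_mult nn_integral_cmult)
    also have "(\<integral>\<^sup>+ x. ennreal (\<rho> (x - y)) \<partial>lborel) = ennreal (LINT x|lborel. \<rho> (x - y))"
      using lborel_integrable_real_affine_iff[of 1 \<rho> "-y"] \<rho>(1,3)
      by (intro nn_integral_eq_integral) auto
    also have "(LINT x|lborel. \<rho> (x - y)) = 1"
      using lborel_integral_real_affine[of 1 \<rho> "-y"] \<rho>(4) by simp
    finally show "(\<integral>\<^sup>+ x. ennreal ((u y)\<^sup>2 * \<rho> (x - y)) \<partial>lborel) = ennreal ((u y)\<^sup>2)" by simp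
  qed
  also have "\<dots> = ennreal (LINT x|lborel. (u x)\<^sup>2)"
    using u by (intro nn_integral_eq_integral) auto
  finally show ?thesis .
qed

text \<open>Morrey's estimate with AM-GM, weighted by l = sqrt (b - a), in the role of
  Cauchy-Schwarz; hence the constant (E + 1) / 2 instead of sqrt E. The energy is an extended
  integral because \<open>convolution_L2_bound\<close> delivers it in that form.\<close>

lemma holder_of_L2_derivative:
  fixes G G' :: "real \<Rightarrow> real"
  assumes der: "\<And>x. (G has_real_derivative G' x) (at x)" and cont: "continuous_on UNIV G'"
    and E: "(\<integral>\<^sup>+ x. ennreal ((G' x)\<^sup>2) \<partial>lborel) \<le> ennreal E" "E \<ge> 0"
  shows "\<bar>G a - G b\<bar> \<le> (E + 1) / 2 * sqrt \<bar>a - b\<bar>"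
proof -
  have *: "\<bar>G b - G a\<bar> \<le> (E + 1) / 2 * sqrt (b - a)" if "a < b" for a b
  proof -
    define l where "l = sqrt (b - a)"
    have l: "l > 0" "l * l = b - a" using that by (auto simp: l_def)
    have cont': "continuous_on {a..b} (\<lambda>x. h (G' x))" if "continuous_on UNIV h" for h :: "real \<Rightarrow> real"
      by (rule continuous_on_compose2[OF that continuous_on_subset[OF cont]]) auto
    have int: "integrable lborel (\<lambda>x. indicator {a..b} x *\<^sub>R h (G' x))"
      if "continuous_on UNIV h" for h :: "real \<Rightarrow> real"
      using borel_integrable_compact[OF compact_Icc cont'[OF that]] by (simp add: set_integrable_def)
    have i1: "integrable lborel (\<lambda>x. indicator {a..b} x *\<^sub>R G' x)"
      using int[of "\<lambda>x. x"] by (simp add: continuous_on_id)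
    have i2: "integrable lborel (\<lambda>x. indicator {a..b} x *\<^sub>R (G' x)\<^sup>2)"
      using int[of "\<lambda>x. x\<^sup>2"] by (simp add: continuous_intros)
    have "ennreal (LINT x|lborel. indicator {a..b} x *\<^sub>R (G' x)\<^sup>2) = (\<integral>\<^sup>+ x. ennreal (indicator {a..b} x *\<^sub>R (G' x)\<^sup>2) \<partial>lborel)"
      using i2 by (intro nn_integral_eq_integral[symmetric]) auto
    also have "\<dots> \<le> (\<integral>\<^sup>+ x. ennreal ((G' x)\<^sup>2) \<partial>lborel)"
      by (intro nn_integral_mono ennreal_leI) (auto simp: indicator_def)
    also have "\<dots> \<le> ennreal E" by (rule E)
    finally have E2: "(LINT x|lborel. indicator {a..b} x *\<^sub>R (G' x)\<^sup>2) \<le> E" using E(2) by simp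
    have "G b - G a = (LINT x|lborel. indicator {a..b} x *\<^sub>R G' x)"
      by (rule integral_FTC_Icc[symmetric])
         (use that continuous_on_subset[OF cont] in \<open>auto intro: has_field_derivative_at_within[OF der] simp: has_real_derivative_iff_has_vector_derivative[symmetric]\<close>)
    also have "\<bar>\<dots>\<bar> \<le> (LINT x|lborel. \<bar>indicator {a..b} x *\<^sub>R G' x\<bar>)"
      by (rule integral_abs_bound)
    also have "\<dots> \<le> (LINT x|lborel. l / 2 * (indicator {a..b} x *\<^sub>R (G' x)\<^sup>2) + 1 / (2 * l) * indicator {a..b} x)"
    proof (rule integral_mono)
      show "\<bar>indicator {a..b} x *\<^sub>R G' x\<bar> \<le> l / 2 * (indicator {a..b} x *\<^sub>R (G' x)\<^sup>2) + 1 / (2 * l) * indicator {a..b} x" for x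
      proof -
        have "2 * (l * \<bar>G' x\<bar>) * 1 \<le> (l * \<bar>G' x\<bar>)\<^sup>2 + 1\<^sup>2" by (rule sum_squares_bound)
        hence "\<bar>G' x\<bar> \<le> l / 2 * (G' x)\<^sup>2 + 1 / (2 * l)"
          using l(1) by (simp add: field_simps power2_eq_square)
        thus ?thesis by (auto simp: indicator_def)
      qed
    qed (use i1 i2 that in auto)
    also have "\<dots> = l / 2 * (LINT x|lborel. indicator {a..b} x *\<^sub>R (G' x)\<^sup>2) + 1 / (2 * l) * (b - a)"
      using i2 that by simp
    also have "\<dots> \<le> l / 2 * E + 1 / (2 * l) * (b - a)"
      using E2 l by (intro add_right_mono mult_left_mono) auto
    also have "\<dots> = (E + 1) / 2 * l" using l(1) by (simp add: l(2)[symmetric] field_simps)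
    finally show ?thesis by (simp add: l_def)
  qed
  show ?thesis using *[of a b] *[of b a] by (cases a b rule: linorder_cases) (auto simp: abs_minus_commute)
qed

text \<open>Difference quotients with step h differ from derivatives by at most K sqrt |h|,
  uniformly in n. A fixed small h therefore transfers pointwise convergence of \<open>u n\<close> to
  the derivatives, and the same estimate in the limit identifies the limit as the derivative of
  \<open>v\<close>.\<close>

lemma holder_derivative_limit:
  fixes u u' :: "nat \<Rightarrow> real \<Rightarrow> real"
  assumes der: "\<And>n x. (u n has_real_derivative u' n x) (at x)"
    and hol: "\<And>n a b. \<bar>u' n a - u' n b\<bar> \<le> K * sqrt \<bar>a - b\<bar>" and K: "K \<ge> 0"
    and lim: "\<And>x. (\<lambda>n. u n x) \<longlonglongrightarrow> v x"
  obtains w where "\<And>x. (v has_real_derivative w x) (at x)" "\<And>x. (\<lambda>n. u' n x) \<longlonglongrightarrow> w x"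
    "\<And>a b. \<bar>w a - w b\<bar> \<le> K * sqrt \<bar>a - b\<bar>"
proof -
  have quot: "\<bar>(u n (x + h) - u n x) / h - u' n x\<bar> \<le> K * sqrt \<bar>h\<bar>" if "h \<noteq> 0" for n x h
  proof -
    obtain y where y: "\<bar>y - x\<bar> \<le> \<bar>h\<bar>" "u n (x + h) - u n x = h * u' n y"
    proof (cases "h > 0")
      case True
      obtain z where "x < z" "z < x + h" "u n (x + h) - u n x = (x + h - x) * u' n z"
        using MVT2[of x "x + h" "u n" "u' n"] True der by auto
      thus ?thesis using that[of z] by auto
    next
      case False
      obtain z where "x + h < z" "z < x" "u n x - u n (x + h) = (x - (x + h)) * u' n z"
        using MVT2[of "x + h" x "u n" "u' n"] False \<open>h \<noteq> 0\<close> der by auto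
      thus ?thesis using that[of z] by (auto simp: algebra_simps)
    qed
    have "\<bar>u' n y - u' n x\<bar> \<le> K * sqrt \<bar>h\<bar>"
      using hol[of n y x] mult_left_mono[OF real_sqrt_le_mono[OF y(1)] K] by linarith
    thus ?thesis using y(2) that by simp
  qed
  have small: "\<exists>h>0. K * sqrt \<bar>h\<bar> < e" if "e > 0" for e
  proof (intro exI conjI)
    define q where "q = e / (K + 1)"
    have q: "q > 0" "K * q < e" using that K by (auto simp: q_def field_simps)
    show "q\<^sup>2 > 0" using q by simp
    show "K * sqrt \<bar>q\<^sup>2\<bar> < e" using q by simp
  qed
  have "Cauchy (\<lambda>n. u' n x)" for x
  proof (rule metric_CauchyI)
    fix e :: real assume e: "e > 0"
    \<comment> \<open>For this fixed h the quotients converge in n, and every derivative lies within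
      e/4 of its quotient.\<close>
    obtain h where h: "h > 0" "K * sqrt \<bar>h\<bar> < e / 4" using small[of "e/4"] e by auto
    have "(\<lambda>n. (u n (x + h) - u n x) / h) \<longlonglongrightarrow> (v (x + h) - v x) / h"
      using h by (intro tendsto_intros lim) auto
    hence "Cauchy (\<lambda>n. (u n (x + h) - u n x) / h)" by (rule LIMSEQ_imp_Cauchy)
    then obtain N where N: "\<And>m n. m \<ge> N \<Longrightarrow> n \<ge> N \<Longrightarrow>
        dist ((u m (x + h) - u m x) / h) ((u n (x + h) - u n x) / h) < e / 2"
      using metric_CauchyD[of "\<lambda>n. (u n (x + h) - u n x) / h" "e/2"] e by auto
    show "\<exists>M. \<forall>m\<ge>M. \<forall>n\<ge>M. dist (u' m x) (u' n x) < e"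
    proof (intro exI[of _ N] allI impI)
      fix m n assume "m \<ge> N" "n \<ge> N"
      from N[OF this] show "dist (u' m x) (u' n x) < e"
        using quot[of h m x] quot[of h n x] h unfolding dist_real_def by linarith
    qed
  qed
  hence "\<exists>l. (\<lambda>n. u' n x) \<longlonglongrightarrow> l" for x
    using real_Cauchy_convergent convergent_def by blast
  then obtain w where w: "\<And>x. (\<lambda>n. u' n x) \<longlonglongrightarrow> w x" by metis
  have qv: "\<bar>(v (x + h) - v x) / h - w x\<bar> \<le> K * sqrt \<bar>h\<bar>" if "h \<noteq> 0" for x h
  proof (rule LIMSEQ_le_const2)
    show "(\<lambda>n. \<bar>(u n (x + h) - u n x) / h - u' n x\<bar>) \<longlonglongrightarrow> \<bar>(v (x + h) - v x) / h - w x\<bar>"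
      using that by (intro tendsto_intros lim w)
    show "\<exists>N. \<forall>n\<ge>N. \<bar>(u n (x + h) - u n x) / h - u' n x\<bar> \<le> K * sqrt \<bar>h\<bar>"
      using quot[OF that] by blast
  qed
  show ?thesis
  proof (rule that[of w])
    show "(v has_real_derivative w x) (at x)" for x
    proof -
      have "((\<lambda>h. (v (x + h) - v x) / h - w x) \<longlongrightarrow> 0) (at 0)"
      proof (rule Lim_null_comparison)
        show "\<forall>\<^sub>F h in at 0. norm ((v (x + h) - v x) / h - w x) \<le> K * sqrt \<bar>h\<bar>"
          using qv by (auto simp: eventually_at_filter)
        have "((\<lambda>h. K * sqrt \<bar>h\<bar>) \<longlongrightarrow> K * sqrt \<bar>0\<bar>) (at (0::real))"
          by (intro tendsto_intros)
        thus "((\<lambda>h. K * sqrt \<bar>h\<bar>) \<longlongrightarrow> 0) (at (0::real))" by simp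
      qed
      thus ?thesis unfolding DERIV_def by (simp add: LIM_zero_iff)
    qed
    show "\<bar>w a - w b\<bar> \<le> K * sqrt \<bar>a - b\<bar>" for a b
    proof (rule LIMSEQ_le_const2)
      show "(\<lambda>n. \<bar>u' n a - u' n b\<bar>) \<longlonglongrightarrow> \<bar>w a - w b\<bar>" by (intro tendsto_intros w)
    qed (use hol in auto)
  qed (rule w)
qed


text \<open>A value of size e far out forces size e/2 on an interval of fixed length d, by Hoelder
  continuity. Infinitely far out this contradicts the vanishing tails of the L2 norm.\<close>

lemma tendsto_0_of_holder_L2:
  fixes u :: "real \<Rightarrow> 'a::real_normed_vector"
  assumes hol: "\<And>a b. \<bar>a - b\<bar> \<le> 1 \<Longrightarrow> norm (u a - u b) \<le> K * sqrt \<bar>a - b\<bar>"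
    and [measurable]: "(\<lambda>x. norm (u x)) \<in> borel_measurable lborel"
    and L2: "integrable lborel (\<lambda>x. (norm (u x))\<^sup>2)"
  shows "(u \<longlongrightarrow> 0) at_infinity"
proof (rule ccontr)
  assume "\<not> ?thesis"
  then obtain e where e: "e > 0" "\<And>B. \<exists>x. \<bar>x\<bar> \<ge> B \<and> norm (u x) \<ge> e"
    unfolding Lim_at_infinity by (force simp: not_less)
  \<comment> \<open>Chosen so that K sqrt d \<le> e/2; the denominator with
    \<open>\<bar>K\<bar> + 1\<close> covers K of either sign and K = 0.\<close>
  define d where "d = min 1 ((e / (2 * (\<bar>K\<bar> + 1)))\<^sup>2)"
  have d: "0 < d" "d \<le> 1" using e by (auto simp: d_def)
  have Kd: "K * sqrt t \<le> e / 2" if "0 \<le> t" "t \<le> d" for t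
  proof -
    have "sqrt t \<le> e / (2 * (\<bar>K\<bar> + 1))"
      using that e by (intro real_le_lsqrt) (auto simp: d_def)
    hence "\<bar>K\<bar> * sqrt t \<le> \<bar>K\<bar> * (e / (2 * (\<bar>K\<bar> + 1)))" by (intro mult_left_mono) auto
    also have "\<dots> \<le> e / 2" using e by (simp add: field_simps)
    finally show ?thesis using mult_right_mono[OF abs_ge_self[of K], of "sqrt t"] that by auto
  qed
  have low: "norm (u y) \<ge> e / 2" if "norm (u x) \<ge> e" "\<bar>y - x\<bar> \<le> d" for x y
    using hol[of y x] Kd[of "\<bar>y - x\<bar>"] that d norm_triangle_ineq3[of "u y" "u x"] by (auto simp: abs_le_iff)
  have tail: "(\<lambda>n. LINT x|lborel. indicator {x. \<bar>x\<bar> \<ge> real n} x * (norm (u x))\<^sup>2) \<longlonglongrightarrow> (LINT x::real|lborel. (0::real))"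
  proof (rule integral_dominated_convergence[where w = "\<lambda>x. (norm (u x))\<^sup>2"])
    show "AE x in lborel. (\<lambda>n. indicator {x. \<bar>x\<bar> \<ge> real n} x * (norm (u x))\<^sup>2) \<longlonglongrightarrow> 0"
    proof (intro AE_I2 tendsto_eventually)
      fix x :: real
      obtain N where "\<bar>x\<bar> < real N" using reals_Archimedean2 by blast
      thus "\<forall>\<^sub>F n in sequentially. indicator {x. \<bar>x\<bar> \<ge> real n} x * (norm (u x))\<^sup>2 = 0"
        by (intro eventually_sequentiallyI[of N]) (auto simp: indicator_def)
    qed
  qed (use L2 in \<open>auto simp: indicator_def\<close>)
  have "\<forall>\<^sub>F n in sequentially. (LINT x|lborel. indicator {x. \<bar>x\<bar> \<ge> real n} x * (norm (u x))\<^sup>2) < (e/2)\<^sup>2 * d"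
    using order_tendstoD(2)[OF tail, of "(e/2)\<^sup>2 * d"] e d by simp
  then obtain n where n: "(LINT x|lborel. indicator {x. \<bar>x\<bar> \<ge> real n} x * (norm (u x))\<^sup>2) < (e/2)\<^sup>2 * d"
    by (auto simp: eventually_sequentially)
  \<comment> \<open>The extra 1 keeps all of [x, x + d] in the region |y| \<ge> n, also when x is
    negative.\<close>
  obtain x where x: "\<bar>x\<bar> \<ge> real n + 1" "norm (u x) \<ge> e" using e(2) by blast
  have "(LINT y|lborel. indicator {x..x+d} y * (e/2)\<^sup>2) \<le> (LINT y|lborel. indicator {y. \<bar>y\<bar> \<ge> real n} y * (norm (u y))\<^sup>2)"
  proof (rule integral_mono)
    show "integrable lborel (\<lambda>y. indicator {y. \<bar>y\<bar> \<ge> real n} y * (norm (u y))\<^sup>2)"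
      by (rule Bochner_Integration.integrable_bound[OF L2]) (auto simp: indicator_def)
    show "indicator {x..x+d} y * (e/2)\<^sup>2 \<le> indicator {y. \<bar>y\<bar> \<ge> real n} y * (norm (u y))\<^sup>2" for y
      using low[OF x(2), of y] x d e by (auto simp: indicator_def intro!: power_mono)
  qed (use d in simp)
  thus False using n d by (simp add: mult.commute)
qed

text \<open>Mollification: derivatives of the mollified f are mollified weak derivatives, so their
  L2 norms are bounded uniformly. The bound of order k + 1 makes the derivatives of order k
  equi-Hoelder, and \<open>holder_derivative_limit\<close>, used twice, passes to the limit.\<close>

lemma sobolev_H3_regularity:
  assumes f: "f \<in> sobolev_H 3" and cont: "continuous_on UNIV f"
  obtains f1 f2 K where
    "\<And>x. (f has_real_derivative f1 x) (at x)" "\<And>x. (f1 has_real_derivative f2 x) (at x)"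
    "\<And>a b. \<bar>f1 a - f1 b\<bar> \<le> K * sqrt \<bar>a - b\<bar>" "\<And>a b. \<bar>f2 a - f2 b\<bar> \<le> K * sqrt \<bar>a - b\<bar>"
    "integrable lborel (\<lambda>x. (f1 x)\<^sup>2)" "integrable lborel (\<lambda>x. (f2 x)\<^sup>2)" "K \<ge> 0"
proof -
  have [measurable]: "f \<in> borel_measurable borel" using cont by (simp add: borel_measurable_continuous_onI)
  have "\<forall>k\<in>{1..3}. \<exists>h. h \<in> borel_measurable lborel \<and> integrable lborel (\<lambda>x. (h x)\<^sup>2) \<and>
      (\<forall>\<phi>. test_function \<phi> \<longrightarrow> \<phi> \<in> borel_measurable lborel \<longrightarrow>
         (LINT x|lebesgue. f x * (deriv ^^ k) \<phi> x) = (-1) ^ k * (LINT x|lborel. h x * \<phi> x))"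
  proof
    fix k :: nat assume "k \<in> {1..3}"
    then obtain h where h: "square_integrable h" "weak_derivative k f h" using f by (force simp: sobolev_H_def)
    obtain h' where "h' \<in> borel_measurable lborel" "integrable lborel (\<lambda>x. (h' x)\<^sup>2)"
      "\<And>\<phi>. \<phi> \<in> borel_measurable lborel \<Longrightarrow> (LINT x|lebesgue. h x * \<phi> x) = (LINT x|lborel. h' x * \<phi> x)"
      by (rule square_integrable_borel[OF h(1)]) (rule that)
    thus "\<exists>h. h \<in> borel_measurable lborel \<and> integrable lborel (\<lambda>x. (h x)\<^sup>2) \<and>
      (\<forall>\<phi>. test_function \<phi> \<longrightarrow> \<phi> \<in> borel_measurable lborel \<longrightarrow>
         (LINT x|lebesgue. f x * (deriv ^^ k) \<phi> x) = (-1) ^ k * (LINT x|lborel. h x * \<phi> x))"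
      using h(2) unfolding weak_derivative_def by (intro exI[of _ h']) auto
  qed
  from bchoice[OF this] obtain h where hh: "\<forall>k\<in>{1..3}. h k \<in> borel_measurable lborel \<and>
      integrable lborel (\<lambda>x. (h k x)\<^sup>2) \<and>
      (\<forall>\<phi>. test_function \<phi> \<longrightarrow> \<phi> \<in> borel_measurable lborel \<longrightarrow>
         (LINT x|lebesgue. f x * (deriv ^^ k) \<phi> x) = (-1) ^ k * (LINT x|lborel. h k x * \<phi> x))" ..
  have h: "h k \<in> borel_measurable lborel" "integrable lborel (\<lambda>x. (h k x)\<^sup>2)"
    "test_function \<phi> \<Longrightarrow> \<phi> \<in> borel_measurable lborel \<Longrightarrow>
       (LINT x|lebesgue. f x * (deriv ^^ k) \<phi> x) = (-1) ^ k * (LINT x|lborel. h k x * \<phi> x)"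
    if "k \<in> {1..3}" for k \<phi>
    using bspec[OF hh that] by auto
  define d where "d n = inverse (real (Suc n))" for n
  have d: "d n > 0" "d n \<le> 1" for n by (auto simp: d_def inverse_le_1_iff)
  have "\<forall>n. \<exists>\<rho>. (\<forall>k. ndiff k \<rho>) \<and> (\<forall>x. \<rho> x \<ge> 0) \<and> (\<forall>x. \<bar>x\<bar> \<ge> d n \<longrightarrow> \<rho> x = 0) \<and>
     integrable lborel \<rho> \<and> (LINT x|lborel. \<rho> x) = 1"
  proof
    fix n
    show "\<exists>\<rho>. (\<forall>k. ndiff k \<rho>) \<and> (\<forall>x. \<rho> x \<ge> 0) \<and> (\<forall>x. \<bar>x\<bar> \<ge> d n \<longrightarrow> \<rho> x = 0) \<and>
     integrable lborel \<rho> \<and> (LINT x|lborel. \<rho> x) = 1"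
    proof (rule mollifier_exists[OF d(1)[of n]], rule exI)
      fix r assume "\<And>k. ndiff k r" "\<And>x. r x \<ge> 0" "\<And>x. \<bar>x\<bar> \<ge> d n \<Longrightarrow> r x = 0"
        "integrable lborel r" "(LINT x|lborel. r x) = 1"
      thus "(\<forall>k. ndiff k r) \<and> (\<forall>x. r x \<ge> 0) \<and> (\<forall>x. \<bar>x\<bar> \<ge> d n \<longrightarrow> r x = 0) \<and>
        integrable lborel r \<and> (LINT x|lborel. r x) = 1" by simp
    qed
  qed
  then obtain \<rho> where \<rho>: "\<And>n k. ndiff k (\<rho> n)" "\<And>n x. \<rho> n x \<ge> 0" "\<And>n x. \<bar>x\<bar> \<ge> d n \<Longrightarrow> \<rho> n x = 0"
    "\<And>n. integrable lborel (\<rho> n)" "\<And>n. (LINT x|lborel. \<rho> n x) = 1" by metis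
  define D where "D k n = (deriv ^^ k) (\<rho> n)" for k n
  have Dd: "(D k n has_real_derivative D (Suc k) n x) (at x)" for k n x
    using differentiable_deriv[OF ndiff_imp_differentiable[OF \<rho>(1)]] by (simp add: D_def)
  have Dc: "continuous_on S (D k n)" for k n S
    using Dd by (meson DERIV_isCont continuous_at_imp_continuous_on)
  have Dm [measurable]: "D k n \<in> borel_measurable borel" for k n
    using Dc by (simp add: borel_measurable_continuous_onI)
  have Dsupp: "D k n x = 0" if "\<bar>x\<bar> > 1" for k n x
    unfolding D_def by (rule deriv_pow_support[of "d n"]) (use \<rho>(3) d(2)[of n] that in auto)
  have "\<exists>B. \<forall>x. \<bar>D k n x\<bar> \<le> B" for k n
  proof -
    have "bounded (D k n ` {-1..1})" by (intro compact_imp_bounded compact_continuous_image Dc compact_Icc)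
    then obtain B where B: "\<forall>x\<in>{-1..1}. \<bar>D k n x\<bar> \<le> B" unfolding bounded_iff by auto
    have "\<bar>D k n x\<bar> \<le> max B 0" for x
      using bspec[OF B, of x] Dsupp[of x k n] by (cases "\<bar>x\<bar> \<le> 1") (auto simp: abs_le_iff)
    thus ?thesis by blast
  qed
  then obtain B where B: "\<And>k n x. \<bar>D k n x\<bar> \<le> B k n" by metis
  \<comment> \<open>The k-th derivative of the mollification of f; by \<open>Fh\<close> below it is
    also the mollification of the k-th weak derivative.\<close>
  define F where "F k n x = (LINT y|lborel. f y * D k n (x - y))" for k n x
  have fint: "integrable lborel (\<lambda>y. indicator {a..b} y *\<^sub>R \<bar>f y\<bar>)" for a b
    using borel_integrable_compact[of "{a..b}" "\<lambda>y. \<bar>f y\<bar>"] continuous_on_subset[OF cont]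
    by (auto simp: set_integrable_def intro!: continuous_intros)
  \<comment> \<open>\<open>D k n\<close> lives in [-1, 1], so for z within 1 of x only y in
    [x - 2, x + 2] contribute. This dominates the integrand locally uniformly in z.\<close>
  have fD: "\<bar>f y * D k n (z - y)\<bar> \<le> B k n * (indicator {x-2..x+2} y *\<^sub>R \<bar>f y\<bar>)" if "\<bar>z - x\<bar> < 1" for k n x y z
  proof (cases "\<bar>z - y\<bar> > 1")
    case True
    have "B k n \<ge> 0" using order_trans[OF abs_ge_zero B[of k n 0]] .
    thus ?thesis using Dsupp[OF True] by (simp add: indicator_def)
  next
    case False
    hence "y \<in> {x-2..x+2}" using that by auto
    thus ?thesis using mult_right_mono[OF B[of k n "z - y"] abs_ge_zero[of "f y"]]
      by (simp add: abs_mult mult.commute)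
  qed
  have Fint: "integrable lborel (\<lambda>y. f y * D k n (x - y))" for k n x
  proof (rule Bochner_Integration.integrable_bound[OF integrable_mult_right[OF fint[of "x-2" "x+2"], of "B k n"]])
    show "AE y in lborel. norm (f y * D k n (x - y)) \<le> norm (B k n * (indicator {x-2..x+2} y *\<^sub>R \<bar>f y\<bar>))"
      using order_trans[OF fD[of x x] abs_ge_self] unfolding real_norm_def by (intro AE_I2) simp
  qed measurable
  have FD: "(F k n has_real_derivative F (Suc k) n x) (at x)" for k n x
    unfolding F_def
  proof (rule has_field_derivative_lebesgue_integral(1)[where r = 1 and h' = "\<lambda>z y. f y * D (Suc k) n (z - y)"])
    show "((\<lambda>z. f s * D k n (z - s)) has_real_derivative f s * D (Suc k) n (z - s)) (at z)" for z s
    proof -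
      have "((\<lambda>z. D k n (z - s)) has_real_derivative D (Suc k) n (z - s) * 1) (at z)"
        by (rule DERIV_chain2[OF Dd]) (auto intro!: derivative_eq_intros)
      from DERIV_cmult[OF this, of "f s"] show ?thesis by (simp only: mult_1_right)
    qed
    show "integrable lborel (\<lambda>s. B (Suc k) n * (indicator {x-2..x+2} s *\<^sub>R \<bar>f s\<bar>))"
      using fint by simp
  qed (use Fint fD in \<open>auto simp: dist_real_def abs_minus_commute\<close>)
  have Fc: "continuous_on UNIV (F k n)" for k n
    using FD by (meson DERIV_isCont continuous_at_imp_continuous_on)
  have Fm [measurable]: "F k n \<in> borel_measurable borel" for k n
    using Fc by (simp add: borel_measurable_continuous_onI)
  have Fh: "F k n x = (LINT y|lborel. h k y * \<rho> n (x - y))" if "k \<in> {1..3}" for k n x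
  proof -
    have t: "test_function (\<lambda>y. \<rho> n (x - y))" using \<rho>(1,3) by (rule test_function_reflect)
    have [measurable]: "\<rho> n \<in> borel_measurable borel" using Dm[of 0 n] by (simp add: D_def)
    have "(LINT y|lebesgue. f y * ((-1)^k * D k n (x - y))) = (-1) ^ k * (LINT y|lborel. h k y * \<rho> n (x - y))"
      using h(3)[OF that t] by (simp add: deriv_pow_reflect[OF \<rho>(1)] D_def)
    moreover have "(LINT y|lebesgue. f y * ((-1)^k * D k n (x - y))) = (LINT y|lborel. f y * ((-1)^k * D k n (x - y)))"
      by (rule integral_completion) measurable
    moreover have "\<dots> = (LINT y|lborel. (-1)^k * (f y * D k n (x - y)))"
      by (intro Bochner_Integration.integral_cong) auto
    moreover have "\<dots> = (-1)^k * F k n x" by (simp add: F_def)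
    ultimately show ?thesis by simp
  qed
  define E where "E k = (LINT x|lborel. (h k x)\<^sup>2)" for k
  have E0: "E k \<ge> 0" for k unfolding E_def by (intro integral_nonneg_AE) auto
  have FE: "(\<integral>\<^sup>+ x. ennreal ((F k n x)\<^sup>2) \<partial>lborel) \<le> ennreal (E k)" if "k \<in> {1..3}" for k n
    unfolding Fh[OF that] E_def
  proof (rule convolution_L2_bound)
    show "\<rho> n x \<le> B 0 n" for x using B[of 0 n x] by (simp add: D_def abs_le_iff)
    show "\<rho> n \<in> borel_measurable lborel" using Dm[of 0 n] by (simp add: D_def)
  qed (use h that \<rho> in auto)
  \<comment> \<open>The energy of order 2 controls increments of the first derivative, that of order
    3 increments of the second.\<close>
  define K where "K = max ((E 2 + 1) / 2) ((E 3 + 1) / 2)"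
  have K0: "K \<ge> 0" using E0[of 2] by (simp add: K_def le_max_iff_disj)
  have Kle: "c * sqrt t \<le> K * sqrt t" if "c \<le> K" "t \<ge> 0" for c t using that by (intro mult_right_mono) auto
  have hol1: "\<bar>F 1 n a - F 1 n b\<bar> \<le> K * sqrt \<bar>a - b\<bar>" for n a b
    using holder_of_L2_derivative[OF FD Fc FE E0, of 1 n a b]
      Kle[of "(E 2 + 1) / 2" "\<bar>a - b\<bar>"] by (simp add: K_def numeral_2_eq_2)
  have hol2: "\<bar>F 2 n a - F 2 n b\<bar> \<le> K * sqrt \<bar>a - b\<bar>" for n a b
    using holder_of_L2_derivative[OF FD Fc FE E0, of 2 n a b]
      Kle[of "(E 3 + 1) / 2" "\<bar>a - b\<bar>"] by (simp add: K_def numeral_3_eq_3)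
  have lim: "(\<lambda>n. F 0 n x) \<longlonglongrightarrow> f x" for x
  proof (rule metric_LIMSEQ_I)
    fix e :: real assume e: "e > 0"
    have "isCont f x" using cont by (simp add: continuous_on_eq_continuous_at)
    then obtain r where r: "r > 0" "\<And>y. \<bar>y - x\<bar> < r \<Longrightarrow> \<bar>f y - f x\<bar> < e / 2"
      using e unfolding continuous_at_eps_delta dist_real_def by (metis half_gt_zero)
    obtain N where N: "d N < r" using reals_Archimedean[OF r(1)] by (auto simp: d_def)
    have "\<bar>F 0 n x - f x\<bar> \<le> e / 2" if "n \<ge> N" for n
    proof -
      have dn: "d n < r" using N that by (smt (verit) d_def inverse_le_imp_le inverse_positive_iff_positive of_nat_0_less_iff of_nat_le_iff Suc_le_mono le_imp_inverse_le zero_less_Suc)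
      have i: "integrable lborel (\<lambda>y. \<rho> n (x - y))"
        using lborel_integrable_real_affine_iff[of "-1" "\<rho> n" x] \<rho>(4) by simp
      have i1: "(LINT y|lborel. \<rho> n (x - y)) = 1"
        using lborel_integral_real_affine[of "-1" "\<rho> n" x] \<rho>(5) by simp
      have i0: "integrable lborel (\<lambda>y. f y * \<rho> n (x - y))" using Fint[of 0 n x] by (simp add: D_def)
      have "F 0 n x - f x = (LINT y|lborel. (f y - f x) * \<rho> n (x - y))"
        using i i0 by (simp add: F_def D_def left_diff_distrib i1)
      also have "\<bar>\<dots>\<bar> \<le> (LINT y|lborel. \<bar>(f y - f x) * \<rho> n (x - y)\<bar>)"
        by (rule integral_abs_bound)
      also have "\<dots> \<le> (LINT y|lborel. e / 2 * \<rho> n (x - y))"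
      proof (rule integral_mono)
        show "integrable lborel (\<lambda>y. \<bar>(f y - f x) * \<rho> n (x - y)\<bar>)"
          using i i0 by (simp add: left_diff_distrib)
        show "\<bar>(f y - f x) * \<rho> n (x - y)\<bar> \<le> e / 2 * \<rho> n (x - y)" for y
        proof (cases "\<bar>x - y\<bar> \<ge> d n")
          case False
          hence "\<bar>f y - f x\<bar> \<le> e / 2" using r(2)[of y] dn by (auto simp: abs_minus_commute)
          thus ?thesis using mult_right_mono[OF _ \<rho>(2)] by (simp add: abs_mult \<rho>(2) del: times_divide_eq_left)
        qed (use \<rho>(3) in auto)
      qed (use i in auto)
      also have "\<dots> = e / 2" by (simp add: i1)
      finally show ?thesis .
    qed
    thus "\<exists>N. \<forall>n\<ge>N. dist (F 0 n x) (f x) < e" using e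
      by (intro exI[of _ N]) (force simp: dist_real_def)
  qed
  have FD0: "(F 0 n has_real_derivative F 1 n x) (at x)" "(F 1 n has_real_derivative F 2 n x) (at x)" for n x
    using FD[of 0 n x] FD[of 1 n x] by (simp_all add: numeral_2_eq_2)
  obtain f1 where f1: "\<And>x. (f has_real_derivative f1 x) (at x)" "\<And>x. (\<lambda>n. F 1 n x) \<longlonglongrightarrow> f1 x"
    "\<And>a b. \<bar>f1 a - f1 b\<bar> \<le> K * sqrt \<bar>a - b\<bar>"
    by (rule holder_derivative_limit[OF FD0(1) hol1 K0 lim]) (rule that)
  obtain f2 where f2: "\<And>x. (f1 has_real_derivative f2 x) (at x)" "\<And>x. (\<lambda>n. F 2 n x) \<longlonglongrightarrow> f2 x"
    "\<And>a b. \<bar>f2 a - f2 b\<bar> \<le> K * sqrt \<bar>a - b\<bar>"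
    by (rule holder_derivative_limit[OF FD0(2) hol2 K0 f1(2)]) (rule that)
  \<comment> \<open>Square integrability survives the pointwise limit by Fatou's lemma.\<close>
  have fatou: "integrable lborel (\<lambda>x. (w x)\<^sup>2)"
    if k: "k \<in> {1..3}" and w: "\<And>x. (\<lambda>n. F k n x) \<longlonglongrightarrow> w x" for k w
  proof (rule integrableI_bounded)
    have "w \<in> borel_measurable borel" by (rule borel_measurable_LIMSEQ_metric[OF Fm w])
    thus "(\<lambda>x. (w x)\<^sup>2) \<in> borel_measurable lborel" by simp
    have "(\<integral>\<^sup>+ x. ennreal (norm ((w x)\<^sup>2)) \<partial>lborel) = (\<integral>\<^sup>+ x. liminf (\<lambda>n. ennreal ((F k n x)\<^sup>2)) \<partial>lborel)"
    proof (intro nn_integral_cong)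
      fix x
      have "(\<lambda>n. ennreal ((F k n x)\<^sup>2)) \<longlonglongrightarrow> ennreal ((w x)\<^sup>2)"
        by (intro tendsto_ennrealI tendsto_power w)
      from lim_imp_Liminf[OF sequentially_bot this]
      show "ennreal (norm ((w x)\<^sup>2)) = liminf (\<lambda>n. ennreal ((F k n x)\<^sup>2))" by simp
    qed
    also have "\<dots> \<le> liminf (\<lambda>n. \<integral>\<^sup>+ x. ennreal ((F k n x)\<^sup>2) \<partial>lborel)"
      by (rule nn_integral_liminf) measurable
    also have "\<dots> \<le> liminf (\<lambda>n. ennreal (E k))"
      by (intro Liminf_mono always_eventually allI FE k)
    also have "\<dots> < \<infinity>" by (simp add: Liminf_const)
    finally show "(\<integral>\<^sup>+ x. ennreal (norm ((w x)\<^sup>2)) \<partial>lborel) < \<infinity>" .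
  qed
  show ?thesis
    by (rule that[OF f1(1) f2(1) f1(3) f2(3) fatou[OF _ f1(2)] fatou[OF _ f2(2)] K0]) auto
qed

section \<open>One-sided boundary values of Cauchy potentials\<close>

text \<open>Dominated convergence speaks about sequences; this transfers it to limits at
  infinity.\<close>

lemma at_infinity_sequentiallyI:
  fixes g :: "'a::real_normed_vector \<Rightarrow> 'b::metric_space"
  assumes "\<And>X. filterlim X at_infinity sequentially \<Longrightarrow> (\<lambda>n. g (X n)) \<longlonglongrightarrow> l"
  shows "(g \<longlongrightarrow> l) at_infinity"
proof (rule ccontr)
  assume "\<not> ?thesis"
  then obtain e where e: "e > 0" "\<And>b. \<exists>x. norm x \<ge> b \<and> \<not> dist (g x) l < e"
    unfolding Lim_at_infinity by metis
  have "\<forall>n. \<exists>x. norm x \<ge> real n \<and> \<not> dist (g x) l < e" using e(2) by blast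
  from choice[OF this] obtain X where X: "\<And>n. norm (X n) \<ge> real n" "\<And>n. \<not> dist (g (X n)) l < e" by blast
  have "filterlim X at_infinity sequentially"
    unfolding filterlim_at_infinity_conv_norm_at_top
    by (rule filterlim_at_top_mono[OF filterlim_real_sequentially]) (use X in auto)
  from tendstoD[OF assms[OF this] e(1)] X(2) show False by simp
qed

lemma integrable_inverse_sqrt_abs:
  "integrable lborel (\<lambda>t::real. indicator {-1..1} t * (1 / sqrt \<bar>t\<bar>))"
proof -
  define m :: "real \<Rightarrow> real" where "m t = indicator {0..1} t * (1 / sqrt \<bar>t\<bar>)" for t
  have [measurable]: "m \<in> borel_measurable borel" unfolding m_def by measurable
  have "set_integrable lborel (einterval 0 1) (\<lambda>t::real. 1 / sqrt t)"
  proof (rule interval_integral_FTC_nonneg[where F = "\<lambda>t. 2 * sqrt t" and A = 0 and B = 2])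
    show "DERIV (\<lambda>t. 2 * sqrt t) t :> 1 / sqrt t" if "0 < ereal t" for t
      using that by (auto intro!: derivative_eq_intros simp: field_simps)
    show "isCont (\<lambda>t. 1 / sqrt t) t" if "0 < ereal t" for t
      using that by (intro continuous_intros) auto
    have "((\<lambda>t. 2 * sqrt t) \<longlongrightarrow> 2 * sqrt 0) (at_right 0)" by (intro tendsto_intros)
    thus "(((\<lambda>t. 2 * sqrt t) \<circ> real_of_ereal) \<longlongrightarrow> 0) (at_right 0)"
      unfolding zero_ereal_def ereal_tendsto_simps1 by simp
    have "((\<lambda>t. 2 * sqrt t) \<longlongrightarrow> 2 * sqrt 1) (at_left 1)" by (intro tendsto_intros)
    thus "(((\<lambda>t. 2 * sqrt t) \<circ> real_of_ereal) \<longlongrightarrow> 2) (at_left 1)"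
      unfolding one_ereal_def ereal_tendsto_simps1 by simp
  qed auto
  hence "integrable lborel (\<lambda>t. indicator (einterval 0 1) t * (1 / sqrt t))"
    by (simp add: set_integrable_def)
  hence m: "integrable lborel m"
    by (rule integrable_cong_AE_imp) (use AE_lborel_singleton[of 0] AE_lborel_singleton[of 1] in
      \<open>auto simp: m_def indicator_def einterval_def elim!: eventually_mono\<close>)
  hence "integrable lborel (\<lambda>t. m (-t))"
    using lborel_integrable_real_affine_iff[of "-1" m 0] by simp
  with m have "integrable lborel (\<lambda>t. m t + m (-t))" by simp
  moreover have "m t + m (-t) = indicator {-1..1} t * (1 / sqrt \<bar>t\<bar>)" for t
    by (cases t "0::real" rule: linorder_cases) (auto simp: m_def indicator_def)
  ultimately show ?thesis by simp
qed

section \<open>Hoelder densities\<close>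

text \<open>The exponent 1/2 is the one given by Morrey's embedding. Increments up to 1 are those
  met inside the window; boundedness makes the class closed under products.\<close>

definition locally_hoelder :: "(real \<Rightarrow> complex) \<Rightarrow> bool" where
  "locally_hoelder \<eta> \<longleftrightarrow>
     (\<exists>B. \<forall>s. norm (\<eta> s) \<le> B) \<and>
     (\<exists>K\<ge>0. \<forall>a b. \<bar>a - b\<bar> \<le> 1 \<longrightarrow> norm (\<eta> a - \<eta> b) \<le> K * sqrt \<bar>a - b\<bar>)"

text \<open>The admissible densities: an ideal in the bounded Hoelder functions, so geometric
  factors such as \<open>Z'\<close>, which are bounded but not square integrable, may multiply
  them.\<close>

definition hoelder_L2 :: "(real \<Rightarrow> complex) \<Rightarrow> bool" where
  "hoelder_L2 \<psi> \<longleftrightarrow> locally_hoelder \<psi> \<and> integrable lborel (\<lambda>s. (norm (\<psi> s))\<^sup>2)"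

lemma locally_hoelder_continuous:
  assumes "locally_hoelder \<eta>"
  shows "continuous_on S \<eta>"
proof (rule continuous_at_imp_continuous_on, rule ballI)
  fix x
  obtain K where K: "\<And>a b. \<bar>a - b\<bar> \<le> 1 \<Longrightarrow> norm (\<eta> a - \<eta> b) \<le> K * sqrt \<bar>a - b\<bar>"
    using assms unfolding locally_hoelder_def by blast
  have "((\<lambda>y. \<eta> y - \<eta> x) \<longlongrightarrow> 0) (at x)"
  proof (rule Lim_null_comparison)
    show "\<forall>\<^sub>F y in at x. norm (\<eta> y - \<eta> x) \<le> K * sqrt \<bar>y - x\<bar>"
      using eventually_at_ball[of 1 x UNIV] by (auto elim!: eventually_mono intro!: K simp: dist_real_def)
    have "((\<lambda>y. K * sqrt \<bar>y - x\<bar>) \<longlongrightarrow> K * sqrt \<bar>x - x\<bar>) (at x)" by (intro tendsto_intros)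
    thus "((\<lambda>y. K * sqrt \<bar>y - x\<bar>) \<longlongrightarrow> 0) (at x)" by simp
  qed
  thus "isCont \<eta> x" by (simp add: isCont_def LIM_zero_iff)
qed

lemma locally_hoelder_measurable: "locally_hoelder \<eta> \<Longrightarrow> \<eta> \<in> borel_measurable borel"
  by (simp add: borel_measurable_continuous_onI locally_hoelder_continuous)

lemma locally_hoelder_mult:
  assumes "locally_hoelder u" "locally_hoelder v"
  shows "locally_hoelder (\<lambda>s. u s * v s)"
proof -
  obtain B C K L where B: "\<And>s. norm (u s) \<le> B" and C: "\<And>s. norm (v s) \<le> C"
    and K: "K \<ge> 0" "\<And>a b. \<bar>a - b\<bar> \<le> 1 \<Longrightarrow> norm (u a - u b) \<le> K * sqrt \<bar>a - b\<bar>"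
    and L: "L \<ge> 0" "\<And>a b. \<bar>a - b\<bar> \<le> 1 \<Longrightarrow> norm (v a - v b) \<le> L * sqrt \<bar>a - b\<bar>"
    using assms unfolding locally_hoelder_def by metis
  have BC: "B \<ge> 0" "C \<ge> 0" using B[of 0] C[of 0] norm_ge_zero order_trans by blast+
  show ?thesis unfolding locally_hoelder_def
  proof (intro conjI exI allI impI)
    show "norm (u s * v s) \<le> B * C" for s
      using B C BC by (simp add: norm_mult mult_mono)
    show "0 \<le> B * L + K * C" using BC K L by simp
    fix a b :: real assume ab: "\<bar>a - b\<bar> \<le> 1"
    have "u a * v a - u b * v b = u a * (v a - v b) + (u a - u b) * v b" by (simp add: algebra_simps)
    hence "norm (u a * v a - u b * v b) \<le> norm (u a) * norm (v a - v b) + norm (u a - u b) * norm (v b)"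
      by (metis norm_mult norm_triangle_ineq)
    also have "\<dots> \<le> B * (L * sqrt \<bar>a - b\<bar>) + (K * sqrt \<bar>a - b\<bar>) * C"
      using B C BC K L ab by (intro add_mono mult_mono) auto
    finally show "norm (u a * v a - u b * v b) \<le> (B * L + K * C) * sqrt \<bar>a - b\<bar>"
      by (simp add: algebra_simps)
  qed
qed

lemma locally_hoelder_cnj: "locally_hoelder u \<Longrightarrow> locally_hoelder (\<lambda>s. cnj (u s))"
  unfolding locally_hoelder_def complex_cnj_diff[symmetric] complex_mod_cnj .

lemma locally_hoelder_diff:
  assumes "locally_hoelder u" "locally_hoelder v"
  shows "locally_hoelder (\<lambda>s. u s - v s)"
proof -
  obtain B C K L where B: "\<And>s. norm (u s) \<le> B" and C: "\<And>s. norm (v s) \<le> C"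
    and K: "K \<ge> 0" "\<And>a b. \<bar>a - b\<bar> \<le> 1 \<Longrightarrow> norm (u a - u b) \<le> K * sqrt \<bar>a - b\<bar>"
    and L: "L \<ge> 0" "\<And>a b. \<bar>a - b\<bar> \<le> 1 \<Longrightarrow> norm (v a - v b) \<le> L * sqrt \<bar>a - b\<bar>"
    using assms unfolding locally_hoelder_def by metis
  show ?thesis unfolding locally_hoelder_def
  proof (intro conjI exI allI impI)
    show "norm (u s - v s) \<le> B + C" for s
      using norm_triangle_ineq4[of "u s" "v s"] B[of s] C[of s] by linarith
    show "0 \<le> K + L" using K L by simp
    fix a b :: real assume ab: "\<bar>a - b\<bar> \<le> 1"
    have "norm (u a - v a - (u b - v b)) \<le> norm (u a - u b) + norm (v a - v b)"
      using norm_triangle_ineq4[of "u a - u b" "v a - v b"] by (simp add: algebra_simps)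
    thus "norm (u a - v a - (u b - v b)) \<le> (K + L) * sqrt \<bar>a - b\<bar>"
      using K(2)[OF ab] L(2)[OF ab] by (simp add: algebra_simps)
  qed
qed

lemma locally_hoelder_inverse:
  assumes "locally_hoelder u" "\<And>s. norm (u s) \<ge> 1"
  shows "locally_hoelder (\<lambda>s. inverse (u s))"
proof -
  obtain K where K: "K \<ge> 0" "\<And>a b. \<bar>a - b\<bar> \<le> 1 \<Longrightarrow> norm (u a - u b) \<le> K * sqrt \<bar>a - b\<bar>"
    using assms unfolding locally_hoelder_def by metis
  have nz: "u s \<noteq> 0" for s using assms(2)[of s] by auto
  have i1: "norm (inverse (u s)) \<le> 1" for s using assms(2)[of s] by (simp add: norm_inverse inverse_le_1_iff)
  show ?thesis unfolding locally_hoelder_def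
  proof (intro conjI exI allI impI)
    show "norm (inverse (u s)) \<le> 1" for s by (rule i1)
    show "0 \<le> K" by (rule K)
    fix a b :: real assume ab: "\<bar>a - b\<bar> \<le> 1"
    have "inverse (u a) - inverse (u b) = - (inverse (u a) * (u a - u b) * inverse (u b))"
      using nz by (simp add: inverse_diff_inverse)
    hence "norm (inverse (u a) - inverse (u b)) = norm (inverse (u a)) * norm (u a - u b) * norm (inverse (u b))"
      by (simp add: norm_mult)
    also have "\<dots> \<le> 1 * norm (u a - u b) * 1" by (intro mult_mono i1) auto
    finally show "norm (inverse (u a) - inverse (u b)) \<le> K * sqrt \<bar>a - b\<bar>"
      using K(2)[OF ab] by linarith
  qed
qed

lemma hoelder_L2_mult:
  assumes "hoelder_L2 u" "locally_hoelder v"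
  shows "hoelder_L2 (\<lambda>s. u s * v s)"
  unfolding hoelder_L2_def
proof
  show "locally_hoelder (\<lambda>s. u s * v s)" using assms by (auto simp: hoelder_L2_def intro: locally_hoelder_mult)
  have [measurable]: "u \<in> borel_measurable borel" "v \<in> borel_measurable borel"
    using assms by (auto simp: hoelder_L2_def locally_hoelder_measurable)
  obtain B where B: "\<And>s. norm (v s) \<le> B" using assms unfolding locally_hoelder_def by blast
  show "integrable lborel (\<lambda>s. (norm (u s * v s))\<^sup>2)"
  proof (rule Bochner_Integration.integrable_bound)
    show "integrable lborel (\<lambda>s. B\<^sup>2 * (norm (u s))\<^sup>2)" using assms by (simp add: hoelder_L2_def)
    show "AE s in lborel. norm ((norm (u s * v s))\<^sup>2) \<le> norm (B\<^sup>2 * (norm (u s))\<^sup>2)"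
    proof (intro AE_I2)
      fix s
      have "(norm (v s))\<^sup>2 \<le> B\<^sup>2" using B by (intro power_mono) auto
      hence "(norm (v s))\<^sup>2 * (norm (u s))\<^sup>2 \<le> B\<^sup>2 * (norm (u s))\<^sup>2" by (intro mult_right_mono) auto
      thus "norm ((norm (u s * v s))\<^sup>2) \<le> norm (B\<^sup>2 * (norm (u s))\<^sup>2)"
        by (simp add: norm_mult power_mult_distrib mult.commute)
    qed
  qed measurable
qed

lemma hoelder_L2_cnj: "hoelder_L2 u \<Longrightarrow> hoelder_L2 (\<lambda>s. cnj (u s))"
  by (simp add: hoelder_L2_def locally_hoelder_cnj)

lemma hoelder_L2_diff:
  assumes "hoelder_L2 u" "hoelder_L2 v"
  shows "hoelder_L2 (\<lambda>s. u s - v s)"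
  unfolding hoelder_L2_def
proof
  show "locally_hoelder (\<lambda>s. u s - v s)" using assms by (auto simp: hoelder_L2_def intro: locally_hoelder_diff)
  have [measurable]: "u \<in> borel_measurable borel" "v \<in> borel_measurable borel"
    using assms by (auto simp: hoelder_L2_def locally_hoelder_measurable)
  show "integrable lborel (\<lambda>s. (norm (u s - v s))\<^sup>2)"
  proof (rule Bochner_Integration.integrable_bound)
    show "integrable lborel (\<lambda>s. 2 * (norm (u s))\<^sup>2 + 2 * (norm (v s))\<^sup>2)" using assms by (simp add: hoelder_L2_def)
    show "AE s in lborel. norm ((norm (u s - v s))\<^sup>2) \<le> norm (2 * (norm (u s))\<^sup>2 + 2 * (norm (v s))\<^sup>2)"
    proof (intro AE_I2)
      fix s
      have "(norm (u s - v s))\<^sup>2 \<le> (norm (u s) + norm (v s))\<^sup>2" by (intro power_mono norm_triangle_ineq4) auto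
      also have "\<dots> \<le> 2 * (norm (u s))\<^sup>2 + 2 * (norm (v s))\<^sup>2"
        using sum_squares_bound[of "norm (u s)" "norm (v s)"] by (simp add: power2_sum)
      finally show "norm ((norm (u s - v s))\<^sup>2) \<le> norm (2 * (norm (u s))\<^sup>2 + 2 * (norm (v s))\<^sup>2)" by simp
    qed
  qed measurable
qed

section \<open>Geometry of the graph\<close>

locale graph_curve =
  fixes f f1 :: "real \<Rightarrow> real" and M K :: real
  assumes f_deriv: "(f has_real_derivative f1 x) (at x)"
    and f1_bound: "\<bar>f1 x\<bar> \<le> M"
    and f1_hoelder: "\<bar>f1 a - f1 b\<bar> \<le> K * sqrt \<bar>a - b\<bar>"
begin

definition Z :: "real \<Rightarrow> complex" where "Z s = Complex s (f s)"
definition Z' :: "real \<Rightarrow> complex" where "Z' s = Complex 1 (f1 s)"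
definition Up :: "complex set" where "Up = {z. Im z > f (Re z)}"
definition Lo :: "complex set" where "Lo = {z. Im z < f (Re z)}"

lemma Re_Z [simp]: "Re (Z s) = s" and Im_Z [simp]: "Im (Z s) = f s"
  and Re_Z' [simp]: "Re (Z' s) = 1" and Im_Z' [simp]: "Im (Z' s) = f1 s"
  by (simp_all add: Z_def Z'_def)

lemma M_nonneg: "M \<ge> 0" using f1_bound[of 0] by linarith

lemma f_continuous [continuous_intros]:
  "continuous_on S g \<Longrightarrow> continuous_on S (\<lambda>x. f (g x))" for g :: "'b::topological_space \<Rightarrow> real"
  by (rule continuous_on_compose2[of UNIV f])
     (auto intro!: continuous_at_imp_continuous_on DERIV_isCont[OF f_deriv])

lemma Z_deriv: "(Z has_vector_derivative Z' s) (at s)"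
  unfolding has_vector_derivative_complex_iff
  using f_deriv by simp

lemma Z'_nz [simp]: "Z' s \<noteq> 0" by (simp add: complex_eq_iff)

lemma norm_Z'_ge: "norm (Z' s) \<ge> 1" using complex_Re_le_cmod[of "Z' s"] by simp

lemma norm_Z'_le: "norm (Z' s) \<le> 1 + M"
  using cmod_le[of "Z' s"] f1_bound[of s] by simp

lemma locally_hoelder_Z': "locally_hoelder Z'"
  unfolding locally_hoelder_def
proof (intro conjI exI allI impI)
  show "norm (Z' s) \<le> 1 + M" for s by (rule norm_Z'_le)
  show "0 \<le> K" using f1_hoelder[of 0 1] by simp
  show "norm (Z' a - Z' b) \<le> K * sqrt \<bar>a - b\<bar>" for a b
    using f1_hoelder[of a b] cmod_le[of "Z' a - Z' b"] by simp
qed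

lemma Z_continuous [continuous_intros]:
  "continuous_on S g \<Longrightarrow> continuous_on S (\<lambda>x. Z (g x))" for g :: "'b::topological_space \<Rightarrow> real"
  unfolding Z_def Complex_eq by (intro continuous_intros)

lemma Z'_continuous [continuous_intros]:
  "continuous_on S g \<Longrightarrow> continuous_on S (\<lambda>x. Z' (g x))" for g :: "'b::topological_space \<Rightarrow> real"
  by (rule continuous_on_compose2[of UNIV Z']) (auto intro: locally_hoelder_continuous locally_hoelder_Z')

lemma Z_measurable [measurable]: "Z \<in> borel_measurable borel"
  and Z'_measurable [measurable]: "Z' \<in> borel_measurable borel"
  by (intro borel_measurable_continuous_onI continuous_intros)+

lemma norm_diff_Z_ge: "norm (z - Z s) \<ge> \<bar>Re z - s\<bar>"
  using abs_Re_le_cmod[of "z - Z s"] by simp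

lemma open_Up: "open Up" and open_Lo: "open Lo"
  unfolding Up_def Lo_def by (intro open_Collect_less continuous_intros)+

lemma off_graph: "z \<in> Up \<union> Lo \<Longrightarrow> z \<noteq> Z s"
  by (auto simp: Up_def Lo_def complex_eq_iff)

lemma f_lipschitz: "\<bar>f a - f b\<bar> \<le> M * \<bar>a - b\<bar>"
  using field_differentiable_bound[of UNIV f f1 M a b] f_deriv f1_bound by auto

text \<open>The distance to the curve is at least r by openness and at least |s| minus a constant by
  its horizontal part; together they grow linearly, uniformly on a ball. All dominating functions
  for differentiation under the integral come from here.\<close>

lemma distance_lower_bound:
  assumes "z \<in> Up \<union> Lo"
  obtains r c where "r > 0" "c > 0" "ball z r \<subseteq> Up \<union> Lo"
    "\<And>z' s. z' \<in> ball z r \<Longrightarrow> c * (1 + \<bar>s\<bar>) \<le> norm (z' - Z s)"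
proof -
  obtain r0 where r0: "r0 > 0" "ball z r0 \<subseteq> Up \<union> Lo"
    using open_contains_ball[of "Up \<union> Lo"] open_Un[OF open_Up open_Lo] assms by blast
  define r where "r = r0 / 2"
  have r: "r > 0" "ball z r \<subseteq> Up \<union> Lo" using r0 subset_ball[of r r0 z] by (auto simp: r_def)
  have far: "norm (z' - Z s) \<ge> r" if "z' \<in> ball z r" for z' s
  proof -
    have "Z s \<notin> ball z r0" using r0(2) by (auto simp: Up_def Lo_def)
    thus ?thesis using that norm_triangle_ineq[of "z - z'" "z' - Z s"]
      by (auto simp: r_def dist_norm)
  qed
  \<comment> \<open>With A = 1 + |Re z| + r and n the distance, 1 + |s| \<le> A + n \<le> (A / r +
    1) n because n \<ge> r.\<close>
  define c where "c = 1 / ((1 + \<bar>Re z\<bar> + r) / r + 1)"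
  have c: "c > 0" using r by (auto simp: c_def intro!: divide_pos_pos add_nonneg_pos)
  have "c * (1 + \<bar>s\<bar>) \<le> norm (z' - Z s)" if "z' \<in> ball z r" for z' s
  proof -
    let ?n = "norm (z' - Z s)"
    have "\<bar>Re z'\<bar> \<le> \<bar>Re z\<bar> + r" using that abs_Re_le_cmod[of "z - z'"] by (auto simp: dist_norm)
    hence "1 + \<bar>s\<bar> \<le> (1 + \<bar>Re z\<bar> + r) + ?n" using norm_diff_Z_ge[of z' s] by linarith
    also have "\<dots> \<le> (1 + \<bar>Re z\<bar> + r) / r * ?n + ?n"
    proof -
      have "(1 + \<bar>Re z\<bar> + r) / r * r \<le> (1 + \<bar>Re z\<bar> + r) / r * ?n"
        using far[OF that] r by (intro mult_left_mono) auto
      thus ?thesis using r by simp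
    qed
    also have "\<dots> = ((1 + \<bar>Re z\<bar> + r) / r + 1) * ?n" by (simp add: algebra_simps)
    finally have "1 + \<bar>s\<bar> \<le> ((1 + \<bar>Re z\<bar> + r) / r + 1) * ?n" .
    moreover have "(1 + \<bar>Re z\<bar> + r) / r + 1 > 0" using r by (intro add_nonneg_pos) auto
    ultimately show ?thesis unfolding c_def by (simp add: field_simps)
  qed
  thus ?thesis using that r c by blast
qed

text \<open>While Re z stays bounded, z can reach infinity only vertically, and the piece of curve
  in the window stays in a bounded set by the Lipschitz bound.\<close>

lemma norm_diff_Z_ge_Im:
  assumes "\<bar>Re z\<bar> \<le> X" "\<bar>t\<bar> \<le> T"
  shows "norm (z - Z (Re z + t)) \<ge> norm z - (X + \<bar>f 0\<bar> + M * (X + T))"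
proof -
  have "\<bar>f (Re z + t)\<bar> \<le> \<bar>f 0\<bar> + M * \<bar>Re z + t\<bar>" using f_lipschitz[of "Re z + t" 0] by auto
  also have "M * \<bar>Re z + t\<bar> \<le> M * (X + T)" using assms M_nonneg by (intro mult_left_mono) auto
  finally have "\<bar>f (Re z + t)\<bar> \<le> \<bar>f 0\<bar> + M * (X + T)" by simp
  moreover have "norm z \<le> \<bar>Re z\<bar> + \<bar>Im z\<bar>" by (rule cmod_le)
  moreover have "norm (z - Z (Re z + t)) \<ge> \<bar>Im z - f (Re z + t)\<bar>"
    using abs_Im_le_cmod[of "z - Z (Re z + t)"] by simp
  ultimately show ?thesis using assms by linarith
qed


section \<open>Integrals over a window moving along the graph\<close>

text \<open>Kernels with the size of 1/w that need not be holomorphic. At w = 0 the bound reads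
  \<open>norm (k 0) \<le> 0\<close>, since division by zero gives 0, so the kernel is total and
  vanishes at its singularity.\<close>

definition cauchy_kernel :: "(complex \<Rightarrow> complex) \<Rightarrow> bool" where
  "cauchy_kernel k \<longleftrightarrow> continuous_on (- {0}) k \<and> (\<forall>w. norm (k w) \<le> 1 / norm w) \<and> k \<in> borel_measurable borel"

text \<open>The window \<open>[-1, 1]\<close> around the parameter \<open>Re z\<close> moves with \<open>z\<close>. Inside it the density is
  corrected by its value at \<open>Re z\<close>, so the integrand is dominated by a multiple of \<open>1 / sqrt \<bar>t\<bar>\<close> uniformly in \<open>z\<close>,
  also for \<open>z\<close> on the graph; only the explicit integral of the bare kernel over the window jumps.\<close>

definition J :: "(complex \<Rightarrow> complex) \<Rightarrow> (real \<Rightarrow> complex) \<Rightarrow> (real \<Rightarrow> complex) \<Rightarrow> complex \<Rightarrow> real \<Rightarrow> complex" where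
  "J k \<eta> \<psi> z t = (if \<bar>t\<bar> \<le> 1 then (\<eta> (Re z + t) - \<eta> (Re z)) * Z' (Re z + t) else \<psi> (Re z + t))
     * k (z - Z (Re z + t))"

context
  fixes k \<eta> \<psi>
  assumes k: "cauchy_kernel k" and \<eta>: "locally_hoelder \<eta>" and \<psi>: "hoelder_L2 \<psi>"
begin

text \<open>Horizontal distance alone bounds the kernel, so the estimate is uniform in z and holds
  on the graph as well.\<close>

lemma k_bound: "norm (k (z - Z (Re z + t))) \<le> 1 / \<bar>t\<bar>" if "t \<noteq> 0"
proof -
  have "norm (k (z - Z (Re z + t))) \<le> 1 / norm (z - Z (Re z + t))" using k by (auto simp: cauchy_kernel_def)
  also have "\<dots> \<le> 1 / \<bar>t\<bar>" using norm_diff_Z_ge[of z "Re z + t"] that by (intro frac_le) auto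
  finally show ?thesis .
qed

lemma k_measurable [measurable]: "k \<in> borel_measurable borel"
  using k by (simp add: cauchy_kernel_def)

lemma eta_measurable [measurable]: "\<eta> \<in> borel_measurable borel"
  using \<eta> by (rule locally_hoelder_measurable)

lemma psi_measurable [measurable]: "\<psi> \<in> borel_measurable borel"
  using \<psi> by (auto simp: hoelder_L2_def intro: locally_hoelder_measurable)

lemma J_measurable [measurable]: "J k \<eta> \<psi> z \<in> borel_measurable borel"
  unfolding J_def by measurable

lemma J_near_bound:
  obtains C where "C \<ge> 0" "\<And>z t. \<bar>t\<bar> \<le> 1 \<Longrightarrow> norm (J k \<eta> \<psi> z t) \<le> C * (indicator {-1..1} t * (1 / sqrt \<bar>t\<bar>))"
proof -
  obtain L where L: "L \<ge> 0" "\<And>a b. \<bar>a - b\<bar> \<le> 1 \<Longrightarrow> norm (\<eta> a - \<eta> b) \<le> L * sqrt \<bar>a - b\<bar>"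
    using \<eta> unfolding locally_hoelder_def by metis
  show ?thesis
  proof (rule that[of "L * (1 + M)"])
    show "L * (1 + M) \<ge> 0" using L M_nonneg by simp
    fix z t assume t: "\<bar>t::real\<bar> \<le> 1"
    show "norm (J k \<eta> \<psi> z t) \<le> L * (1 + M) * (indicator {-1..1} t * (1 / sqrt \<bar>t\<bar>))"
    proof (cases "t = 0")
      case False
      have "norm (J k \<eta> \<psi> z t) = norm (\<eta> (Re z + t) - \<eta> (Re z)) * norm (Z' (Re z + t)) * norm (k (z - Z (Re z + t)))"
        using t by (simp add: J_def norm_mult)
      also have "\<dots> \<le> (L * sqrt \<bar>t\<bar>) * (1 + M) * (1 / \<bar>t\<bar>)"
        using L(2)[of "Re z + t" "Re z"] t M_nonneg L(1) False
        by (intro mult_mono k_bound norm_Z'_le) auto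
      also have "\<dots> = L * (1 + M) * (1 / sqrt \<bar>t\<bar>)"
        using False by (simp add: field_simps)
      finally show ?thesis using t by (simp add: abs_le_iff indicator_def)
    qed (simp add: J_def)
  qed
qed

lemma J_far_bound: "norm (J k \<eta> \<psi> z t) \<le> norm (\<psi> (Re z + t)) * (1 / \<bar>t\<bar>)" if "\<bar>t\<bar> > 1"
proof -
  have t: "t \<noteq> 0" "\<not> \<bar>t\<bar> \<le> 1" using that by auto
  have "norm (J k \<eta> \<psi> z t) = norm (\<psi> (Re z + t)) * norm (k (z - Z (Re z + t)))"
    using t by (simp add: J_def norm_mult)
  thus ?thesis using mult_left_mono[OF k_bound[OF t(1), of z] norm_ge_zero] by metis
qed

text \<open>AM-GM with a free weight \<alpha>. The first term has an integral independent of z, by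
  translation invariance, and can be made small through \<alpha>; the second is an integrable
  function of t alone.\<close>

lemma J_far_bound': "norm (J k \<eta> \<psi> z t) \<le> \<alpha> * (norm (\<psi> (Re z + t)))\<^sup>2 + 2 / \<alpha> * (1 / (1 + t\<^sup>2))"
  if t: "\<bar>t\<bar> > 1" and \<alpha>: "\<alpha> > 0"
proof -
  let ?p = "norm (\<psi> (Re z + t))"
  have "0 \<le> (\<alpha> * ?p - 1 / \<bar>t\<bar>)\<^sup>2" by simp
  hence "2 * \<alpha> * (?p * (1 / \<bar>t\<bar>)) \<le> \<alpha>\<^sup>2 * ?p\<^sup>2 + 1 / t\<^sup>2"
    by (simp add: power2_diff power_mult_distrib power_divide algebra_simps)
  hence "\<alpha> * (2 * (?p * (1 / \<bar>t\<bar>))) \<le> \<alpha> * (\<alpha> * ?p\<^sup>2 + 1 / \<alpha> * (1 / t\<^sup>2))"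
    using \<alpha> by (simp add: power2_eq_square algebra_simps)
  hence "2 * (?p * (1 / \<bar>t\<bar>)) \<le> \<alpha> * ?p\<^sup>2 + 1 / \<alpha> * (1 / t\<^sup>2)" using \<alpha> by (simp only: mult_le_cancel_left_pos)
  moreover have "1 / \<alpha> * (1 / t\<^sup>2) \<le> 2 / \<alpha> * (1 / (1 + t\<^sup>2))"
  proof -
    have "1 < t\<^sup>2" using one_less_power[OF t, of 2] by simp
    hence "0 < t\<^sup>2" "1 + t\<^sup>2 \<le> 2 * t\<^sup>2" by auto
    hence "1 / t\<^sup>2 \<le> 2 * (1 / (1 + t\<^sup>2))" by (simp add: field_simps)
    from mult_left_mono[OF this, of "1 / \<alpha>"] \<alpha> show ?thesis by simp
  qed
  moreover have "0 \<le> \<alpha> * ?p\<^sup>2" "0 \<le> 2 / \<alpha> * (1 / (1 + t\<^sup>2))" "?p * (1 / \<bar>t\<bar>) \<ge> 0"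
    using \<alpha> by (auto intro!: mult_nonneg_nonneg divide_nonneg_nonneg add_nonneg_nonneg)
  ultimately have "?p * (1 / \<bar>t\<bar>) \<le> \<alpha> * ?p\<^sup>2 + 2 / \<alpha> * (1 / (1 + t\<^sup>2))" by linarith
  thus ?thesis using J_far_bound[OF t, of z] by linarith
qed

lemma psi_shift_L2:
  "integrable lborel (\<lambda>t. (norm (\<psi> (x + t)))\<^sup>2)"
  "(LINT t|lborel. (norm (\<psi> (x + t)))\<^sup>2) = (LINT t|lborel. (norm (\<psi> t))\<^sup>2)"
  using \<psi> lborel_integrable_real_affine_iff[of 1 "\<lambda>t. (norm (\<psi> t))\<^sup>2" x]
    lborel_integral_real_affine[of 1 "\<lambda>t. (norm (\<psi> t))\<^sup>2" x] by (simp_all add: hoelder_L2_def)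

lemma J_integrable: "integrable lborel (J k \<eta> \<psi> z)"
proof -
  obtain C where C: "C \<ge> 0" "\<And>z t. \<bar>t\<bar> \<le> 1 \<Longrightarrow> norm (J k \<eta> \<psi> z t) \<le> C * (indicator {-1..1} t * (1 / sqrt \<bar>t\<bar>))"
    using J_near_bound by blast
  show ?thesis
  proof (rule Bochner_Integration.integrable_bound)
    show "integrable lborel (\<lambda>t. C * (indicator {-1..1} t * (1 / sqrt \<bar>t\<bar>)) +
        (1 * (norm (\<psi> (Re z + t)))\<^sup>2 + 2 / 1 * (1 / (1 + t\<^sup>2))))"
      using integrable_inverse_sqrt_abs integrable_inverse_square_line psi_shift_L2
      by (intro Bochner_Integration.integrable_add integrable_mult_right) auto
    show "AE t in lborel. norm (J k \<eta> \<psi> z t) \<le> norm (C * (indicator {-1..1} t * (1 / sqrt \<bar>t\<bar>)) +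
        (1 * (norm (\<psi> (Re z + t)))\<^sup>2 + 2 / 1 * (1 / (1 + t\<^sup>2))))"
    proof (intro AE_I2)
      fix t :: real
      have a: "C * (indicator {-1..1} t * (1 / sqrt \<bar>t\<bar>)) \<ge> 0" using C by (simp add: indicator_def)
      have b: "1 * (norm (\<psi> (Re z + t)))\<^sup>2 + 2 / 1 * (1 / (1 + t\<^sup>2)) \<ge> 0"
        by (auto intro!: mult_nonneg_nonneg divide_nonneg_nonneg add_nonneg_nonneg)
      show "norm (J k \<eta> \<psi> z t) \<le> norm (C * (indicator {-1..1} t * (1 / sqrt \<bar>t\<bar>)) +
        (1 * (norm (\<psi> (Re z + t)))\<^sup>2 + 2 / 1 * (1 / (1 + t\<^sup>2))))"
        using C(2)[of t z] J_far_bound'[of t 1 z] a b unfolding real_norm_def by (cases "\<bar>t\<bar> \<le> 1") linarith+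
    qed
  qed measurable
qed

text \<open>The translates of \<psi> have no common integrable majorant, but their L2 norms agree.
  Fixing first \<alpha> and then N makes the tail small uniformly in z.\<close>

lemma J_tail:
  assumes "e > 0"
  obtains N :: nat where "N \<ge> 1" "\<And>z. norm (LINT t|lborel. indicator {t. \<bar>t\<bar> > real N} t *\<^sub>R J k \<eta> \<psi> z t) < e"
proof -
  define E where "E = (LINT t|lborel. (norm (\<psi> t))\<^sup>2)"
  have E: "E \<ge> 0" unfolding E_def by (intro integral_nonneg_AE) auto
  \<comment> \<open>Makes the L2 part smaller than e/2; \<open>E + 1\<close> avoids dividing by zero
    when the density vanishes.\<close>
  define \<alpha> where "\<alpha> = e / (2 * (E + 1))"
  have \<alpha>: "\<alpha> > 0" "\<alpha> * E < e / 2" using assms E by (auto simp: \<alpha>_def field_simps)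
  have L: "(\<lambda>n. LINT t|lborel. indicator {t. \<bar>t\<bar> > real n} t * (1 / (1 + t\<^sup>2))) \<longlonglongrightarrow> (LINT t::real|lborel. (0::real))"
  proof (rule integral_dominated_convergence[where w = "\<lambda>t. 1 / (1 + t\<^sup>2)"])
    show "AE t in lborel. (\<lambda>n. indicator {t. \<bar>t\<bar> > real n} t * (1 / (1 + t\<^sup>2))) \<longlonglongrightarrow> 0"
    proof (intro AE_I2 tendsto_eventually)
      fix t :: real
      obtain N where "\<bar>t\<bar> < real N" using reals_Archimedean2 by blast
      thus "\<forall>\<^sub>F n in sequentially. indicator {t. \<bar>t\<bar> > real n} t * (1 / (1 + t\<^sup>2)) = 0"
        by (intro eventually_sequentiallyI[of N]) (auto simp: indicator_def)
    qed
    show "AE t in lborel. norm (indicator {t. \<bar>t\<bar> > real n} t * (1 / (1 + t\<^sup>2))) \<le> 1 / (1 + t\<^sup>2)" for n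
      by (intro AE_I2) (auto simp: indicator_def abs_if add_nonneg_nonneg)
  qed (use integrable_inverse_square_line in auto)
  have "\<forall>\<^sub>F n in sequentially. (LINT t|lborel. indicator {t. \<bar>t\<bar> > real n} t * (1 / (1 + t\<^sup>2))) < \<alpha> * e / 4"
    by (rule order_tendstoD(2)[OF L[unfolded Bochner_Integration.integral_zero]]) (use \<alpha> assms in simp)
  hence "\<forall>\<^sub>F n in sequentially. n \<ge> 1 \<and> (LINT t|lborel. indicator {t. \<bar>t\<bar> > real n} t * (1 / (1 + t\<^sup>2))) < \<alpha> * e / 4"
    using eventually_ge_at_top[of 1] by eventually_elim auto
  from eventually_happens'[OF sequentially_bot this] obtain N where N: "N \<ge> 1" "(LINT t|lborel. indicator {t. \<bar>t\<bar> > real N} t * (1 / (1 + t\<^sup>2))) < \<alpha> * e / 4"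
    by blast
  have i: "integrable lborel (\<lambda>t. indicator {t. \<bar>t\<bar> > real N} t * (1 / (1 + t\<^sup>2)))"
    by (rule Bochner_Integration.integrable_bound[OF integrable_inverse_square_line])
       (auto simp: indicator_def)
  have "norm (LINT t|lborel. indicator {t. \<bar>t\<bar> > real N} t *\<^sub>R J k \<eta> \<psi> z t) < e" for z
  proof -
    have "norm (LINT t|lborel. indicator {t. \<bar>t\<bar> > real N} t *\<^sub>R J k \<eta> \<psi> z t) \<le>
      (LINT t|lborel. norm (indicator {t. \<bar>t\<bar> > real N} t *\<^sub>R J k \<eta> \<psi> z t))"
      by (rule integral_norm_bound)
    also have "\<dots> \<le> (LINT t|lborel. \<alpha> * (norm (\<psi> (Re z + t)))\<^sup>2 + 2 / \<alpha> * (indicator {t. \<bar>t\<bar> > real N} t * (1 / (1 + t\<^sup>2))))"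
    proof (rule integral_mono)
      show "integrable lborel (\<lambda>t. norm (indicator {t. \<bar>t\<bar> > real N} t *\<^sub>R J k \<eta> \<psi> z t))"
        by (rule Bochner_Integration.integrable_bound[OF J_integrable[of z]]) (auto simp: indicator_def)
      show "integrable lborel (\<lambda>t. \<alpha> * (norm (\<psi> (Re z + t)))\<^sup>2 + 2 / \<alpha> * (indicator {t. \<bar>t\<bar> > real N} t * (1 / (1 + t\<^sup>2))))"
        using psi_shift_L2 i by (intro Bochner_Integration.integrable_add integrable_mult_right) auto
      show "norm (indicator {t. \<bar>t\<bar> > real N} t *\<^sub>R J k \<eta> \<psi> z t) \<le> \<alpha> * (norm (\<psi> (Re z + t)))\<^sup>2 + 2 / \<alpha> * (indicator {t. \<bar>t\<bar> > real N} t * (1 / (1 + t\<^sup>2)))" for t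
      proof (cases "\<bar>t\<bar> > real N")
        case True
        hence "\<bar>t\<bar> > 1" using N(1) by linarith
        from J_far_bound'[OF this \<alpha>(1), of z] True show ?thesis by simp
      qed (use \<alpha> in simp)
    qed
    also have "\<dots> = \<alpha> * E + 2 / \<alpha> * (LINT t|lborel. indicator {t. \<bar>t\<bar> > real N} t * (1 / (1 + t\<^sup>2)))"
      using Bochner_Integration.integral_add[OF integrable_mult_right[OF psi_shift_L2(1), of \<alpha>] integrable_mult_right[OF i, of "2 / \<alpha>"], of "Re z"]
      by (simp only: E_def integral_mult_right_zero psi_shift_L2(2))
    also have "\<dots> < e / 2 + 2 / \<alpha> * (\<alpha> * e / 4)"
      using \<alpha> N(2) by (intro add_strict_mono mult_strict_left_mono) auto
    also have "\<dots> = e" using \<alpha>(1) by simp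
    finally show ?thesis .
  qed
  thus ?thesis using that N(1) by blast
qed

text \<open>Dominated convergence for |t| \<le> N, with the uniform tail bound beyond. The two forms
  of the limit j serve the two applications: J at the limit point for continuity, zero for decay. In
  both cases the tail of j is under control.\<close>

lemma J_convergence:
  fixes X :: "nat \<Rightarrow> complex"
  assumes lim: "\<And>t. t \<noteq> 0 \<Longrightarrow> (\<lambda>n. J k \<eta> \<psi> (X n) t) \<longlonglongrightarrow> j t"
    and j: "j = (\<lambda>_. 0) \<or> (\<exists>z. j = J k \<eta> \<psi> z)"
  shows "(\<lambda>n. LINT t|lborel. J k \<eta> \<psi> (X n) t) \<longlonglongrightarrow> (LINT t|lborel. j t)"
proof (rule metric_LIMSEQ_I)
  fix e :: real assume "e > 0"
  hence e3: "e / 3 > 0" by simp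
  obtain N :: nat where N: "N \<ge> 1" "\<And>z. norm (LINT t|lborel. indicator {t. \<bar>t\<bar> > real N} t *\<^sub>R J k \<eta> \<psi> z t) < e/3"
    using J_tail[OF e3] by blast
  have jt: "norm (LINT t|lborel. indicator {t. \<bar>t\<bar> > real N} t *\<^sub>R j t) < e/3" using j N(2) e3 by auto
  have ji: "integrable lborel j" using j J_integrable by auto
  obtain C where C: "C \<ge> 0" "\<And>z t. \<bar>t\<bar> \<le> 1 \<Longrightarrow> norm (J k \<eta> \<psi> z t) \<le> C * (indicator {-1..1} t * (1 / sqrt \<bar>t\<bar>))"
    using J_near_bound by blast
  obtain B where B: "\<And>s. norm (\<psi> s) \<le> B" using \<psi> unfolding hoelder_L2_def locally_hoelder_def by blast
  have B0: "B \<ge> 0" using B[of 0] norm_ge_zero order_trans by blast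
  have "(\<lambda>n. LINT t|lborel. indicator {t. \<bar>t\<bar> \<le> real N} t *\<^sub>R J k \<eta> \<psi> (X n) t) \<longlonglongrightarrow>
      (LINT t|lborel. indicator {t. \<bar>t\<bar> \<le> real N} t *\<^sub>R j t)"
  proof (rule integral_dominated_convergence[where w = "\<lambda>t. C * (indicator {-1..1} t * (1 / sqrt \<bar>t\<bar>)) + B * indicator {-real N..real N} t"])
    show "(\<lambda>t. indicator {t. \<bar>t\<bar> \<le> real N} t *\<^sub>R j t) \<in> borel_measurable lborel" using ji by simp
    show "integrable lborel (\<lambda>t. C * (indicator {-1..1} t * (1 / sqrt \<bar>t\<bar>)) + B * indicator {-real N..real N} t)"
      using integrable_inverse_sqrt_abs by (intro Bochner_Integration.integrable_add integrable_mult_right) auto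
    show "AE t in lborel. (\<lambda>n. indicator {t. \<bar>t\<bar> \<le> real N} t *\<^sub>R J k \<eta> \<psi> (X n) t) \<longlonglongrightarrow> indicator {t. \<bar>t\<bar> \<le> real N} t *\<^sub>R j t"
      using AE_lborel_singleton[of 0] by eventually_elim (intro tendsto_intros lim)
    show "AE t in lborel. norm (indicator {t. \<bar>t\<bar> \<le> real N} t *\<^sub>R J k \<eta> \<psi> (X n) t) \<le>
        C * (indicator {-1..1} t * (1 / sqrt \<bar>t\<bar>)) + B * indicator {-real N..real N} t" for n
    proof (intro AE_I2)
      fix t :: real
      have nn: "C * (indicator {-1..1} t * (1 / sqrt \<bar>t\<bar>)) \<ge> 0" "B * indicator {-real N..real N} t \<ge> 0"
        using C B0 by (auto simp: indicator_def)
      consider "\<bar>t\<bar> \<le> 1" | "\<bar>t\<bar> > 1" "\<bar>t\<bar> \<le> real N" | "\<bar>t\<bar> > real N" by linarith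
      thus "norm (indicator {t. \<bar>t\<bar> \<le> real N} t *\<^sub>R J k \<eta> \<psi> (X n) t) \<le>
        C * (indicator {-1..1} t * (1 / sqrt \<bar>t\<bar>)) + B * indicator {-real N..real N} t"
      proof cases
        case 1
        thus ?thesis using C(2)[OF 1, of "X n"] N(1) nn by (auto simp: indicator_def split: if_splits)
      next
        case 2
        have "norm (\<psi> (Re (X n) + t)) * (1 / \<bar>t\<bar>) \<le> B * 1"
          using 2 B B0 by (intro mult_mono) auto
        with J_far_bound[OF 2(1), of "X n"] 2 nn show ?thesis by (auto simp: indicator_def abs_le_iff split: if_splits)
      qed (use nn in auto)
    qed
  qed measurable
  from metric_LIMSEQ_D[OF this e3] obtain n0 where n0: "\<And>n. n \<ge> n0 \<Longrightarrow>
    norm ((LINT t|lborel. indicator {t. \<bar>t\<bar> \<le> real N} t *\<^sub>R J k \<eta> \<psi> (X n) t) -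
      (LINT t|lborel. indicator {t. \<bar>t\<bar> \<le> real N} t *\<^sub>R j t)) < e / 3" unfolding dist_norm by blast
  have split: "(LINT t|lborel. h t) = (LINT t|lborel. indicator {t. \<bar>t\<bar> \<le> real N} t *\<^sub>R h t) +
      (LINT t|lborel. indicator {t. \<bar>t\<bar> > real N} t *\<^sub>R h t)" if h: "integrable lborel h" for h :: "real \<Rightarrow> complex"
  proof -
    have "integrable lborel (\<lambda>t. indicator A t *\<^sub>R h t)" if [measurable]: "A \<in> sets borel" for A :: "real set"
      by (rule Bochner_Integration.integrable_bound[OF h]) (use h in \<open>auto simp: indicator_def\<close>)
    hence "(LINT t|lborel. indicator {t. \<bar>t\<bar> \<le> real N} t *\<^sub>R h t) +
      (LINT t|lborel. indicator {t. \<bar>t\<bar> > real N} t *\<^sub>R h t) =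
      (LINT t|lborel. indicator {t. \<bar>t\<bar> \<le> real N} t *\<^sub>R h t + indicator {t. \<bar>t\<bar> > real N} t *\<^sub>R h t)"
      by (intro Bochner_Integration.integral_add[symmetric]) measurable
    also have "\<dots> = (LINT t|lborel. h t)"
      by (intro Bochner_Integration.integral_cong) (auto simp: indicator_def)
    finally show ?thesis by simp
  qed
  show "\<exists>n0. \<forall>n\<ge>n0. dist (LINT t|lborel. J k \<eta> \<psi> (X n) t) (LINT t|lborel. j t) < e"
  proof (intro exI[of _ n0] allI impI)
    fix n assume n: "n \<ge> n0"
    have tri: "norm ((a + b) - (c + d)) < e" if "norm (a - c) < e/3" "norm b < e/3" "norm d < e/3" for a b c d :: complex
      using norm_triangle_ineq4[of "(a - c) + b" d] norm_triangle_ineq[of "a - c" b] that by (simp add: algebra_simps)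
    show "dist (LINT t|lborel. J k \<eta> \<psi> (X n) t) (LINT t|lborel. j t) < e"
      unfolding dist_norm split[OF J_integrable] split[OF ji]
      by (rule tri[OF n0[OF n] N(2) jt])
  qed
qed

lemma J_isCont: "isCont (\<lambda>z. J k \<eta> \<psi> z t) z" if "t \<noteq> 0"
proof -
  have c: "isCont (\<lambda>z. h (Re z + r)) z" if "locally_hoelder h" for h :: "real \<Rightarrow> complex" and r
  proof -
    have "isCont h (Re z + r)" using locally_hoelder_continuous[OF that, of UNIV] by (simp add: continuous_on_eq_continuous_at)
    moreover have "isCont (\<lambda>z. Re z + r) z" by (intro continuous_add continuous_Re continuous_ident continuous_const)
    ultimately show ?thesis using continuous_at_compose[of z "\<lambda>z. Re z + r" h] by (simp add: o_def)
  qed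
  have "z - Z (Re z + t) \<noteq> 0" using norm_diff_Z_ge[of z "Re z + t"] that by auto
  hence "isCont k (z - Z (Re z + t))"
    using k continuous_on_eq_continuous_at[of "- {0}" k] by (auto simp: cauchy_kernel_def open_Compl)
  moreover have "continuous_on UNIV (\<lambda>z. z - Z (Re z + t))" by (intro continuous_intros)
  hence "isCont (\<lambda>z. z - Z (Re z + t)) z" by (simp only: continuous_on_eq_continuous_at[OF open_UNIV] ball_UNIV)
  ultimately have "isCont (\<lambda>z. k (z - Z (Re z + t))) z"
    using continuous_at_compose[of z "\<lambda>z. z - Z (Re z + t)" k] by (simp add: o_def)
  moreover have "locally_hoelder \<psi>" using \<psi> by (simp add: hoelder_L2_def)
  ultimately show ?thesis unfolding J_def
    using c[OF \<eta>, of t] c[OF \<eta>, of 0] c[OF locally_hoelder_Z', of t] c[of \<psi> t]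
    by (cases "\<bar>t\<bar> \<le> 1") (auto intro!: continuous_intros)
qed

lemma J_integral_continuous: "continuous_on UNIV (\<lambda>z. LINT t|lborel. J k \<eta> \<psi> z t)"
  unfolding continuous_on_sequentially
proof safe
  fix X :: "nat \<Rightarrow> complex" and z assume X: "X \<longlonglongrightarrow> z"
  show "((\<lambda>z. LINT t|lborel. J k \<eta> \<psi> z t) \<circ> X) \<longlonglongrightarrow> (LINT t|lborel. J k \<eta> \<psi> z t)"
    unfolding o_def by (rule J_convergence) (use isCont_tendsto_compose[OF J_isCont X] in auto)
qed


text \<open>With zero far density only the window remains, where the majorant does not depend on z.
  Used to bound the window integral inside \<open>W2\<close>.\<close>

lemma J_integral_bound_near:
  assumes "\<psi> = (\<lambda>_. 0)"
  obtains C where "\<And>z. norm (LINT t|lborel. J k \<eta> \<psi> z t) \<le> C"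
proof -
  obtain C where C: "C \<ge> 0" "\<And>z t. \<bar>t\<bar> \<le> 1 \<Longrightarrow> norm (J k \<eta> \<psi> z t) \<le> C * (indicator {-1..1} t * (1 / sqrt \<bar>t\<bar>))"
    using J_near_bound by blast
  have "norm (LINT t|lborel. J k \<eta> \<psi> z t) \<le> (LINT t|lborel. C * (indicator {-1..1} t * (1 / sqrt \<bar>t\<bar>)))" for z
  proof -
    have "norm (LINT t|lborel. J k \<eta> \<psi> z t) \<le> (LINT t|lborel. norm (J k \<eta> \<psi> z t))" by (rule integral_norm_bound)
    also have "\<dots> \<le> (LINT t|lborel. C * (indicator {-1..1} t * (1 / sqrt \<bar>t\<bar>)))"
    proof (rule integral_mono)
      show "norm (J k \<eta> \<psi> z t) \<le> C * (indicator {-1..1} t * (1 / sqrt \<bar>t\<bar>))" for t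
        using C(2)[of t z] C(1) by (cases "\<bar>t\<bar> \<le> 1") (auto simp: J_def assms indicator_def)
      show "integrable lborel (\<lambda>t. norm (J k \<eta> \<psi> z t))" by (intro integrable_norm J_integrable)
      show "integrable lborel (\<lambda>t. C * (indicator {-1..1} t * (1 / sqrt \<bar>t\<bar>)))"
        by (intro integrable_mult_right integrable_inverse_sqrt_abs)
    qed
    finally show ?thesis .
  qed
  thus ?thesis using that by blast
qed

text \<open>Infinity is approached in two ways: either Re z is large and \<phi> is small while the
  kernel is at most 1 / |t|, or Re z stays bounded and the distance to the curve point is large
  while \<phi> is bounded.\<close>

lemma kernel_decay:
  fixes \<phi> :: "real \<Rightarrow> complex" and r t :: real
  assumes \<phi>: "(\<phi> \<longlongrightarrow> 0) at_infinity" "\<And>s. norm (\<phi> s) \<le> B" and t: "t \<noteq> 0"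
  shows "((\<lambda>z. \<phi> (Re z + r) * k (z - Z (Re z + t))) \<longlongrightarrow> (0::complex)) at_infinity"
  unfolding Lim_at_infinity
proof (intro allI impI)
  fix e :: real assume e: "e > 0"
  have B: "B \<ge> 0" using \<phi>(2)[of 0] norm_ge_zero order_trans by blast
  have "e * \<bar>t\<bar> > 0" using e t by simp
  then obtain X where X: "\<And>s. \<bar>s\<bar> \<ge> X \<Longrightarrow> norm (\<phi> s) < e * \<bar>t\<bar>"
    using \<phi>(1) unfolding Lim_at_infinity by (auto simp: dist_norm)
  \<comment> \<open>Absorbs the shift r: outside the first case |Re z + r| < X, hence |Re z| \<le>
    X'.\<close>
  define X' where "X' = \<bar>X\<bar> + \<bar>r\<bar>"
  define D where "D = (B + 1) / e"
  have D: "D > 0" "B / D < e" using B e by (auto simp: D_def field_simps)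
  show "\<exists>b. \<forall>z. b \<le> norm z \<longrightarrow> dist (\<phi> (Re z + r) * k (z - Z (Re z + t))) 0 < e"
  proof (intro exI[of _ "X' + \<bar>f 0\<bar> + M * (X' + \<bar>t\<bar>) + D"] allI impI)
    fix z :: complex assume z: "X' + \<bar>f 0\<bar> + M * (X' + \<bar>t\<bar>) + D \<le> norm z"
    show "dist (\<phi> (Re z + r) * k (z - Z (Re z + t))) 0 < e"
    proof (cases "\<bar>Re z + r\<bar> \<ge> X")
      case True
      have "norm (\<phi> (Re z + r)) * norm (k (z - Z (Re z + t))) \<le> norm (\<phi> (Re z + r)) * (1 / \<bar>t\<bar>)"
        using k_bound[OF t] by (intro mult_left_mono) auto
      also have "\<dots> < e * \<bar>t\<bar> * (1 / \<bar>t\<bar>)" using X[OF True] t by (intro mult_strict_right_mono) auto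
      finally show ?thesis using t by (simp add: norm_mult)
    next
      case False
      hence "\<bar>Re z\<bar> \<le> X'" by (auto simp: X'_def)
      hence d: "norm (z - Z (Re z + t)) \<ge> D" using norm_diff_Z_ge_Im[of z X' t "\<bar>t\<bar>"] z by simp
      have "norm (k (z - Z (Re z + t))) \<le> 1 / norm (z - Z (Re z + t))" using k by (auto simp: cauchy_kernel_def)
      also have "\<dots> \<le> 1 / D" using d D by (intro frac_le) auto
      finally have "norm (\<phi> (Re z + r)) * norm (k (z - Z (Re z + t))) \<le> B * (1 / D)"
        using \<phi>(2) B by (intro mult_mono) auto
      thus ?thesis using D(2) by (simp add: norm_mult)
    qed
  qed
qed

lemma J_integral_decay:
  assumes \<eta>0: "(\<eta> \<longlongrightarrow> 0) at_infinity" and \<psi>0: "(\<psi> \<longlongrightarrow> 0) at_infinity"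
  shows "((\<lambda>z. LINT t|lborel. J k \<eta> \<psi> z t) \<longlongrightarrow> 0) at_infinity"
proof (rule at_infinity_sequentiallyI)
  obtain B where B: "\<And>s. norm (\<eta> s) \<le> B" using \<eta> unfolding locally_hoelder_def by blast
  obtain C where C: "\<And>s. norm (\<psi> s) \<le> C" using \<psi> unfolding hoelder_L2_def locally_hoelder_def by blast
  have J0: "((\<lambda>z. J k \<eta> \<psi> z t) \<longlongrightarrow> 0) at_infinity" if t: "t \<noteq> 0" for t
  proof (cases "\<bar>t\<bar> \<le> 1")
    case True
    have *: "((\<lambda>z. \<eta> (Re z + r) * Z' (Re z + t) * k (z - Z (Re z + t))) \<longlongrightarrow> 0) at_infinity" for r
    proof (rule tendsto_0_le[OF kernel_decay[OF \<eta>0 B t, of r]], rule always_eventually, rule allI)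
      fix z
      show "norm (\<eta> (Re z + r) * Z' (Re z + t) * k (z - Z (Re z + t))) \<le> norm (\<eta> (Re z + r) * k (z - Z (Re z + t))) * (1 + M)"
        using mult_left_mono[OF norm_Z'_le[of "Re z + t"], of "norm (\<eta> (Re z + r) * k (z - Z (Re z + t)))"]
        by (simp add: norm_mult mult_ac)
    qed
    have "((\<lambda>z. \<eta> (Re z + t) * Z' (Re z + t) * k (z - Z (Re z + t)) -
        \<eta> (Re z + 0) * Z' (Re z + t) * k (z - Z (Re z + t))) \<longlongrightarrow> 0 - 0) at_infinity"
      by (intro tendsto_diff *)
    thus ?thesis using True by (simp add: J_def left_diff_distrib)
  next
    case False
    thus ?thesis using kernel_decay[OF \<psi>0 C t, of t] by (simp add: J_def)
  qed
  fix X :: "nat \<Rightarrow> complex" assume X: "filterlim X at_infinity sequentially"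
  have "(\<lambda>n. LINT t|lborel. J k \<eta> \<psi> (X n) t) \<longlonglongrightarrow> (LINT t::real|lborel. (0::complex))"
    by (rule J_convergence) (use filterlim_compose[OF J0 X] in auto)
  thus "(\<lambda>n. LINT t|lborel. J k \<eta> \<psi> (X n) t) \<longlonglongrightarrow> 0" by simp
qed

end

definition pot :: "(complex \<Rightarrow> complex) \<Rightarrow> (real \<Rightarrow> complex) \<Rightarrow> complex \<Rightarrow> complex" where
  "pot k \<psi> z = (LINT s|lborel. \<psi> s * k (z - Z s))"

text \<open>Writing \<psi> = \<eta> \<open>Z'\<close> in the window and subtracting \<eta> (Re z)
  isolates the integral of \<open>Z'\<close> times the kernel. Dividing out \<open>Z'\<close> is
  what makes this remainder an integral against dZ, for which a bounded continuous W can be given on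
  each side.\<close>

lemma potential_extension:
  assumes k: "cauchy_kernel k" and \<psi>: "hoelder_L2 \<psi>" and \<psi>0: "(\<psi> \<longlongrightarrow> 0) at_infinity"
    and S: "S \<subseteq> Up \<union> Lo"
    and W: "continuous_on UNIV W" "\<And>z. norm (W z) \<le> C"
      "\<And>z. z \<in> S \<Longrightarrow> W z = (LINT t|lborel. indicator {-1..1} t *\<^sub>R (Z' (Re z + t) * k (z - Z (Re z + t))))"
  defines "E \<equiv> \<lambda>z. (LINT t|lborel. J k (\<lambda>s. \<psi> s * inverse (Z' s)) \<psi> z t) + \<psi> (Re z) * inverse (Z' (Re z)) * W z"
  shows "continuous_on UNIV E"
    and "\<And>z. z \<in> S \<Longrightarrow> pot k \<psi> z = E z"
    and "\<And>z. z \<in> S \<Longrightarrow> integrable lborel (\<lambda>s. \<psi> s * k (z - Z s))"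
    and "(E \<longlongrightarrow> 0) (inf at_infinity (principal S))"
proof -
  define \<eta> where "\<eta> s = \<psi> s * inverse (Z' s)" for s
  have \<eta>h: "locally_hoelder \<eta>" unfolding \<eta>_def using \<psi>
    by (intro locally_hoelder_mult locally_hoelder_inverse locally_hoelder_Z' norm_Z'_ge) (auto simp: hoelder_L2_def)
  have kc: "continuous_on (- {0}) k" and kb: "\<And>w. norm (k w) \<le> 1 / norm w"
    and [measurable]: "k \<in> borel_measurable borel"
    using k unfolding cauchy_kernel_def by blast+
  have [measurable]: "\<psi> \<in> borel_measurable borel" using \<psi> by (auto simp: hoelder_L2_def intro: locally_hoelder_measurable)
  have E: "E z = (LINT t|lborel. J k \<eta> \<psi> z t) + \<eta> (Re z) * W z" for z
    by (simp add: E_def \<eta>_def[abs_def])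
  have c\<eta>: "continuous_on UNIV (\<lambda>z. \<eta> (Re z))"
    by (rule continuous_on_compose2[OF locally_hoelder_continuous[OF \<eta>h, of UNIV]]) (auto intro!: continuous_intros)
  have Efun: "E = (\<lambda>z. (LINT t|lborel. J k \<eta> \<psi> z t) + \<eta> (Re z) * W z)" using E by (rule ext)
  show "continuous_on UNIV E" unfolding Efun
    by (rule continuous_on_add[OF J_integral_continuous[OF k \<eta>h \<psi>] continuous_on_mult[OF c\<eta> W(1)]])
  have near: "integrable lborel (\<lambda>t. indicator {-1..1} t *\<^sub>R (Z' (Re z + t) * k (z - Z (Re z + t))))" if "z \<in> S" for z
  proof -
    have "z - Z s \<noteq> 0" for s using off_graph[of z s] S that by auto
    hence sub: "(\<lambda>t. z - Z (Re z + t)) ` {-1..1} \<subseteq> - {0}" by auto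
    have zc: "continuous_on {-1..1} (\<lambda>t. z - Z (Re z + t))" by (intro continuous_intros)
    have "continuous_on {-1..1} (\<lambda>t. k (z - Z (Re z + t)))"
      by (rule continuous_on_compose2[OF kc zc sub])
    hence "continuous_on {-1..1} (\<lambda>t. Z' (Re z + t) * k (z - Z (Re z + t)))" by (intro continuous_intros)
    from borel_integrable_compact[OF compact_Icc this] show ?thesis by (simp only: set_integrable_def)
  qed
  have eq: "\<psi> (Re z + t) * k (z - Z (Re z + t)) = J k \<eta> \<psi> z t +
      \<eta> (Re z) * (indicator {-1..1} t *\<^sub>R (Z' (Re z + t) * k (z - Z (Re z + t))))" for z t
    by (cases "\<bar>t\<bar> \<le> 1") (auto simp: J_def \<eta>_def algebra_simps indicator_def abs_le_iff)
  have int: "integrable lborel (\<lambda>t. \<psi> (Re z + t) * k (z - Z (Re z + t)))" if "z \<in> S" for z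
    unfolding eq by (intro Bochner_Integration.integrable_add integrable_mult_right near that J_integrable[OF k \<eta>h \<psi>])
  thus "integrable lborel (\<lambda>s. \<psi> s * k (z - Z s))" if "z \<in> S" for z
    using lborel_integrable_real_affine_iff[of 1 "\<lambda>s. \<psi> s * k (z - Z s)" "Re z"] that by simp
  show "pot k \<psi> z = E z" if "z \<in> S" for z
  proof -
    have "pot k \<psi> z = (LINT t|lborel. \<psi> (Re z + t) * k (z - Z (Re z + t)))"
      unfolding pot_def using lborel_integral_real_affine[of 1 "\<lambda>s. \<psi> s * k (z - Z s)" "Re z"] by simp
    also have "\<dots> = (LINT t|lborel. J k \<eta> \<psi> z t) + (LINT t|lborel. \<eta> (Re z) * (indicator {-1..1} t *\<^sub>R (Z' (Re z + t) * k (z - Z (Re z + t)))))"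
      unfolding eq by (intro Bochner_Integration.integral_add integrable_mult_right near that J_integrable[OF k \<eta>h \<psi>])
    also have "(LINT t|lborel. \<eta> (Re z) * (indicator {-1..1} t *\<^sub>R (Z' (Re z + t) * k (z - Z (Re z + t))))) = \<eta> (Re z) * W z"
      by (simp only: integral_mult_right_zero W(3)[OF that])
    finally show ?thesis by (simp add: E)
  qed
  obtain B where B: "\<And>s. norm (\<eta> s) \<le> B" using \<eta>h unfolding locally_hoelder_def by blast
  have B0: "B \<ge> 0" using B[of 0] norm_ge_zero order_trans by blast
  have C0: "C \<ge> 0" using W(2)[of 0] norm_ge_zero order_trans by blast
  have \<eta>0: "(\<eta> \<longlongrightarrow> 0) at_infinity"
  proof (rule tendsto_0_le[OF \<psi>0, of _ 1], rule always_eventually, rule allI)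
    fix s
    have "norm (inverse (Z' s)) \<le> 1" using norm_Z'_ge[of s] by (simp add: norm_inverse inverse_le_1_iff)
    thus "norm (\<eta> s) \<le> norm (\<psi> s) * 1" unfolding \<eta>_def norm_mult by (intro mult_left_mono) auto
  qed
  have "((\<lambda>z. \<eta> (Re z) * W z) \<longlongrightarrow> 0) (inf at_infinity (principal S))"
    unfolding tendsto_iff eventually_inf_principal eventually_at_infinity
  proof (intro allI impI)
    fix e :: real assume e: "e > 0"
    have "e / (C + 1) > 0" using e C0 by simp
    then obtain X where X: "\<And>s. \<bar>s\<bar> \<ge> X \<Longrightarrow> norm (\<eta> s) < e / (C + 1)"
      using \<eta>0 unfolding Lim_at_infinity by (auto simp: dist_norm)
    \<comment> \<open>If Re z is bounded, the kernel is at most 1/D on the whole window, so W is at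
      most 2 (1 + M) / D: window length times the bound on \<open>Z'\<close>.\<close>
    define D where "D = (B * (2 * (1 + M)) + 1) / e"
    have BM: "B * (2 * (1 + M)) \<ge> 0" using B0 M_nonneg by simp
    have D: "D > 0" "B * (2 * (1 + M) / D) < e" using e BM by (auto simp: D_def field_simps)
    show "\<exists>b. \<forall>z. b \<le> norm z \<longrightarrow> z \<in> S \<longrightarrow> dist (\<eta> (Re z) * W z) 0 < e"
    proof (intro exI[of _ "\<bar>X\<bar> + \<bar>f 0\<bar> + M * (\<bar>X\<bar> + 1) + D"] allI impI)
      fix z assume z: "\<bar>X\<bar> + \<bar>f 0\<bar> + M * (\<bar>X\<bar> + 1) + D \<le> norm z" and zS: "z \<in> S"
      show "dist (\<eta> (Re z) * W z) 0 < e"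
      proof (cases "\<bar>Re z\<bar> \<ge> X")
        case True
        have "norm (\<eta> (Re z)) * norm (W z) \<le> e / (C + 1) * C"
          using X[OF True] W(2) C0 e by (intro mult_mono) auto
        also have "\<dots> < e" using e C0 by (simp add: field_simps)
        finally show ?thesis by (simp add: norm_mult)
      next
        case False
        hence R: "\<bar>Re z\<bar> \<le> \<bar>X\<bar>" by auto
        have "norm (W z) \<le> (LINT t|lborel. norm (indicator {-1..1} t *\<^sub>R (Z' (Re z + t) * k (z - Z (Re z + t)))))"
          unfolding W(3)[OF zS] by (rule integral_norm_bound)
        also have "\<dots> \<le> (LINT t::real|lborel. indicator {-1..1} t * ((1 + M) * (1 / D)))"
        proof (rule integral_mono)
          show "norm (indicator {-1..1} t *\<^sub>R (Z' (Re z + t) * k (z - Z (Re z + t)))) \<le> indicator {-1..1} t * ((1 + M) * (1 / D))" for t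
          proof (cases "\<bar>t\<bar> \<le> 1")
            case True
            have "norm (k (z - Z (Re z + t))) \<le> 1 / norm (z - Z (Re z + t))" by (rule kb)
            also have "\<dots> \<le> 1 / D"
            proof (rule frac_le)
              show "D \<le> norm (z - Z (Re z + t))" using norm_diff_Z_ge_Im[OF R True] z by linarith
            qed (use D in auto)
            finally have "norm (Z' (Re z + t)) * norm (k (z - Z (Re z + t))) \<le> (1 + M) * (1 / D)"
              using M_nonneg norm_Z'_le by (intro mult_mono) auto
            thus ?thesis by (simp add: indicator_def norm_mult)
          qed (auto simp: indicator_def)
          show "integrable lborel (\<lambda>t. norm (indicator {-1..1} t *\<^sub>R (Z' (Re z + t) * k (z - Z (Re z + t)))))"
            by (rule integrable_norm[OF near[OF zS]])
        qed auto
        also have "\<dots> = 2 * (1 + M) / D" by simp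
        finally have "norm (\<eta> (Re z)) * norm (W z) \<le> B * (2 * (1 + M) / D)"
          using B B0 by (intro mult_mono) auto
        thus ?thesis using D by (simp add: norm_mult)
      qed
    qed
  qed
  moreover have "((\<lambda>z. LINT t|lborel. J k \<eta> \<psi> z t) \<longlongrightarrow> 0) (inf at_infinity (principal S))"
    using J_integral_decay[OF k \<eta>h \<psi> \<eta>0 \<psi>0] by (rule tendsto_mono[rotated]) simp
  ultimately have "((\<lambda>z. (LINT t|lborel. J k \<eta> \<psi> z t) + \<eta> (Re z) * W z) \<longlongrightarrow> 0 + 0) (inf at_infinity (principal S))"
    by (intro tendsto_add)
  thus "(E \<longlongrightarrow> 0) (inf at_infinity (principal S))" unfolding Efun by simp
qed

section \<open>The two kernels and their Plemelj jumps\<close>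

definition k1 :: "complex \<Rightarrow> complex" where "k1 w = 1 / w"
text \<open>Minus the derivative in w of \<open>cnj w / w\<close>, the conjugate of the quotient
  that forms the direction-dependent part of the Stokeslet in complex notation.\<close>

definition k2 :: "complex \<Rightarrow> complex" where "k2 w = cnj w / w\<^sup>2"

lemma cauchy_kernel_k1: "cauchy_kernel k1"
  unfolding cauchy_kernel_def k1_def[abs_def]
  by (auto intro!: continuous_intros simp: norm_divide)

lemma cauchy_kernel_k2: "cauchy_kernel k2"
  unfolding cauchy_kernel_def k2_def[abs_def]
proof (intro conjI allI)
  show "norm (cnj w / w\<^sup>2) \<le> 1 / norm w" for w
    by (cases "w = 0") (auto simp: norm_divide norm_mult power2_eq_square)
  have "(\<lambda>w. cnj w) \<in> borel_measurable borel" by (intro borel_measurable_continuous_onI continuous_intros)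
  thus "(\<lambda>w. cnj w / w\<^sup>2) \<in> borel_measurable borel" by measurable
qed (auto intro!: continuous_intros)

text \<open>The sign encodes the side, so that one proof covers both; here \<sigma> is not the
  surface tension.\<close>

definition Side :: "real \<Rightarrow> complex set" where "Side \<sigma> = {z. \<sigma> * (Im z - f (Re z)) > 0}"

lemma Side_Up: "Side 1 = Up" and Side_Lo: "Side (- 1) = Lo"
  by (auto simp: Side_def Up_def Lo_def)

lemma Side_subset: "Side \<sigma> \<subseteq> Up \<union> Lo"
  by (auto simp: Side_def Up_def Lo_def zero_less_mult_iff)

text \<open>In the right half plane the argument is below pi/2 in modulus, so a quarter turn does
  not reach the branch cut.\<close>

lemma Ln_rotate:
  assumes "Re w > 0" "\<tau> = 1 \<or> \<tau> = - 1"
  shows "Ln (of_real \<tau> * \<i> * w) = Ln w + of_real \<tau> * \<i> * (pi / 2)"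
proof (rule Ln_unique)
  have w: "w \<noteq> 0" using assms by auto
  have "exp (of_real \<tau> * \<i> * (pi / 2)) = of_real \<tau> * \<i>"
    using assms(2) by (auto simp: complex_eq_iff Re_exp Im_exp)
  thus "exp (Ln w + of_real \<tau> * \<i> * (pi / 2)) = of_real \<tau> * \<i> * w"
    using w by (simp add: exp_add)
  have "\<bar>Im (Ln w)\<bar> < pi / 2" using Re_Ln_pos_lt[OF w] assms by simp
  thus "- pi < Im (Ln w + of_real \<tau> * \<i> * (pi / 2))" "Im (Ln w + of_real \<tau> * \<i> * (pi / 2)) \<le> pi"
    using assms(2) by auto
qed

text \<open>Unlike \<open>Ln (z - w)\<close>, both logarithms below have their argument in the right half plane, so this
  value of the window integral of \<open>Z' * k1\<close> is continuous across the graph; the side enters through the branch constant alone.\<close>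

definition W1 :: "real \<Rightarrow> complex \<Rightarrow> complex" where
  "W1 \<sigma> z = Ln (z - Z (Re z - 1)) - Ln (Z (Re z + 1) - z) - of_real \<sigma> * \<i> * pi"

lemma W1_continuous: "continuous_on UNIV (W1 \<sigma>)"
  unfolding W1_def[abs_def]
  by (intro continuous_intros continuous_on_Ln') (auto simp: complex_nonpos_Reals_iff)

text \<open>Both logarithms may be unbounded as Im z grows, but their difference is not: the
  arguments a and b have real part 1 and a sum of norm at most 2 (1 + M), hence |a| \<le> (3 + 2 M)
  |b| and vice versa.\<close>

lemma W1_bound: obtains C where "\<And>z. norm (W1 \<sigma> z) \<le> C"
proof -
  have ratio: "ln (norm a) - ln (norm b) \<le> ln (3 + 2 * M)"
    if "Re a = 1" "Re b = 1" "norm (a + b) \<le> 2 * (1 + M)" for a b :: complex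
  proof -
    have b1: "norm b \<ge> 1" "norm a \<ge> 1" using complex_Re_le_cmod[of b] complex_Re_le_cmod[of a] that by auto
    have "norm a \<le> norm (a + b) + norm b" using norm_triangle_ineq4[of "a + b" b] by simp
    also have "\<dots> \<le> 2 * (1 + M) * norm b + norm b"
    proof -
      have "2 * (1 + M) * 1 \<le> 2 * (1 + M) * norm b" using b1 M_nonneg by (intro mult_left_mono) auto
      thus ?thesis using that(3) by linarith
    qed
    also have "\<dots> = (3 + 2 * M) * norm b" by (simp add: algebra_simps)
    finally have "norm a \<le> (3 + 2 * M) * norm b" .
    moreover have "0 < norm a" using b1 by linarith
    ultimately have "ln (norm a) \<le> ln ((3 + 2 * M) * norm b)"
      by (metis less_le_trans ln_le_cancel_iff)
    also have "\<dots> = ln (3 + 2 * M) + ln (norm b)" using b1 M_nonneg by (subst ln_mult) auto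
    finally show ?thesis by simp
  qed
  have "norm (W1 \<sigma> z) \<le> ln (3 + 2 * M) + 2 * pi + \<bar>\<sigma>\<bar> * pi" for z
  proof -
    let ?a = "z - Z (Re z - 1)" and ?b = "Z (Re z + 1) - z"
    have re: "Re ?a = 1" "Re ?b = 1" by auto
    have nz: "?a \<noteq> 0" "?b \<noteq> 0" using re by fastforce+
    have "norm (?a + ?b) \<le> 2 * (1 + M)"
    proof -
      have "\<bar>f (Re z + 1) - f (Re z - 1)\<bar> \<le> M * 2" using f_lipschitz[of "Re z + 1" "Re z - 1"] by simp
      thus ?thesis using cmod_le[of "?a + ?b"] by simp
    qed
    hence "\<bar>ln (norm ?a) - ln (norm ?b)\<bar> \<le> ln (3 + 2 * M)"
      using ratio[OF re] ratio[OF re(2,1)] by (auto simp: abs_le_iff add.commute)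
    hence "\<bar>Re (Ln ?a - Ln ?b)\<bar> \<le> ln (3 + 2 * M)" using nz by simp
    moreover have "\<bar>Im (Ln ?a - Ln ?b)\<bar> \<le> 2 * pi"
      using mpi_less_Im_Ln[OF nz(1)] Im_Ln_le_pi[OF nz(1)] mpi_less_Im_Ln[OF nz(2)] Im_Ln_le_pi[OF nz(2)] by auto
    ultimately have "norm (Ln ?a - Ln ?b) \<le> ln (3 + 2 * M) + 2 * pi"
      using cmod_le[of "Ln ?a - Ln ?b"] by linarith
    moreover have "norm (W1 \<sigma> z) \<le> norm (Ln ?a - Ln ?b) + norm (of_real \<sigma> * \<i> * complex_of_real pi)"
      unfolding W1_def by (rule norm_triangle_ineq4)
    ultimately show ?thesis by (simp add: norm_mult)
  qed
  thus ?thesis using that by blast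
qed

lemma shifted_curve_deriv:
  "((\<lambda>t. z - Z (x + t)) has_vector_derivative - Z' (x + t)) (at t within A)"
proof -
  have "((\<lambda>t. Z (x + t)) has_vector_derivative 1 *\<^sub>R Z' (x + t)) (at t within A)"
    by (rule vector_diff_chain_within[of "\<lambda>t. x + t" 1 t A Z "Z' (x + t)", unfolded o_def])
       (auto intro!: derivative_eq_intros has_vector_derivative_at_within[OF Z_deriv])
  thus ?thesis by (auto intro!: derivative_eq_intros)
qed

text \<open>A rotation by a quarter turn, in a sense depending on the side, moves the branch cut off
  the path, so that \<open>Ln\<close> is an antiderivative on the whole window. Undoing the rotation
  costs i pi/2 at each end, which adds up to the branch constant of \<open>W1\<close>.\<close>

lemma W1_integral:
  assumes "\<sigma> = 1 \<or> \<sigma> = - 1" and z: "z \<in> Side \<sigma>"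
  shows "W1 \<sigma> z = (LINT t|lborel. indicator {-1..1} t *\<^sub>R (Z' (Re z + t) * k1 (z - Z (Re z + t))))"
proof -
  let ?y = "\<lambda>t. z - Z (Re z + t)"
  let ?F = "\<lambda>t. - Ln (of_real (- \<sigma>) * \<i> * ?y t)"
  have ynz: "?y t \<noteq> 0" for t using off_graph[of z] Side_subset z by auto
  \<comment> \<open>The rotated point has imaginary part \<sigma> t, and at t = 0 its real part
    \<open>\<sigma> * (Im z - f (Re z))\<close> is positive.\<close>
  have dom: "of_real (- \<sigma>) * \<i> * ?y t \<notin> \<real>\<^sub>\<le>\<^sub>0" for t
    using z assms(1) by (auto simp: complex_nonpos_Reals_iff Side_def)
  have "(LINT t|lborel. indicator {-1..1} t *\<^sub>R (Z' (Re z + t) * k1 (?y t))) = ?F 1 - ?F (-1)"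
  proof (rule integral_FTC_Icc)
    show "continuous_on {-1..1} (\<lambda>t. Z' (Re z + t) * k1 (?y t))"
      unfolding k1_def using ynz by (intro continuous_intros) auto
    fix t :: real
    have "((\<lambda>t. of_real (- \<sigma>) * \<i> * ?y t) has_vector_derivative of_real (- \<sigma>) * \<i> * (- Z' (Re z + t))) (at t within {-1..1})"
      by (intro has_vector_derivative_mult_right shifted_curve_deriv)
    from field_vector_diff_chain_within[OF this has_field_derivative_Ln[OF dom, THEN has_field_derivative_at_within]]
    have "((\<lambda>t. Ln (of_real (- \<sigma>) * \<i> * ?y t)) has_vector_derivative
       of_real (- \<sigma>) * \<i> * (- Z' (Re z + t)) * inverse (of_real (- \<sigma>) * \<i> * ?y t)) (at t within {-1..1})"
      by (simp only: o_def)
    hence "(?F has_vector_derivative - (of_real (- \<sigma>) * \<i> * (- Z' (Re z + t)) * inverse (of_real (- \<sigma>) * \<i> * ?y t))) (at t within {-1..1})"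
      by (rule has_vector_derivative_minus)
    moreover have "- (of_real (- \<sigma>) * \<i> * (- Z' (Re z + t)) * inverse (of_real (- \<sigma>) * \<i> * ?y t)) = Z' (Re z + t) * k1 (?y t)"
      using assms(1) ynz[of t] by (auto simp: k1_def field_simps)
    ultimately show "(?F has_vector_derivative Z' (Re z + t) * k1 (?y t)) (at t within {-1..1})" by simp
  qed auto
  moreover have "Ln (of_real (- \<sigma>) * \<i> * (z - Z (Re z - 1))) = Ln (z - Z (Re z - 1)) + of_real (- \<sigma>) * \<i> * (pi / 2)"
    using assms(1) by (intro Ln_rotate) auto
  moreover have "Ln (of_real \<sigma> * \<i> * (Z (Re z + 1) - z)) = Ln (Z (Re z + 1) - z) + of_real \<sigma> * \<i> * (pi / 2)"
    using assms(1) by (intro Ln_rotate) auto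
  moreover have "of_real (- \<sigma>) * \<i> * (z - Z (Re z + 1)) = of_real \<sigma> * \<i> * (Z (Re z + 1) - z)"
    by (simp add: algebra_simps)
  ultimately show ?thesis by (simp add: W1_def)
qed

text \<open>Obtained from \<open>W1\<close> by an integration by parts, since \<open>Z' * k2\<close> differs from
  \<open>cnj Z' * k1\<close> by an exact derivative.\<close>

definition W2 :: "real \<Rightarrow> complex \<Rightarrow> complex" where
  "W2 \<sigma> z = cnj (z - Z (Re z + 1)) / (z - Z (Re z + 1)) - cnj (z - Z (Re z - 1)) / (z - Z (Re z - 1))
     + (LINT t|lborel. J k1 (\<lambda>s. cnj (Z' s) * inverse (Z' s)) (\<lambda>_. 0) z t)
     + cnj (Z' (Re z)) * inverse (Z' (Re z)) * W1 \<sigma> z"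

lemma hoelder_L2_0: "hoelder_L2 (\<lambda>_. 0)"
  by (auto simp: hoelder_L2_def locally_hoelder_def intro!: exI[of _ 0])

lemma locally_hoelder_tangent: "locally_hoelder (\<lambda>s. cnj (Z' s) * inverse (Z' s))"
  by (intro locally_hoelder_mult locally_hoelder_cnj locally_hoelder_inverse locally_hoelder_Z' norm_Z'_ge)

lemma W2_continuous: "continuous_on UNIV (W2 \<sigma>)"
proof -
  have nz: "z - Z (Re z + 1) \<noteq> 0" "z - Z (Re z - 1) \<noteq> 0" for z
    by (auto simp: complex_eq_iff)
  show ?thesis unfolding W2_def[abs_def]
    by (intro continuous_intros W1_continuous J_integral_continuous cauchy_kernel_k1 locally_hoelder_tangent hoelder_L2_0)
       (use nz in auto)
qed

lemma W2_bound: obtains C where "\<And>z. norm (W2 \<sigma> z) \<le> C"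
proof -
  obtain C where C: "\<And>z. norm (W1 \<sigma> z) \<le> C" using W1_bound by blast
  obtain D where D: "\<And>z. norm (LINT t|lborel. J k1 (\<lambda>s. cnj (Z' s) * inverse (Z' s)) (\<lambda>_. 0) z t) \<le> D"
    using J_integral_bound_near[OF cauchy_kernel_k1 locally_hoelder_tangent hoelder_L2_0 refl] by blast
  have u: "norm (cnj w / w) \<le> 1" for w by (cases "w = 0") (auto simp: norm_divide)
  have v: "norm (cnj (Z' s) * inverse (Z' s) * c) \<le> norm c" for s c
    using norm_Z'_ge[of s] by (simp add: norm_mult norm_inverse)
  have tri: "norm (a - b + c + d) \<le> norm a + norm b + norm c + norm d" for a b c d :: complex
    by (metis (no_types, opaque_lifting) add_mono norm_triangle_ineq4 norm_triangle_ineq norm_triangle_mono order_refl)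
  have "norm (W2 \<sigma> z) \<le> 1 + 1 + D + C" for z
    unfolding W2_def by (rule order_trans[OF tri]) (intro add_mono u D order_trans[OF v C])
  thus ?thesis using that by blast
qed

text \<open>Along the curve the derivative of cnj y / y is \<open>Z'\<close> k2 - cnj
  \<open>Z'\<close> k1. The last term is a Cauchy integral against dZ of the unimodular density cnj
  \<open>Z'\<close> / \<open>Z'\<close>, so it falls under the scheme of \<open>J\<close> with zero
  far density.\<close>

lemma W2_integral:
  assumes \<sigma>: "\<sigma> = 1 \<or> \<sigma> = - 1" and z: "z \<in> Side \<sigma>"
  shows "W2 \<sigma> z = (LINT t|lborel. indicator {-1..1} t *\<^sub>R (Z' (Re z + t) * k2 (z - Z (Re z + t))))"
proof -
  let ?y = "\<lambda>t. z - Z (Re z + t)"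
  let ?\<eta> = "\<lambda>s. cnj (Z' s) * inverse (Z' s)"
  have ynz: "?y t \<noteq> 0" for t using off_graph[of z] Side_subset z by auto
  let ?A = "\<lambda>t. indicator {-1..1} t *\<^sub>R (Z' (Re z + t) * k2 (?y t))"
  let ?B = "\<lambda>t. indicator {-1..1} t *\<^sub>R (cnj (Z' (Re z + t)) * k1 (?y t))"
  let ?C = "\<lambda>t. indicator {-1..1} t *\<^sub>R (Z' (Re z + t) * k1 (?y t))"
  have icont: "integrable lborel (\<lambda>t::real. indicator {-1..1} t *\<^sub>R h t)" if "continuous_on UNIV h" for h :: "real \<Rightarrow> complex"
    using borel_integrable_compact[of "{-1..1::real}" h] continuous_on_subset[OF that] by (auto simp: set_integrable_def)
  have iA: "integrable lborel ?A" and iB: "integrable lborel ?B" and iC: "integrable lborel ?C"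
    unfolding k1_def k2_def using ynz by (intro icont continuous_intros; simp)+
  have fd: "((\<lambda>t. cnj (?y t) / ?y t) has_vector_derivative Z' (Re z + t) * k2 (?y t) - cnj (Z' (Re z + t)) * k1 (?y t)) (at t within {-1..1})" for t
  proof -
    have "((\<lambda>t. cnj (?y t)) has_vector_derivative cnj (- Z' (Re z + t))) (at t within {-1..1})"
      by (intro has_vector_derivative_cnj shifted_curve_deriv)
    moreover have "((\<lambda>t. inverse (?y t)) has_vector_derivative - Z' (Re z + t) * - (inverse (?y t) * inverse (?y t))) (at t within {-1..1})"
      using field_vector_diff_chain_within[OF shifted_curve_deriv[of z "Re z" t "{-1..1}"] DERIV_subset[OF DERIV_inverse'[OF DERIV_ident ynz] subset_UNIV]]
      by (simp add: o_def mult_ac)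
    ultimately have "((\<lambda>t. cnj (?y t) * inverse (?y t)) has_vector_derivative
        cnj (?y t) * (- Z' (Re z + t) * - (inverse (?y t) * inverse (?y t))) + cnj (- Z' (Re z + t)) * inverse (?y t)) (at t within {-1..1})"
      by (rule has_vector_derivative_mult)
    moreover have "cnj (?y t) * (- Z' (Re z + t) * - (inverse (?y t) * inverse (?y t))) + cnj (- Z' (Re z + t)) * inverse (?y t) =
        Z' (Re z + t) * k2 (?y t) - cnj (Z' (Re z + t)) * k1 (?y t)"
      using ynz[of t] by (simp add: k1_def k2_def field_simps power2_eq_square)
    ultimately show ?thesis by (simp add: divide_inverse)
  qed
  have "(LINT t|lborel. indicator {-1..1} t *\<^sub>R (Z' (Re z + t) * k2 (?y t) - cnj (Z' (Re z + t)) * k1 (?y t)))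
     = cnj (?y 1) / ?y 1 - cnj (?y (-1)) / ?y (-1)"
    by (rule integral_FTC_Icc) (use fd ynz in \<open>auto intro!: continuous_intros simp: k1_def k2_def\<close>)
  moreover have "(LINT t|lborel. indicator {-1..1} t *\<^sub>R (Z' (Re z + t) * k2 (?y t) - cnj (Z' (Re z + t)) * k1 (?y t)))
     = (LINT t|lborel. ?A t) - (LINT t|lborel. ?B t)"
    unfolding scaleR_diff_right using iA iB by (rule Bochner_Integration.integral_diff)
  ultimately have "(LINT t|lborel. ?A t) = cnj (?y 1) / ?y 1 - cnj (?y (-1)) / ?y (-1) + (LINT t|lborel. ?B t)"
    by (simp only: diff_eq_eq)
  moreover have "(LINT t|lborel. ?B t) = (LINT t|lborel. J k1 ?\<eta> (\<lambda>_. 0) z t) + ?\<eta> (Re z) * W1 \<sigma> z"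
  proof -
    have "?B t = J k1 ?\<eta> (\<lambda>_. 0) z t + ?\<eta> (Re z) * ?C t" for t
      by (auto simp: J_def indicator_def algebra_simps)
    hence "(LINT t|lborel. ?B t) = (LINT t|lborel. J k1 ?\<eta> (\<lambda>_. 0) z t + ?\<eta> (Re z) * ?C t)"
      by (simp only:)
    also have "\<dots> = (LINT t|lborel. J k1 ?\<eta> (\<lambda>_. 0) z t) + (LINT t|lborel. ?\<eta> (Re z) * ?C t)"
      by (intro Bochner_Integration.integral_add J_integrable cauchy_kernel_k1 locally_hoelder_tangent hoelder_L2_0 integrable_mult_right iC)
    finally show ?thesis by (simp only: integral_mult_right_zero W1_integral[OF \<sigma> z])
  qed
  ultimately show ?thesis by (simp only: W2_def add.assoc minus_add_cancel add_uminus_conv_diff)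
qed

definition ext1 :: "(real \<Rightarrow> complex) \<Rightarrow> real \<Rightarrow> complex \<Rightarrow> complex" where
  "ext1 \<psi> \<sigma> z = (LINT t|lborel. J k1 (\<lambda>s. \<psi> s * inverse (Z' s)) \<psi> z t) + \<psi> (Re z) * inverse (Z' (Re z)) * W1 \<sigma> z"
definition ext2 :: "(real \<Rightarrow> complex) \<Rightarrow> real \<Rightarrow> complex \<Rightarrow> complex" where
  "ext2 \<psi> \<sigma> z = (LINT t|lborel. J k2 (\<lambda>s. \<psi> s * inverse (Z' s)) \<psi> z t) + \<psi> (Re z) * inverse (Z' (Re z)) * W2 \<sigma> z"

text \<open>Plemelj's formula: only the branch constant in \<open>W1\<close> distinguishes the
  sides. The division by \<open>Z'\<close> reflects integration in the parameter s rather than in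
  dZ.\<close>

lemma ext1_jump: "ext1 \<psi> 1 z - ext1 \<psi> (- 1) z = - 2 * pi * \<i> * \<psi> (Re z) / Z' (Re z)"
  by (simp add: ext1_def W1_def field_simps)

text \<open>The end terms and the window integral in \<open>W2\<close> do not depend on the side;
  the jump of \<open>W1\<close> arrives with the extra factor cnj \<open>Z'\<close> /
  \<open>Z'\<close>.\<close>

lemma ext2_jump: "ext2 \<psi> 1 z - ext2 \<psi> (- 1) z = - 2 * pi * \<i> * \<psi> (Re z) * cnj (Z' (Re z)) / (Z' (Re z))\<^sup>2"
  by (simp add: ext2_def W2_def W1_def field_simps power2_eq_square)

context
  fixes \<psi> and \<sigma> :: real
  assumes \<psi>: "hoelder_L2 \<psi>" and \<psi>0: "(\<psi> \<longlongrightarrow> 0) at_infinity" and \<sigma>: "\<sigma> = 1 \<or> \<sigma> = - 1"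
begin

lemma ext1_properties:
  "continuous_on UNIV (ext1 \<psi> \<sigma>)"
  "z \<in> Side \<sigma> \<Longrightarrow> pot k1 \<psi> z = ext1 \<psi> \<sigma> z"
  "z \<in> Side \<sigma> \<Longrightarrow> integrable lborel (\<lambda>s. \<psi> s * k1 (z - Z s))"
  "(ext1 \<psi> \<sigma> \<longlongrightarrow> 0) (inf at_infinity (principal (Side \<sigma>)))"
proof -
  obtain C where C: "\<And>z. norm (W1 \<sigma> z) \<le> C" using W1_bound by blast
  note * = potential_extension[OF cauchy_kernel_k1 \<psi> \<psi>0 Side_subset W1_continuous C W1_integral[OF \<sigma>], folded ext1_def]
  show "continuous_on UNIV (ext1 \<psi> \<sigma>)"
    "z \<in> Side \<sigma> \<Longrightarrow> pot k1 \<psi> z = ext1 \<psi> \<sigma> z"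
    "z \<in> Side \<sigma> \<Longrightarrow> integrable lborel (\<lambda>s. \<psi> s * k1 (z - Z s))"
    "(ext1 \<psi> \<sigma> \<longlongrightarrow> 0) (inf at_infinity (principal (Side \<sigma>)))"
    using * by blast+
qed

lemma ext2_properties:
  "continuous_on UNIV (ext2 \<psi> \<sigma>)"
  "z \<in> Side \<sigma> \<Longrightarrow> pot k2 \<psi> z = ext2 \<psi> \<sigma> z"
  "z \<in> Side \<sigma> \<Longrightarrow> integrable lborel (\<lambda>s. \<psi> s * k2 (z - Z s))"
  "(ext2 \<psi> \<sigma> \<longlongrightarrow> 0) (inf at_infinity (principal (Side \<sigma>)))"
proof -
  obtain C where C: "\<And>z. norm (W2 \<sigma> z) \<le> C" using W2_bound by blast
  note * = potential_extension[OF cauchy_kernel_k2 \<psi> \<psi>0 Side_subset W2_continuous C W2_integral[OF \<sigma>], folded ext2_def]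
  show "continuous_on UNIV (ext2 \<psi> \<sigma>)"
    "z \<in> Side \<sigma> \<Longrightarrow> pot k2 \<psi> z = ext2 \<psi> \<sigma> z"
    "z \<in> Side \<sigma> \<Longrightarrow> integrable lborel (\<lambda>s. \<psi> s * k2 (z - Z s))"
    "(ext2 \<psi> \<sigma> \<longlongrightarrow> 0) (inf at_infinity (principal (Side \<sigma>)))"
    using * by blast+
qed

end

end

section \<open>Goursat representation of the layer potential\<close>

lemma integral_derivative_eq_0:
  fixes F F' :: "real \<Rightarrow> complex"
  assumes der: "\<And>s. (F has_vector_derivative F' s) (at s)" and cont: "continuous_on UNIV F'"
    and int: "integrable lborel F'" and lim: "(F \<longlongrightarrow> 0) at_infinity"
  shows "(LINT s|lborel. F' s) = 0"
proof -
  have "(LBINT s=-\<infinity>..\<infinity>. F' s) = 0 - 0"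
  proof (rule interval_integral_FTC_integrable)
    show "isCont F' x" for x using cont by (simp add: continuous_on_eq_continuous_at)
    show "set_integrable lborel (einterval (- \<infinity>) \<infinity>) F'" using int by (simp add: set_integrable_def)
    have "(F \<longlongrightarrow> 0) at_top" "(F \<longlongrightarrow> 0) at_bot"
      by (rule tendsto_mono[OF _ lim]; simp add: at_infinity_eq_at_top_bot)+
    thus "((F \<circ> real_of_ereal) \<longlongrightarrow> 0) (at_right (- \<infinity>))" "((F \<circ> real_of_ereal) \<longlongrightarrow> 0) (at_left \<infinity>)"
      unfolding ereal_tendsto_simps1 by auto
  qed (use der in auto)
  thus ?thesis by (simp add: interval_lebesgue_integral_def set_lebesgue_integral_def)
qed

lemma integrable_inverse_square_bound:
  fixes h :: "real \<Rightarrow> 'a::{banach, second_countable_topology}"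
  assumes "h \<in> borel_measurable borel" "\<And>s. norm (h s) \<le> C / (1 + \<bar>s\<bar>)\<^sup>2"
  shows "integrable lborel h"
proof (rule Bochner_Integration.integrable_bound)
  show "integrable lborel (\<lambda>s. \<bar>C\<bar> * (1 / (1 + s\<^sup>2)))"
    by (intro integrable_mult_right integrable_inverse_square_line)
  show "AE s in lborel. norm (h s) \<le> norm (\<bar>C\<bar> * (1 / (1 + s\<^sup>2)))"
  proof (intro AE_I2)
    fix s :: real
    have "1 + s\<^sup>2 \<le> (1 + \<bar>s\<bar>)\<^sup>2" by (simp add: power2_eq_square algebra_simps flip: abs_mult)
    moreover have "0 < 1 + s\<^sup>2" by (simp add: add_pos_nonneg)
    ultimately have "\<bar>C\<bar> / (1 + \<bar>s\<bar>)\<^sup>2 \<le> \<bar>C\<bar> / (1 + s\<^sup>2)" by (intro divide_left_mono mult_pos_pos) auto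
    moreover have "C / (1 + \<bar>s\<bar>)\<^sup>2 \<le> \<bar>C\<bar> / (1 + \<bar>s\<bar>)\<^sup>2" by (intro divide_right_mono) auto
    ultimately show "norm (h s) \<le> norm (\<bar>C\<bar> * (1 / (1 + s\<^sup>2)))"
      using assms(2)[of s] by (simp add: abs_mult)
  qed
qed (use assms in simp)

text \<open>Pairs g with 1 / (1 + |s|), which is square integrable though not integrable.\<close>

lemma integrable_L2_bound:
  fixes h :: "real \<Rightarrow> complex"
  assumes "h \<in> borel_measurable borel" "g \<in> borel_measurable borel"
    and "integrable lborel (\<lambda>s. (norm (g s :: complex))\<^sup>2)" "\<And>s. norm (h s) \<le> C * norm (g s) / (1 + \<bar>s\<bar>)"
  shows "integrable lborel h"
proof (rule Bochner_Integration.integrable_bound)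
  have "integrable lborel (\<lambda>s. (norm (1 / complex_of_real (1 + \<bar>s\<bar>)))\<^sup>2)"
  proof (rule integrable_inverse_square_bound)
    show "norm ((norm (1 / complex_of_real (1 + \<bar>s\<bar>)))\<^sup>2) \<le> 1 / (1 + \<bar>s\<bar>)\<^sup>2" for s
      unfolding norm_divide norm_of_real by (simp add: power_divide)
  qed measurable
  from integrable_mult_L2[OF _ _ assms(3) this]
  have "integrable lborel (\<lambda>s. g s * (1 / complex_of_real (1 + \<bar>s\<bar>)))" using assms by measurable
  thus "integrable lborel (\<lambda>s. complex_of_real C * (g s * (1 / complex_of_real (1 + \<bar>s\<bar>))))"
    by (rule integrable_mult_right)
  show "AE s in lborel. norm (h s) \<le> norm (complex_of_real C * (g s * (1 / complex_of_real (1 + \<bar>s\<bar>))))"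
  proof (intro AE_I2)
    fix s
    have "C * norm (g s) / (1 + \<bar>s\<bar>) \<le> \<bar>C\<bar> * norm (g s) / (1 + \<bar>s\<bar>)"
      by (intro divide_right_mono mult_right_mono) auto
    thus "norm (h s) \<le> norm (complex_of_real C * (g s * (1 / complex_of_real (1 + \<bar>s\<bar>))))"
      using assms(4)[of s] unfolding norm_mult norm_divide norm_of_real by simp
  qed
qed (use assms in simp)

locale curve_density = graph_curve f f1 M K for f f1 M K +
  fixes g g' :: "real \<Rightarrow> complex"
  assumes g_deriv: "(g has_vector_derivative g' s) (at s)"
    and g: "hoelder_L2 g" and g0: "(g \<longlongrightarrow> 0) at_infinity"
    and g': "hoelder_L2 g'" and g'0: "(g' \<longlongrightarrow> 0) at_infinity"
begin

lemma g_continuous [continuous_intros]: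
  "continuous_on S u \<Longrightarrow> continuous_on S (\<lambda>x. g (u x))" for u :: "'b::topological_space \<Rightarrow> real"
  by (rule continuous_on_compose2[of UNIV g]) (use g in \<open>auto simp: hoelder_L2_def intro: locally_hoelder_continuous\<close>)

lemma g'_continuous [continuous_intros]:
  "continuous_on S u \<Longrightarrow> continuous_on S (\<lambda>x. g' (u x))" for u :: "'b::topological_space \<Rightarrow> real"
  by (rule continuous_on_compose2[of UNIV g']) (use g' in \<open>auto simp: hoelder_L2_def intro: locally_hoelder_continuous\<close>)

lemma density_facts:
  "hoelder_L2 (\<lambda>s. g s * Z' s)" "((\<lambda>s. g s * Z' s) \<longlongrightarrow> 0) at_infinity"
  "hoelder_L2 (\<lambda>s. cnj (g' s))" "((\<lambda>s. cnj (g' s)) \<longlongrightarrow> 0) at_infinity"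
  "hoelder_L2 (\<lambda>s. cnj (g s) * Z' s - g s * cnj (Z' s))"
  "((\<lambda>s. cnj (g s) * Z' s - g s * cnj (Z' s)) \<longlongrightarrow> 0) at_infinity"
proof -
  have bd: "((\<lambda>s. u s * v s) \<longlongrightarrow> 0) at_infinity"
    if "(u \<longlongrightarrow> 0) at_infinity" "\<And>s. norm (v s) \<le> 1 + M" for u v :: "real \<Rightarrow> complex"
    by (rule tendsto_0_le[OF that(1), of _ "1 + M"])
       (use that(2) in \<open>auto simp: norm_mult intro!: always_eventually mult_left_mono\<close>)
  show "hoelder_L2 (\<lambda>s. g s * Z' s)" "hoelder_L2 (\<lambda>s. cnj (g' s))"
    "hoelder_L2 (\<lambda>s. cnj (g s) * Z' s - g s * cnj (Z' s))"
    by (intro hoelder_L2_mult hoelder_L2_diff hoelder_L2_cnj locally_hoelder_cnj locally_hoelder_Z' g g')+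
  show "((\<lambda>s. g s * Z' s) \<longlongrightarrow> 0) at_infinity" by (rule bd[OF g0 norm_Z'_le])
  have c0: "((\<lambda>s. cnj (u s)) \<longlongrightarrow> 0) at_infinity" if "(u \<longlongrightarrow> 0) at_infinity" for u :: "real \<Rightarrow> complex"
    using tendsto_cnj[OF that] by simp
  show "((\<lambda>s. cnj (g' s)) \<longlongrightarrow> 0) at_infinity" by (rule c0[OF g'0])
  have "((\<lambda>s. cnj (g s) * Z' s - g s * cnj (Z' s)) \<longlongrightarrow> 0 - 0) at_infinity"
    by (intro tendsto_diff bd c0 g0) (auto simp: norm_Z'_le)
  thus "((\<lambda>s. cnj (g s) * Z' s - g s * cnj (Z' s)) \<longlongrightarrow> 0) at_infinity" by simp
qed

lemma pot_integrable:
  assumes "hoelder_L2 \<psi>" "(\<psi> \<longlongrightarrow> 0) at_infinity" "z \<in> Up \<union> Lo"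
  shows "integrable lborel (\<lambda>s. \<psi> s * k1 (z - Z s))" "integrable lborel (\<lambda>s. \<psi> s * k2 (z - Z s))"
  using assms(3) ext1_properties(3)[OF assms(1,2)] ext2_properties(3)[OF assms(1,2)]
  by (auto simp flip: Side_Up Side_Lo)

text \<open>Freezing \<open>z\<^sub>0\<close> in the antiholomorphic factor makes the potential holomorphic in \<open>w\<close>;
  the conjugated part of the velocity potential is recovered on the diagonal \<open>w = z\<^sub>0\<close>.\<close>

definition H :: "complex \<Rightarrow> complex \<Rightarrow> complex" where
  "H z0 w = (LINT s|lborel. (cnj (g s) * Z' s - g s * cnj (Z' s)) * k1 (w - Z s) +
     cnj (z0 - Z s) * Z' s * g s / (w - Z s)\<^sup>2)"

lemma Z_growth:
  obtains C where "C \<ge> 0" "\<And>s. norm (z0 - Z s) \<le> C * (1 + \<bar>s\<bar>)"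
proof
  define C where "C = norm z0 + 1 + \<bar>f 0\<bar> + M"
  show "C \<ge> 0" using M_nonneg by (simp add: C_def)
  fix s
  have "\<bar>f s\<bar> \<le> \<bar>f 0\<bar> + M * \<bar>s\<bar>" using f_lipschitz[of s 0] by auto
  hence "norm (Z s) \<le> \<bar>s\<bar> + \<bar>f 0\<bar> + M * \<bar>s\<bar>" using cmod_le[of "Z s"] by simp
  hence "norm (z0 - Z s) \<le> norm z0 + (\<bar>s\<bar> + \<bar>f 0\<bar> + M * \<bar>s\<bar>)" using norm_triangle_ineq4[of z0 "Z s"] by linarith
  also have "\<dots> \<le> C * (1 + \<bar>s\<bar>)"
    using M_nonneg by (auto simp: C_def algebra_simps intro!: add_nonneg_nonneg mult_nonneg_nonneg)
  finally show "norm (z0 - Z s) \<le> C * (1 + \<bar>s\<bar>)" .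
qed

lemma g_bound: obtains B where "B \<ge> 0" "\<And>s. norm (g s) \<le> B"
proof -
  obtain B where B: "\<And>s. norm (g s) \<le> B" using g unfolding hoelder_L2_def locally_hoelder_def by blast
  moreover have "B \<ge> 0" using B[of 0] norm_ge_zero order_trans by blast
  ultimately show ?thesis using that by blast
qed

lemma measurable_gs [measurable]: "g \<in> borel_measurable borel" "g' \<in> borel_measurable borel"
  "cnj \<in> borel_measurable borel"
  by (intro borel_measurable_continuous_onI continuous_intros)+

section \<open>Differentiation and integration by parts off the graph\<close>

lemma kernel_decay_bounds:
  fixes y a :: complex
  assumes "c * (1 + \<bar>s\<bar>) \<le> norm y" "c > 0"
  shows "y \<noteq> 0" "norm (a / y) \<le> norm a / c / (1 + \<bar>s\<bar>)" "norm (a / y\<^sup>2) \<le> norm a / c\<^sup>2 / (1 + \<bar>s\<bar>)\<^sup>2"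
    "norm (a / y ^ 3) \<le> norm a / c ^ 3 / (1 + \<bar>s\<bar>) ^ 3"
proof -
  have p: "c * (1 + \<bar>s\<bar>) > 0" using assms by (intro mult_pos_pos) auto
  have ny: "norm y > 0" using p assms(1) by linarith
  thus "y \<noteq> 0" by simp
  have *: "norm (a / y ^ n) \<le> norm a / c ^ n / (1 + \<bar>s\<bar>) ^ n" for n
  proof -
    have "norm a / norm y ^ n \<le> norm a / (c * (1 + \<bar>s\<bar>)) ^ n"
      using p ny assms by (intro divide_left_mono power_mono mult_pos_pos zero_less_power) auto
    thus ?thesis by (simp add: norm_divide norm_power power_mult_distrib)
  qed
  show "norm (a / y) \<le> norm a / c / (1 + \<bar>s\<bar>)" using *[of 1] by simp
  show "norm (a / y\<^sup>2) \<le> norm a / c\<^sup>2 / (1 + \<bar>s\<bar>)\<^sup>2" using *[of 2] .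
  show "norm (a / y ^ 3) \<le> norm a / c ^ 3 / (1 + \<bar>s\<bar>) ^ 3" using *[of 3] .
qed

lemma quadratic_integrable:
  assumes z: "z \<in> Up \<union> Lo" and u: "u \<in> borel_measurable borel" "\<And>s. norm (u s) \<le> B"
  shows "integrable lborel (\<lambda>s. u s / (z - Z s)\<^sup>2)"
proof -
  obtain r c where rc: "r > 0" "c > 0" "\<And>z' s. z' \<in> ball z r \<Longrightarrow> c * (1 + \<bar>s\<bar>) \<le> norm (z' - Z s)"
    using distance_lower_bound[OF z] by metis
  show ?thesis
  proof (rule integrable_inverse_square_bound)
    show "norm (u s / (z - Z s)\<^sup>2) \<le> B / c\<^sup>2 / (1 + \<bar>s\<bar>)\<^sup>2" for s
    proof -
      have "norm (u s / (z - Z s)\<^sup>2) \<le> norm (u s) / c\<^sup>2 / (1 + \<bar>s\<bar>)\<^sup>2"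
        using rc by (intro kernel_decay_bounds) auto
      also have "\<dots> \<le> B / c\<^sup>2 / (1 + \<bar>s\<bar>)\<^sup>2" using u(2) by (intro divide_right_mono) auto
      finally show ?thesis .
    qed
  qed (use u in measurable)
qed

text \<open>The weight z0 - Z s grows linearly and uses up one power of the denominator; the
  remaining 1 / (1 + |s|) is paired with the square integrable g.\<close>

lemma weighted_integrable:
  assumes z: "z \<in> Up \<union> Lo"
  shows "integrable lborel (\<lambda>s. cnj (z0 - Z s) * Z' s * g s / (z - Z s)\<^sup>2)"
proof -
  obtain r c where rc: "r > 0" "c > 0" "\<And>z' s. z' \<in> ball z r \<Longrightarrow> c * (1 + \<bar>s\<bar>) \<le> norm (z' - Z s)"
    using distance_lower_bound[OF z] by metis
  obtain C where C: "C \<ge> 0" "\<And>s. norm (z0 - Z s) \<le> C * (1 + \<bar>s\<bar>)" using Z_growth by blast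
  show ?thesis
  proof (rule integrable_L2_bound)
    show "norm (cnj (z0 - Z s) * Z' s * g s / (z - Z s)\<^sup>2) \<le> (C * (1 + M) / c\<^sup>2) * norm (g s) / (1 + \<bar>s\<bar>)" for s
    proof -
      have "norm (cnj (z0 - Z s) * Z' s * g s / (z - Z s)\<^sup>2) \<le> norm (cnj (z0 - Z s) * Z' s * g s) / c\<^sup>2 / (1 + \<bar>s\<bar>)\<^sup>2"
        using rc by (intro kernel_decay_bounds) auto
      also have "\<dots> \<le> (C * (1 + \<bar>s\<bar>)) * (1 + M) * norm (g s) / c\<^sup>2 / (1 + \<bar>s\<bar>)\<^sup>2"
        unfolding norm_mult complex_mod_cnj using C M_nonneg norm_Z'_le
        by (intro divide_right_mono mult_mono) auto
      also have "\<dots> = (C * (1 + M) / c\<^sup>2) * norm (g s) / (1 + \<bar>s\<bar>)"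
        by (simp add: power2_eq_square)
      finally show ?thesis .
    qed
  qed (use g in \<open>auto simp: hoelder_L2_def\<close>)
qed

lemma A_derivative:
  assumes z: "z \<in> Up \<union> Lo"
  shows "(pot k1 (\<lambda>s. g s * Z' s) has_field_derivative (LINT s|lborel. - (g s * Z' s) / (z - Z s)\<^sup>2)) (at z)"
  unfolding pot_def
proof -
  obtain r c where rc: "r > 0" "c > 0" "ball z r \<subseteq> Up \<union> Lo" "\<And>z' s. z' \<in> ball z r \<Longrightarrow> c * (1 + \<bar>s\<bar>) \<le> norm (z' - Z s)"
    using distance_lower_bound[OF z] by metis
  obtain B where B: "B \<ge> 0" "\<And>s. norm (g s) \<le> B" using g_bound by blast
  show "((\<lambda>z. LINT s|lborel. g s * Z' s * k1 (z - Z s)) has_field_derivative (LINT s|lborel. - (g s * Z' s) / (z - Z s)\<^sup>2)) (at z)"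
  proof (rule has_field_derivative_lebesgue_integral(1)[OF rc(1), where h' = "\<lambda>z s. - (g s * Z' s) / (z - Z s)\<^sup>2"])
    fix w s assume w: "w \<in> ball z r"
    note b = kernel_decay_bounds[OF rc(4)[OF w] rc(2)]
    show "((\<lambda>z. g s * Z' s * k1 (z - Z s)) has_field_derivative - (g s * Z' s) / (w - Z s)\<^sup>2) (at w)"
      unfolding k1_def using b(1)[of s] by (auto intro!: derivative_eq_intros simp: power2_eq_square)
    have "norm (- (g s * Z' s) / (w - Z s)\<^sup>2) \<le> norm (- (g s * Z' s)) / c\<^sup>2 / (1 + \<bar>s\<bar>)\<^sup>2" by (rule b)
    also have "\<dots> \<le> (B * (1 + M)) / c\<^sup>2 / (1 + \<bar>s\<bar>)\<^sup>2"
      unfolding norm_minus_cancel norm_mult using B norm_Z'_le M_nonneg by (intro divide_right_mono mult_mono) auto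
    finally show "norm (- (g s * Z' s) / (w - Z s)\<^sup>2) \<le> (B * (1 + M)) / c\<^sup>2 / (1 + \<bar>s\<bar>)\<^sup>2" .
  next
    fix w assume "w \<in> ball z r"
    thus "integrable lborel (\<lambda>s. g s * Z' s * k1 (w - Z s))" using rc(3) by (intro pot_integrable density_facts) auto
  next
    show "integrable lborel (\<lambda>s. (B * (1 + M)) / c\<^sup>2 / (1 + \<bar>s\<bar>)\<^sup>2)"
      by (rule integrable_inverse_square_bound[where C = "(B * (1 + M)) / c\<^sup>2"]) (use B M_nonneg in auto)
  qed
qed

lemma H_derivative:
  assumes z: "z \<in> Up \<union> Lo"
  shows "(H z0 has_field_derivative (LINT s|lborel. - (cnj (g s) * Z' s - g s * cnj (Z' s)) / (z - Z s)\<^sup>2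
     - 2 * (cnj (z0 - Z s) * Z' s * g s) / (z - Z s) ^ 3)) (at z)" (is ?A)
    and "integrable lborel (\<lambda>s. - (cnj (g s) * Z' s - g s * cnj (Z' s)) / (z - Z s)\<^sup>2
     - 2 * (cnj (z0 - Z s) * Z' s * g s) / (z - Z s) ^ 3)" (is ?B)
proof -
  obtain r c where rc: "r > 0" "c > 0" "ball z r \<subseteq> Up \<union> Lo" "\<And>z' s. z' \<in> ball z r \<Longrightarrow> c * (1 + \<bar>s\<bar>) \<le> norm (z' - Z s)"
    using distance_lower_bound[OF z] by metis
  obtain B where B: "B \<ge> 0" "\<And>s. norm (g s) \<le> B" using g_bound by blast
  obtain C where C: "C \<ge> 0" "\<And>s. norm (z0 - Z s) \<le> C * (1 + \<bar>s\<bar>)" using Z_growth by blast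
  define u where "u s = cnj (g s) * Z' s - g s * cnj (Z' s)" for s
  define v where "v s = cnj (z0 - Z s) * Z' s * g s" for s
  define D where "D = 2 * (B * (1 + M)) / c\<^sup>2 + 2 * (C * (1 + M) * B) / c ^ 3"
  have ub: "norm (u s) \<le> 2 * (B * (1 + M))" for s
  proof -
    have "norm (u s) \<le> norm (cnj (g s) * Z' s) + norm (g s * cnj (Z' s))" unfolding u_def by (rule norm_triangle_ineq4)
    also have "\<dots> = 2 * (norm (g s) * norm (Z' s))" by (simp add: norm_mult)
    also have "\<dots> \<le> 2 * (B * (1 + M))" using B norm_Z'_le M_nonneg by (intro mult_left_mono mult_mono) auto
    finally show ?thesis .
  qed
  have vb: "norm (v s) \<le> C * (1 + \<bar>s\<bar>) * (1 + M) * B" for s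
    unfolding v_def norm_mult complex_mod_cnj using C B norm_Z'_le M_nonneg by (intro mult_mono) auto
  have bound: "norm (- u s / (w - Z s)\<^sup>2 - 2 * v s / (w - Z s) ^ 3) \<le> D / (1 + \<bar>s\<bar>)\<^sup>2" if w: "w \<in> ball z r" for w s
  proof -
    note b = kernel_decay_bounds[OF rc(4)[OF w] rc(2)]
    have "norm (- u s / (w - Z s)\<^sup>2) \<le> norm (- u s) / c\<^sup>2 / (1 + \<bar>s\<bar>)\<^sup>2" by (rule b)
    also have "\<dots> \<le> 2 * (B * (1 + M)) / c\<^sup>2 / (1 + \<bar>s\<bar>)\<^sup>2"
      using ub by (intro divide_right_mono) auto
    finally have 1: "norm (- u s / (w - Z s)\<^sup>2) \<le> 2 * (B * (1 + M)) / c\<^sup>2 / (1 + \<bar>s\<bar>)\<^sup>2" .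
    have "norm (2 * v s / (w - Z s) ^ 3) \<le> norm (2 * v s) / c ^ 3 / (1 + \<bar>s\<bar>) ^ 3" by (rule b)
    also have "\<dots> \<le> 2 * (C * (1 + \<bar>s\<bar>) * (1 + M) * B) / c ^ 3 / (1 + \<bar>s\<bar>) ^ 3"
      using vb[of s] rc(2) by (intro divide_right_mono) (auto simp: norm_mult)
    also have "\<dots> = 2 * (C * (1 + M) * B) / c ^ 3 / (1 + \<bar>s\<bar>)\<^sup>2"
      by (simp add: power3_eq_cube power2_eq_square)
    finally have 2: "norm (2 * v s / (w - Z s) ^ 3) \<le> 2 * (C * (1 + M) * B) / c ^ 3 / (1 + \<bar>s\<bar>)\<^sup>2" .
    show ?thesis using norm_triangle_ineq4[of "- u s / (w - Z s)\<^sup>2" "2 * v s / (w - Z s) ^ 3"] 1 2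
      unfolding D_def add_divide_distrib[of _ _ "(1 + \<bar>s\<bar>)\<^sup>2"] by linarith
  qed
  have der: "((\<lambda>w. u s * k1 (w - Z s) + v s / (w - Z s)\<^sup>2) has_field_derivative - u s / (w - Z s)\<^sup>2 - 2 * v s / (w - Z s) ^ 3) (at w)"
    if w: "w \<in> ball z r" for w s
  proof -
    have q: "((\<lambda>y. u s * k1 y + v s / y\<^sup>2) has_field_derivative - u s / y\<^sup>2 - 2 * v s / y ^ 3) (at y)" if "y \<noteq> 0" for y
      unfolding k1_def using that
      by (auto intro!: derivative_eq_intros simp: field_simps power2_eq_square power3_eq_cube)
    have "((\<lambda>w. w - Z s) has_field_derivative 1) (at w)" by (auto intro!: derivative_eq_intros)
    from DERIV_chain2[OF q[OF kernel_decay_bounds(1)[OF rc(4)[OF w, of s] rc(2)]] this] show ?thesis by simp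
  qed
  have int: "integrable lborel (\<lambda>s. u s * k1 (w - Z s) + v s / (w - Z s)\<^sup>2)" if w: "w \<in> ball z r" for w
    using rc(3) w unfolding u_def v_def
    by (intro Bochner_Integration.integrable_add pot_integrable density_facts weighted_integrable) auto
  have D0: "integrable lborel (\<lambda>s. D / (1 + \<bar>s\<bar>)\<^sup>2)"
    by (rule integrable_inverse_square_bound[where C = "\<bar>D\<bar>"]) auto
  note * = has_field_derivative_lebesgue_integral[OF rc(1) der int bound D0, unfolded u_def v_def]
  show ?A unfolding H_def[abs_def] using *(1) by simp
  show ?B using *(2) by simp
qed

lemma quotient_derivatives:
  assumes z: "z \<in> Up \<union> Lo" and u: "(u has_vector_derivative u') (at s)"
  shows "((\<lambda>s. u s * k1 (z - Z s)) has_vector_derivative u' * k1 (z - Z s) + u s * Z' s / (z - Z s)\<^sup>2) (at s)"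
    and "((\<lambda>s. u s * k2 (z - Z s)) has_vector_derivative
      u' * k2 (z - Z s) + (u s * (- cnj (Z' s)) / (z - Z s)\<^sup>2 + 2 * (u s * cnj (z - Z s) * Z' s) / (z - Z s) ^ 3)) (at s)"
proof -
  have nz: "z - Z s \<noteq> 0" using off_graph[OF z] by simp
  have y: "((\<lambda>s. z - Z s) has_vector_derivative - Z' s) (at s)"
    using shifted_curve_deriv[of z 0 s UNIV] by simp
  have inv: "((\<lambda>s. inverse (z - Z s)) has_vector_derivative Z' s * (inverse (z - Z s) * inverse (z - Z s))) (at s)"
    using field_vector_diff_chain_at[OF y DERIV_inverse'[OF DERIV_ident nz]] by (simp add: o_def mult_ac)
  have mi: "((\<lambda>s. u s * inverse (z - Z s)) has_vector_derivative
      u s * (Z' s * (inverse (z - Z s) * inverse (z - Z s))) + u' * inverse (z - Z s)) (at s)"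
    if "(u has_vector_derivative u') (at s)" for u u'
    by (rule has_vector_derivative_mult[OF that inv])
  have "u s * (Z' s * (inverse (z - Z s) * inverse (z - Z s))) + u' * inverse (z - Z s) = u' * k1 (z - Z s) + u s * Z' s / (z - Z s)\<^sup>2"
    by (simp add: k1_def divide_inverse power2_eq_square)
  with mi[OF u] show "((\<lambda>s. u s * k1 (z - Z s)) has_vector_derivative u' * k1 (z - Z s) + u s * Z' s / (z - Z s)\<^sup>2) (at s)"
    by (simp add: k1_def divide_inverse)
  have cy: "((\<lambda>s. cnj (z - Z s)) has_vector_derivative cnj (- Z' s)) (at s)"
    by (intro has_vector_derivative_cnj y)
  have fun_eq: "(\<lambda>s. u s * cnj (z - Z s) * inverse (z - Z s) * inverse (z - Z s)) = (\<lambda>s. u s * k2 (z - Z s))"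
    by (simp add: k2_def power2_eq_square divide_inverse mult.assoc)
  have gen: "a * c * i * (p * (i * i)) + (a * c * (p * (i * i)) + (a * (- q) + a' * c) * i) * i =
     a' * (c * (i * i)) + (a * (- q) * (i * i) + 2 * (a * c * p) * (i * (i * i)))" for a a' c i p q :: complex
    by (simp add: algebra_simps)
  have rhs: "u s * cnj (z - Z s) * inverse (z - Z s) * (Z' s * (inverse (z - Z s) * inverse (z - Z s))) +
     (u s * cnj (z - Z s) * (Z' s * (inverse (z - Z s) * inverse (z - Z s))) +
      (u s * cnj (- Z' s) + u' * cnj (z - Z s)) * inverse (z - Z s)) * inverse (z - Z s) =
     u' * k2 (z - Z s) + (u s * (- cnj (Z' s)) / (z - Z s)\<^sup>2 + 2 * (u s * cnj (z - Z s) * Z' s) / (z - Z s) ^ 3)"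
    unfolding k2_def divide_inverse power2_eq_square power3_eq_cube inverse_mult_distrib complex_cnj_minus mult.assoc[of "inverse _"]
    using gen[of "u s" "cnj (z - Z s)" "inverse (z - Z s)" "Z' s" "cnj (Z' s)" u'] by (simp only: mult.assoc)
  from mi[OF mi[OF has_vector_derivative_mult[OF u cy]]]
  show "((\<lambda>s. u s * k2 (z - Z s)) has_vector_derivative
      u' * k2 (z - Z s) + (u s * (- cnj (Z' s)) / (z - Z s)\<^sup>2 + 2 * (u s * cnj (z - Z s) * Z' s) / (z - Z s) ^ 3)) (at s)"
    unfolding fun_eq rhs .
qed

lemma boundary_decay:
  assumes z: "z \<in> Up \<union> Lo" and k: "cauchy_kernel k" and u: "(u \<longlongrightarrow> 0) at_infinity"
  shows "((\<lambda>s. u s * k (z - Z s)) \<longlongrightarrow> (0::complex)) at_infinity"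
proof -
  obtain r c where rc: "r > 0" "c > 0" "\<And>z' s. z' \<in> ball z r \<Longrightarrow> c * (1 + \<bar>s\<bar>) \<le> norm (z' - Z s)"
    using distance_lower_bound[OF z] by metis
  have "norm (k (z - Z s)) \<le> 1 / c" for s
  proof -
    have "c * 1 \<le> c * (1 + \<bar>s\<bar>)" using rc(2) by (intro mult_left_mono) auto
    hence "c \<le> norm (z - Z s)" using rc(1) rc(3)[of z s] by simp
    hence "1 / norm (z - Z s) \<le> 1 / c" using rc(2) by (intro frac_le) auto
    moreover have "norm (k (z - Z s)) \<le> 1 / norm (z - Z s)" using k unfolding cauchy_kernel_def by blast
    ultimately show ?thesis by linarith
  qed
  thus ?thesis
    by (intro tendsto_0_le[OF u, of _ "1 / c"] always_eventually allI) (simp only: norm_mult mult_left_mono norm_ge_zero)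
qed

text \<open>The s-derivative of the kernel is \<open>Z'\<close> / (z - Z s)^2, so differentiation in
  z can be moved onto the density. This trades the singularity 1/w^2 for 1/w, which has boundary
  values.\<close>

lemma A_by_parts:
  assumes z: "z \<in> Up \<union> Lo"
  shows "(LINT s|lborel. - (g s * Z' s) / (z - Z s)\<^sup>2) = pot k1 g' z"
proof -
  obtain B where B: "B \<ge> 0" "\<And>s. norm (g s) \<le> B" using g_bound by blast
  have i2: "integrable lborel (\<lambda>s. g s * Z' s / (z - Z s)\<^sup>2)"
    by (rule quadratic_integrable[OF z, of _ "B * (1 + M)"])
       (use B norm_Z'_le M_nonneg in \<open>auto simp: norm_mult intro!: mult_mono\<close>)
  have i1: "integrable lborel (\<lambda>s. g' s * k1 (z - Z s))" by (intro pot_integrable g' g'0 z)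
  have nz: "z - Z s \<noteq> 0" for s using off_graph[OF z] by simp
  have "(LINT s|lborel. g' s * k1 (z - Z s) + g s * Z' s / (z - Z s)\<^sup>2) = 0"
  proof (rule integral_derivative_eq_0[where F = "\<lambda>s. g s * k1 (z - Z s)"])
    show "continuous_on UNIV (\<lambda>s. g' s * k1 (z - Z s) + g s * Z' s / (z - Z s)\<^sup>2)"
      unfolding k1_def using nz by (intro continuous_intros) auto
    show "((\<lambda>s. g s * k1 (z - Z s)) has_vector_derivative g' s * k1 (z - Z s) + g s * Z' s / (z - Z s)\<^sup>2) (at s)" for s
      by (rule quotient_derivatives(1)[OF z g_deriv])
    show "integrable lborel (\<lambda>s. g' s * k1 (z - Z s) + g s * Z' s / (z - Z s)\<^sup>2)"
      by (rule Bochner_Integration.integrable_add[OF i1 i2])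
    show "((\<lambda>s. g s * k1 (z - Z s)) \<longlongrightarrow> 0) at_infinity"
      by (rule boundary_decay[OF z cauchy_kernel_k1 g0])
  qed
  hence "(LINT s|lborel. g s * Z' s / (z - Z s)\<^sup>2) + pot k1 g' z = 0"
    using i1 i2 by (simp add: pot_def add.commute)
  from minus_unique[OF this] show ?thesis by simp
qed

text \<open>On the diagonal z0 = z the integrand differs from the terms with \<open>g'\<close> by
  the exact derivative of cnj g k1 + g k2. The part - g cnj \<open>Z'\<close> of the density in
  \<open>H\<close> is the one needed for this.\<close>

lemma H_by_parts:
  assumes z: "z \<in> Up \<union> Lo"
  shows "(LINT s|lborel. - (cnj (g s) * Z' s - g s * cnj (Z' s)) / (z - Z s)\<^sup>2
     - 2 * (cnj (z - Z s) * Z' s * g s) / (z - Z s) ^ 3) = pot k1 (\<lambda>s. cnj (g' s)) z + pot k2 g' z"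
proof -
  let ?h = "\<lambda>s. - (cnj (g s) * Z' s - g s * cnj (Z' s)) / (z - Z s)\<^sup>2
     - 2 * (cnj (z - Z s) * Z' s * g s) / (z - Z s) ^ 3"
  let ?p = "\<lambda>s. cnj (g' s) * k1 (z - Z s)" and ?q = "\<lambda>s. g' s * k2 (z - Z s)"
  have ip: "integrable lborel ?p" and iq: "integrable lborel ?q"
    by (intro pot_integrable density_facts g' g'0 z)+
  have ih: "integrable lborel ?h" by (rule H_derivative[OF z])
  have nz: "z - Z s \<noteq> 0" for s using off_graph[OF z] by simp
  have "(LINT s|lborel. ?p s + ?q s - ?h s) = 0"
  proof (rule integral_derivative_eq_0[where F = "\<lambda>s. cnj (g s) * k1 (z - Z s) + g s * k2 (z - Z s)"])
    fix s
    have "((\<lambda>s. cnj (g s)) has_vector_derivative cnj (g' s)) (at s)" by (intro has_vector_derivative_cnj g_deriv)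
    from has_vector_derivative_add[OF quotient_derivatives(1)[OF z this] quotient_derivatives(2)[OF z g_deriv]]
    show "((\<lambda>s. cnj (g s) * k1 (z - Z s) + g s * k2 (z - Z s)) has_vector_derivative ?p s + ?q s - ?h s) (at s)"
      unfolding has_vector_derivative_def
      by (rule has_derivative_eq_rhs) (simp add: diff_divide_distrib algebra_simps)
  next
    show "continuous_on UNIV (\<lambda>s. ?p s + ?q s - ?h s)"
      unfolding k1_def k2_def using nz by (intro continuous_intros) auto
    show "integrable lborel (\<lambda>s. ?p s + ?q s - ?h s)"
      by (intro Bochner_Integration.integrable_add Bochner_Integration.integrable_diff ip iq ih)
    have "((\<lambda>s. cnj (g s)) \<longlongrightarrow> 0) at_infinity" using tendsto_cnj[OF g0] by simp
    hence "((\<lambda>s. cnj (g s) * k1 (z - Z s) + g s * k2 (z - Z s)) \<longlongrightarrow> 0 + 0) at_infinity"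
      by (intro tendsto_add boundary_decay z cauchy_kernel_k1 cauchy_kernel_k2 g0)
    thus "((\<lambda>s. cnj (g s) * k1 (z - Z s) + g s * k2 (z - Z s)) \<longlongrightarrow> 0) at_infinity" by simp
  qed
  moreover have "(LINT s|lborel. ?p s + ?q s - ?h s) = pot k1 (\<lambda>s. cnj (g' s)) z + pot k2 g' z - (LINT s|lborel. ?h s)"
    using Bochner_Integration.integral_diff[OF Bochner_Integration.integrable_add[OF ip iq] ih]
      Bochner_Integration.integral_add[OF ip iq] by (simp only: pot_def)
  ultimately show ?thesis by simp
qed

text \<open>The velocity potential in complex notation, stripped of the factor - \<sigma> / (8 pi
  \<mu>).\<close>

definition vel :: "complex \<Rightarrow> complex" where
  "vel z = pot k1 (\<lambda>s. g s * Z' s) z +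
     cnj (pot k1 (\<lambda>s. cnj (g s) * Z' s - g s * cnj (Z' s)) z + pot k2 (\<lambda>s. g s * Z' s) z)"

text \<open>The conjugate of the derivative of \<open>vel\<close> with respect to cnj z.\<close>

definition vel_dbar :: "complex \<Rightarrow> complex" where
  "vel_dbar z = pot k1 (\<lambda>s. cnj (g' s)) z + pot k2 g' z"

text \<open>\<open>H z0\<close> is affine in cnj z0 with slope - A'. Hence B = H 0, and evaluation
  on the diagonal followed by conjugation produces the term - z cnj A'.\<close>

lemma goursat_representation:
  obtains A B where "A holomorphic_on (Up \<union> Lo)" "B holomorphic_on (Up \<union> Lo)"
    "\<And>z. z \<in> Up \<union> Lo \<Longrightarrow> deriv A z = pot k1 g' z"
    "\<And>z. z \<in> Up \<union> Lo \<Longrightarrow> deriv B z - cnj z * deriv (deriv A) z = vel_dbar z"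
    "\<And>z. z \<in> Up \<union> Lo \<Longrightarrow> vel z = A z + cnj (B z) - z * cnj (deriv A z)"
proof -
  define A where "A = pot k1 (\<lambda>s. g s * Z' s)"
  have op: "open (Up \<union> Lo)" using open_Up open_Lo by blast
  have Ad: "(A has_field_derivative pot k1 g' z) (at z)" if "z \<in> Up \<union> Lo" for z
    using A_derivative[OF that] A_by_parts[OF that] by (simp add: A_def)
  have dA: "deriv A z = pot k1 g' z" if "z \<in> Up \<union> Lo" for z using Ad[OF that] by (rule DERIV_imp_deriv)
  have Ah: "A holomorphic_on (Up \<union> Lo)"
    unfolding holomorphic_on_def field_differentiable_def using has_field_derivative_at_within[OF Ad] by blast
  have Bh: "H 0 holomorphic_on (Up \<union> Lo)"
    unfolding holomorphic_on_def field_differentiable_def using has_field_derivative_at_within[OF H_derivative(1)] by blast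
  obtain B where B: "B \<ge> 0" "\<And>s. norm (g s) \<le> B" using g_bound by blast
  have Hsplit: "H z0 w = H 0 w - cnj z0 * deriv A w" if w: "w \<in> Up \<union> Lo" for z0 w
  proof -
    have i1: "integrable lborel (\<lambda>s. (cnj (g s) * Z' s - g s * cnj (Z' s)) * k1 (w - Z s) +
       cnj (0 - Z s) * Z' s * g s / (w - Z s)\<^sup>2)"
      by (intro Bochner_Integration.integrable_add pot_integrable density_facts weighted_integrable w)
    have i2: "integrable lborel (\<lambda>s. - (g s * Z' s) / (w - Z s)\<^sup>2)"
      by (rule quadratic_integrable[OF w, of _ "B * (1 + M)"])
         (use B norm_Z'_le M_nonneg in \<open>auto simp: norm_mult intro!: mult_mono\<close>)
    have gen: "a + (x - y) * p * q / d = (a + (0 - y) * p * q / d) - x * (- (q * p) / d)" for a x y p q d :: complex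
      by (simp add: left_diff_distrib right_diff_distrib diff_divide_distrib mult_ac)
    have "H z0 w = (LINT s|lborel. ((cnj (g s) * Z' s - g s * cnj (Z' s)) * k1 (w - Z s) +
       cnj (0 - Z s) * Z' s * g s / (w - Z s)\<^sup>2) - cnj z0 * (- (g s * Z' s) / (w - Z s)\<^sup>2))"
      unfolding H_def complex_cnj_diff by (subst gen) (simp only: complex_cnj_zero)
    also have "\<dots> = H 0 w - cnj z0 * (LINT s|lborel. - (g s * Z' s) / (w - Z s)\<^sup>2)"
      unfolding H_def using Bochner_Integration.integral_diff[OF i1 integrable_mult_right[OF i2, of "cnj z0"]]
      by (simp only: integral_mult_right_zero)
    finally show ?thesis by (simp only: A_by_parts[OF w] dA[OF w])
  qed
  show ?thesis
  proof (rule that[OF Ah Bh dA])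
    fix z assume z: "z \<in> Up \<union> Lo"
    \<comment> \<open>With z frozen in the first argument, the derivative of \<open>H z\<close> at z
      is computed in two ways, by parts and through the affine formula; uniqueness of derivatives
      gives the identity.\<close>
    have "(H z has_field_derivative vel_dbar z) (at z)"
      using H_derivative(1)[OF z, of z] H_by_parts[OF z] by (simp add: vel_dbar_def)
    moreover have "(H z has_field_derivative deriv (H 0) z - cnj z * deriv (deriv A) z) (at z)"
    proof (rule has_field_derivative_transform_within_open[OF _ op z])
      show "((\<lambda>w. H 0 w - cnj z * deriv A w) has_field_derivative deriv (H 0) z - cnj z * deriv (deriv A) z) (at z)"
        using holomorphic_derivI[OF Bh op z] holomorphic_derivI[OF holomorphic_deriv[OF Ah op] op z]
        by (intro DERIV_diff DERIV_cmult)
    qed (rule Hsplit[symmetric])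
    ultimately show "deriv (H 0) z - cnj z * deriv (deriv A) z = vel_dbar z" by (rule DERIV_unique[symmetric])
    have "H z z = pot k1 (\<lambda>s. cnj (g s) * Z' s - g s * cnj (Z' s)) z + pot k2 (\<lambda>s. g s * Z' s) z"
    proof -
      have eq: "cnj (z - Z s) * Z' s * g s / (z - Z s)\<^sup>2 = g s * Z' s * k2 (z - Z s)" for s
        by (simp add: k2_def)
      show ?thesis unfolding H_def eq pot_def
        by (intro Bochner_Integration.integral_add pot_integrable density_facts z)
    qed
    with Hsplit[OF z, of z] show "vel z = A z + cnj (H 0 z) - z * cnj (deriv A z)"
      by (simp add: vel_def A_def)
  qed
qed

end

section \<open>Uniqueness across the interface\<close>

context graph_curve
begin

section \<open>Estimates up to the graph from one side\<close>

definition CS :: "real \<Rightarrow> complex set" where "CS \<sigma> = {z. \<sigma> * (Im z - f (Re z)) \<ge> 0}"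

lemma closed_CS: "closed (CS \<sigma>)"
  unfolding CS_def by (intro closed_Collect_le continuous_intros)

lemma open_Side: "open (Side \<sigma>)"
  unfolding Side_def by (intro open_Collect_less continuous_intros)

lemma Side_subset_CS: "Side \<sigma> \<subseteq> CS \<sigma>"
  by (auto simp: Side_def CS_def)

lemma Z_in_CS: "Z s \<in> CS \<sigma>" by (simp add: CS_def)

lemma CS_cases: "z \<in> CS \<sigma> \<Longrightarrow> \<sigma> = 1 \<or> \<sigma> = - 1 \<Longrightarrow> z \<in> Side \<sigma> \<or> z = Z (Re z)"
  by (auto simp: CS_def Side_def complex_eq_iff)

lemma CS_push:
  assumes "z \<in> CS \<sigma>" "\<sigma> = 1 \<or> \<sigma> = - 1" "h > 0"
  shows "z + of_real (\<sigma> * h) * \<i> \<in> Side \<sigma>"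
  using assms by (auto simp: CS_def Side_def)

lemma push_tendsto: "(\<lambda>n. z + of_real (\<sigma> * inverse (real (Suc n))) * \<i>) \<longlonglongrightarrow> z"
proof -
  have "(\<lambda>n. z + of_real (\<sigma> * inverse (real (Suc n))) * \<i>) \<longlonglongrightarrow> z + of_real (\<sigma> * 0) * \<i>"
    by (intro tendsto_add tendsto_const tendsto_mult tendsto_of_real LIMSEQ_inverse_real_of_nat)
  thus ?thesis by simp
qed

lemma closure_Side:
  assumes "\<sigma> = 1 \<or> \<sigma> = - 1"
  shows "closure (Side \<sigma>) = CS \<sigma>"
proof
  show "closure (Side \<sigma>) \<subseteq> CS \<sigma>" by (rule closure_minimal[OF Side_subset_CS closed_CS])
  show "CS \<sigma> \<subseteq> closure (Side \<sigma>)"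
  proof
    fix z assume z: "z \<in> CS \<sigma>"
    have "z + of_real (\<sigma> * inverse (real (Suc n))) * \<i> \<in> Side \<sigma>" for n
      by (rule CS_push[OF z assms]) simp
    thus "z \<in> closure (Side \<sigma>)" unfolding closure_sequential
      using push_tendsto[of z \<sigma>] by (intro exI[of _ "\<lambda>n. z + of_real (\<sigma> * inverse (real (Suc n))) * \<i>"]) auto
  qed
qed

lemma UNIV_CS: "z \<in> CS 1 \<or> z \<in> Side (- 1)" by (auto simp: CS_def Side_def)

text \<open>A side is not convex. Lifting both points vertically by h clears the slope of the graph,
  and the lifted segment stays inside; since h is at most (M + 1) |z1 - z2|, the detour has
  comparable length.\<close>

lemma Side_path:
  assumes \<sigma>: "\<sigma> = 1 \<or> \<sigma> = - 1" and z: "z1 \<in> Side \<sigma>" "z2 \<in> Side \<sigma>"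
  defines "h \<equiv> M * \<bar>Re z1 - Re z2\<bar> + \<bar>Im z1 - Im z2\<bar>"
  shows "closed_segment z1 (z1 + of_real (\<sigma> * h) * \<i>) \<subseteq> Side \<sigma>"
    and "closed_segment (z1 + of_real (\<sigma> * h) * \<i>) (z2 + of_real (\<sigma> * h) * \<i>) \<subseteq> Side \<sigma>"
proof -
  have h: "h \<ge> 0" using M_nonneg by (simp add: h_def)
  show "closed_segment z1 (z1 + of_real (\<sigma> * h) * \<i>) \<subseteq> Side \<sigma>"
  proof
    fix w assume "w \<in> closed_segment z1 (z1 + of_real (\<sigma> * h) * \<i>)"
    then obtain u where u: "0 \<le> u" "w = z1 + of_real u * (of_real (\<sigma> * h) * \<i>)"
      by (auto simp: in_segment scaleR_conv_of_real algebra_simps)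
    have "0 \<le> u * h" using u h by simp
    thus "w \<in> Side \<sigma>" using z(1) \<sigma> u by (auto simp: Side_def)
  qed
  show "closed_segment (z1 + of_real (\<sigma> * h) * \<i>) (z2 + of_real (\<sigma> * h) * \<i>) \<subseteq> Side \<sigma>"
  proof
    fix w assume "w \<in> closed_segment (z1 + of_real (\<sigma> * h) * \<i>) (z2 + of_real (\<sigma> * h) * \<i>)"
    then obtain u where u: "0 \<le> u" "u \<le> 1" "w = z1 + of_real (\<sigma> * h) * \<i> + of_real u * (z2 - z1)"
      by (auto simp: in_segment scaleR_conv_of_real algebra_simps)
    have re: "Re w = Re z1 + u * (Re z2 - Re z1)" and im: "Im w = Im z1 + \<sigma> * h + u * (Im z2 - Im z1)"
      using u by auto
    have "\<bar>f (Re w) - f (Re z1)\<bar> \<le> M * (u * \<bar>Re z1 - Re z2\<bar>)"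
      using f_lipschitz[of "Re w" "Re z1"] u re by (simp add: abs_mult abs_minus_commute)
    also have "\<dots> \<le> M * \<bar>Re z1 - Re z2\<bar>"
      using M_nonneg u by (intro mult_left_mono mult_left_le_one_le) auto
    finally have 1: "\<bar>f (Re w) - f (Re z1)\<bar> \<le> M * \<bar>Re z1 - Re z2\<bar>" .
    have "\<bar>u * (Im z2 - Im z1)\<bar> \<le> \<bar>Im z1 - Im z2\<bar>"
      using u mult_left_le_one_le[of "\<bar>Im z1 - Im z2\<bar>" u] by (simp add: abs_mult abs_minus_commute)
    with 1 z(1) \<sigma> show "w \<in> Side \<sigma>" unfolding Side_def im mem_Collect_eq h_def by (auto simp: algebra_simps abs_le_iff)
  qed
qed

text \<open>Subtracting the linear part frozen at z0 leaves a function with small derivative near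
  z0, and the detour of \<open>Side_path\<close> replaces the straight segment in the mean value
  inequality. The estimate is uniform up to the graph.\<close>

lemma linear_approximation:
  fixes V a b :: "complex \<Rightarrow> complex"
  assumes \<sigma>: "\<sigma> = 1 \<or> \<sigma> = - 1"
    and der: "\<And>z. z \<in> Side \<sigma> \<Longrightarrow> (V has_derivative (\<lambda>h. a z * h + b z * cnj h)) (at z)"
    and cont: "continuous_on (CS \<sigma>) a" "continuous_on (CS \<sigma>) b"
    and z0: "z0 \<in> CS \<sigma>" and e: "e > 0"
  obtains d where "d > 0" "\<And>z1 z2. z1 \<in> Side \<sigma> \<Longrightarrow> z2 \<in> Side \<sigma> \<Longrightarrow> z1 \<in> ball z0 d \<Longrightarrow> z2 \<in> ball z0 d \<Longrightarrow>
    norm (V z1 - V z2 - (a z0 * (z1 - z2) + b z0 * cnj (z1 - z2))) \<le> e * norm (z1 - z2)"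
proof -
  \<comment> \<open>Two vertical pieces of length at most (M + 1) |z1 - z2| and one parallel
    segment. The 2 in e' accounts for the two coefficients a and b.\<close>
  define L where "L = 2 * (M + 1) + 1"
  have L: "L > 0" using M_nonneg by (simp add: L_def)
  define e' where "e' = e / (2 * L)"
  have e': "e' > 0" using e L by (simp add: e'_def)
  obtain r1 where r1: "r1 > 0" "\<And>z. z \<in> CS \<sigma> \<Longrightarrow> dist z z0 < r1 \<Longrightarrow> dist (a z) (a z0) < e'"
    using cont(1) z0 e' unfolding continuous_on_iff by metis
  obtain r2 where r2: "r2 > 0" "\<And>z. z \<in> CS \<sigma> \<Longrightarrow> dist z z0 < r2 \<Longrightarrow> dist (b z) (b z0) < e'"
    using cont(2) z0 e' unfolding continuous_on_iff by metis
  define r where "r = min r1 r2"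
  have r: "r > 0" "r \<le> r1" "r \<le> r2" using r1 r2 by (auto simp: r_def)
  \<comment> \<open>The detour of two points in the ball of radius d reaches at most L d = r/2 from
    z0.\<close>
  define d where "d = r / (2 * L)"
  have L1: "L \<ge> 3" using M_nonneg by (simp add: L_def)
  have d: "d > 0" using r L by (simp add: d_def)
  let ?T = "\<lambda>z. V z - (a z0 * z + b z0 * cnj z)"
  have seg: "norm (?T x - ?T y) \<le> 2 * e' * norm (x - y)"
    if sub: "closed_segment x y \<subseteq> Side \<sigma>" "closed_segment x y \<subseteq> ball z0 r" for x y
  proof (rule differentiable_bound[of "closed_segment x y"])
    fix z assume z: "z \<in> closed_segment x y"
    hence zS: "z \<in> Side \<sigma>" "z \<in> ball z0 r" using sub by auto
    show "(?T has_derivative (\<lambda>h. (a z - a z0) * h + (b z - b z0) * cnj h)) (at z within closed_segment x y)"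
      using has_derivative_at_withinI[OF der[OF zS(1)]]
      by (auto intro!: derivative_eq_intros has_derivative_cnj simp: algebra_simps)
    show "onorm (\<lambda>h. (a z - a z0) * h + (b z - b z0) * cnj h) \<le> 2 * e'"
    proof (rule onorm_le)
      fix h
      have da: "norm (a z - a z0) \<le> e'" "norm (b z - b z0) \<le> e'"
        using r1(2)[of z] r2(2)[of z] zS r Side_subset_CS by (auto simp: dist_norm norm_minus_commute intro: less_imp_le)
      have "norm ((a z - a z0) * h + (b z - b z0) * cnj h) \<le> norm (a z - a z0) * norm h + norm (b z - b z0) * norm h"
        by (metis norm_triangle_ineq norm_mult complex_mod_cnj)
      also have "\<dots> \<le> e' * norm h + e' * norm h" by (intro add_mono mult_right_mono da) auto
      finally show "norm ((a z - a z0) * h + (b z - b z0) * cnj h) \<le> 2 * e' * norm h" by simp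
    qed
  qed auto
  show ?thesis
  proof (rule that[OF d])
    fix z1 z2 assume z: "z1 \<in> Side \<sigma>" "z2 \<in> Side \<sigma>" "z1 \<in> ball z0 d" "z2 \<in> ball z0 d"
    define h where "h = M * \<bar>Re z1 - Re z2\<bar> + \<bar>Im z1 - Im z2\<bar>"
    have h': "h = M * \<bar>Re z2 - Re z1\<bar> + \<bar>Im z2 - Im z1\<bar>" by (simp add: h_def abs_minus_commute)
    let ?w1 = "z1 + of_real (\<sigma> * h) * \<i>" and ?w2 = "z2 + of_real (\<sigma> * h) * \<i>"
    have h0: "h \<ge> 0" using M_nonneg by (simp add: h_def)
    have hle: "h \<le> (M + 1) * norm (z1 - z2)"
      using mult_left_mono[OF abs_Re_le_cmod[of "z1 - z2"] M_nonneg] abs_Im_le_cmod[of "z1 - z2"]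
      by (simp add: h_def algebra_simps)
    have n: "norm (of_real (\<sigma> * h) * \<i>) = h" using \<sigma> h0 by (auto simp: norm_mult)
    have "norm (z1 - z2) \<le> 2 * d" using z(3,4) norm_triangle_ineq4[of "z1 - z0" "z2 - z0"] by (auto simp: dist_norm norm_minus_commute)
    hence "(M + 1) * norm (z1 - z2) \<le> (M + 1) * (2 * d)" using M_nonneg by (intro mult_left_mono) auto
    hence "h \<le> (M + 1) * (2 * d)" using hle by linarith
    moreover have "d + (M + 1) * (2 * d) = L * d" by (simp add: L_def algebra_simps)
    moreover have "L * d < r" using L r by (simp add: d_def)
    ultimately have dh: "d + h < r" by linarith
    have inb: "z + of_real (\<sigma> * h) * \<i> \<in> ball z0 r" "z \<in> ball z0 r" if "z \<in> ball z0 d" for z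
    proof -
      have "dist z0 (z + of_real (\<sigma> * h) * \<i>) \<le> dist z0 z + h"
        using dist_triangle[of z0 "z + of_real (\<sigma> * h) * \<i>" z] n by (simp add: dist_norm)
      thus "z + of_real (\<sigma> * h) * \<i> \<in> ball z0 r" "z \<in> ball z0 r" using that dh h0 by auto
    qed
    have s: "closed_segment x y \<subseteq> ball z0 r" if "x \<in> ball z0 r" "y \<in> ball z0 r" for x y
      using that by (simp add: closed_segment_subset)
    have 1: "norm (?T z1 - ?T ?w1) \<le> 2 * e' * h"
      using seg[OF Side_path(1)[OF \<sigma> z(1,2), folded h_def] s] inb z n by simp
    have 2: "norm (?T ?w1 - ?T ?w2) \<le> 2 * e' * norm (z1 - z2)"
      using seg[OF Side_path(2)[OF \<sigma> z(1,2), folded h_def] s] inb z by simp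
    have 3: "norm (?T z2 - ?T ?w2) \<le> 2 * e' * h"
      using seg[OF Side_path(1)[OF \<sigma> z(2,1), folded h'] s] inb z n by simp
    have "norm (?T z1 - ?T z2) \<le> norm (?T z1 - ?T ?w1) + norm (?T ?w1 - ?T ?w2) + norm (?T z2 - ?T ?w2)"
    proof -
      have tri: "norm (p - q) \<le> norm (p - p') + norm (p' - q') + norm (q - q')" for p q p' q' :: complex
        using norm_triangle_ineq[of "p - p'" "p' - q'"] norm_triangle_ineq4[of "(p - p') + (p' - q')" "q - q'"] by (simp add: algebra_simps)
      show ?thesis by (rule tri)
    qed
    also have "\<dots> \<le> 2 * e' * (h + norm (z1 - z2) + h)" using 1 2 3 by (simp add: algebra_simps)
    also have "\<dots> \<le> 2 * e' * (L * norm (z1 - z2))"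
      using hle e' by (intro mult_left_mono) (auto simp: L_def algebra_simps)
    also have "\<dots> = e * norm (z1 - z2)" using L by (simp add: e'_def)
    finally show "norm (V z1 - V z2 - (a z0 * (z1 - z2) + b z0 * cnj (z1 - z2))) \<le> e * norm (z1 - z2)"
      by (simp add: algebra_simps)
  qed
qed

text \<open>\<open>V'\<close> holds the vertical limits of V and is kept apart from V because a
  primitive obtained on the open side has no prescribed values on the graph.\<close>

lemma linear_approximation_closure:
  fixes V a b :: "complex \<Rightarrow> complex"
  assumes \<sigma>: "\<sigma> = 1 \<or> \<sigma> = - 1"
    and der: "\<And>z. z \<in> Side \<sigma> \<Longrightarrow> (V has_derivative (\<lambda>h. a z * h + b z * cnj h)) (at z)"
    and cont: "continuous_on (CS \<sigma>) a" "continuous_on (CS \<sigma>) b" and lim: "\<And>z. z \<in> CS \<sigma> \<Longrightarrow>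
      (\<lambda>n. V (z + of_real (\<sigma> * inverse (real (Suc n))) * \<i>)) \<longlonglongrightarrow> V' z"
    and z0: "z0 \<in> CS \<sigma>" and e: "e > 0"
  obtains d where "d > 0" "\<And>z1 z2. z1 \<in> CS \<sigma> \<Longrightarrow> z2 \<in> CS \<sigma> \<Longrightarrow> z1 \<in> ball z0 d \<Longrightarrow> z2 \<in> ball z0 d \<Longrightarrow>
    norm (V' z1 - V' z2 - (a z0 * (z1 - z2) + b z0 * cnj (z1 - z2))) \<le> e * norm (z1 - z2)"
proof -
  obtain d where d: "d > 0" "\<And>z1 z2. z1 \<in> Side \<sigma> \<Longrightarrow> z2 \<in> Side \<sigma> \<Longrightarrow> z1 \<in> ball z0 d \<Longrightarrow> z2 \<in> ball z0 d \<Longrightarrow>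
    norm (V z1 - V z2 - (a z0 * (z1 - z2) + b z0 * cnj (z1 - z2))) \<le> e * norm (z1 - z2)"
    using linear_approximation[OF \<sigma> der cont z0 e] by blast
  let ?p = "\<lambda>z n. z + of_real (\<sigma> * inverse (real (Suc n))) * \<i>"
  show ?thesis
  proof (rule that[OF d(1)])
    fix z1 z2 assume z: "z1 \<in> CS \<sigma>" "z2 \<in> CS \<sigma>" "z1 \<in> ball z0 d" "z2 \<in> ball z0 d"
    have ev: "\<forall>\<^sub>F n in sequentially. ?p z n \<in> ball z0 d" if "z \<in> ball z0 d" for z
      using topological_tendstoD[OF push_tendsto open_ball that] .
    show "norm (V' z1 - V' z2 - (a z0 * (z1 - z2) + b z0 * cnj (z1 - z2))) \<le> e * norm (z1 - z2)"
    proof (rule tendsto_le[OF sequentially_bot])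
      show "(\<lambda>n. norm (V (?p z1 n) - V (?p z2 n) - (a z0 * (?p z1 n - ?p z2 n) + b z0 * cnj (?p z1 n - ?p z2 n))))
        \<longlonglongrightarrow> norm (V' z1 - V' z2 - (a z0 * (z1 - z2) + b z0 * cnj (z1 - z2)))"
        by (intro tendsto_norm tendsto_diff tendsto_add tendsto_mult tendsto_const tendsto_cnj push_tendsto lim z)
      show "(\<lambda>n. e * norm (?p z1 n - ?p z2 n)) \<longlonglongrightarrow> e * norm (z1 - z2)"
        by (intro tendsto_norm tendsto_diff tendsto_mult tendsto_const push_tendsto)
      show "\<forall>\<^sub>F n in sequentially. norm (V (?p z1 n) - V (?p z2 n) - (a z0 * (?p z1 n - ?p z2 n) + b z0 * cnj (?p z1 n - ?p z2 n))) \<le> e * norm (?p z1 n - ?p z2 n)"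
        using ev[OF z(3)] ev[OF z(4)]
      proof eventually_elim
        case (elim n)
        thus ?case by (intro d(2) CS_push \<sigma> z) auto
      qed
    qed
  qed
qed

text \<open>The shear that flattens the graph maps the side homeomorphically onto a half plane.
  Simple connectedness needs no more than that, and it yields a global primitive.\<close>

lemma Side_primitive:
  assumes \<sigma>: "\<sigma> = 1 \<or> \<sigma> = - 1" and hol: "\<Phi> holomorphic_on Side \<sigma>"
  obtains P where "\<And>z. z \<in> Side \<sigma> \<Longrightarrow> (P has_field_derivative \<Phi> z) (at z)"
proof -
  have "Side \<sigma> homeomorphic {z. 0 < Im z}"
  proof (rule homeomorphicI[where f = "\<lambda>z. Complex (Re z) (\<sigma> * (Im z - f (Re z)))" and g = "\<lambda>z. Complex (Re z) (f (Re z) + \<sigma> * Im z)"])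
    have s: "\<sigma> * (\<sigma> * x) = x" for x using \<sigma> by auto
    show "(\<lambda>z. Complex (Re z) (\<sigma> * (Im z - f (Re z)))) ` Side \<sigma> = {z. 0 < Im z}"
    proof safe
      fix z assume "0 < Im z"
      thus "z \<in> (\<lambda>z. Complex (Re z) (\<sigma> * (Im z - f (Re z)))) ` Side \<sigma>"
        by (intro image_eqI[of _ _ "Complex (Re z) (f (Re z) + \<sigma> * Im z)"]) (auto simp: Side_def s complex_eq_iff)
    qed (auto simp: Side_def)
    show "(\<lambda>z. Complex (Re z) (f (Re z) + \<sigma> * Im z)) ` {z. 0 < Im z} = Side \<sigma>"
    proof safe
      fix z assume "z \<in> Side \<sigma>"
      thus "z \<in> (\<lambda>z. Complex (Re z) (f (Re z) + \<sigma> * Im z)) ` {z. 0 < Im z}"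
        by (intro image_eqI[of _ _ "Complex (Re z) (\<sigma> * (Im z - f (Re z)))"]) (auto simp: Side_def s complex_eq_iff)
    qed (auto simp: Side_def s)
    show "continuous_on (Side \<sigma>) (\<lambda>z. Complex (Re z) (\<sigma> * (Im z - f (Re z))))"
      "continuous_on {z. 0 < Im z} (\<lambda>z. Complex (Re z) (f (Re z) + \<sigma> * Im z))"
      unfolding Complex_eq by (intro continuous_intros)+
  qed (use \<sigma> in \<open>auto simp: complex_eq_iff\<close>)
  moreover have "simply_connected {z. 0 < Im z}"
    by (intro convex_imp_simply_connected convex_halfspace_Im_gt)
  ultimately have "simply_connected (Side \<sigma>)" using homeomorphic_simply_connected_eq by blast
  thus ?thesis using simply_connected_eq_global_primitive[OF open_Side, of \<sigma>] hol that by metis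
qed

section \<open>Holomorphy across the graph and the homogeneous problem\<close>

text \<open>Primitives on the two sides extend to the graph with one-sided derivative \<Phi>. Along
  the curve their traces differ by a constant, so they glue to a primitive on the plane, and \<Phi>
  is holomorphic as the derivative of a holomorphic function.\<close>

lemma holomorphic_across_graph:
  assumes cont: "continuous_on UNIV \<Phi>" and hol: "\<And>\<sigma>. \<sigma> = 1 \<or> \<sigma> = - 1 \<Longrightarrow> \<Phi> holomorphic_on Side \<sigma>"
  shows "\<Phi> holomorphic_on UNIV"
proof -
  define p where "p \<sigma> z n = z + of_real (\<sigma> * inverse (real (Suc n))) * \<i>" for \<sigma> z and n :: nat
  have "\<exists>P. \<forall>z\<in>CS \<sigma>. (z \<in> Side \<sigma> \<longrightarrow> (P has_field_derivative \<Phi> z) (at z)) \<and>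
     (\<forall>e>0. \<exists>d>0. \<forall>z1\<in>CS \<sigma>. \<forall>z2\<in>CS \<sigma>. z1 \<in> ball z d \<longrightarrow> z2 \<in> ball z d \<longrightarrow>
        norm (P z1 - P z2 - \<Phi> z * (z1 - z2)) \<le> e * norm (z1 - z2))"
    if \<sigma>: "\<sigma> = 1 \<or> \<sigma> = - 1" for \<sigma>
  proof -
    obtain P where P: "\<And>z. z \<in> Side \<sigma> \<Longrightarrow> (P has_field_derivative \<Phi> z) (at z)"
      using Side_primitive[OF \<sigma> hol[OF \<sigma>]] by blast
    have der: "(P has_derivative (\<lambda>h. \<Phi> z * h + 0 * cnj h)) (at z)" if "z \<in> Side \<sigma>" for z
      using P[OF that] by (simp add: has_field_derivative_def)
    have cS: "continuous_on (CS \<sigma>) \<Phi>" "continuous_on (CS \<sigma>) (\<lambda>_. 0::complex)"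
      using continuous_on_subset[OF cont] by auto
    have "\<exists>l. (\<lambda>n. P (p \<sigma> z n)) \<longlonglongrightarrow> l" if z: "z \<in> CS \<sigma>" for z
    proof -
      obtain d where d: "d > 0" "\<And>z1 z2. z1 \<in> Side \<sigma> \<Longrightarrow> z2 \<in> Side \<sigma> \<Longrightarrow> z1 \<in> ball z d \<Longrightarrow> z2 \<in> ball z d \<Longrightarrow>
          norm (P z1 - P z2 - (\<Phi> z * (z1 - z2) + 0 * cnj (z1 - z2))) \<le> 1 * norm (z1 - z2)"
        using linear_approximation[OF \<sigma> der cS z, of 1] by auto
      \<comment> \<open>A Lipschitz constant for P near z, also when z lies on the graph; it makes
        the values along the vertical approach a Cauchy sequence.\<close>
      define C where "C = norm (\<Phi> z) + 1"
      have C: "C > 0" by (simp add: C_def add_nonneg_pos)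
      have lip: "norm (P z1 - P z2) \<le> C * norm (z1 - z2)"
        if "z1 \<in> Side \<sigma>" "z2 \<in> Side \<sigma>" "z1 \<in> ball z d" "z2 \<in> ball z d" for z1 z2
      proof -
        have "norm (P z1 - P z2) \<le> norm (P z1 - P z2 - \<Phi> z * (z1 - z2)) + norm (\<Phi> z * (z1 - z2))"
          using norm_triangle_ineq[of "P z1 - P z2 - \<Phi> z * (z1 - z2)" "\<Phi> z * (z1 - z2)"] by simp
        also have "\<dots> \<le> 1 * norm (z1 - z2) + norm (\<Phi> z) * norm (z1 - z2)"
          using d(2)[OF that] by (simp add: norm_mult)
        finally show ?thesis by (simp add: C_def algebra_simps)
      qed
      have conv: "p \<sigma> z \<longlonglongrightarrow> z" unfolding p_def by (rule push_tendsto)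
      have pin: "p \<sigma> z n \<in> Side \<sigma>" for n unfolding p_def by (rule CS_push[OF z \<sigma>]) simp
      obtain N0 where N0: "\<And>n. n \<ge> N0 \<Longrightarrow> p \<sigma> z n \<in> ball z d"
        using topological_tendstoD[OF conv open_ball, of z d] d(1) by (auto simp: eventually_sequentially)
      have "Cauchy (\<lambda>n. P (p \<sigma> z n))"
      proof (rule metric_CauchyI)
        fix e :: real assume e: "e > 0"
        obtain N1 where N1: "\<And>m n. m \<ge> N1 \<Longrightarrow> n \<ge> N1 \<Longrightarrow> dist (p \<sigma> z m) (p \<sigma> z n) < e / C"
          using metric_CauchyD[OF LIMSEQ_imp_Cauchy[OF conv], of "e / C"] e C by auto
        have "dist (P (p \<sigma> z m)) (P (p \<sigma> z n)) < e" if "m \<ge> max N0 N1" "n \<ge> max N0 N1" for m n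
        proof -
          have "dist (P (p \<sigma> z m)) (P (p \<sigma> z n)) \<le> C * dist (p \<sigma> z m) (p \<sigma> z n)"
            unfolding dist_norm using that by (intro lip pin N0) auto
          also have "\<dots> < C * (e / C)" using N1[of m n] that C by (intro mult_strict_left_mono) auto
          finally show ?thesis using C by simp
        qed
        thus "\<exists>N. \<forall>m\<ge>N. \<forall>n\<ge>N. dist (P (p \<sigma> z m)) (P (p \<sigma> z n)) < e" by blast
      qed
      thus ?thesis using Cauchy_convergent convergent_def by blast
    qed
    then obtain P' where P': "\<And>z. z \<in> CS \<sigma> \<Longrightarrow> (\<lambda>n. P (p \<sigma> z n)) \<longlonglongrightarrow> P' z" by metis
    have eqP: "P' z = P z" if "z \<in> Side \<sigma>" for z
    proof -
      have "(\<lambda>n. P (p \<sigma> z n)) \<longlonglongrightarrow> P z"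
        unfolding p_def by (rule isCont_tendsto_compose[OF DERIV_isCont[OF P[OF that]] push_tendsto])
      with P'[of z] that Side_subset_CS show ?thesis using LIMSEQ_unique by blast
    qed
    show ?thesis
    proof (intro exI[of _ P'] ballI conjI impI allI)
      fix z assume z: "z \<in> CS \<sigma>"
      show "(P' has_field_derivative \<Phi> z) (at z)" if "z \<in> Side \<sigma>"
        using has_field_derivative_transform_within_open[OF P[OF that] open_Side that] eqP by metis
      fix e :: real assume e: "e > 0"
      obtain d where "d > 0" "\<And>z1 z2. z1 \<in> CS \<sigma> \<Longrightarrow> z2 \<in> CS \<sigma> \<Longrightarrow> z1 \<in> ball z d \<Longrightarrow> z2 \<in> ball z d \<Longrightarrow>
        norm (P' z1 - P' z2 - (\<Phi> z * (z1 - z2) + 0 * cnj (z1 - z2))) \<le> e * norm (z1 - z2)"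
        using linear_approximation_closure[OF \<sigma> der cS P'[unfolded p_def] z e] by blast
      thus "\<exists>d>0. \<forall>z1\<in>CS \<sigma>. \<forall>z2\<in>CS \<sigma>. z1 \<in> ball z d \<longrightarrow> z2 \<in> ball z d \<longrightarrow>
        norm (P' z1 - P' z2 - \<Phi> z * (z1 - z2)) \<le> e * norm (z1 - z2)" by auto
    qed
  qed
  note ex = this
  obtain P where P: "\<And>z. z \<in> Side 1 \<Longrightarrow> (P has_field_derivative \<Phi> z) (at z)"
    and Pe: "\<And>z e. z \<in> CS 1 \<Longrightarrow> e > 0 \<Longrightarrow> \<exists>d>0. \<forall>z1\<in>CS 1. \<forall>z2\<in>CS 1. z1 \<in> ball z d \<longrightarrow> z2 \<in> ball z d \<longrightarrow>
        norm (P z1 - P z2 - \<Phi> z * (z1 - z2)) \<le> e * norm (z1 - z2)"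
    using ex[of 1] Side_subset_CS by blast
  obtain Q where Q: "\<And>z. z \<in> Side (-1) \<Longrightarrow> (Q has_field_derivative \<Phi> z) (at z)"
    and Qe: "\<And>z e. z \<in> CS (-1) \<Longrightarrow> e > 0 \<Longrightarrow> \<exists>d>0. \<forall>z1\<in>CS (-1). \<forall>z2\<in>CS (-1). z1 \<in> ball z d \<longrightarrow> z2 \<in> ball z d \<longrightarrow>
        norm (Q z1 - Q z2 - \<Phi> z * (z1 - z2)) \<le> e * norm (z1 - z2)"
    using ex[of "-1"] Side_subset_CS by blast
  have Zc: "isCont Z s" for s
    using Z_deriv has_vector_derivative_continuous by blast
  have Zlip: "norm (Z s - Z t) \<le> (1 + M) * \<bar>s - t\<bar>" for s t
    using cmod_le[of "Z s - Z t"] f_lipschitz[of s t] by (simp add: algebra_simps)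
  \<comment> \<open>Both traces have the derivative \<Phi> (Z s) \<open>Z'\<close> s along the
    curve, so their difference has derivative zero.\<close>
  define D where "D s = P (Z s) - Q (Z s)" for s
  have "(D has_derivative (\<lambda>h. 0)) (at s)" for s
    unfolding has_derivative_at_alt
  proof (intro conjI allI impI)
    fix e :: real assume e: "e > 0"
    define e' where "e' = e / (2 * (1 + M))"
    have e': "e' > 0" "2 * e' * (1 + M) = e" using e M_nonneg by (auto simp: e'_def field_simps)
    obtain d1 where d1: "d1 > 0" "\<And>z1 z2. z1 \<in> CS 1 \<Longrightarrow> z2 \<in> CS 1 \<Longrightarrow> z1 \<in> ball (Z s) d1 \<Longrightarrow> z2 \<in> ball (Z s) d1 \<Longrightarrow>
      norm (P z1 - P z2 - \<Phi> (Z s) * (z1 - z2)) \<le> e' * norm (z1 - z2)" using Pe[OF Z_in_CS e'(1)] by blast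
    obtain d2 where d2: "d2 > 0" "\<And>z1 z2. z1 \<in> CS (-1) \<Longrightarrow> z2 \<in> CS (-1) \<Longrightarrow> z1 \<in> ball (Z s) d2 \<Longrightarrow> z2 \<in> ball (Z s) d2 \<Longrightarrow>
      norm (Q z1 - Q z2 - \<Phi> (Z s) * (z1 - z2)) \<le> e' * norm (z1 - z2)" using Qe[OF Z_in_CS e'(1)] by blast
    obtain d where d: "d > 0" "\<And>t. norm (t - s) < d \<Longrightarrow> norm (Z t - Z s) < min d1 d2"
      using Zc[of s] d1(1) d2(1) unfolding continuous_at_eps_delta dist_norm by (metis min_less_iff_conj)
    show "\<exists>d>0. \<forall>t. norm (t - s) < d \<longrightarrow> norm (D t - D s - 0) \<le> e * norm (t - s)"
    proof (intro exI conjI allI impI)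
      fix t assume "norm (t - s) < d"
      hence zt: "Z t \<in> ball (Z s) d1" "Z t \<in> ball (Z s) d2" using d(2)[of t] by (auto simp: dist_norm norm_minus_commute)
      have "norm (D t - D s - 0) \<le> norm (P (Z t) - P (Z s) - \<Phi> (Z s) * (Z t - Z s)) + norm (Q (Z t) - Q (Z s) - \<Phi> (Z s) * (Z t - Z s))"
        using norm_triangle_ineq4[of "P (Z t) - P (Z s) - \<Phi> (Z s) * (Z t - Z s)" "Q (Z t) - Q (Z s) - \<Phi> (Z s) * (Z t - Z s)"]
        by (simp add: D_def algebra_simps)
      also have "\<dots> \<le> e' * norm (Z t - Z s) + e' * norm (Z t - Z s)"
        using zt d1(1) d2(1) by (intro add_mono d1(2) d2(2) Z_in_CS) auto
      also have "\<dots> = 2 * e' * norm (Z t - Z s)" by simp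
      also have "\<dots> \<le> 2 * e' * ((1 + M) * \<bar>t - s\<bar>)" using Zlip e'(1) by (intro mult_left_mono) auto
      also have "\<dots> = e * norm (t - s)" using e'(2) by (simp flip: mult.assoc)
      finally show "norm (D t - D s - 0) \<le> e * norm (t - s)" .
    qed (rule d(1))
  qed simp
  hence "\<exists>c. \<forall>s. D s = c"
    using has_derivative_zero_constant[of UNIV D] by auto
  then obtain c where c: "\<And>s. P (Z s) = Q (Z s) + c" unfolding D_def by (metis add.commute diff_add_cancel)
  define \<Psi> where "\<Psi> z = (if z \<in> CS 1 then P z else Q z + c)" for z
  have \<Psi>Q: "\<Psi> z = Q z + c" if "z \<in> CS (-1)" for z
    using CS_cases[of z 1] that c[of "Re z"] by (auto simp: \<Psi>_def Side_def CS_def)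
  have \<Psi>P: "\<Psi> z = P z" if "z \<in> CS 1" for z using that by (simp add: \<Psi>_def)
  have "(\<Psi> has_field_derivative \<Phi> z) (at z)" for z
  proof -
    consider "z \<in> Side 1" | "z \<in> Side (-1)" | "z \<in> CS 1" "z \<in> CS (-1)" by (force simp: CS_def Side_def)
    thus ?thesis
    proof cases
      case 1
      show ?thesis
        by (rule has_field_derivative_transform_within_open[OF P[OF 1] open_Side 1])
             (rule \<Psi>P[symmetric], use Side_subset_CS in blast)
    next
      case 2
      have "((\<lambda>z. Q z + c) has_field_derivative \<Phi> z) (at z)" using Q[OF 2] by (auto intro!: derivative_eq_intros)
      thus ?thesis
        by (rule has_field_derivative_transform_within_open[OF _ open_Side 2])
             (rule \<Psi>Q[symmetric], use Side_subset_CS in blast)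
    next
      \<comment> \<open>At a point of the graph the two one-sided expansions share the value and the
        linear part, which together amount to complex differentiability.\<close>
      case 3
      show ?thesis unfolding has_field_derivative_def has_derivative_at_alt
      proof (intro conjI allI impI)
        fix e :: real assume e: "e > 0"
        obtain d1 where d1: "d1 > 0" "\<And>z1 z2. z1 \<in> CS 1 \<Longrightarrow> z2 \<in> CS 1 \<Longrightarrow> z1 \<in> ball z d1 \<Longrightarrow> z2 \<in> ball z d1 \<Longrightarrow>
          norm (P z1 - P z2 - \<Phi> z * (z1 - z2)) \<le> e * norm (z1 - z2)" using Pe[OF 3(1) e] by blast
        obtain d2 where d2: "d2 > 0" "\<And>z1 z2. z1 \<in> CS (-1) \<Longrightarrow> z2 \<in> CS (-1) \<Longrightarrow> z1 \<in> ball z d2 \<Longrightarrow> z2 \<in> ball z d2 \<Longrightarrow>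
          norm (Q z1 - Q z2 - \<Phi> z * (z1 - z2)) \<le> e * norm (z1 - z2)" using Qe[OF 3(2) e] by blast
        show "\<exists>d>0. \<forall>y. norm (y - z) < d \<longrightarrow> norm (\<Psi> y - \<Psi> z - \<Phi> z * (y - z)) \<le> e * norm (y - z)"
        proof (intro exI[of _ "min d1 d2"] conjI allI impI)
          fix y assume y: "norm (y - z) < min d1 d2"
          have yb: "y \<in> ball z d1" "y \<in> ball z d2" using y by (auto simp: dist_norm norm_minus_commute)
          show "norm (\<Psi> y - \<Psi> z - \<Phi> z * (y - z)) \<le> e * norm (y - z)"
          proof (cases "y \<in> CS 1")
            case True
            show ?thesis unfolding \<Psi>P[OF True] \<Psi>P[OF 3(1)] by (rule d1(2)) (use True 3 yb d1(1) in auto)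
          next
            case False
            hence yC: "y \<in> CS (-1)" by (auto simp: CS_def)
            have "\<Psi> y - \<Psi> z = Q y - Q z" unfolding \<Psi>Q[OF yC] \<Psi>Q[OF 3(2)] by simp
            thus ?thesis using d2(2)[OF yC 3(2) yb(2)] d2(1) by simp
          qed
        qed (use d1 d2 in auto)
      qed (auto intro!: bounded_linear_mult_right)
    qed
  qed
  hence d\<Psi>: "deriv \<Psi> = \<Phi>" and "\<Psi> holomorphic_on UNIV"
    by (auto intro: DERIV_imp_deriv simp: holomorphic_on_def field_differentiable_def)
  thus ?thesis using holomorphic_deriv[of \<Psi> UNIV] by simp
qed


lemma continuous_on_glue:
  assumes "continuous_on (CS 1) (F 1)" "continuous_on (CS (-1)) (F (-1))" "\<And>s. F 1 (Z s) = F (-1) (Z s)"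
  shows "continuous_on UNIV (\<lambda>z. if z \<in> CS 1 then F 1 z else F (- 1 :: real) z :: complex)"
proof -
  have "continuous_on (CS 1 \<union> CS (-1)) (\<lambda>z. if z \<in> CS 1 then F 1 z else F (-1) z)"
  proof (rule continuous_on_cases[OF closed_CS closed_CS assms(1,2)], safe)
    fix z assume "z \<in> CS 1" "z \<in> CS (-1)"
    hence "z = Z (Re z)" by (auto simp: CS_def complex_eq_iff)
    thus "F 1 z = F (-1) z" using assms(3) by metis
  qed
  moreover have "CS 1 \<union> CS (-1) = UNIV" by (auto simp: CS_def)
  ultimately show ?thesis by simp
qed

lemma holomorphic_on_glue:
  assumes "continuous_on (CS 1) (F 1)" "continuous_on (CS (-1)) (F (-1))" "\<And>s. F 1 (Z s) = F (-1) (Z s)"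
    and hol: "F 1 holomorphic_on Side 1" "F (-1) holomorphic_on Side (-1)"
  shows "(\<lambda>z. if z \<in> CS 1 then F 1 z else F (- 1 :: real) z :: complex) holomorphic_on UNIV"
proof (rule holomorphic_across_graph[OF continuous_on_glue[OF assms(1-3)]])
  fix \<sigma> :: real assume "\<sigma> = 1 \<or> \<sigma> = - 1"
  thus "(\<lambda>z. if z \<in> CS 1 then F 1 z else F (-1) z) holomorphic_on Side \<sigma>"
  proof
    assume "\<sigma> = 1"
    thus ?thesis using hol(1) by (auto elim!: holomorphic_transform simp: Side_def CS_def)
  next
    assume "\<sigma> = -1"
    thus ?thesis using hol(2) by (auto elim!: holomorphic_transform simp: Side_def CS_def)
  qed
qed

text \<open>Liouville's theorem for linear growth leaves U = p + q z. Decay along each ray then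
  forces q e = k cnj e for every direction e.\<close>

lemma linear_growth_entire:
  assumes hol: "U holomorphic_on UNIV" and lim: "((\<lambda>z. U z - k * cnj z) \<longlongrightarrow> 0) at_infinity"
  shows "k = 0 \<and> (\<forall>z. U z = 0)"
proof -
  obtain b where b: "\<And>z. norm z \<ge> b \<Longrightarrow> norm (U z - k * cnj z) < 1"
    using lim[unfolded Lim_at_infinity, rule_format, of 1] by (auto simp: dist_norm)
  have liou: "U \<xi> = (\<Sum>j\<le>1. (deriv ^^ j) U 0 / fact j * \<xi> ^ j)" for \<xi>
  proof (rule Liouville_polynomial[OF hol, of "max b 1" "norm k + 1"])
    fix z :: complex assume z: "max b 1 \<le> norm z"
    have "norm (U z) \<le> norm (U z - k * cnj z) + norm (k * cnj z)"
      using norm_triangle_ineq[of "U z - k * cnj z" "k * cnj z"] by simp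
    also have "\<dots> \<le> norm z + norm k * norm z" using b[of z] z by (simp add: norm_mult)
    finally show "norm (U z) \<le> (norm k + 1) * norm z ^ 1" by (simp add: algebra_simps)
  qed
  define p q where "p = U 0" "q = deriv U 0"
  have pq: "U z = p + q * z" for z using liou[of z] by (simp add: p_q_def(1) p_q_def(2))
  \<comment> \<open>Along the multiples n e the function equals p + n w; successive differences give
    w = 0, and then p = 0. The directions 1 and \<i> finally give q = k and q = - k.\<close>
  have line: "p = 0 \<and> q * e - k * cnj e = 0" if e: "e \<noteq> 0" for e
  proof -
    define w where "w = q * e - k * cnj e"
    have "filterlim (\<lambda>n. of_real (real n) * e) at_infinity sequentially"
      unfolding filterlim_at_infinity_conv_norm_at_top norm_mult norm_of_real
      using filterlim_tendsto_pos_mult_at_top[OF tendsto_const[of "norm e"] _ filterlim_real_sequentially] e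
      by (simp add: mult.commute)
    from filterlim_compose[OF lim this]
    have "(\<lambda>n. p + of_real (real n) * w) \<longlonglongrightarrow> 0" by (simp add: pq w_def algebra_simps)
    note l0 = this
    from tendsto_diff[OF LIMSEQ_Suc[OF l0] l0] have "(\<lambda>n. w) \<longlonglongrightarrow> 0" by (simp add: algebra_simps)
    hence w: "w = 0" by (simp add: LIMSEQ_const_iff)
    with l0 have "p = 0" by (simp add: LIMSEQ_const_iff)
    with w show ?thesis by (simp add: w_def)
  qed
  from line[of 1] line[of \<i>] have "p = 0" "q = k" "(q + k) * \<i> = 0" by (auto simp: algebra_simps)
  hence "k = 0" "q = 0" "p = 0" by auto
  thus ?thesis using pq by simp
qed

text \<open>\<open>V\<close>, \<open>a\<close>, \<open>b\<close>, \<open>Q\<close> are indexed by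
  the side and continuous up to the graph. The traction condition carries the direction \<i>
  \<open>Z'\<close> of the normal without its positive length, which is harmless because the
  condition is homogeneous.\<close>

lemma homogeneous_uniqueness:
  fixes V a b :: "real \<Rightarrow> complex \<Rightarrow> complex" and Q :: "real \<Rightarrow> complex \<Rightarrow> real"
  assumes \<mu>: "\<mu> > 0"
    and cont: "\<And>\<sigma>. \<sigma> = 1 \<or> \<sigma> = - 1 \<Longrightarrow> continuous_on (CS \<sigma>) (V \<sigma>) \<and> continuous_on (CS \<sigma>) (a \<sigma>) \<and>
       continuous_on (CS \<sigma>) (b \<sigma>) \<and> continuous_on (CS \<sigma>) (Q \<sigma>)"
    and der: "\<And>\<sigma> z. \<sigma> = 1 \<or> \<sigma> = - 1 \<Longrightarrow> z \<in> Side \<sigma> \<Longrightarrow> (V \<sigma> has_derivative (\<lambda>h. a \<sigma> z * h + b \<sigma> z * cnj h)) (at z)"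
    and Re_a: "\<And>\<sigma> z. \<sigma> = 1 \<or> \<sigma> = - 1 \<Longrightarrow> z \<in> Side \<sigma> \<Longrightarrow> Re (a \<sigma> z) = 0"
    and hol: "\<And>\<sigma>. \<sigma> = 1 \<or> \<sigma> = - 1 \<Longrightarrow> (\<lambda>z. of_real (Q \<sigma> z) - 2 * of_real \<mu> * a \<sigma> z) holomorphic_on Side \<sigma>"
    and V_jump: "\<And>s. V 1 (Z s) = V (-1) (Z s)"
    and T_jump: "\<And>s. - of_real (Q 1 (Z s) - Q (-1) (Z s)) * (\<i> * Z' s) +
       2 * of_real \<mu> * (b 1 (Z s) - b (-1) (Z s)) * cnj (\<i> * Z' s) = 0"
    and V_decay: "\<And>\<sigma>. \<sigma> = 1 \<or> \<sigma> = - 1 \<Longrightarrow> (V \<sigma> \<longlongrightarrow> 0) (inf at_infinity (principal (CS \<sigma>)))"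
    and Q_decay: "\<And>\<sigma>. \<sigma> = 1 \<or> \<sigma> = - 1 \<Longrightarrow> (Q \<sigma> \<longlongrightarrow> 0) (inf at_infinity (principal (CS \<sigma>)))"
    and \<sigma>: "\<sigma> = 1 \<or> \<sigma> = - 1" and z: "z \<in> CS \<sigma>"
  shows "V \<sigma> z = 0 \<and> Q \<sigma> z = 0"
proof -
  have Re_a': "Re (a \<sigma> z) = 0" if \<sigma>: "\<sigma> = 1 \<or> \<sigma> = - 1" and z: "z \<in> CS \<sigma>" for \<sigma> z
  proof -
    have "continuous_on (closure (Side \<sigma>)) (\<lambda>z. Re (a \<sigma> z))"
      unfolding closure_Side[OF \<sigma>] using cont[OF \<sigma>] by (intro continuous_intros) auto
    from continuous_constant_on_closure[OF this] Re_a[OF \<sigma>] z show ?thesis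
      unfolding closure_Side[OF \<sigma>] by blast
  qed
  \<comment> \<open>The tangential derivative of the continuity of the velocity. The values on the
    graph are reached by the one-sided expansions, since V is differentiable only inside.\<close>
  have tang: "(a 1 (Z s) - a (-1) (Z s)) * Z' s + (b 1 (Z s) - b (-1) (Z s)) * cnj (Z' s) = 0" (is "?l = 0") for s
  proof -
    have app: "\<forall>\<^sub>F t in at s. norm (V \<sigma> (Z t) - V \<sigma> (Z s) - (a \<sigma> (Z s) * (Z t - Z s) + b \<sigma> (Z s) * cnj (Z t - Z s))) \<le> e * norm (Z t - Z s)"
      if \<sigma>: "\<sigma> = 1 \<or> \<sigma> = - 1" and e: "e > 0" for \<sigma> e
    proof -
      have lim: "(\<lambda>n. V \<sigma> (z + of_real (\<sigma> * inverse (real (Suc n))) * \<i>)) \<longlonglongrightarrow> V \<sigma> z" if z: "z \<in> CS \<sigma>" for z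
      proof -
        have "\<forall>n. z + of_real (\<sigma> * inverse (real (Suc n))) * \<i> \<in> CS \<sigma>"
          using CS_push[OF z \<sigma>] Side_subset_CS by (metis inverse_positive_iff_positive of_nat_0_less_iff subsetD zero_less_Suc)
        thus ?thesis using cont[OF \<sigma>]
          by (intro continuous_on_tendsto_compose[OF _ push_tendsto z]) auto
      qed
      have ca: "continuous_on (CS \<sigma>) (a \<sigma>)" "continuous_on (CS \<sigma>) (b \<sigma>)" using cont[OF \<sigma>] by auto
      obtain d where d: "d > 0" "\<And>z1 z2. z1 \<in> CS \<sigma> \<Longrightarrow> z2 \<in> CS \<sigma> \<Longrightarrow> z1 \<in> ball (Z s) d \<Longrightarrow> z2 \<in> ball (Z s) d \<Longrightarrow>
        norm (V \<sigma> z1 - V \<sigma> z2 - (a \<sigma> (Z s) * (z1 - z2) + b \<sigma> (Z s) * cnj (z1 - z2))) \<le> e * norm (z1 - z2)"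
        using linear_approximation_closure[OF \<sigma> der[OF \<sigma>] ca lim Z_in_CS e] by blast
      have "isCont Z s" using Z_deriv has_vector_derivative_continuous by blast
      hence "\<forall>\<^sub>F t in at s. dist (Z t) (Z s) < d" using d(1) unfolding isCont_def by (rule tendstoD)
      thus ?thesis by eventually_elim (use d Z_in_CS in \<open>auto simp: dist_commute\<close>)
    qed
    have quot: "((\<lambda>t. (Z t - Z s) / of_real (t - s)) \<longlongrightarrow> Z' s) (at s)"
    proof -
      have "((\<lambda>t. (f t - f s) / (t - s)) \<longlongrightarrow> f1 s) (at s)"
        using f_deriv[of s] by (simp add: has_field_derivative_iff)
      hence "((\<lambda>t. Complex 1 ((f t - f s) / (t - s))) \<longlongrightarrow> Complex 1 (f1 s)) (at s)"
        by (intro tendsto_Complex tendsto_const)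
      thus ?thesis unfolding Z'_def
      proof (rule Lim_transform_eventually)
        have "Complex 1 ((f t - f s) / (t - s)) = (Z t - Z s) / of_real (t - s)" if "t \<noteq> s" for t
          using that by (simp add: complex_eq_iff)
        thus "\<forall>\<^sub>F t in at s. Complex 1 ((f t - f s) / (t - s)) = (Z t - Z s) / of_real (t - s)"
          by (auto simp: eventually_at_filter)
      qed
    qed
    have "((\<lambda>t. (a 1 (Z s) - a (-1) (Z s)) * ((Z t - Z s) / of_real (t - s)) + (b 1 (Z s) - b (-1) (Z s)) * cnj ((Z t - Z s) / of_real (t - s))) \<longlongrightarrow> ?l) (at s)"
      by (intro tendsto_intros quot)
    moreover have "((\<lambda>t. (a 1 (Z s) - a (-1) (Z s)) * ((Z t - Z s) / of_real (t - s)) + (b 1 (Z s) - b (-1) (Z s)) * cnj ((Z t - Z s) / of_real (t - s))) \<longlongrightarrow> 0) (at s)"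
      unfolding tendsto_iff
    proof (intro allI impI)
      fix e :: real assume e: "e > 0"
      define c where "c = 1 + M"
      \<comment> \<open>Each side contributes e' (1 + M) |t - s|; the 4 leaves room for a strict
        inequality.\<close>
      define e' where "e' = e / (4 * c)"
      have c: "c > 0" using M_nonneg by (simp add: c_def)
      hence "2 * e' * c = e / 2" by (simp add: e'_def)
      hence e': "e' > 0" "2 * e' * (1 + M) < e" using e c by (simp_all add: e'_def flip: c_def)
      have ne: "\<forall>\<^sub>F t in at s. t \<noteq> s" by (simp add: eventually_at_filter)
      show "\<forall>\<^sub>F t in at s. dist ((a 1 (Z s) - a (-1) (Z s)) * ((Z t - Z s) / of_real (t - s)) + (b 1 (Z s) - b (-1) (Z s)) * cnj ((Z t - Z s) / of_real (t - s))) 0 < e"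
        using app[OF disjI1[OF refl] e'(1)] app[OF disjI2[OF refl] e'(1)] ne
      proof eventually_elim
        case (elim t)
        let ?x = "V 1 (Z t) - V 1 (Z s) - (a 1 (Z s) * (Z t - Z s) + b 1 (Z s) * cnj (Z t - Z s))"
        let ?y = "V (-1) (Z t) - V (-1) (Z s) - (a (-1) (Z s) * (Z t - Z s) + b (-1) (Z s) * cnj (Z t - Z s))"
        let ?w = "(a 1 (Z s) - a (-1) (Z s)) * (Z t - Z s) + (b 1 (Z s) - b (-1) (Z s)) * cnj (Z t - Z s)"
        have "?w = ?y - ?x" by (simp add: V_jump algebra_simps)
        hence "norm ?w \<le> 2 * e' * norm (Z t - Z s)"
          using norm_triangle_ineq4[of ?y ?x] elim(1,2) by simp
        also have "norm (Z t - Z s) \<le> (1 + M) * \<bar>t - s\<bar>"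
          using cmod_le[of "Z t - Z s"] f_lipschitz[of t s] by (simp add: algebra_simps)
        hence "2 * e' * norm (Z t - Z s) \<le> 2 * e' * ((1 + M) * \<bar>t - s\<bar>)" using e' by (intro mult_left_mono) auto
        also have "\<dots> < e * \<bar>t - s\<bar>" using mult_strict_right_mono[OF e'(2), of "\<bar>t - s\<bar>"] elim(3) by (simp add: mult_ac)
        finally have "norm ?w < e * \<bar>t - s\<bar>" .
        moreover have "(a 1 (Z s) - a (-1) (Z s)) * ((Z t - Z s) / of_real (t - s)) + (b 1 (Z s) - b (-1) (Z s)) * cnj ((Z t - Z s) / of_real (t - s)) = ?w / of_real (t - s)"
          by (simp add: add_divide_distrib)
        ultimately show ?case using elim(3) by (simp only: dist_0_norm dist_norm diff_0_right norm_divide norm_of_real) (simp add: divide_less_eq)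
      qed
    qed
    ultimately show ?thesis by (rule tendsto_unique[OF trivial_limit_at])
  qed
  \<comment> \<open>Eliminating the jump of b from the tangential and the traction condition gives
    (jq - 2 \<mu> ja) \<open>Z'\<close> = 0. The jump of Q is real and that of a imaginary, so both
    vanish.\<close>
  have aQ: "a 1 (Z s) = a (-1) (Z s) \<and> Q 1 (Z s) = Q (-1) (Z s)" for s
  proof -
    define ja jb jq where j: "ja = a 1 (Z s) - a (-1) (Z s)" "jb = b 1 (Z s) - b (-1) (Z s)" "jq = Q 1 (Z s) - Q (-1) (Z s)"
    have 1: "ja * Z' s + jb * cnj (Z' s) = 0" using tang[of s] by (simp add: j)
    have 2: "- of_real jq * (\<i> * Z' s) + 2 * of_real \<mu> * jb * cnj (\<i> * Z' s) = 0" using T_jump[of s] by (simp add: j)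
    have "\<i> * (of_real jq * Z' s + 2 * of_real \<mu> * (jb * cnj (Z' s))) =
        - (- of_real jq * (\<i> * Z' s) + 2 * of_real \<mu> * jb * cnj (\<i> * Z' s))" by (simp add: algebra_simps)
    hence "of_real jq * Z' s + 2 * of_real \<mu> * (jb * cnj (Z' s)) = 0" unfolding 2 by simp
    moreover have "jb * cnj (Z' s) = - (ja * Z' s)" using 1 by (simp add: eq_neg_iff_add_eq_0 add.commute)
    ultimately have "(of_real jq - 2 * of_real \<mu> * ja) * Z' s = 0" by (simp add: algebra_simps)
    hence 3: "of_real jq = 2 * of_real \<mu> * ja" by simp
    have "Re ja = 0" using Re_a'[OF _ Z_in_CS, of 1 s] Re_a'[OF _ Z_in_CS, of "-1" s] by (simp add: j)
    with arg_cong[OF 3, of Re] have "jq = 0" by simp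
    with 3 \<mu> have "ja = 0" by simp
    with \<open>jq = 0\<close> show ?thesis by (simp add: j)
  qed
  have gl_decay: "((\<lambda>z. if z \<in> CS 1 then F 1 z else F (-1) z) \<longlongrightarrow> 0) at_infinity"
    if "\<And>\<sigma>. \<sigma> = 1 \<or> \<sigma> = - 1 \<Longrightarrow> (F \<sigma> \<longlongrightarrow> 0) (inf at_infinity (principal (CS \<sigma>)))"
    for F :: "real \<Rightarrow> complex \<Rightarrow> 'x::real_normed_vector"
    unfolding tendsto_iff
  proof (intro allI impI)
    fix e :: real assume e: "e > 0"
    have E: "\<forall>\<^sub>F z in at_infinity. z \<in> CS \<sigma> \<longrightarrow> dist (F \<sigma> z) 0 < e" if "\<sigma> = 1 \<or> \<sigma> = - 1" for \<sigma>
      using tendstoD[OF \<open>\<And>\<sigma>. \<sigma> = 1 \<or> \<sigma> = - 1 \<Longrightarrow> (F \<sigma> \<longlongrightarrow> 0) (inf at_infinity (principal (CS \<sigma>)))\<close>[OF that] e]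
      by (simp add: eventually_inf_principal)
    show "\<forall>\<^sub>F z in at_infinity. dist (if z \<in> CS 1 then F 1 z else F (-1) z) 0 < e"
      using eventually_conj[OF E[OF disjI1[OF refl]] E[OF disjI2[OF refl]]]
      by (rule eventually_mono) (auto simp: CS_def)
  qed
  define \<Phi> where "\<Phi> \<sigma> z = of_real (Q \<sigma> z) - 2 * of_real \<mu> * a \<sigma> z" for \<sigma> z
  define G where "G z = (if z \<in> CS 1 then \<Phi> 1 z else \<Phi> (-1) z)" for z
  define q where "q z = (if z \<in> CS 1 then Q 1 z else Q (-1) z)" for z
  have c\<Phi>: "continuous_on (CS \<sigma>) (\<Phi> \<sigma>)" if "\<sigma> = 1 \<or> \<sigma> = - 1" for \<sigma>
    unfolding \<Phi>_def using cont[OF that] by (intro continuous_intros) auto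
  have G: "G holomorphic_on UNIV" unfolding G_def
    by (rule holomorphic_on_glue) (use c\<Phi> hol aQ in \<open>auto simp: \<Phi>_def\<close>)
  have ReG: "Re (G z) = q z" for z
    using Re_a'[of 1 z] Re_a'[of "-1" z] UNIV_CS[of z] Side_subset_CS[of "-1"] by (auto simp: G_def q_def \<Phi>_def)
  have q0: "(q \<longlongrightarrow> 0) at_infinity" unfolding q_def[abs_def] by (rule gl_decay[OF Q_decay])
  \<comment> \<open>Only the real part of G is under control. It is bounded, so exp G is a bounded
    entire function, hence constant, and G has derivative zero.\<close>
  have "\<exists>c. \<forall>z. exp (G z) = c"
  proof -
    obtain r where r: "\<And>z. norm z \<ge> r \<Longrightarrow> \<bar>q z\<bar> < 1"
      using q0[unfolded Lim_at_infinity, rule_format, of 1] by auto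
    have "compact ((\<lambda>z. exp (G z)) ` cball 0 r)"
      by (intro compact_continuous_image compact_cball continuous_intros holomorphic_on_imp_continuous_on holomorphic_on_subset[OF G]) auto
    hence "bounded ((\<lambda>z. exp (G z)) ` cball 0 r)" by (rule compact_imp_bounded)
    then obtain B where B: "\<forall>z\<in>cball 0 r. norm (exp (G z)) \<le> B" unfolding bounded_iff by auto
    have "norm (exp (G z)) \<le> max B (exp 1)" for z
      using bspec[OF B, of z] r[of z] by (cases "norm z \<le> r") (auto simp: ReG le_max_iff_disj)
    hence "bounded (range (\<lambda>z. exp (G z)))" unfolding bounded_iff by blast
    moreover have "(\<lambda>z. exp (G z)) holomorphic_on UNIV" using G by (intro holomorphic_intros)
    ultimately have "(\<lambda>z. exp (G z)) constant_on UNIV" using Liouville_theorem by blast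
    thus ?thesis by (auto simp: constant_on_def)
  qed
  then obtain c where c: "\<And>z. exp (G z) = c" by blast
  have "(G has_field_derivative 0) (at z)" for z
  proof -
    have dG: "(G has_field_derivative deriv G z) (at z)" using holomorphic_derivI[OF G] by simp
    have "((\<lambda>z. exp (G z)) has_field_derivative exp (G z) * deriv G z) (at z)" using DERIV_chain2[OF DERIV_exp dG] .
    moreover have "((\<lambda>z. exp (G z)) has_field_derivative 0) (at z)" using c by simp
    ultimately have "exp (G z) * deriv G z = 0" by (rule DERIV_unique)
    with dG show ?thesis by simp
  qed
  hence "\<exists>m. \<forall>z\<in>UNIV. G z = m" by (intro has_field_derivative_zero_constant) auto
  then obtain m where m: "\<And>z. G z = m" by blast
  have "q = (\<lambda>_. Re m)" using ReG m by (intro ext) (metis)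
  with q0 have "((\<lambda>_::complex. Re m) \<longlongrightarrow> 0) at_infinity" by simp
  hence "Re m = 0" by (rule tendsto_unique[OF trivial_limit_at_infinity tendsto_const])
  have Qz: "Q \<sigma> z = 0" and az: "a \<sigma> z = - m / (2 * of_real \<mu>)" if \<sigma>: "\<sigma> = 1 \<or> \<sigma> = - 1" and z: "z \<in> CS \<sigma>" for \<sigma> z
  proof -
    have "\<Phi> \<sigma> z = m"
    proof (cases "\<sigma> = 1")
      case False
      hence s: "\<sigma> = -1" using \<sigma> by simp
      show ?thesis
      proof (cases "z \<in> CS 1")
        case True
        hence "z = Z (Re z)" using z s by (auto simp: CS_def complex_eq_iff)
        hence "\<Phi> (-1) z = \<Phi> 1 z" using aQ[of "Re z"] by (simp add: \<Phi>_def)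
        thus ?thesis using m[of z] True s by (simp add: G_def)
      qed (use m[of z] s in \<open>simp add: G_def\<close>)
    qed (use m[of z] z in \<open>simp add: G_def\<close>)
    moreover have "Re (\<Phi> \<sigma> z) = Q \<sigma> z" using Re_a'[OF \<sigma> z] by (simp add: \<Phi>_def)
    ultimately show Q: "Q \<sigma> z = 0" using \<open>Re m = 0\<close> by simp
    with \<open>\<Phi> \<sigma> z = m\<close> \<mu> show "a \<sigma> z = - m / (2 * of_real \<mu>)" by (auto simp: \<Phi>_def field_simps)
  qed
  \<comment> \<open>The constant value of the z-derivative of V. Subtracting k z leaves an
    antiholomorphic function, whose conjugate can be glued across the graph.\<close>
  define k where "k = - m / (2 * of_real \<mu>)"
  define U where "U \<sigma> z = cnj (V \<sigma> z - k * z)" for \<sigma> z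
  have cU: "continuous_on (CS \<sigma>) (U \<sigma>)" if "\<sigma> = 1 \<or> \<sigma> = - 1" for \<sigma>
    unfolding U_def using cont[OF that] by (intro continuous_intros) auto
  have hU: "U \<sigma> holomorphic_on Side \<sigma>" if \<sigma>: "\<sigma> = 1 \<or> \<sigma> = - 1" for \<sigma>
    unfolding holomorphic_on_def
  proof
    fix z assume z: "z \<in> Side \<sigma>"
    have "a \<sigma> z = k" using az[OF \<sigma>, of z] z Side_subset_CS by (auto simp: k_def)
    hence "((\<lambda>z. V \<sigma> z - k * z) has_derivative (\<lambda>h. b \<sigma> z * cnj h)) (at z)"
      using has_derivative_diff[OF der[OF \<sigma> z] has_derivative_mult_right[OF has_derivative_ident, of k]] by simp
    from has_derivative_cnj[OF this] have "(U \<sigma> has_derivative (\<lambda>h. cnj (b \<sigma> z) * h)) (at z)"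
      by (simp add: U_def[abs_def])
    thus "U \<sigma> field_differentiable at z within Side \<sigma>"
      unfolding field_differentiable_def has_field_derivative_def using has_derivative_at_withinI by blast
  qed
  define W where "W z = (if z \<in> CS 1 then U 1 z else U (-1) z)" for z
  have W: "W holomorphic_on UNIV" unfolding W_def
    by (rule holomorphic_on_glue[OF cU cU _ hU hU]) (auto simp: U_def V_jump)
  have "((\<lambda>z. if z \<in> CS 1 then V 1 z else V (-1) z) \<longlongrightarrow> 0) at_infinity" by (rule gl_decay[OF V_decay])
  from tendsto_cnj[OF this] have "((\<lambda>z. cnj (if z \<in> CS 1 then V 1 z else V (-1) z)) \<longlongrightarrow> 0) at_infinity" by simp
  moreover have "(\<lambda>z. cnj (if z \<in> CS 1 then V 1 z else V (-1) z)) = (\<lambda>z. W z - (- cnj k) * cnj z)"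
    by (auto simp: W_def U_def)
  ultimately have "((\<lambda>z. W z - (- cnj k) * cnj z) \<longlongrightarrow> 0) at_infinity" by (simp only:)
  from linear_growth_entire[OF W this]
  have k0: "k = 0" and W0: "W z = 0" for z by auto
  have "V \<sigma> z = 0"
  proof (cases "z \<in> CS 1")
    case True
    hence "V 1 z = 0" using W0[of z] k0 by (simp add: W_def U_def)
    moreover have "V \<sigma> z = V 1 z"
    proof (cases "\<sigma> = 1")
      case False
      hence "z = Z (Re z)" using z \<sigma> True by (auto simp: CS_def complex_eq_iff)
      thus ?thesis using V_jump[of "Re z"] False \<sigma> by auto
    qed simp
    ultimately show ?thesis by simp
  next
    case False
    hence "\<sigma> = -1" using z \<sigma> by auto
    thus ?thesis using W0[of z] k0 False by (simp add: W_def U_def)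
  qed
  with Qz[OF \<sigma> z] show ?thesis by simp
qed

end

section \<open>Partial derivatives and complex notation\<close>

unbundle no fps_syntax

section \<open>Calculus with axiswise partial derivatives\<close>

lemma partial_eqI: "((\<lambda>t. h (x + t *\<^sub>R axis i 1)) has_real_derivative D) (at 0) \<Longrightarrow> partial i h x = D"
  unfolding partial_def by (rule DERIV_imp_deriv)

lemma partial_has_derivative:
  "(\<lambda>t. h (x + t *\<^sub>R axis i 1)) differentiable (at 0) \<Longrightarrow>
    ((\<lambda>t. h (x + t *\<^sub>R axis i 1)) has_real_derivative partial i h x) (at 0)"
  unfolding partial_def using DERIV_deriv_iff_real_differentiable by blast

lemma eventually_axis_in_open:
  fixes S :: "(real ^ 'n::finite) set"
  assumes "open S" "x \<in> S"
  shows "\<forall>\<^sub>F t in nhds 0. x + t *\<^sub>R axis i 1 \<in> S"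
proof -
  have "((\<lambda>t. x + t *\<^sub>R axis i 1) \<longlongrightarrow> x + 0 *\<^sub>R axis i 1) (nhds (0::real))"
    by (intro tendsto_intros filterlim_ident)
  from topological_tendstoD[OF this assms(1)] assms(2) show ?thesis by simp
qed

lemma partial_cong:
  fixes S :: "(real ^ 'n::finite) set"
  assumes "open S" "x \<in> S" "\<And>y. y \<in> S \<Longrightarrow> h y = h' y"
  shows "partial i h x = partial i h' x"
  unfolding partial_def
  by (intro deriv_cong_ev eventually_mono[OF eventually_axis_in_open[OF assms(1,2), of i]]) (use assms(3) in auto)

lemma axis_derivative_cong:
  fixes S :: "(real ^ 'n::finite) set"
  assumes "open S" "x \<in> S" "\<And>y. y \<in> S \<Longrightarrow> h y = h' y"
    and "((\<lambda>t. h (x + t *\<^sub>R axis i 1)) has_real_derivative D) (at 0)"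
  shows "((\<lambda>t. h' (x + t *\<^sub>R axis i 1)) has_real_derivative D) (at 0)"
proof -
  have "\<forall>\<^sub>F t in nhds 0. h (x + t *\<^sub>R axis i 1) = h' (x + t *\<^sub>R axis i 1)"
    by (rule eventually_mono[OF eventually_axis_in_open[OF assms(1,2), of i]]) (use assms(3) in auto)
  from DERIV_cong_ev[OF refl this refl] assms(4) show ?thesis by blast
qed

lemma C_k_SucI:
  assumes "continuous_on S h" "\<And>i x. x \<in> S \<Longrightarrow> ((\<lambda>t. h (x + t *\<^sub>R axis i 1)) has_real_derivative D i x) (at 0)"
    and "\<And>i. C_k k S (partial i h)"
  shows "C_k (Suc k) S h"
  using assms real_differentiable_def by (auto simp del: One_nat_def)

lemma C_k_imp_continuous: "C_k k S h \<Longrightarrow> continuous_on S h"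
  by (cases k) auto

lemma C_k_derivative:
  "C_k (Suc k) S h \<Longrightarrow> x \<in> S \<Longrightarrow> ((\<lambda>t. h (x + t *\<^sub>R axis i 1)) has_real_derivative partial i h x) (at 0)"
  by (intro partial_has_derivative) auto

lemma C_k_partial: "C_k (Suc k) S h \<Longrightarrow> C_k k S (partial i h)"
  by simp

lemma C_k_cong:
  fixes S :: "(real ^ 'n::finite) set"
  assumes "open S" "\<And>x. x \<in> S \<Longrightarrow> h x = h' x" "C_k k S h"
  shows "C_k k S h'"
  using assms(2,3)
proof (induction k arbitrary: h h')
  case 0
  thus ?case by (auto cong: continuous_on_cong)
next
  case (Suc k)
  show ?case
  proof (rule C_k_SucI)
    show "continuous_on S h'" using C_k_imp_continuous[OF Suc.prems(2)] Suc.prems(1) by (auto cong: continuous_on_cong)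
    show "((\<lambda>t. h' (x + t *\<^sub>R axis i 1)) has_real_derivative partial i h x) (at 0)" if "x \<in> S" for i x
      using axis_derivative_cong[OF assms(1) that Suc.prems(1) C_k_derivative[OF Suc.prems(2) that]] .
    show "C_k k S (partial i h')" for i
      by (rule Suc.IH[OF partial_cong[OF assms(1) _ Suc.prems(1)] C_k_partial[OF Suc.prems(2)]])
  qed
qed

lemma C_k_Suc_imp: "C_k (Suc k) S h \<Longrightarrow> C_k k S h"
  by (induction k arbitrary: h) auto

lemma C_k_add:
  fixes S :: "(real ^ 'n::finite) set"
  assumes "open S" "C_k k S h" "C_k k S h'"
  shows "C_k k S (\<lambda>x. h x + h' x)"
  using assms(2,3)
proof (induction k arbitrary: h h')
  case 0
  thus ?case by (auto intro: continuous_intros)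
next
  case (Suc k)
  have d: "((\<lambda>t. h (x + t *\<^sub>R axis i 1) + h' (x + t *\<^sub>R axis i 1)) has_real_derivative partial i h x + partial i h' x) (at 0)" if "x \<in> S" for i x
    using that Suc.prems by (intro DERIV_add C_k_derivative)
  show ?case
  proof (rule C_k_SucI[OF _ d])
    show "continuous_on S (\<lambda>x. h x + h' x)" using Suc.prems by (intro continuous_on_add C_k_imp_continuous)
    show "C_k k S (partial i (\<lambda>x. h x + h' x))" for i
      by (rule C_k_cong[OF assms(1) _ Suc.IH[OF C_k_partial[OF Suc.prems(1)] C_k_partial[OF Suc.prems(2)]]])
         (rule partial_eqI[symmetric], rule d)
  qed
qed

lemma C_k_mult:
  fixes S :: "(real ^ 'n::finite) set"
  assumes "open S" "C_k k S h" "C_k k S h'"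
  shows "C_k k S (\<lambda>x. h x * h' x)"
  using assms(2,3)
proof (induction k arbitrary: h h')
  case 0
  thus ?case by (auto intro: continuous_intros)
next
  case (Suc k)
  have d: "((\<lambda>t. h (x + t *\<^sub>R axis i 1) * h' (x + t *\<^sub>R axis i 1)) has_real_derivative partial i h x * h' x + partial i h' x * h x) (at 0)" if "x \<in> S" for i x
    using DERIV_mult[OF C_k_derivative[OF Suc.prems(1) that] C_k_derivative[OF Suc.prems(2) that]] by simp
  show ?case
  proof (rule C_k_SucI[OF _ d])
    show "continuous_on S (\<lambda>x. h x * h' x)" using Suc.prems by (intro continuous_on_mult C_k_imp_continuous)
    show "C_k k S (partial i (\<lambda>x. h x * h' x))" for i
      by (rule C_k_cong[OF assms(1) _ C_k_add[OF assms(1)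
            Suc.IH[OF C_k_partial[OF Suc.prems(1)] C_k_Suc_imp[OF Suc.prems(2)]]
            Suc.IH[OF C_k_partial[OF Suc.prems(2)] C_k_Suc_imp[OF Suc.prems(1)]]]])
         (rule partial_eqI[symmetric], rule d)
  qed
qed

lemma C_k_const: "C_k k S (\<lambda>_. c)"
proof (induction k arbitrary: c)
  case (Suc k)
  have "partial i (\<lambda>_. c) = (\<lambda>_. 0)" for i :: 'a by (rule ext, rule partial_eqI) simp
  with Suc show ?case by simp
qed simp

lemma C_k_nth: "C_k k S (\<lambda>x. x $ j)"
proof (cases k)
  case (Suc m)
  have d: "((\<lambda>t. (x + t *\<^sub>R axis i 1) $ j) has_real_derivative axis i 1 $ j) (at 0)" for x :: "real ^ 'a" and i
    by (auto intro!: derivative_eq_intros)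
  have p: "partial i (\<lambda>x. x $ j) = (\<lambda>_. axis i 1 $ j)" for i by (rule ext, rule partial_eqI, rule d)
  show ?thesis unfolding Suc
    by (rule C_k_SucI[OF _ d]) (auto simp: p intro!: continuous_intros C_k_const)
qed (auto intro!: continuous_intros)

lemma C_k_diff:
  fixes S :: "(real ^ 'n::finite) set"
  assumes "open S" "C_k k S h" "C_k k S h'"
  shows "C_k k S (\<lambda>x. h x - h' x)"
  using C_k_add[OF assms(1,2) C_k_mult[OF assms(1) C_k_const[of k S "-1"] assms(3)]] by simp

text \<open>\<open>C_k\<close> provides iterated partial derivatives along the axes only. The second
  difference over the square of side t, evaluated by the mean value theorem in both orders, equates
  them as t tends to 0.\<close>

lemma mixed_partials_eq:
  fixes h h1 h2 h12 h21 :: "real \<Rightarrow> real \<Rightarrow> real"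
  assumes r: "r > 0"
    and h1: "\<And>s t. \<bar>s\<bar> < r \<Longrightarrow> \<bar>t\<bar> < r \<Longrightarrow> ((\<lambda>s. h s t) has_real_derivative h1 s t) (at s)"
    and h2: "\<And>s t. \<bar>s\<bar> < r \<Longrightarrow> \<bar>t\<bar> < r \<Longrightarrow> ((\<lambda>t. h s t) has_real_derivative h2 s t) (at t)"
    and h12: "\<And>s t. \<bar>s\<bar> < r \<Longrightarrow> \<bar>t\<bar> < r \<Longrightarrow> ((\<lambda>t. h1 s t) has_real_derivative h12 s t) (at t)"
    and h21: "\<And>s t. \<bar>s\<bar> < r \<Longrightarrow> \<bar>t\<bar> < r \<Longrightarrow> ((\<lambda>s. h2 s t) has_real_derivative h21 s t) (at s)"
    and c12: "isCont (\<lambda>p. h12 (fst p) (snd p)) (0, 0)" and c21: "isCont (\<lambda>p. h21 (fst p) (snd p)) (0, 0)"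
  shows "h12 0 0 = h21 0 0"
proof -
  have a: "\<exists>s' t'. 0 < s' \<and> s' < t \<and> 0 < t' \<and> t' < t \<and> h t t - h t 0 - (h 0 t - h 0 0) = t * (t * h12 s' t')"
    if t: "0 < t" "t < r" for t
  proof -
    have "\<exists>s'. 0 < s' \<and> s' < t \<and> (h t t - h t 0) - (h 0 t - h 0 0) = (t - 0) * (h1 s' t - h1 s' 0)"
      using t by (intro MVT2) (auto intro!: DERIV_diff h1)
    then obtain s' where s': "0 < s'" "s' < t" "h t t - h t 0 - (h 0 t - h 0 0) = t * (h1 s' t - h1 s' 0)" by auto
    have "\<exists>t'. 0 < t' \<and> t' < t \<and> h1 s' t - h1 s' 0 = (t - 0) * h12 s' t'"
      using t s' by (intro MVT2) (auto intro!: h12)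
    thus ?thesis using s' by auto
  qed
  have b: "\<exists>s' t'. 0 < s' \<and> s' < t \<and> 0 < t' \<and> t' < t \<and> h t t - h 0 t - (h t 0 - h 0 0) = t * (t * h21 s' t')"
    if t: "0 < t" "t < r" for t
  proof -
    have "\<exists>t'. 0 < t' \<and> t' < t \<and> (h t t - h 0 t) - (h t 0 - h 0 0) = (t - 0) * (h2 t t' - h2 0 t')"
      using t by (intro MVT2) (auto intro!: DERIV_diff h2)
    then obtain t' where t': "0 < t'" "t' < t" "h t t - h 0 t - (h t 0 - h 0 0) = t * (h2 t t' - h2 0 t')" by auto
    have "\<exists>s'. 0 < s' \<and> s' < t \<and> h2 t t' - h2 0 t' = (t - 0) * h21 s' t'"
      using t t' by (intro MVT2) (auto intro!: h21)
    thus ?thesis using t' by auto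
  qed
  show ?thesis
  proof (rule ccontr)
    assume ne: "h12 0 0 \<noteq> h21 0 0"
    define e where "e = \<bar>h12 0 0 - h21 0 0\<bar> / 2"
    have e: "e > 0" using ne by (simp add: e_def)
    obtain d1 where d1: "d1 > 0" "\<And>p. dist p (0, 0) < d1 \<Longrightarrow> \<bar>h12 (fst p) (snd p) - h12 0 0\<bar> < e"
      using c12 e unfolding continuous_at_eps_delta dist_real_def by fastforce
    obtain d2 where d2: "d2 > 0" "\<And>p. dist p (0, 0) < d2 \<Longrightarrow> \<bar>h21 (fst p) (snd p) - h21 0 0\<bar> < e"
      using c21 e unfolding continuous_at_eps_delta dist_real_def by fastforce
    define t where "t = min (r / 2) (min (d1 / 2) (d2 / 2))"
    have t: "0 < t" "t < r" "2 * t \<le> d1" "2 * t \<le> d2" using r d1 d2 by (auto simp: t_def)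
    have near: "dist (s', t') (0, 0) < 2 * t" if "0 < s'" "s' < t" "0 < t'" "t' < t" for s' t' :: real
      using sqrt_sum_squares_le_sum_abs[of s' t'] that by (simp add: dist_norm norm_Pair)
    obtain s1 t1 where 1: "0 < s1" "s1 < t" "0 < t1" "t1 < t" "h t t - h t 0 - (h 0 t - h 0 0) = t * (t * h12 s1 t1)" using a[OF t(1,2)] by blast
    obtain s2 t2 where 2: "0 < s2" "s2 < t" "0 < t2" "t2 < t" "h t t - h 0 t - (h t 0 - h 0 0) = t * (t * h21 s2 t2)" using b[OF t(1,2)] by blast
    have "t * (t * h12 s1 t1) = t * (t * h21 s2 t2)" using 1(5) 2(5) by linarith
    hence "h12 s1 t1 = h21 s2 t2" using t(1) by simp
    moreover have "\<bar>h12 s1 t1 - h12 0 0\<bar> < e" using d1(2)[of "(s1, t1)"] near[OF 1(1-4)] t by simp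
    moreover have "\<bar>h21 s2 t2 - h21 0 0\<bar> < e" using d2(2)[of "(s2, t2)"] near[OF 2(1-4)] t by simp
    moreover have "\<bar>h12 0 0 - h21 0 0\<bar> \<le> \<bar>h12 s1 t1 - h12 0 0\<bar> + \<bar>h12 s1 t1 - h21 0 0\<bar>" by linarith
    moreover have "\<bar>h12 0 0 - h21 0 0\<bar> = 2 * e" by (simp add: e_def)
    ultimately show False by linarith
  qed
qed

section \<open>The plane as the complex numbers\<close>

definition cx :: "real ^ 2 \<Rightarrow> complex" where "cx x = Complex (x $ 1) (x $ 2)"
definition vc :: "complex \<Rightarrow> real ^ 2" where "vc z = vector [Re z, Im z]"
definition dir :: "2 \<Rightarrow> complex" where "dir i = (if i = 1 then 1 else \<i>)"

lemma cx_vc [simp]: "cx (vc z) = z" by (simp add: cx_def vc_def)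
lemma vc_cx [simp]: "vc (cx x) = x" by (simp add: cx_def vc_def vec_eq_iff forall_2)
lemma vc_nth [simp]: "vc z $ 1 = Re z" "vc z $ 2 = Im z" by (simp_all add: vc_def)
lemma Re_cx [simp]: "Re (cx x) = x $ 1" and Im_cx [simp]: "Im (cx x) = x $ 2" by (simp_all add: cx_def)

lemma norm_cx [simp]: "norm (cx x) = norm x"
  by (simp add: cx_def cmod_def norm_vec_def L2_set_def sum_2)

lemma norm_vc [simp]: "norm (vc z) = norm z" using norm_cx[of "vc z"] by simp

lemma bounded_linear_cx: "bounded_linear cx"
  by (rule bounded_linear_intro[where K = 1]) (auto simp: complex_eq_iff)

lemma bounded_linear_vc: "bounded_linear vc"
  by (rule bounded_linear_intro[where K = 1]) (auto simp: vec_eq_iff forall_2)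

lemmas cx_continuous [continuous_intros] = bounded_linear.continuous_on[OF bounded_linear_cx]
lemmas vc_continuous [continuous_intros] = bounded_linear.continuous_on[OF bounded_linear_vc]
lemma cx_diff: "cx (x - y) = cx x - cx y" by (simp add: complex_eq_iff)

lemma cx_axis: "cx (x + t *\<^sub>R axis i 1) = cx x + of_real t * dir i"
  using exhaust_2[of i] by (auto simp: complex_eq_iff dir_def axis_def)

text \<open>\<open>a\<close> and \<open>b\<close> are the Wirtinger derivatives with respect to z
  and cnj z, and \<open>dir i\<close> is the i-th axis as a complex number.\<close>

lemma derivative_along_axis:
  assumes "(F has_derivative (\<lambda>h. a * h + b * cnj h)) (at (cx x))"
  shows "((\<lambda>t. F (cx (x + t *\<^sub>R axis i 1))) has_vector_derivative a * dir i + b * cnj (dir i)) (at 0)"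
proof -
  have "((\<lambda>t. cx x + of_real t * dir i) has_derivative (\<lambda>t. of_real t * dir i)) (at 0)"
    by (auto intro!: derivative_eq_intros)
  moreover have "(F has_derivative (\<lambda>h. a * h + b * cnj h)) (at (cx x + of_real 0 * dir i))"
    using assms by simp
  ultimately have "((\<lambda>t. F (cx x + of_real t * dir i)) has_derivative (\<lambda>t. a * (of_real t * dir i) + b * cnj (of_real t * dir i))) (at 0)"
    by (rule has_derivative_compose)
  thus ?thesis unfolding cx_axis has_vector_derivative_def
    by (rule has_derivative_eq_rhs) (auto simp: scaleR_conv_of_real algebra_simps)
qed

lemma axis_derivative_Re_Im:
  assumes "(F has_derivative (\<lambda>h. a * h + b * cnj h)) (at (cx x))"
  shows "((\<lambda>t. Re (F (cx (x + t *\<^sub>R axis i 1)))) has_real_derivative Re (a * dir i + b * cnj (dir i))) (at 0)"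
    and "((\<lambda>t. Im (F (cx (x + t *\<^sub>R axis i 1)))) has_real_derivative Im (a * dir i + b * cnj (dir i))) (at 0)"
  using derivative_along_axis[OF assms, of i] unfolding has_vector_derivative_complex_iff by auto

lemma has_derivative_of_holomorphic:
  assumes "F holomorphic_on T" "open T" "z \<in> T"
  shows "(F has_derivative (\<lambda>h. deriv F z * h + 0 * cnj h)) (at z)"
  using holomorphic_derivI[OF assms] by (simp add: has_field_derivative_def)

text \<open>The induction replaces F by \<open>deriv F\<close>, whose real and imaginary parts are
  up to sign the partial derivatives.\<close>

lemma C_k_holomorphic:
  assumes "open T" "F holomorphic_on T"
  shows "C_k k (cx -` T) (\<lambda>x. Re (F (cx x))) \<and> C_k k (cx -` T) (\<lambda>x. Im (F (cx x)))"
  using assms(2)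
proof (induction k arbitrary: F)
  have cT: "continuous_on (cx -` T) (\<lambda>x. F (cx x))" if "F holomorphic_on T" for F
    by (rule continuous_on_compose2[OF holomorphic_on_imp_continuous_on[OF that]]) (auto intro!: continuous_intros)
  {
    case 0
    thus ?case using cT[OF 0] by (auto intro!: continuous_intros)
  next
    case (Suc k)
    have oS: "open (cx -` T)" by (rule open_vimage[OF assms(1)]) (intro continuous_intros)
    have IH: "C_k k (cx -` T) (\<lambda>x. Re (deriv F (cx x)))" "C_k k (cx -` T) (\<lambda>x. Im (deriv F (cx x)))"
      using Suc.IH[OF holomorphic_deriv[OF Suc.prems assms(1)]] by auto
    have nI: "C_k k (cx -` T) (\<lambda>x. - Im (deriv F (cx x)))"
      using C_k_diff[OF oS C_k_const[of k _ 0] IH(2)] by simp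
    have d: "((\<lambda>t. Re (F (cx (x + t *\<^sub>R axis i 1)))) has_real_derivative Re (deriv F (cx x) * dir i)) (at 0)"
      "((\<lambda>t. Im (F (cx (x + t *\<^sub>R axis i 1)))) has_real_derivative Im (deriv F (cx x) * dir i)) (at 0)"
      if "x \<in> cx -` T" for x i
      using axis_derivative_Re_Im[OF has_derivative_of_holomorphic[OF Suc.prems assms(1)], of x i] that by auto
    have "C_k k (cx -` T) (\<lambda>x. Re (deriv F (cx x) * dir i))" "C_k k (cx -` T) (\<lambda>x. Im (deriv F (cx x) * dir i))" for i
      using IH nI by (auto simp: dir_def)
    note c = C_k_cong[OF oS partial_eqI[symmetric, OF d(1)] this(1)] C_k_cong[OF oS partial_eqI[symmetric, OF d(2)] this(2)]
    show ?case
      by (intro conjI C_k_SucI[OF _ d(1) c(1)] C_k_SucI[OF _ d(2) c(2)] continuous_Re continuous_Im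
           continuous_on_Re continuous_on_Im cT Suc.prems)
  }
qed

text \<open>Axiswise differentiability with continuous partials gives the total derivative that
  Wirtinger calculus requires. The argument runs on a rectangle, as the theorem on partial
  derivatives is stated for products.\<close>

lemma C1_has_derivative:
  assumes S: "open S" and h: "C_k 1 S h" and x: "x \<in> S"
  shows "((\<lambda>z. h (vc z)) has_derivative (\<lambda>w. partial 1 h x * Re w + partial 2 h x * Im w)) (at (cx x))"
proof -
  have h': "C_k (Suc 0) S h" using h by simp
  have "open (vc -` S)" by (rule open_vimage[OF S]) (intro continuous_intros)
  then obtain r where r: "r > 0" "ball (cx x) r \<subseteq> vc -` S"
    using x by (metis open_contains_ball vimage_eq vc_cx)
  \<comment> \<open>Half sides r/2 keep the rectangle inside the ball, since the norm is at most the
    sum of the coordinates in modulus.\<close>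
  define X where "X = {x $ 1 - r/2 <..< x $ 1 + r/2}"
  define Y where "Y = {x $ 2 - r/2 <..< x $ 2 + r/2}"
  have inS: "vc (Complex s t) \<in> S" if "s \<in> X" "t \<in> Y" for s t
  proof -
    have "norm (cx x - Complex s t) \<le> \<bar>x $ 1 - s\<bar> + \<bar>x $ 2 - t\<bar>" using cmod_le[of "cx x - Complex s t"] by simp
    also have "\<dots> < r" using that by (auto simp: X_def Y_def abs_if)
    finally show ?thesis using r(2) by (auto simp: dist_norm)
  qed
  have shift1: "vc (Complex s t) + u *\<^sub>R axis 1 1 = vc (Complex (s + u) t)"
    and shift2: "vc (Complex s t) + u *\<^sub>R axis 2 1 = vc (Complex s (t + u))" for s t u
    by (auto simp: vec_eq_iff forall_2 axis_def)
  have d1: "((\<lambda>s. h (vc (Complex s t))) has_real_derivative partial 1 h (vc (Complex s t))) (at s)" if "s \<in> X" "t \<in> Y" for s t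
    using C_k_derivative[OF h' inS[OF that], of 1] unfolding shift1 DERIV_shift[of "\<lambda>s. h (vc (Complex s t))" _ 0 s, simplified]
    by (simp add: add.commute)
  have d2: "((\<lambda>t. h (vc (Complex s t))) has_real_derivative partial 2 h (vc (Complex s t))) (at t)" if "s \<in> X" "t \<in> Y" for s t
    using C_k_derivative[OF h' inS[OF that], of 2] unfolding shift2 DERIV_shift[of "\<lambda>t. h (vc (Complex s t))" _ 0 t, simplified]
    by (simp add: add.commute)
  have x0: "x $ 1 \<in> X" "x $ 2 \<in> Y" using r by (auto simp: X_def Y_def)
  have xv: "vc (Complex (x $ 1) (x $ 2)) = x" by (simp add: vec_eq_iff forall_2)
  have c2: "continuous_on S (partial 2 h)" using h by simp
  have "((\<lambda>(s, t). h (vc (Complex s t))) has_derivative (\<lambda>(ts, tt). partial 1 h x * ts + blinfun_mult_right (partial 2 h (vc (Complex (x $ 1) (x $ 2)))) tt))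
     (at (x $ 1, x $ 2) within X \<times> Y)"
  proof (rule has_derivative_partialsI[where fy = "\<lambda>s t. blinfun_mult_right (partial 2 h (vc (Complex s t)))"])
    show "((\<lambda>s. h (vc (Complex s (x $ 2)))) has_derivative (*) (partial 1 h x)) (at (x $ 1) within X)"
      using d1[OF x0] xv by (simp add: has_field_derivative_def has_derivative_at_withinI)
    show "((\<lambda>t. h (vc (Complex s t))) has_derivative blinfun_apply (blinfun_mult_right (partial 2 h (vc (Complex s t))))) (at t within Y)"
      if "s \<in> X" "t \<in> Y" for s t
      using d2[OF that] by (simp add: has_field_derivative_def has_derivative_at_withinI)
    have "continuous_on (X \<times> Y) (\<lambda>p. partial 2 h (vc (Complex (fst p) (snd p))))"
      by (rule continuous_on_compose2[OF c2]) (use inS in \<open>auto simp: Complex_eq intro!: continuous_intros\<close>)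
    hence "continuous_on (X \<times> Y) (\<lambda>p. blinfun_mult_right (partial 2 h (vc (Complex (fst p) (snd p)))))"
      by (intro continuous_intros)
    moreover have "(x $ 1, x $ 2) \<in> X \<times> Y" using x0 by simp
    ultimately have "continuous (at (x $ 1, x $ 2) within X \<times> Y) (\<lambda>p. blinfun_mult_right (partial 2 h (vc (Complex (fst p) (snd p)))))"
      unfolding continuous_on_eq_continuous_within by (rule bspec)
    thus "continuous (at (x $ 1, x $ 2) within X \<times> Y) (\<lambda>(s, t). blinfun_mult_right (partial 2 h (vc (Complex s t))))"
      by (simp only: case_prod_unfold)
  qed (use x0 in \<open>auto simp: Y_def\<close>)
  moreover have "at (x $ 1, x $ 2) within X \<times> Y = at (x $ 1, x $ 2)"
    using x0 by (intro at_within_open open_Times) (auto simp: X_def Y_def)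
  ultimately have *: "((\<lambda>(s, t). h (vc (Complex s t))) has_derivative (\<lambda>(ts, tt). partial 1 h x * ts + partial 2 h x * tt)) (at (x $ 1, x $ 2))"
    by (simp add: xv)
  have "((\<lambda>z. (Re z, Im z)) has_derivative (\<lambda>w. (Re w, Im w))) (at (cx x))"
    by (intro has_derivative_Pair bounded_linear_imp_has_derivative bounded_linear_Re bounded_linear_Im)
  moreover have "((\<lambda>(s, t). h (vc (Complex s t))) has_derivative (\<lambda>(ts, tt). partial 1 h x * ts + partial 2 h x * tt)) (at (Re (cx x), Im (cx x)))"
    using * by simp
  ultimately have "((\<lambda>z. case (Re z, Im z) of (s, t) \<Rightarrow> h (vc (Complex s t))) has_derivative
     (\<lambda>w. case (Re w, Im w) of (ts, tt) \<Rightarrow> partial 1 h x * ts + partial 2 h x * tt)) (at (cx x))"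
    by (rule has_derivative_compose)
  thus ?thesis by (simp add: complex_surj)
qed

lemma C2_mixed_partials:
  assumes S: "open S" and h: "C_k 2 S h" and x: "x \<in> S"
  shows "partial 1 (partial 2 h) x = partial 2 (partial 1 h) x"
proof -
  have h0: "C_k (Suc (Suc 0)) S h" using h by (simp add: numeral_2_eq_2)
  have hp: "C_k (Suc 0) S (partial i h)" for i using h0 by (rule C_k_partial)
  let ?p = "\<lambda>s t. x + s *\<^sub>R axis 1 1 + t *\<^sub>R axis 2 1"
  have pc: "continuous_on A (\<lambda>p. ?p (fst p) (snd p))" for A by (intro continuous_intros)
  have "open ((\<lambda>p. ?p (fst p) (snd p)) -` S)" by (rule open_vimage[OF S pc])
  then obtain r where r: "r > 0" "ball (0, 0) r \<subseteq> (\<lambda>p. ?p (fst p) (snd p)) -` S"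
    unfolding open_contains_ball using that x by (auto dest!: bspec[of _ _ "(0, 0)"])
  have inS: "?p s t \<in> S" if "\<bar>s\<bar> < r / 2" "\<bar>t\<bar> < r / 2" for s t
  proof -
    have "norm (s, t) \<le> \<bar>s\<bar> + \<bar>t\<bar>" using sqrt_sum_squares_le_sum_abs by (simp add: norm_Pair)
    hence "(s, t) \<in> ball (0, 0) r" using that by (auto simp: dist_norm norm_Pair)
    thus ?thesis using r(2) by auto
  qed
  have sh: "?p s t + u *\<^sub>R axis 1 1 = ?p (s + u) t" "?p s t + u *\<^sub>R axis 2 1 = ?p s (t + u)" for s t u
    by (simp_all add: algebra_simps)
  have d1: "((\<lambda>s. k (?p s t)) has_real_derivative partial 1 k (?p s t)) (at s)"
    and d2: "((\<lambda>t. k (?p s t)) has_real_derivative partial 2 k (?p s t)) (at t)"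
    if "C_k (Suc 0) S k" "\<bar>s\<bar> < r / 2" "\<bar>t\<bar> < r / 2" for k s t
    using C_k_derivative[OF that(1) inS[OF that(2,3)], of 1] C_k_derivative[OF that(1) inS[OF that(2,3)], of 2]
      DERIV_shift[of "\<lambda>s. k (?p s t)" _ 0 s] DERIV_shift[of "\<lambda>t. k (?p s t)" _ 0 t] unfolding sh
    by (simp_all add: add.commute)
  have c: "isCont (\<lambda>p. partial i (partial j h) (?p (fst p) (snd p))) (0, 0)" for i j
  proof -
    have "continuous_on ((\<lambda>p. ?p (fst p) (snd p)) -` S) (\<lambda>p. partial i (partial j h) (?p (fst p) (snd p)))"
      by (rule continuous_on_compose2[OF _ pc]) (use hp[of j] in auto)
    moreover have "(0, 0) \<in> (\<lambda>p. ?p (fst p) (snd p)) -` S" using x by simp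
    ultimately show ?thesis using open_vimage[OF S pc] by (simp add: continuous_on_eq_continuous_at)
  qed
  have "partial 2 (partial 1 h) (?p 0 0) = partial 1 (partial 2 h) (?p 0 0)"
  proof (rule mixed_partials_eq[of "r/2" "\<lambda>s t. h (?p s t)" "\<lambda>s t. partial 1 h (?p s t)" "\<lambda>s t. partial 2 h (?p s t)"
      "\<lambda>s t. partial 2 (partial 1 h) (?p s t)" "\<lambda>s t. partial 1 (partial 2 h) (?p s t)"])
    fix s t :: real assume st: "\<bar>s\<bar> < r / 2" "\<bar>t\<bar> < r / 2"
    show "((\<lambda>s. h (?p s t)) has_real_derivative partial 1 h (?p s t)) (at s)" by (rule d1[OF C_k_Suc_imp[OF h0] st])
    show "((\<lambda>t. h (?p s t)) has_real_derivative partial 2 h (?p s t)) (at t)" by (rule d2[OF C_k_Suc_imp[OF h0] st])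
    show "((\<lambda>t. partial 1 h (?p s t)) has_real_derivative partial 2 (partial 1 h) (?p s t)) (at t)" by (rule d2[OF hp st])
    show "((\<lambda>s. partial 2 h (?p s t)) has_real_derivative partial 1 (partial 2 h) (?p s t)) (at s)" by (rule d1[OF hp st])
  qed (rule c | use r(1) in simp)+
  thus ?thesis by simp
qed

section \<open>The Stokes system in complex form\<close>

lemma cx_eq_iff: "cx x = cx y \<longleftrightarrow> x = y" by (metis vc_cx)

lemma vimage_cx: "cx -` T = vc ` T"
proof safe
  fix x assume "cx x \<in> T"
  thus "x \<in> vc ` T" using imageI[of "cx x" T vc] by simp
qed simp

lemma closure_vimage_cx: "closure (cx -` T) = cx -` closure T"
  unfolding vimage_cx
  by (rule closure_injective_linear_image[symmetric])
     (auto intro!: bounded_linear.linear[OF bounded_linear_vc] injI simp: complex_eq_iff vec_eq_iff forall_2)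

lemma decay_vimage_cx:
  fixes h :: "real ^ 2 \<Rightarrow> 'a::real_normed_vector"
  shows "(h \<longlongrightarrow> 0) (inf at_infinity (principal (cx -` T))) \<longleftrightarrow>
    ((\<lambda>z. h (vc z)) \<longlongrightarrow> 0) (inf at_infinity (principal T))"
proof -
  have "(\<forall>x. b \<le> norm x \<longrightarrow> x \<in> cx -` T \<longrightarrow> dist (h x) 0 < e) \<longleftrightarrow>
     (\<forall>z. b \<le> norm z \<longrightarrow> z \<in> T \<longrightarrow> dist (h (vc z)) 0 < e)" for b e
    by (metis cx_vc norm_cx norm_vc vc_cx vimage_eq)
  thus ?thesis unfolding tendsto_iff eventually_inf_principal eventually_at_infinity by simp
qed

text \<open>The stress tensor in Wirtinger derivatives: the strain sees Re a and b only, while Im a,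
  half the vorticity, drops out.\<close>

definition stress_matrix :: "real \<Rightarrow> real \<Rightarrow> complex \<Rightarrow> complex \<Rightarrow> real ^ 2 ^ 2" where
  "stress_matrix \<mu> q a b = (\<chi> i j. - q * (if i = j then 1 else 0) +
     \<mu> * (if i = j then (if i = 1 then 2 * (Re a + Re b) else 2 * (Re a - Re b)) else 2 * Im b))"

lemma stress_matrix_mult:
  "cx (stress_matrix \<mu> q a b *v vc n) = - of_real q * n + 2 * of_real \<mu> * of_real (Re a) * n + 2 * of_real \<mu> * b * cnj n"
  by (simp add: complex_eq_iff matrix_vector_mult_def stress_matrix_def sum_2 algebra_simps)

lemma partial_components:
  fixes v :: "real ^ 2 \<Rightarrow> real ^ 2"
  assumes "((\<lambda>z. cx (v (vc z))) has_derivative (\<lambda>h. a * h + b * cnj h)) (at (cx x))"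
  shows "partial 1 (\<lambda>y. v y $ 1) x = Re a + Re b" "partial 1 (\<lambda>y. v y $ 2) x = Im a + Im b"
    "partial 2 (\<lambda>y. v y $ 1) x = Im b - Im a" "partial 2 (\<lambda>y. v y $ 2) x = Re a - Re b"
  using partial_eqI[OF axis_derivative_Re_Im(1)[OF assms, of 1, simplified]] partial_eqI[OF axis_derivative_Re_Im(2)[OF assms, of 1, simplified]]
    partial_eqI[OF axis_derivative_Re_Im(1)[OF assms, of 2, simplified]] partial_eqI[OF axis_derivative_Re_Im(2)[OF assms, of 2, simplified]]
  by (simp_all add: dir_def)

lemma stress_eq_stress_matrix:
  assumes "((\<lambda>z. cx (v (vc z))) has_derivative (\<lambda>h. a * h + b * cnj h)) (at (cx x))"
  shows "stress \<mu> v q x = stress_matrix \<mu> (q x) a b"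
  by (simp add: vec_eq_iff forall_2 stress_def stress_matrix_def partial_components[OF assms])

context graph_curve
begin

section \<open>Stokes solutions on one side of the graph\<close>

lemma domains: "upper_domain f = cx -` Side 1" "lower_domain f = cx -` Side (-1)"
  by (auto simp: upper_domain_def lower_domain_def Side_def)

lemma closure_domain: "\<sigma> = 1 \<or> \<sigma> = - 1 \<Longrightarrow> closure (cx -` Side \<sigma>) = cx -` CS \<sigma>"
  by (simp add: closure_vimage_cx closure_Side)

lemma open_domain: "open (cx -` Side \<sigma>)"
  by (rule open_vimage[OF open_Side]) (intro continuous_intros)

lemma Xi_eq: "Xi f s = vc (Z s)"
  by (simp add: Xi_def vc_def)

lemma inv_Xi: "inv (Xi f) (vc (Z s)) = s"
proof -
  have "inj (Xi f)" by (rule injI) (metis Xi_eq cx_vc Re_Z)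
  thus ?thesis using inv_f_f[of "Xi f" s] by (simp add: Xi_eq)
qed

lemma off_interface: "x \<notin> interface f \<longleftrightarrow> cx x \<in> Up \<union> Lo"
proof -
  have "x \<in> interface f \<longleftrightarrow> (\<exists>s. cx x = Z s)"
    unfolding interface_def Xi_eq by (metis cx_vc rangeE rangeI vc_cx)
  also have "\<dots> \<longleftrightarrow> Im (cx x) = f (Re (cx x))" by (auto simp: complex_eq_iff)
  finally show ?thesis by (auto simp: Up_def Lo_def)
qed

text \<open>\<open>a\<close> and \<open>b\<close> are the derivatives of \<open>V\<close> with respect to \<open>z\<close> and \<open>cnj z\<close>. Incompressibility is
  \<open>Re a = 0\<close>, and the momentum equation says that \<open>Q - 2 \<mu> a\<close> is holomorphic.\<close>

definition stokes_data :: "real \<Rightarrow> real \<Rightarrow> (complex \<Rightarrow> complex) \<Rightarrow> (complex \<Rightarrow> complex) \<Rightarrow> (complex \<Rightarrow> complex) \<Rightarrow> (complex \<Rightarrow> real) \<Rightarrow> bool" where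
  "stokes_data \<mu> \<sigma> V a b Q \<longleftrightarrow>
     continuous_on (CS \<sigma>) V \<and> continuous_on (CS \<sigma>) a \<and> continuous_on (CS \<sigma>) b \<and> continuous_on (CS \<sigma>) Q \<and>
     (\<forall>z\<in>Side \<sigma>. (V has_derivative (\<lambda>h. a z * h + b z * cnj h)) (at z) \<and> Re (a z) = 0) \<and>
     (\<lambda>z. of_real (Q z) - 2 * of_real \<mu> * a z) holomorphic_on Side \<sigma> \<and>
     (V \<longlongrightarrow> 0) (inf at_infinity (principal (CS \<sigma>))) \<and> (Q \<longlongrightarrow> 0) (inf at_infinity (principal (CS \<sigma>)))"

lemma stokes_data_diff:
  assumes 1: "stokes_data \<mu> \<sigma> V a b Q" and 2: "stokes_data \<mu> \<sigma> V' a' b' Q'"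
  shows "stokes_data \<mu> \<sigma> (\<lambda>z. V z - V' z) (\<lambda>z. a z - a' z) (\<lambda>z. b z - b' z) (\<lambda>z. Q z - Q' z)"
  unfolding stokes_data_def
proof (intro conjI ballI)
  show "continuous_on (CS \<sigma>) (\<lambda>z. V z - V' z)" "continuous_on (CS \<sigma>) (\<lambda>z. a z - a' z)"
    "continuous_on (CS \<sigma>) (\<lambda>z. b z - b' z)" "continuous_on (CS \<sigma>) (\<lambda>z. Q z - Q' z)"
    using 1 2 unfolding stokes_data_def by (intro continuous_on_diff; blast)+
  show "((\<lambda>z. V z - V' z) \<longlongrightarrow> 0) (inf at_infinity (principal (CS \<sigma>)))"
    using tendsto_diff[of V 0 _ V' 0] 1 2 unfolding stokes_data_def by simp
  show "((\<lambda>z. Q z - Q' z) \<longlongrightarrow> 0) (inf at_infinity (principal (CS \<sigma>)))"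
    using tendsto_diff[of Q 0 _ Q' 0] 1 2 unfolding stokes_data_def by simp
  fix z assume z: "z \<in> Side \<sigma>"
  show "Re (a z - a' z) = 0" using 1 2 z by (simp add: stokes_data_def)
  have "((\<lambda>z. V z - V' z) has_derivative (\<lambda>h. (a z * h + b z * cnj h) - (a' z * h + b' z * cnj h))) (at z)"
    using 1 2 z by (intro has_derivative_diff) (auto simp: stokes_data_def)
  thus "((\<lambda>z. V z - V' z) has_derivative (\<lambda>h. (a z - a' z) * h + (b z - b' z) * cnj h)) (at z)"
    by (rule has_derivative_eq_rhs) (auto simp: algebra_simps)
next
  have "(\<lambda>z. (of_real (Q z) - 2 * of_real \<mu> * a z) - (of_real (Q' z) - 2 * of_real \<mu> * a' z)) holomorphic_on Side \<sigma>"
    by (rule holomorphic_on_diff) (use 1 2 in \<open>auto simp: stokes_data_def\<close>)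
  thus "(\<lambda>z. of_real (Q z - Q' z) - 2 * of_real \<mu> * (a z - a' z)) holomorphic_on Side \<sigma>"
    by (simp add: algebra_simps)
qed

lemma stokes_data_Re_a:
  assumes "stokes_data \<mu> \<sigma> V a b Q" "\<sigma> = 1 \<or> \<sigma> = - 1" "z \<in> CS \<sigma>"
  shows "Re (a z) = 0"
proof -
  have "continuous_on (closure (Side \<sigma>)) (\<lambda>z. Re (a z))"
    unfolding closure_Side[OF assms(2)] using assms(1) by (intro continuous_on_Re) (simp add: stokes_data_def)
  from continuous_constant_on_closure[OF this] assms show ?thesis
    unfolding closure_Side[OF assms(2)] stokes_data_def by blast
qed

text \<open>Evaluates the \<open>Lim\<close> inside \<open>jump\<close> as a boundary value, using
  that a, b and the pressure extend continuously to the closed side.\<close>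

lemma stress_limit:
  assumes d: "stokes_data \<mu> \<sigma> (\<lambda>z. cx (v (vc z))) a b (\<lambda>z. q (vc z))" and \<sigma>: "\<sigma> = 1 \<or> \<sigma> = - 1"
  shows "Lim (at (vc (Z s)) within cx -` Side \<sigma>) (stress \<mu> v q) = stress_matrix \<mu> (q (vc (Z s))) (a (Z s)) (b (Z s))"
proof (rule tendsto_Lim)
  \<comment> \<open>The point is in the closure but not in the side, so it is a limit point and the
    limit is unique.\<close>
  have "vc (Z s) \<in> closure (cx -` Side \<sigma>)"
    unfolding closure_domain[OF \<sigma>] using Z_in_CS by simp
  moreover have "vc (Z s) \<notin> cx -` Side \<sigma>" by (simp add: Side_def)
  ultimately have "(vc (Z s)) islimpt (cx -` Side \<sigma>)" by (simp add: closure_def)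
  thus "\<not> trivial_limit (at (vc (Z s)) within cx -` Side \<sigma>)" by (simp add: trivial_limit_within)
  have "continuous_on (CS \<sigma>) a" "continuous_on (CS \<sigma>) b" "continuous_on (CS \<sigma>) (\<lambda>z. q (vc z))"
    using d by (auto simp: stokes_data_def)
  note cs = this
  have cc: "continuous_on (cx -` CS \<sigma>) (\<lambda>x. F (cx x))" if "continuous_on (CS \<sigma>) F" for F :: "complex \<Rightarrow> 'x::topological_space"
    by (rule continuous_on_compose2[OF that]) (auto intro!: continuous_intros)
  have c: "continuous_on (cx -` CS \<sigma>) (\<lambda>x. a (cx x))" "continuous_on (cx -` CS \<sigma>) (\<lambda>x. b (cx x))"
    "continuous_on (cx -` CS \<sigma>) (\<lambda>x. q (vc (cx x)))"
    by (rule cc[OF cs(1)], rule cc[OF cs(2)], rule cc[OF cs(3)])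
  have sc: "continuous_on (cx -` CS \<sigma>) (\<lambda>x. stress_matrix \<mu> (q (vc (cx x))) (a (cx x)) (b (cx x)))"
    unfolding stress_matrix_def
  proof (intro continuous_on_vec_lambda)
    fix i j :: 2
    show "continuous_on (cx -` CS \<sigma>) (\<lambda>x. - q (vc (cx x)) * (if i = j then 1 else 0) +
      \<mu> * (if i = j then (if i = 1 then 2 * (Re (a (cx x)) + Re (b (cx x))) else 2 * (Re (a (cx x)) - Re (b (cx x)))) else 2 * Im (b (cx x))))"
      using c by (cases "i = j"; cases "i = 1") (auto intro!: continuous_intros)
  qed
  have "vc (Z s) \<in> cx -` CS \<sigma>" using Z_in_CS by simp
  from bspec[OF sc[unfolded continuous_on_def] this] have "((\<lambda>x. stress_matrix \<mu> (q (vc (cx x))) (a (cx x)) (b (cx x))) \<longlongrightarrow>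
      stress_matrix \<mu> (q (vc (Z s))) (a (Z s)) (b (Z s))) (at (vc (Z s)) within cx -` CS \<sigma>)"
    by (simp only: cx_vc)
  hence "((\<lambda>x. stress_matrix \<mu> (q (vc (cx x))) (a (cx x)) (b (cx x))) \<longlongrightarrow>
      stress_matrix \<mu> (q (vc (Z s))) (a (Z s)) (b (Z s))) (at (vc (Z s)) within cx -` Side \<sigma>)"
    by (rule tendsto_within_subset) (use Side_subset_CS in auto)
  thus "(stress \<mu> v q \<longlongrightarrow> stress_matrix \<mu> (q (vc (Z s))) (a (Z s)) (b (Z s))) (at (vc (Z s)) within cx -` Side \<sigma>)"
  proof (rule Lim_transform_eventually)
    have "stress_matrix \<mu> (q (vc (cx x))) (a (cx x)) (b (cx x)) = stress \<mu> v q x" if "x \<in> cx -` Side \<sigma>" for x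
      using stress_eq_stress_matrix[of v "a (cx x)" "b (cx x)" x \<mu> q] d that by (auto simp: stokes_data_def)
    thus "\<forall>\<^sub>F x in at (vc (Z s)) within cx -` Side \<sigma>. stress_matrix \<mu> (q (vc (cx x))) (a (cx x)) (b (cx x)) = stress \<mu> v q x"
      by (auto simp: eventually_at_filter)
  qed
qed

text \<open>After eliminating with div v = 0 and the symmetry of mixed partials, the momentum
  equation is the pair of Cauchy-Riemann equations for the pressure and - \<mu> times the
  vorticity.\<close>

lemma stokes_data_of_solution:
  assumes \<sigma>: "\<sigma> = 1 \<or> \<sigma> = - 1"
  defines "S \<equiv> cx -` Side \<sigma>"
  assumes reg: "stokes_regular S v q" and eqs: "stokes_equations \<mu> S v q"
    and van: "vanishes_at_infinity (closure S) v" "vanishes_at_infinity (closure S) q"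
  obtains a b where "stokes_data \<mu> \<sigma> (\<lambda>z. cx (v (vc z))) a b (\<lambda>z. q (vc z))"
proof -
  have S: "open S" unfolding S_def by (rule open_domain)
  have clS: "closure S = cx -` CS \<sigma>" unfolding S_def by (rule closure_domain[OF \<sigma>])
  have inS: "vc z \<in> S \<longleftrightarrow> z \<in> Side \<sigma>" and inC: "vc z \<in> closure S \<longleftrightarrow> z \<in> CS \<sigma>" for z
    by (simp_all add: S_def clS closure_domain[OF \<sigma>])
  have C2: "C_k 2 S (\<lambda>x. v x $ j)" and cv: "continuous_on (closure S) (\<lambda>x. v x $ j)"
    and ex: "\<exists>d. continuous_on (closure S) d \<and> (\<forall>x\<in>S. d x = partial i (\<lambda>x. v x $ j) x)" for i j
    using reg by (auto simp: stokes_regular_def C1_closure_def)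
  have q1: "C_k 1 S q" and cq: "continuous_on (closure S) q" using reg by (auto simp: stokes_regular_def)
  define p where "p i j = partial i (\<lambda>x. v x $ j)" for i j
  have "\<forall>i j. \<exists>d. continuous_on (closure S) d \<and> (\<forall>x\<in>S. d x = p i j x)" using ex by (simp add: p_def)
  then obtain d where d: "\<And>i j. continuous_on (closure S) (d i j)" "\<And>i j x. x \<in> S \<Longrightarrow> d i j x = p i j x" by metis
  have C2': "C_k (Suc 1) S (\<lambda>x. v x $ j)" for j using C2[of j] by (simp add: numeral_2_eq_2)
  have p1: "C_k 1 S (p i j)" for i j unfolding p_def by (rule C_k_partial[OF C2'])
  have v1: "C_k 1 S (\<lambda>x. v x $ j)" for j by (rule C_k_Suc_imp[OF C2'])
  have p1': "C_k (Suc 0) S (p i j)" for i j using p1 by simp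
  have div: "p 1 1 x + p 2 2 x = 0" if "x \<in> S" for x
    using eqs that by (auto simp: stokes_equations_def divergence_def sum_2 p_def)
  have mom: "\<mu> * (partial 1 (p 1 j) x + partial 2 (p 2 j) x) = partial j q x" if "x \<in> S" for x j
    using eqs that by (auto simp: stokes_equations_def laplacian_def sum_2 p_def)
  have mix: "partial 1 (p 2 j) x = partial 2 (p 1 j) x" if "x \<in> S" for x j
    unfolding p_def by (rule C2_mixed_partials[OF S C2 that])
  have neg: "partial i h x = - partial i h' x" if h: "\<And>y. y \<in> S \<Longrightarrow> h y = - h' y" "C_k (Suc 0) S h'" "x \<in> S" for i h h' x
  proof -
    have "partial i h x = partial i (\<lambda>y. - h' y) x" by (rule partial_cong[OF S h(3) h(1)])
    also have "\<dots> = - partial i h' x" by (intro partial_eqI DERIV_minus C_k_derivative[OF h(2,3)])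
    finally show ?thesis .
  qed
  have div1: "partial i (p 1 1) x = - partial i (p 2 2) x" if "x \<in> S" for x i
    by (rule neg[OF _ p1' that]) (use div in \<open>auto simp: eq_neg_iff_add_eq_0\<close>)
  \<comment> \<open>Built from the continuous extensions \<open>d\<close>, because
    \<open>partial\<close> evaluated at a point of the graph has no connection with the one-sided
    derivatives.\<close>
  define a where "a z = Complex ((d 1 1 (vc z) + d 2 2 (vc z)) / 2) ((d 1 2 (vc z) - d 2 1 (vc z)) / 2)" for z
  define b where "b z = Complex ((d 1 1 (vc z) - d 2 2 (vc z)) / 2) ((d 1 2 (vc z) + d 2 1 (vc z)) / 2)" for z
  have cc: "continuous_on (CS \<sigma>) (\<lambda>z. h (vc z))" if "continuous_on (closure S) h" for h :: "real ^ 2 \<Rightarrow> real"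
    by (rule continuous_on_compose2[OF that]) (auto simp: inC intro!: continuous_intros)
  have Re_a: "Re (a z) = 0" if "z \<in> Side \<sigma>" for z using div[of "vc z"] d(2) that by (simp add: a_def inS)
  show ?thesis
  proof (rule that[of a b], unfold stokes_data_def, intro conjI ballI)
    have "continuous_on (CS \<sigma>) (\<lambda>z. Complex (v (vc z) $ 1) (v (vc z) $ 2))"
      unfolding Complex_eq by (intro continuous_intros cc cv)
    thus "continuous_on (CS \<sigma>) (\<lambda>z. cx (v (vc z)))" by (simp add: cx_def)
    show "continuous_on (CS \<sigma>) a" "continuous_on (CS \<sigma>) b" unfolding a_def b_def Complex_eq
      by (intro continuous_intros cc d(1); simp)+
    show "continuous_on (CS \<sigma>) (\<lambda>z. q (vc z))" by (rule cc[OF cq])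
    have "(v \<longlongrightarrow> 0) (inf at_infinity (principal (cx -` CS \<sigma>)))" "(q \<longlongrightarrow> 0) (inf at_infinity (principal (cx -` CS \<sigma>)))"
      using van by (auto simp: vanishes_at_infinity_def clS)
    hence dv: "((\<lambda>z. v (vc z)) \<longlongrightarrow> 0) (inf at_infinity (principal (CS \<sigma>)))"
      and dq: "((\<lambda>z. q (vc z)) \<longlongrightarrow> 0) (inf at_infinity (principal (CS \<sigma>)))" by (auto simp: decay_vimage_cx)
    show "((\<lambda>z. q (vc z)) \<longlongrightarrow> 0) (inf at_infinity (principal (CS \<sigma>)))" by (rule dq)
    show "((\<lambda>z. cx (v (vc z))) \<longlongrightarrow> 0) (inf at_infinity (principal (CS \<sigma>)))"
      using dv by (rule tendsto_0_le[where K = 1]) auto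
    show "Re (a z) = 0" if "z \<in> Side \<sigma>" for z using Re_a[OF that] .
    fix z assume z: "z \<in> Side \<sigma>"
    have zS: "vc z \<in> S" using z by (simp add: inS)
    have "((\<lambda>w. of_real (v (vc w) $ 1) + \<i> * of_real (v (vc w) $ 2)) has_derivative
       (\<lambda>w. of_real (p 1 1 (vc z) * Re w + p 2 1 (vc z) * Im w) + \<i> * of_real (p 1 2 (vc z) * Re w + p 2 2 (vc z) * Im w))) (at z)"
      using C1_has_derivative[OF S v1 zS, of 1] C1_has_derivative[OF S v1 zS, of 2]
      by (intro has_derivative_add has_derivative_mult_right has_derivative_of_real) (auto simp: p_def)
    moreover have "(\<lambda>w. of_real (v (vc w) $ 1) + \<i> * of_real (v (vc w) $ 2)) = (\<lambda>w. cx (v (vc w)))"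
      by (auto simp: complex_eq_iff)
    ultimately have *: "((\<lambda>w. cx (v (vc w))) has_derivative
       (\<lambda>w. of_real (p 1 1 (vc z) * Re w + p 2 1 (vc z) * Im w) + \<i> * of_real (p 1 2 (vc z) * Re w + p 2 2 (vc z) * Im w))) (at z)"
      by simp
    show "((\<lambda>z. cx (v (vc z))) has_derivative (\<lambda>h. a z * h + b z * cnj h)) (at z)"
      by (rule has_derivative_eq_rhs[OF *])
         (use d(2)[OF zS] in \<open>auto simp: a_def b_def complex_eq_iff algebra_simps add_divide_distrib diff_divide_distrib\<close>)
  next
    \<comment> \<open>- \<mu> times the vorticity, which is the imaginary part of Q - 2 \<mu>
      a.\<close>
    define m where "m x = - \<mu> * (p 1 2 x - p 2 1 x)" for x
    have m1: "C_k 1 S m" unfolding m_def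
      by (intro C_k_mult[OF S C_k_const] C_k_diff[OF S] p1)
    have pm: "partial i m x = - \<mu> * (partial i (p 1 2) x - partial i (p 2 1) x)" if "x \<in> S" for i x
      unfolding m_def by (intro partial_eqI DERIV_cmult DERIV_diff C_k_derivative[OF p1'] that)
    show "(\<lambda>z. complex_of_real (q (vc z)) - 2 * complex_of_real \<mu> * a z) holomorphic_on Side \<sigma>"
    proof (rule holomorphic_transform)
      show "of_real (q (vc z)) + \<i> * of_real (m (vc z)) = of_real (q (vc z)) - 2 * of_real \<mu> * a z" if "z \<in> Side \<sigma>" for z
        using Re_a[OF that] d(2)[of "vc z"] that by (simp add: complex_eq_iff m_def inS) (simp add: a_def)
      show "(\<lambda>z. of_real (q (vc z)) + \<i> * of_real (m (vc z))) holomorphic_on Side \<sigma>"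
        unfolding holomorphic_on_def
      proof
        fix z assume z: "z \<in> Side \<sigma>"
        have zS: "vc z \<in> S" using z by (simp add: inS)
        define q1 where "q1 = partial 1 q (vc z)"
        define m1' where "m1' = partial 1 m (vc z)"
        have cr1: "partial 2 m (vc z) = q1"
        proof -
          have "q1 = \<mu> * (- partial 1 (p 2 2) (vc z) + partial 2 (p 2 1) (vc z))"
            using mom[OF zS, of 1] div1[OF zS, of 1] by (simp add: q1_def)
          also have "\<dots> = partial 2 m (vc z)" unfolding pm[OF zS] mix[OF zS] by (simp add: algebra_simps)
          finally show ?thesis by simp
        qed
        have cr2: "partial 2 q (vc z) = - m1'"
        proof -
          have "partial 2 q (vc z) = \<mu> * (partial 1 (p 1 2) (vc z) + partial 2 (p 2 2) (vc z))"
            using mom[OF zS, of 2] by simp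
          also have "partial 2 (p 2 2) (vc z) = - partial 1 (p 2 1) (vc z)"
            using div1[OF zS, of 2] mix[OF zS, of 1] by simp
          finally show ?thesis unfolding m1'_def pm[OF zS] by (simp add: algebra_simps)
        qed
        have "((\<lambda>w. of_real (q (vc w)) + \<i> * of_real (m (vc w))) has_derivative
          (\<lambda>w. of_real (partial 1 q (vc z) * Re w + partial 2 q (vc z) * Im w) + \<i> * of_real (partial 1 m (vc z) * Re w + partial 2 m (vc z) * Im w))) (at z)"
          using C1_has_derivative[OF S q1 zS] C1_has_derivative[OF S m1 zS]
          by (intro has_derivative_add has_derivative_mult_right has_derivative_of_real) auto
        hence "((\<lambda>w. of_real (q (vc w)) + \<i> * of_real (m (vc w))) has_derivative (*) (Complex q1 m1')) (at z)"
          unfolding cr1 cr2 by (rule has_derivative_eq_rhs) (auto simp: q1_def m1'_def complex_eq_iff algebra_simps)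
        thus "(\<lambda>z. of_real (q (vc z)) + \<i> * of_real (m (vc z))) field_differentiable at z within Side \<sigma>"
          unfolding field_differentiable_def has_field_derivative_def using has_derivative_at_withinI by blast
      qed
    qed
  qed
qed

lemma goursat_derivative:
  assumes hol: "A holomorphic_on Side \<sigma>" "B holomorphic_on Side \<sigma>"
    and V: "\<And>z. z \<in> Side \<sigma> \<Longrightarrow> V z = A z + cnj (B z) - z * cnj (deriv A z)"
    and a: "a z = deriv A z - cnj (deriv A z)" and b: "b z = cnj (deriv B z) - z * cnj (deriv (deriv A) z)"
    and z: "z \<in> Side \<sigma>"
  shows "(V has_derivative (\<lambda>h. a z * h + b z * cnj h)) (at z)"
proof -
  have hder: "(F has_derivative (\<lambda>h. deriv F z * h)) (at z)" if "F holomorphic_on Side \<sigma>" for F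
    using has_derivative_of_holomorphic[OF that open_Side z] by simp
  have "((\<lambda>z. A z + cnj (B z) - z * cnj (deriv A z)) has_derivative
    (\<lambda>h. deriv A z * h + cnj (deriv B z * h) - (z * cnj (deriv (deriv A) z * h) + h * cnj (deriv A z)))) (at z)"
    using hol by (intro has_derivative_diff has_derivative_add has_derivative_mult has_derivative_cnj hder
        has_derivative_ident holomorphic_deriv open_Side)
  hence "((\<lambda>z. A z + cnj (B z) - z * cnj (deriv A z)) has_derivative (\<lambda>h. a z * h + b z * cnj h)) (at z)"
    by (rule has_derivative_eq_rhs) (auto simp: a b algebra_simps)
  thus ?thesis by (rule has_derivative_transform_within_open[OF _ open_Side z V[symmetric]])
qed

text \<open>The divergence is 2 Re a = 0. The Laplacian is four times the mixed Wirtinger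
  derivative, - 4 cnj (A''), and \<mu> times it is the complex gradient of - 4 \<mu> Re A'.\<close>

lemma goursat_solves_stokes:
  assumes \<sigma>: "\<sigma> = 1 \<or> \<sigma> = - 1" and hol: "A holomorphic_on Side \<sigma>" "B holomorphic_on Side \<sigma>"
    and cont: "continuous_on (CS \<sigma>) V" "continuous_on (CS \<sigma>) a" "continuous_on (CS \<sigma>) b" "continuous_on (CS \<sigma>) Q"
    and V: "\<And>z. z \<in> Side \<sigma> \<Longrightarrow> V z = A z + cnj (B z) - z * cnj (deriv A z)"
    and a: "\<And>z. z \<in> Side \<sigma> \<Longrightarrow> a z = deriv A z - cnj (deriv A z)"
    and b: "\<And>z. z \<in> Side \<sigma> \<Longrightarrow> b z = cnj (deriv B z) - z * cnj (deriv (deriv A) z)"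
    and Q: "\<And>z. z \<in> Side \<sigma> \<Longrightarrow> Q z = - 4 * \<mu> * Re (deriv A z)"
  defines "S \<equiv> cx -` Side \<sigma>"
  shows "stokes_regular S (\<lambda>x. vc (V (cx x))) (\<lambda>x. Q (cx x))" "stokes_equations \<mu> S (\<lambda>x. vc (V (cx x))) (\<lambda>x. Q (cx x))"
proof -
  have S: "open S" unfolding S_def by (rule open_domain)
  have clS: "closure S = cx -` CS \<sigma>" unfolding S_def by (rule closure_domain[OF \<sigma>])
  note hd = holomorphic_deriv[OF _ open_Side]
  have hA: "A holomorphic_on Side \<sigma>" "deriv A holomorphic_on Side \<sigma>" "deriv (deriv A) holomorphic_on Side \<sigma>"
    "B holomorphic_on Side \<sigma>" "deriv B holomorphic_on Side \<sigma>" by (intro hd hol)+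
  have hder: "(F has_derivative (\<lambda>h. deriv F z * h)) (at z)" if "F holomorphic_on Side \<sigma>" "z \<in> Side \<sigma>" for F z
    using has_derivative_of_holomorphic[OF that(1) open_Side that(2)] by simp
  have tr: "(F has_derivative D) (at z)" if "(G has_derivative D) (at z)" "z \<in> Side \<sigma>" "\<And>w. w \<in> Side \<sigma> \<Longrightarrow> G w = F w" for F G :: "complex \<Rightarrow> complex" and D z
    by (rule has_derivative_transform_within_open[OF that(1) open_Side that(2,3)])
  have dV: "(V has_derivative (\<lambda>h. a z * h + b z * cnj h)) (at z)" if z: "z \<in> Side \<sigma>" for z
    by (rule goursat_derivative[where A = A and B = B and a = a and b = b, OF hol V a[OF z] b[OF z] z])
  have da: "(a has_derivative (\<lambda>h. deriv (deriv A) z * h + (- cnj (deriv (deriv A) z)) * cnj h)) (at z)" if z: "z \<in> Side \<sigma>" for z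
  proof (rule tr[OF _ z a[symmetric]])
    have "((\<lambda>z. deriv A z - cnj (deriv A z)) has_derivative (\<lambda>h. deriv (deriv A) z * h - cnj (deriv (deriv A) z * h))) (at z)"
      using z hA by (intro has_derivative_diff has_derivative_cnj hder)
    thus "((\<lambda>z. deriv A z - cnj (deriv A z)) has_derivative (\<lambda>h. deriv (deriv A) z * h + (- cnj (deriv (deriv A) z)) * cnj h)) (at z)"
      by (rule has_derivative_eq_rhs) (auto simp: algebra_simps)
  qed
  \<comment> \<open>The cnj z derivative of b. It cancels in the Laplacian because the squares of
    \<open>cnj (dir i)\<close> sum to zero.\<close>
  define X where "X z = cnj (deriv (deriv B) z) - z * cnj (deriv (deriv (deriv A)) z)" for z
  have db: "(b has_derivative (\<lambda>h. (- cnj (deriv (deriv A) z)) * h + X z * cnj h)) (at z)" if z: "z \<in> Side \<sigma>" for z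
  proof (rule tr[OF _ z b[symmetric]])
    have "((\<lambda>z. cnj (deriv B z) - z * cnj (deriv (deriv A) z)) has_derivative
      (\<lambda>h. cnj (deriv (deriv B) z * h) - (z * cnj (deriv (deriv (deriv A)) z * h) + h * cnj (deriv (deriv A) z)))) (at z)"
      using z hA by (intro has_derivative_diff has_derivative_mult has_derivative_cnj hder has_derivative_ident)
    thus "((\<lambda>z. cnj (deriv B z) - z * cnj (deriv (deriv A) z)) has_derivative (\<lambda>h. (- cnj (deriv (deriv A) z)) * h + X z * cnj h)) (at z)"
      by (rule has_derivative_eq_rhs) (auto simp: X_def algebra_simps)
  qed
  have inS: "x \<in> S \<longleftrightarrow> cx x \<in> Side \<sigma>" for x by (simp add: S_def)
  define G where "G i z = a z * dir i + b z * cnj (dir i)" for i z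
  have pV: "partial i (\<lambda>y. Re (V (cx y))) x = Re (G i (cx x))" "partial i (\<lambda>y. Im (V (cx y))) x = Im (G i (cx x))" if "x \<in> S" for i x
    using that axis_derivative_Re_Im[OF dV, of x i] by (auto simp: G_def inS intro!: partial_eqI)
  have dG: "(G i has_derivative (\<lambda>h. (deriv (deriv A) z * dir i - cnj (deriv (deriv A) z) * cnj (dir i)) * h +
      (- cnj (deriv (deriv A) z) * dir i + X z * cnj (dir i)) * cnj h)) (at z)" if z: "z \<in> Side \<sigma>" for i z
  proof -
    have "(G i has_derivative (\<lambda>h. (deriv (deriv A) z * h + (- cnj (deriv (deriv A) z)) * cnj h) * dir i +
      ((- cnj (deriv (deriv A) z)) * h + X z * cnj h) * cnj (dir i))) (at z)"
      unfolding G_def[abs_def] by (intro has_derivative_add has_derivative_mult_left da db z)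
    thus ?thesis by (rule has_derivative_eq_rhs) (auto simp: algebra_simps)
  qed
  have hC: "C_k k S (\<lambda>x. Re (F (cx x)))" "C_k k S (\<lambda>x. Im (F (cx x)))" if "F holomorphic_on Side \<sigma>" for F k
    using C_k_holomorphic[OF open_Side that] by (auto simp: S_def)
  have CV: "C_k k S (\<lambda>x. Re (V (cx x)))" "C_k k S (\<lambda>x. Im (V (cx x)))" for k
  proof -
    \<comment> \<open>Smoothness of every order is read off from real and imaginary parts of
      holomorphic functions and the coordinates.\<close>
    have "C_k k S (\<lambda>x. Re (A (cx x)) + Re (B (cx x)) - (x $ 1 * Re (deriv A (cx x)) + x $ 2 * Im (deriv A (cx x))))"
      "C_k k S (\<lambda>x. Im (A (cx x)) - Im (B (cx x)) - (x $ 2 * Re (deriv A (cx x)) - x $ 1 * Im (deriv A (cx x))))"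
      by (intro C_k_add[OF S] C_k_diff[OF S] C_k_mult[OF S] C_k_nth hC hA)+
    note c = this
    show "C_k k S (\<lambda>x. Re (V (cx x)))" by (rule C_k_cong[OF S _ c(1)]) (simp add: V inS)
    show "C_k k S (\<lambda>x. Im (V (cx x)))" by (rule C_k_cong[OF S _ c(2)]) (simp add: V inS)
  qed
  have CQ: "C_k k S (\<lambda>x. Q (cx x))" for k
    by (rule C_k_cong[OF S _ C_k_mult[OF S C_k_const[of k S "- 4 * \<mu>"] hC(1)[OF hA(2)]]]) (simp add: Q inS)
  have cc: "continuous_on (closure S) (\<lambda>x. F (cx x))" if "continuous_on (CS \<sigma>) F" for F :: "complex \<Rightarrow> 'x::topological_space"
    by (rule continuous_on_compose2[OF that]) (auto simp: clS intro!: continuous_intros)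
  have cG: "continuous_on (closure S) (\<lambda>x. G i (cx x))" for i
    unfolding G_def by (intro continuous_intros cc cont)
  have C1gen: "C1_closure S h" if "C_k 1 S h" "continuous_on (closure S) h"
    "\<And>i. continuous_on (closure S) (d i)" "\<And>i x. x \<in> S \<Longrightarrow> d i x = partial i h x" for h d
    using that unfolding C1_closure_def by blast
  have C1: "C1_closure S (\<lambda>x. Re (V (cx x)))" "C1_closure S (\<lambda>x. Im (V (cx x)))"
    by (rule C1gen[OF CV(1) continuous_on_Re[OF cc[OF cont(1)]] continuous_on_Re[OF cG] pV(1)[symmetric]], assumption)
       (rule C1gen[OF CV(2) continuous_on_Im[OF cc[OF cont(1)]] continuous_on_Im[OF cG] pV(2)[symmetric]], assumption)
  show "stokes_regular S (\<lambda>x. vc (V (cx x))) (\<lambda>x. Q (cx x))"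
    unfolding stokes_regular_def forall_2 using CV C1 CQ cc[OF cont(4)] by (simp del: C_k.simps)
  have lap: "laplacian (\<lambda>y. Re (V (cx y))) x = - 4 * Re (deriv (deriv A) (cx x))"
    "laplacian (\<lambda>y. Im (V (cx y))) x = 4 * Im (deriv (deriv A) (cx x))" if x: "x \<in> S" for x
  proof -
    have "partial i (partial i (\<lambda>y. Re (V (cx y)))) x = partial i (\<lambda>y. Re (G i (cx y))) x"
      "partial i (partial i (\<lambda>y. Im (V (cx y)))) x = partial i (\<lambda>y. Im (G i (cx y))) x" for i
      by (intro partial_cong[OF S x] pV; assumption)+
    moreover have "partial i (\<lambda>y. Re (G i (cx y))) x = Re ((deriv (deriv A) (cx x) * dir i - cnj (deriv (deriv A) (cx x)) * cnj (dir i)) * dir i +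
      (- cnj (deriv (deriv A) (cx x)) * dir i + X (cx x) * cnj (dir i)) * cnj (dir i))"
      "partial i (\<lambda>y. Im (G i (cx y))) x = Im ((deriv (deriv A) (cx x) * dir i - cnj (deriv (deriv A) (cx x)) * cnj (dir i)) * dir i +
      (- cnj (deriv (deriv A) (cx x)) * dir i + X (cx x) * cnj (dir i)) * cnj (dir i))" for i
      using axis_derivative_Re_Im[OF dG, of x i i] x by (auto simp only: inS intro!: partial_eqI)
    ultimately show "laplacian (\<lambda>y. Re (V (cx y))) x = - 4 * Re (deriv (deriv A) (cx x))"
      "laplacian (\<lambda>y. Im (V (cx y))) x = 4 * Im (deriv (deriv A) (cx x))"
      by (simp_all add: laplacian_def sum_2 dir_def)
  qed
  have pQ: "partial i (\<lambda>y. Q (cx y)) x = - 4 * \<mu> * Re (deriv (deriv A) (cx x) * dir i)" if x: "x \<in> S" for i x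
  proof -
    have "partial i (\<lambda>y. Q (cx y)) x = partial i (\<lambda>y. - 4 * \<mu> * Re (deriv A (cx y))) x"
      by (rule partial_cong[OF S x]) (simp add: Q inS)
    also have "\<dots> = - 4 * \<mu> * Re (deriv (deriv A) (cx x) * dir i + 0 * cnj (dir i))"
      using x by (intro partial_eqI DERIV_cmult axis_derivative_Re_Im(1) has_derivative_of_holomorphic[OF hA(2) open_Side]) (simp add: inS)
    finally show ?thesis by simp
  qed
  show "stokes_equations \<mu> S (\<lambda>x. vc (V (cx x))) (\<lambda>x. Q (cx x))"
    unfolding stokes_equations_def forall_2
  proof (intro ballI conjI)
    fix x assume x: "x \<in> S"
    show "\<mu> * laplacian (\<lambda>y. vc (V (cx y)) $ 1) x - partial 1 (\<lambda>x. Q (cx x)) x = 0"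
      "\<mu> * laplacian (\<lambda>y. vc (V (cx y)) $ 2) x - partial 2 (\<lambda>x. Q (cx x)) x = 0"
      using lap[OF x] pQ[OF x] by (simp_all add: dir_def)
    have "cx x \<in> Side \<sigma>" using x by (simp add: inS)
    thus "divergence (\<lambda>x. vc (V (cx x))) x = 0"
      using pV[OF x] a by (simp add: divergence_def sum_2 G_def dir_def)
  qed
qed

end

section \<open>Complex form of the layer potentials\<close>

lemma locally_hoelder_const: "locally_hoelder (\<lambda>_. c)"
  unfolding locally_hoelder_def by (intro conjI exI[of _ "norm c"] exI[of _ 0]) auto

lemma locally_hoelder_norm:
  assumes "locally_hoelder u"
  shows "locally_hoelder (\<lambda>s. of_real (norm (u s)))"
proof -
  obtain B K where B: "\<And>s. norm (u s) \<le> B"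
    and K: "K \<ge> 0" "\<And>a b. \<bar>a - b\<bar> \<le> 1 \<Longrightarrow> norm (u a - u b) \<le> K * sqrt \<bar>a - b\<bar>"
    using assms unfolding locally_hoelder_def by metis
  have "norm (complex_of_real (norm (u a)) - of_real (norm (u b))) \<le> K * sqrt \<bar>a - b\<bar>" if "\<bar>a - b\<bar> \<le> 1" for a b
    using K(2)[OF that] norm_triangle_ineq3[of "u a" "u b"] by (simp flip: of_real_diff)
  thus ?thesis unfolding locally_hoelder_def using B K(1) by (intro conjI exI[of _ B] exI[of _ K]) auto
qed

lemma locally_hoelder_of_real:
  assumes "\<And>s. \<bar>u s\<bar> \<le> B" "\<And>a b. \<bar>u a - u b\<bar> \<le> K * sqrt \<bar>a - b\<bar>"
  shows "locally_hoelder (\<lambda>s. of_real (u s))"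
  unfolding locally_hoelder_def
proof (intro conjI exI allI impI)
  show "norm (complex_of_real (u s)) \<le> B" for s using assms(1) by simp
  show "0 \<le> K" using assms(2)[of 0 1] by simp
  show "norm (complex_of_real (u a) - of_real (u b)) \<le> K * sqrt \<bar>a - b\<bar>" for a b
    using assms(2)[of a b] by (simp flip: of_real_diff)
qed

lemma hoelder_L2_tendsto_0:
  assumes "hoelder_L2 u"
  shows "(u \<longlongrightarrow> 0) at_infinity"
proof -
  obtain K where K: "\<And>a b. \<bar>a - b\<bar> \<le> 1 \<Longrightarrow> norm (u a - u b) \<le> K * sqrt \<bar>a - b\<bar>"
    using assms unfolding hoelder_L2_def locally_hoelder_def by blast
  have [measurable]: "u \<in> borel_measurable borel"
    using assms by (simp add: hoelder_L2_def locally_hoelder_measurable)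
  show ?thesis
    by (rule tendsto_0_of_holder_L2[OF K]) (use assms in \<open>auto simp: hoelder_L2_def\<close>)
qed

lemma hoelder_L2_Re_Im:
  assumes "hoelder_L2 u"
  shows "hoelder_L2 (\<lambda>s. of_real (Re (u s)))" "hoelder_L2 (\<lambda>s. of_real (Im (u s)))"
proof -
  have "hoelder_L2 (\<lambda>s. (u s - - cnj (u s)) * (1 / 2))" "hoelder_L2 (\<lambda>s. (u s - cnj (u s)) * (1 / (2 * \<i>)))"
    using hoelder_L2_mult[OF hoelder_L2_cnj[OF assms] locally_hoelder_const[of "-1"]] assms
    by (intro hoelder_L2_mult hoelder_L2_diff hoelder_L2_cnj locally_hoelder_const; simp)+
  moreover have "(u s - - cnj (u s)) * (1 / 2) = of_real (Re (u s))" "(u s - cnj (u s)) * (1 / (2 * \<i>)) = of_real (Im (u s))" for s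
    by (auto simp: complex_eq_iff complex_add_cnj complex_diff_cnj)
  ultimately show "hoelder_L2 (\<lambda>s. of_real (Re (u s)))" "hoelder_L2 (\<lambda>s. of_real (Im (u s)))" by simp_all
qed

section \<open>The tangent density of the graph\<close>

locale H3_graph = graph_curve f f1 M K for f f1 M K +
  fixes f2 :: "real \<Rightarrow> real"
  assumes f1_deriv: "(f1 has_real_derivative f2 x) (at x)"
    and f2_bound: "\<bar>f2 x\<bar> \<le> M"
    and f2_hoelder: "\<bar>f2 a - f2 b\<bar> \<le> K * sqrt \<bar>a - b\<bar>"
    and f1_L2: "integrable lborel (\<lambda>x. (f1 x)\<^sup>2)"
    and f2_L2: "integrable lborel (\<lambda>x. (f2 x)\<^sup>2)"
begin

definition om :: "real \<Rightarrow> real" where "om s = norm (Z' s)"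
text \<open>The unit tangent minus 1, its value at infinity; the subtraction makes it square
  integrable.\<close>

definition gg :: "real \<Rightarrow> complex" where "gg s = Z' s * inverse (of_real (om s)) - 1"
text \<open>Arc length factor times curvature times unit normal, which is the derivative of the unit
  tangent.\<close>

definition gg' :: "real \<Rightarrow> complex" where "gg' s = of_real (f2 s) * (\<i> * Z' s * (inverse (of_real (om s)))^3)"

lemma om_ge: "om s \<ge> 1" unfolding om_def by (rule norm_Z'_ge)

lemma om_eq: "om s = sqrt (1 + (f1 s)\<^sup>2)" by (simp add: om_def cmod_def)

lemma om_sq: "om s * om s = 1 + (f1 s)\<^sup>2"
  unfolding om_eq by (simp add: add_nonneg_nonneg)

lemma gg_Re: "Re (gg s) = 1 / om s - 1" and gg_Im: "Im (gg s) = f1 s / om s"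
  by (simp_all add: gg_def divide_inverse flip: of_real_inverse)

lemma gg'_Re: "Re (gg' s) = - f1 s * f2 s / om s ^ 3" and gg'_Im: "Im (gg' s) = f2 s / om s ^ 3"
  by (simp_all add: gg'_def divide_inverse power_inverse flip: of_real_inverse of_real_power)

lemma om_deriv: "(om has_real_derivative f1 s * f2 s / om s) (at s)"
proof -
  have "((\<lambda>s. sqrt (1 + (f1 s)\<^sup>2)) has_real_derivative (2 * f1 s * f2 s) * (inverse (sqrt (1 + (f1 s)\<^sup>2)) / 2)) (at s)"
  proof (rule DERIV_chain2[OF DERIV_real_sqrt, THEN DERIV_cong])
    show "0 < 1 + (f1 s)\<^sup>2" by (simp add: add_pos_nonneg)
    show "((\<lambda>s. 1 + (f1 s)\<^sup>2) has_real_derivative 2 * f1 s * f2 s) (at s)"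
      using f1_deriv[of s] by (auto intro!: derivative_eq_intros)
  qed simp
  moreover have "(2 * f1 s * f2 s) * (inverse (sqrt (1 + (f1 s)\<^sup>2)) / 2) = f1 s * f2 s / om s"
    unfolding om_eq[symmetric] by (simp add: inverse_eq_divide)
  ultimately show ?thesis unfolding om_eq[symmetric] by simp
qed

lemma gg_deriv: "(gg has_vector_derivative gg' s) (at s)"
  unfolding has_vector_derivative_complex_iff gg_Re[abs_def] gg_Im[abs_def] gg'_Re gg'_Im
proof
  have o: "om s \<noteq> 0" using om_ge[of s] by auto
  show "((\<lambda>s. 1 / om s - 1) has_real_derivative - f1 s * f2 s / om s ^ 3) (at s)"
  proof -
    have "((\<lambda>s. inverse (om s) - 1) has_real_derivative - (f1 s * f2 s / om s * inverse ((om s) ^ Suc (Suc 0))) - 0) (at s)"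
      by (intro DERIV_diff DERIV_const DERIV_inverse_fun om_deriv o)
    thus ?thesis by (simp add: divide_inverse power3_eq_cube mult_ac)
  qed
  have "((\<lambda>s. f1 s / om s) has_real_derivative (f2 s * om s - f1 s * (f1 s * f2 s / om s)) / (om s * om s)) (at s)"
    using o by (intro DERIV_divide f1_deriv om_deriv)
  moreover have "(f2 s * om s - f1 s * (f1 s * f2 s / om s)) / (om s * om s) = f2 s / om s ^ 3"
  proof -
    have "f2 s * om s - f1 s * (f1 s * f2 s / om s) = f2 s * (om s * om s - (f1 s)\<^sup>2) / om s"
      using o by (simp add: field_simps power2_eq_square)
    also have "om s * om s - (f1 s)\<^sup>2 = 1" by (simp add: om_sq)
    finally show ?thesis by (simp add: power3_eq_cube)
  qed
  ultimately show "((\<lambda>s. f1 s / om s) has_real_derivative f2 s / om s ^ 3) (at s)" by simp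
qed

lemma locally_hoelder_inverse_om: "locally_hoelder (\<lambda>s. inverse (of_real (om s)))"
  unfolding om_def
  by (intro locally_hoelder_inverse locally_hoelder_norm locally_hoelder_Z') (simp add: norm_Z'_ge)

lemma hoelder_L2_gg': "hoelder_L2 gg'"
  unfolding gg'_def[abs_def] power3_eq_cube
proof (rule hoelder_L2_mult)
  show "hoelder_L2 (\<lambda>s. of_real (f2 s))"
    unfolding hoelder_L2_def using locally_hoelder_of_real[OF f2_bound f2_hoelder] f2_L2 by simp
  show "locally_hoelder (\<lambda>s. \<i> * Z' s * (inverse (of_real (om s)) * inverse (of_real (om s)) * inverse (of_real (om s))))"
    by (intro locally_hoelder_mult locally_hoelder_const locally_hoelder_inverse_om locally_hoelder_Z')
qed

text \<open>The 2 collects |\<open>Z'\<close> - 1| = |f'| from the numerator and \<open>om\<close> -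
  1 \<le> |f'| from the normalisation.\<close>

lemma norm_gg_le: "norm (gg s) \<le> 2 * \<bar>f1 s\<bar>"
proof -
  have o: "om s > 0" "om s \<ge> 1" using om_ge[of s] by auto
  have z1: "norm (Z' s - 1) = \<bar>f1 s\<bar>" by (simp add: cmod_def)
  have o1: "om s - 1 \<le> \<bar>f1 s\<bar>" using norm_triangle_ineq2[of "Z' s" 1] z1 by (simp add: om_def)
  have "gg s * of_real (om s) = (Z' s - 1) - of_real (om s - 1)"
    using o by (simp add: gg_def algebra_simps)
  hence "norm (gg s) * om s \<le> norm (Z' s - 1) + \<bar>om s - 1\<bar>"
    using norm_triangle_ineq4[of "Z' s - 1" "of_real (om s - 1)"] o(1) by (metis abs_of_pos norm_mult norm_of_real)
  hence "norm (gg s) * om s \<le> 2 * \<bar>f1 s\<bar>" using z1 o1 o(2) by simp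
  moreover have "norm (gg s) * 1 \<le> norm (gg s) * om s" using o by (intro mult_left_mono) auto
  ultimately show ?thesis by simp
qed

lemma hoelder_L2_gg: "hoelder_L2 gg"
proof -
  have h: "locally_hoelder gg" unfolding gg_def[abs_def]
    by (intro locally_hoelder_diff locally_hoelder_mult locally_hoelder_const locally_hoelder_inverse_om locally_hoelder_Z')
  have [measurable]: "gg \<in> borel_measurable borel" by (rule locally_hoelder_measurable[OF h])
  have "integrable lborel (\<lambda>s. (norm (gg s))\<^sup>2)"
  proof (rule Bochner_Integration.integrable_bound)
    show "integrable lborel (\<lambda>s. 4 * (f1 s)\<^sup>2)" using f1_L2 by simp
    show "AE s in lborel. norm ((norm (gg s))\<^sup>2) \<le> norm (4 * (f1 s)\<^sup>2)"
    proof (intro AE_I2)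
      fix s
      have "(norm (gg s))\<^sup>2 \<le> (2 * \<bar>f1 s\<bar>)\<^sup>2" by (intro power_mono norm_gg_le) auto
      thus "norm ((norm (gg s))\<^sup>2) \<le> norm (4 * (f1 s)\<^sup>2)" by (simp add: power_mult_distrib)
    qed
  qed measurable
  with h show ?thesis by (simp add: hoelder_L2_def)
qed

sublocale curve_density f f1 M K gg gg'
  by standard (intro gg_deriv hoelder_L2_gg hoelder_L2_gg' hoelder_L2_tendsto_0)+

lemma deriv_f: "deriv f = f1" using f_deriv DERIV_imp_deriv by blast
lemma deriv_f1: "deriv f1 = f2" using f1_deriv DERIV_imp_deriv by blast

lemma omega_eq: "omega f s = om s" by (simp add: omega_def om_eq deriv_f)

lemma normal_eq: "normal f s = vc (\<i> * Z' s / of_real (om s))"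
  by (simp add: vec_eq_iff forall_2 normal_def omega_eq deriv_f Re_divide_of_real Im_divide_of_real)

lemma curvature_normal: "of_real (curvature f s) * (\<i> * Z' s / of_real (om s)) = gg' s / of_real (om s)"
  by (simp add: curvature_def omega_eq deriv_f deriv_f1 gg'_def divide_inverse power_inverse mult_ac)

lemma g_vec_eq: "g_vec f s = vc (gg s)"
  by (simp add: vec_eq_iff forall_2 g_vec_def omega_eq deriv_f gg_Re gg_Im)

lemma g_vec_deriv: "deriv (\<lambda>r. g_vec f r $ k) s = vc (gg' s) $ k"
proof -
  have "((\<lambda>r. vc (gg r) $ 1) has_real_derivative vc (gg' s) $ 1) (at s)" "((\<lambda>r. vc (gg r) $ 2) has_real_derivative vc (gg' s) $ 2) (at s)"
    using gg_deriv[of s] by (auto simp: has_vector_derivative_complex_iff)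
  thus ?thesis using exhaust_2[of k] by (auto simp: g_vec_eq intro: DERIV_imp_deriv)
qed

section \<open>The fundamental solutions in complex notation\<close>

text \<open>With d = \<open>dir k\<close>, the identity w Re (w cnj d) / |w|^2 = (d + (w / cnj w)
  cnj d) / 2 splits the rank-one part of the Stokeslet into a constant, which differentiation
  removes, and the quotient w / cnj w.\<close>

lemma stokes_U_complex:
  assumes "y \<noteq> 0"
  shows "cx (stokes_U \<mu> k y) = - (1 / (4 * pi * \<mu>)) * (dir k * of_real (ln (1 / norm y)) +
     (dir k + cx y / cnj (cx y) * cnj (dir k)) / 2)"
proof -
  define w where "w = cx y"
  have w: "w \<noteq> 0" using assms norm_cx[of y] unfolding w_def by (metis norm_eq_zero)
  have nw: "norm y = norm w" by (simp add: w_def)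
  have yk: "y $ k = Re (w * cnj (dir k))"
    using exhaust_2[of k] by (auto simp: w_def dir_def)
  define l r where "l = ln (1 / norm w)" and "r = Re (w * cnj (dir k))"
  define p where "p = complex_of_real (- (1 / (4 * pi * \<mu>)))"
  have "stokes_U \<mu> k y $ j = - (1 / (4 * pi * \<mu>)) * ((if j = k then 1 else 0) * l + y $ j * r / (norm w)\<^sup>2)" for j
    by (simp only: stokes_U_def vec_lambda_beta nw yk l_def r_def)
  moreover have "Re (dir k) = (if 1 = k then 1 else 0)" "Im (dir k) = (if 2 = k then 1 else 0)"
    using exhaust_2[of k] by (auto simp: dir_def)
  ultimately have "cx (stokes_U \<mu> k y) = p * (dir k * of_real l + w * of_real (r / (norm w)\<^sup>2))"
    by (simp add: complex_eq_iff w_def p_def)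
  also have "w * of_real (r / (norm w)\<^sup>2) = (dir k + w / cnj w * cnj (dir k)) / 2"
  proof -
    have r: "2 * of_real r = w * cnj (dir k) + cnj w * dir k"
      using complex_add_cnj[of "w * cnj (dir k)"] by (simp add: r_def)
    have "w * of_real (r / (norm w)\<^sup>2) = w * of_real r / (w * cnj w)"
      by (simp add: complex_norm_square[symmetric])
    also have "\<dots> = (2 * of_real r) / cnj w / 2" using w by simp
    also have "\<dots> = (dir k + w / cnj w * cnj (dir k)) / 2" using w unfolding r by (simp add: field_simps)
    finally show ?thesis .
  qed
  finally show ?thesis by (simp only: w_def nw p_def l_def)
qed

context
  fixes x :: "real ^ 2"
  assumes x: "cx x \<in> Up \<union> Lo"
begin

abbreviation yy :: "real \<Rightarrow> complex" where "yy s \<equiv> cx x - Z s"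

lemma cx_shift: "cx (x - Xi f s) = yy s" by (simp add: cx_diff Xi_eq)

lemma yy_nz: "yy s \<noteq> 0" using off_graph[OF x] by simp

lemma yy_deriv: "(yy has_vector_derivative - Z' s) (at s)"
  using shifted_curve_deriv[of "cx x" 0 s UNIV] by simp

lemma ln_norm_deriv: "((\<lambda>s. ln (1 / norm (yy s))) has_real_derivative Re (Z' s * k1 (yy s))) (at s)"
proof -
  define N where "N s = (x $ 1 - s)\<^sup>2 + (x $ 2 - f s)\<^sup>2" for s
  have N: "N s = (norm (yy s))\<^sup>2" for s by (simp add: N_def cmod_power2)
  have Np: "N s > 0" for s using yy_nz[of s] by (simp add: N)
  have "(N has_real_derivative - 2 * (x $ 1 - s) - 2 * (x $ 2 - f s) * f1 s) (at s)"
    unfolding N_def[abs_def] using f_deriv[of s] by (auto intro!: derivative_eq_intros)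
  from DERIV_chain2[OF DERIV_ln_divide[OF Np] this]
  have "((\<lambda>s. - (1 / 2) * ln (N s)) has_real_derivative - (1 / 2) * (1 / N s * (- 2 * (x $ 1 - s) - 2 * (x $ 2 - f s) * f1 s))) (at s)"
    by (rule DERIV_cmult)
  moreover have "- (1 / 2) * ln (N s) = ln (1 / norm (yy s))" for s
    using yy_nz[of s] by (simp add: N ln_realpow ln_div)
  moreover have "- (1 / 2) * (1 / N s * (- 2 * (x $ 1 - s) - 2 * (x $ 2 - f s) * f1 s)) = Re (Z' s * k1 (yy s))"
  proof -
    have "Re (Z' s * k1 (yy s)) = ((x $ 1 - s) + f1 s * (x $ 2 - f s)) / N s"
      by (simp add: k1_def Re_divide N_def power2_eq_square)
    thus ?thesis by (simp add: algebra_simps add_divide_distrib diff_divide_distrib)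
  qed
  ultimately show ?thesis by simp
qed

lemma stokes_U_deriv:
  "((\<lambda>r. stokes_U \<mu> k (x - Xi f r)) has_vector_derivative
     vc (- (1 / (4 * pi * \<mu>)) * (dir k * of_real (Re (Z' s * k1 (yy s))) +
       (- Z' s * cnj (k1 (yy s)) + cnj (Z' s * k2 (yy s))) * cnj (dir k) / 2))) (at s)"
proof -
  have nz: "yy s \<noteq> 0" "cnj (yy s) \<noteq> 0" for s using yy_nz[of s] by auto
  have "((\<lambda>s. of_real (ln (1 / norm (yy s)))) has_vector_derivative complex_of_real (Re (Z' s * k1 (yy s)))) (at s)"
    using ln_norm_deriv[of s] by (intro has_vector_derivative_of_real) (simp add: has_real_derivative_iff_has_vector_derivative)
  note l = has_vector_derivative_mult_right[OF this, of "dir k"]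
  have ic: "((\<lambda>s. inverse (cnj (yy s))) has_vector_derivative cnj (- Z' s) * - (inverse (cnj (yy s)) * inverse (cnj (yy s)))) (at s)"
    using field_vector_diff_chain_at[OF has_vector_derivative_cnj[OF yy_deriv] DERIV_inverse'[OF DERIV_ident nz(2)]]
    by (simp add: o_def mult_ac)
  have "((\<lambda>s. yy s * inverse (cnj (yy s))) has_vector_derivative
      yy s * (cnj (- Z' s) * - (inverse (cnj (yy s)) * inverse (cnj (yy s)))) + - Z' s * inverse (cnj (yy s))) (at s)"
    by (rule has_vector_derivative_mult[OF yy_deriv ic])
  moreover have "yy s * (cnj (- Z' s) * - (inverse (cnj (yy s)) * inverse (cnj (yy s)))) + - Z' s * inverse (cnj (yy s)) =
     - Z' s * cnj (k1 (yy s)) + cnj (Z' s * k2 (yy s))"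
    by (simp add: k1_def k2_def divide_inverse power2_eq_square)
  ultimately have r: "((\<lambda>s. yy s / cnj (yy s)) has_vector_derivative - Z' s * cnj (k1 (yy s)) + cnj (Z' s * k2 (yy s))) (at s)"
    by (simp add: divide_inverse)
  have "((\<lambda>s. - (1 / (4 * pi * \<mu>)) * (dir k * of_real (ln (1 / norm (yy s))) + (dir k + yy s / cnj (yy s) * cnj (dir k)) / 2)) has_vector_derivative
     - (1 / (4 * pi * \<mu>)) * (dir k * of_real (Re (Z' s * k1 (yy s))) + (0 + (- Z' s * cnj (k1 (yy s)) + cnj (Z' s * k2 (yy s))) * cnj (dir k)) / 2)) (at s)"
    by (intro has_vector_derivative_mult_right has_vector_derivative_add has_vector_derivative_divide l has_vector_derivative_const
        has_vector_derivative_mult_left r)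
  from bounded_linear.has_vector_derivative[OF bounded_linear_vc this]
  have "((\<lambda>s. vc (- (1 / (4 * pi * \<mu>)) * (dir k * of_real (ln (1 / norm (yy s))) + (dir k + yy s / cnj (yy s) * cnj (dir k)) / 2))) has_vector_derivative
     vc (- (1 / (4 * pi * \<mu>)) * (dir k * of_real (Re (Z' s * k1 (yy s))) + (- Z' s * cnj (k1 (yy s)) + cnj (Z' s * k2 (yy s))) * cnj (dir k) / 2))) (at s)"
    by (simp only: add_0)
  moreover have "(\<lambda>s. vc (- (1 / (4 * pi * \<mu>)) * (dir k * of_real (ln (1 / norm (yy s))) + (dir k + yy s / cnj (yy s) * cnj (dir k)) / 2))) =
     (\<lambda>r. stokes_U \<mu> k (x - Xi f r))"
  proof
    fix s
    have "x - Xi f s \<noteq> 0" using yy_nz[of s] cx_shift[of s] by (auto simp: Xi_eq)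
    from stokes_U_complex[OF this, of \<mu> k] show "vc (- (1 / (4 * pi * \<mu>)) * (dir k * of_real (ln (1 / norm (yy s))) + (dir k + yy s / cnj (yy s) * cnj (dir k)) / 2)) =
      stokes_U \<mu> k (x - Xi f s)" unfolding cx_shift norm_cx[symmetric] by (metis vc_cx)
  qed
  ultimately show ?thesis by (simp only:)
qed

lemma velocity_integrand_complex:
  "cx (velocity_integrand \<mu> f x k s) = - (1 / (8 * pi * \<mu>)) *
     (dir k * (of_real (vc (gg s) $ k) * Z' s * k1 (yy s)) + dir k * cnj (of_real (vc (gg s) $ k) * Z' s * k1 (yy s)) -
      cnj (dir k) * cnj (of_real (vc (gg s) $ k) * cnj (Z' s) * k1 (yy s)) + cnj (dir k) * cnj (of_real (vc (gg s) $ k) * Z' s * k2 (yy s)))"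
proof -
  have lin: "cx (c *\<^sub>R v) = of_real c * cx v" for c v by (simp add: complex_eq_iff)
  have Rek: "complex_of_real (Re w) = (w + cnj w) / 2" for w using complex_add_cnj[of w] by simp
  have gen: "c * (- (1 / (4 * p)) * (d * ((w + cw) / 2) + (- v + u) * e / 2)) = - (1 / (8 * p)) * (d * (c * w) + d * (c * cw) - e * (c * v) + e * (c * u))"
    for c p d w cw v u e :: complex
  proof -
    define r where "r = 1 / p"
    have r: "1 / (4 * p) = r / 4" "1 / (8 * p) = r / 8" by (simp_all add: r_def)
    show ?thesis unfolding r by (simp add: field_simps)
  qed
  show ?thesis
    unfolding velocity_integrand_def vector_derivative_at[OF stokes_U_deriv] g_vec_eq lin cx_vc Rek
    using gen[of "of_real (vc (gg s) $ k)" "of_real (pi * \<mu>)" "dir k" "Z' s * k1 (yy s)" "cnj (Z' s * k1 (yy s))" "Z' s * cnj (k1 (yy s))" "cnj (Z' s * k2 (yy s))" "cnj (dir k)"]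
    by (simp add: mult_ac)
qed

lemma component_density: "hoelder_L2 (\<lambda>s. of_real (vc (gg s) $ k))"
  using exhaust_2[of k] hoelder_L2_Re_Im[OF hoelder_L2_gg] by auto

lemma component_density': "hoelder_L2 (\<lambda>s. of_real (vc (gg' s) $ k))"
  using exhaust_2[of k] hoelder_L2_Re_Im[OF hoelder_L2_gg'] by auto

lemma component_integrable:
  "integrable lborel (\<lambda>s. of_real (vc (gg s) $ k) * Z' s * k1 (yy s))"
  "integrable lborel (\<lambda>s. of_real (vc (gg s) $ k) * cnj (Z' s) * k1 (yy s))"
  "integrable lborel (\<lambda>s. of_real (vc (gg s) $ k) * Z' s * k2 (yy s))"
  by (intro pot_integrable x hoelder_L2_mult hoelder_L2_tendsto_0 component_density locally_hoelder_Z' locally_hoelder_cnj)+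

lemma velocity_integrable_complex: "integrable lborel (\<lambda>s. cx (velocity_integrand \<mu> f x k s))"
  unfolding velocity_integrand_complex
  by (intro integrable_mult_right Bochner_Integration.integrable_add Bochner_Integration.integrable_diff
      component_integrable integrable_bounded_linear[OF bounded_linear_cnj])

lemma velocity_integrable: "integrable lborel (velocity_integrand \<mu> f x k)"
  using integrable_bounded_linear[OF bounded_linear_vc velocity_integrable_complex[of \<mu> k]] by simp

text \<open>The factor 1/8 is 1/4 from the Stokeslet times the 1/2 common to real parts and the
  rank-one term. Summation over k recombines the real components into \<open>gg\<close> and its
  conjugate.\<close>

lemma velocity_potential_complex:
  "cx (velocity_potential \<mu> \<sigma>0 f x) = of_real (- \<sigma>0 / (8 * pi * \<mu>)) * vel (cx x)"
proof -
  let ?g = "\<lambda>k s. complex_of_real (vc (gg s) $ k)"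
  have lin: "cx (c *\<^sub>R v) = of_real c * cx v" "cx (v + w) = cx v + cx w" for c v w by (simp_all add: complex_eq_iff)
  have "cx (LINT s|lborel. velocity_integrand \<mu> f x k s) = (LINT s|lborel. cx (velocity_integrand \<mu> f x k s))" for k
    by (rule integral_bounded_linear[OF bounded_linear_cx velocity_integrable, symmetric])
  hence "cx (velocity_potential \<mu> \<sigma>0 f x) = of_real \<sigma>0 * ((LINT s|lborel. cx (velocity_integrand \<mu> f x 1 s)) + (LINT s|lborel. cx (velocity_integrand \<mu> f x 2 s)))"
    by (simp add: velocity_potential_def sum_2 lin)
  also have "\<dots> = of_real \<sigma>0 * (LINT s|lborel. cx (velocity_integrand \<mu> f x 1 s) + cx (velocity_integrand \<mu> f x 2 s))"
    using velocity_integrable_complex by simp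
  also have "(\<lambda>s. cx (velocity_integrand \<mu> f x 1 s) + cx (velocity_integrand \<mu> f x 2 s)) =
    (\<lambda>s. - (1 / (8 * pi * \<mu>)) * (gg s * Z' s * k1 (yy s) +
      cnj ((cnj (gg s) * Z' s - gg s * cnj (Z' s)) * k1 (yy s) + gg s * Z' s * k2 (yy s))))"
  proof
    fix s
    have g: "gg s = of_real (Re (gg s)) + \<i> * of_real (Im (gg s))" by (simp add: complex_eq_iff)
    \<comment> \<open>Weights with \<open>dir k\<close> sum to h and those with
      \<open>cnj (dir k)\<close> to cnj h; moving them under the outer conjugation exchanges the
      two.\<close>
    have gen: "(dir 1 * (of_real c * z * p) + dir 1 * cnj (of_real c * z * p) - cnj (dir 1) * cnj (of_real c * cnj z * p) + cnj (dir 1) * cnj (of_real c * z * q)) +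
       (dir 2 * (of_real d * z * p) + dir 2 * cnj (of_real d * z * p) - cnj (dir 2) * cnj (of_real d * cnj z * p) + cnj (dir 2) * cnj (of_real d * z * q)) =
       h * z * p + cnj ((cnj h * z - h * cnj z) * p + h * z * q)"
      if "h = of_real c + \<i> * of_real d" for c d :: real and h z p q
      unfolding that by (simp add: dir_def algebra_simps)
    show "cx (velocity_integrand \<mu> f x 1 s) + cx (velocity_integrand \<mu> f x 2 s) = - (1 / (8 * pi * \<mu>)) * (gg s * Z' s * k1 (yy s) +
      cnj ((cnj (gg s) * Z' s - gg s * cnj (Z' s)) * k1 (yy s) + gg s * Z' s * k2 (yy s)))"
      unfolding velocity_integrand_complex
      by (rule trans[OF distrib_left[symmetric]], rule arg_cong[where f = "\<lambda>w. complex_of_real (- (1 / (8 * pi * \<mu>))) * w"])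
         (use gen[OF g] in simp)
  qed
  also have "(LINT s|lborel. - (1 / (8 * pi * \<mu>)) * (gg s * Z' s * k1 (yy s) +
      cnj ((cnj (gg s) * Z' s - gg s * cnj (Z' s)) * k1 (yy s) + gg s * Z' s * k2 (yy s)))) = - (1 / (8 * pi * \<mu>)) * vel (cx x)"
  proof -
    have i: "integrable lborel (\<lambda>s. gg s * Z' s * k1 (yy s))" "integrable lborel (\<lambda>s. (cnj (gg s) * Z' s - gg s * cnj (Z' s)) * k1 (yy s))"
      "integrable lborel (\<lambda>s. gg s * Z' s * k2 (yy s))"
      by (intro pot_integrable density_facts x)+
    note i' = Bochner_Integration.integrable_add[OF i(2,3)]
    have "(LINT s|lborel. gg s * Z' s * k1 (yy s) +
      cnj ((cnj (gg s) * Z' s - gg s * cnj (Z' s)) * k1 (yy s) + gg s * Z' s * k2 (yy s))) = vel (cx x)"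
      unfolding Bochner_Integration.integral_add[OF i(1) integrable_bounded_linear[OF bounded_linear_cnj i']]
        integral_bounded_linear[OF bounded_linear_cnj i'] Bochner_Integration.integral_add[OF i(2,3)] vel_def pot_def ..
    thus ?thesis by (simp only: integral_mult_right_zero)
  qed
  finally show ?thesis by simp
qed

lemma pressure_integrand_eq:
  "pressure_integrand f x k s = - (1 / (2 * pi)) * Re (dir k * (of_real (vc (gg' s) $ k) * k1 (yy s)))"
proof -
  have nz: "yy s \<noteq> 0" by (rule yy_nz)
  have yk: "(x - Xi f s) $ k = Re (yy s * cnj (dir k))"
    using exhaust_2[of k] by (auto simp: dir_def Xi_eq)
  have e: "(x - Xi f s) $ k / (norm (x - Xi f s))\<^sup>2 = Re (dir k * k1 (yy s))"
    unfolding yk norm_cx[symmetric, of "x - Xi f s"] cx_shift cmod_power2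
    by (simp add: k1_def Re_divide algebra_simps add_divide_distrib diff_divide_distrib)
  have l: "Re (dir k * (of_real c * w)) = c * Re (dir k * w)" for c w by (simp add: algebra_simps)
  show ?thesis unfolding pressure_integrand_def stokes_P_def g_vec_deriv e l by (simp only: mult_ac)
qed

lemma pressure_integrable: "integrable lborel (pressure_integrand f x k)"
proof -
  have "integrable lborel (\<lambda>s. of_real (vc (gg' s) $ k) * k1 (yy s))"
    by (intro pot_integrable x hoelder_L2_tendsto_0 component_density')
  hence "integrable lborel (\<lambda>s. - (1 / (2 * pi)) * Re (dir k * (of_real (vc (gg' s) $ k) * k1 (yy s))))"
    by (intro integrable_mult_right integrable_Re)
  thus ?thesis by (simp only: pressure_integrand_eq[symmetric])
qed

lemma pressure_potential_complex:
  "pressure_potential \<sigma>0 f x = \<sigma>0 / (2 * pi) * Re (pot k1 gg' (cx x))"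
proof -
  have i: "integrable lborel (\<lambda>s. gg' s * k1 (yy s))" by (intro pot_integrable x g' g'0)
  have "pressure_potential \<sigma>0 f x = - \<sigma>0 * (LINT s|lborel. pressure_integrand f x 1 s + pressure_integrand f x 2 s)"
    using pressure_integrable by (simp add: pressure_potential_def sum_2)
  also have "(\<lambda>s. pressure_integrand f x 1 s + pressure_integrand f x 2 s) = (\<lambda>s. - (1 / (2 * pi)) * Re (gg' s * k1 (yy s)))"
    unfolding pressure_integrand_eq by (rule ext) (simp add: dir_def algebra_simps)
  also have "(LINT s|lborel. - (1 / (2 * pi)) * Re (gg' s * k1 (yy s))) = - (1 / (2 * pi)) * Re (pot k1 gg' (cx x))"
    using i by (simp only: integral_mult_right_zero pot_def integral_Re)
  finally show ?thesis by simp
qed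

end

end

section \<open>Existence and uniqueness of the two-phase solution\<close>

context graph_curve
begin

lemma decay_CS:
  fixes F :: "complex \<Rightarrow> 'a::real_normed_vector"
  assumes \<sigma>: "\<sigma> = 1 \<or> \<sigma> = - 1" and c: "continuous_on UNIV F" and d: "(F \<longlongrightarrow> 0) (inf at_infinity (principal (Side \<sigma>)))"
  shows "(F \<longlongrightarrow> 0) (inf at_infinity (principal (CS \<sigma>)))"
  unfolding tendsto_iff eventually_inf_principal eventually_at_infinity
proof (intro allI impI)
  fix e :: real assume e: "e > 0"
  have "\<forall>\<^sub>F z in inf at_infinity (principal (Side \<sigma>)). dist (F z) 0 < e / 2"
    using e by (intro tendstoD[OF d]) simp
  then obtain b where b: "\<And>z. b \<le> norm z \<Longrightarrow> z \<in> Side \<sigma> \<Longrightarrow> norm (F z) < e / 2"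
    unfolding eventually_inf_principal eventually_at_infinity by auto
  \<comment> \<open>The bound is raised by 1 because the pushed points lie within distance 1 of
    z.\<close>
  have "norm (F z) \<le> e / 2" if z: "b + 1 \<le> norm z" "z \<in> CS \<sigma>" for z
  proof (rule tendsto_upperbound)
    let ?w = "\<lambda>n. z + of_real (\<sigma> * inverse (real (Suc n))) * \<i>"
    show "(\<lambda>n. norm (F (?w n))) \<longlonglongrightarrow> norm (F z)"
      by (intro tendsto_norm continuous_on_tendsto_compose[OF c push_tendsto]) auto
    have "?w n \<in> Side \<sigma>" for n
      using CS_push[OF z(2) \<sigma>] by (metis inverse_positive_iff_positive of_nat_0_less_iff zero_less_Suc)
    moreover have "b \<le> norm (?w n)" for n
    proof -
      have "norm (complex_of_real (\<sigma> * inverse (real (Suc n))) * \<i>) = inverse (real (Suc n))"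
        using \<sigma> by (auto simp: norm_mult norm_inverse simp del: of_nat_Suc)
      moreover have "inverse (real (Suc n)) \<le> 1" by (simp add: field_simps)
      moreover have "norm z - norm (complex_of_real (\<sigma> * inverse (real (Suc n))) * \<i>) \<le> norm (?w n)"
        by (rule norm_diff_ineq)
      ultimately show ?thesis using z(1) by linarith
    qed
    ultimately show "\<forall>\<^sub>F n in sequentially. norm (F (?w n)) \<le> e / 2"
      using b by (intro always_eventually allI less_imp_le) blast
  qed simp
  thus "\<exists>b. \<forall>z. b \<le> norm z \<longrightarrow> z \<in> CS \<sigma> \<longrightarrow> dist (F z) 0 < e"
    using e by (intro exI[of _ "b + 1"]) fastforce
qed

lemma goursat_stokes_data:
  assumes \<sigma>: "\<sigma> = 1 \<or> \<sigma> = - 1" and hol: "A holomorphic_on Side \<sigma>" "B holomorphic_on Side \<sigma>"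
    and cont: "continuous_on (CS \<sigma>) V" "continuous_on (CS \<sigma>) a" "continuous_on (CS \<sigma>) b" "continuous_on (CS \<sigma>) Q"
    and V: "\<And>z. z \<in> Side \<sigma> \<Longrightarrow> V z = A z + cnj (B z) - z * cnj (deriv A z)"
    and a: "\<And>z. z \<in> Side \<sigma> \<Longrightarrow> a z = deriv A z - cnj (deriv A z)"
    and b: "\<And>z. z \<in> Side \<sigma> \<Longrightarrow> b z = cnj (deriv B z) - z * cnj (deriv (deriv A) z)"
    and Q: "\<And>z. z \<in> Side \<sigma> \<Longrightarrow> Q z = - 4 * \<mu> * Re (deriv A z)"
    and decay: "(V \<longlongrightarrow> 0) (inf at_infinity (principal (CS \<sigma>)))" "(Q \<longlongrightarrow> 0) (inf at_infinity (principal (CS \<sigma>)))"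
  shows "stokes_data \<mu> \<sigma> V a b Q"
  unfolding stokes_data_def
proof (intro conjI ballI cont decay)
  fix z assume z: "z \<in> Side \<sigma>"
  show "(V has_derivative (\<lambda>h. a z * h + b z * cnj h)) (at z)"
    by (rule goursat_derivative[where A = A and B = B and a = a and b = b, OF hol V a[OF z] b[OF z] z])
  show "Re (a z) = 0" by (simp add: a[OF z])
next
  have "(\<lambda>z. - 4 * of_real \<mu> * deriv A z) holomorphic_on Side \<sigma>"
    by (intro holomorphic_intros holomorphic_deriv hol open_Side)
  moreover have "- 4 * of_real \<mu> * deriv A z = of_real (Q z) - 2 * of_real \<mu> * a z" if "z \<in> Side \<sigma>" for z
    by (simp add: a[OF that] Q[OF that] complex_eq_iff)
  ultimately show "(\<lambda>z. of_real (Q z) - 2 * of_real \<mu> * a z) holomorphic_on Side \<sigma>"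
    by (rule holomorphic_transform)
qed

text \<open>Incompressibility persists up to the graph and removes the term with Re a from the
  traction, so only the pressure and b jump.\<close>

lemma stress_jump_mult:
  assumes p: "stokes_data \<mu> 1 (\<lambda>z. cx (vp (vc z))) ap bp (\<lambda>z. qp (vc z))"
    and m: "stokes_data \<mu> (- 1) (\<lambda>z. cx (vm (vc z))) am bm (\<lambda>z. qm (vc z))"
  shows "cx (jump f (stress \<mu> vp qp) (stress \<mu> vm qm) (vc (Z s)) *v vc n) =
    - of_real (qp (vc (Z s)) - qm (vc (Z s))) * n + 2 * of_real \<mu> * (bp (Z s) - bm (Z s)) * cnj n"
proof -
  have ra: "Re (ap (Z s)) = 0" "Re (am (Z s)) = 0"
    using stokes_data_Re_a[OF p _ Z_in_CS] stokes_data_Re_a[OF m _ Z_in_CS] by auto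
  show ?thesis
    unfolding jump_def domains stress_limit[OF p disjI1[OF refl]] stress_limit[OF m disjI2[OF refl]]
      matrix_vector_mult_diff_rdistrib cx_diff stress_matrix_mult ra
    by (simp add: algebra_simps)
qed

end

context H3_graph
begin

context
  fixes \<mu> \<sigma>0 :: real
  assumes \<mu>: "\<mu> > 0"
begin

section \<open>Boundary extensions of the layer potentials\<close>

text \<open>The factor between \<open>vel\<close> and the velocity potential;
  \<open>\<sigma>0\<close> is the surface tension, while \<sigma> below is the side.\<close>

definition stokes_coef :: real where "stokes_coef = - \<sigma>0 / (8 * pi * \<mu>)"

text \<open>\<open>vel\<close> with every potential replaced by its one-sided extension, so that
  values on the graph are available; the next two definitions treat the Wirtinger derivatives
  likewise.\<close>

definition ext_velocity :: "real \<Rightarrow> complex \<Rightarrow> complex" where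
  "ext_velocity \<sigma> z = of_real stokes_coef * (ext1 (\<lambda>s. gg s * Z' s) \<sigma> z +
     cnj (ext1 (\<lambda>s. cnj (gg s) * Z' s - gg s * cnj (Z' s)) \<sigma> z + ext2 (\<lambda>s. gg s * Z' s) \<sigma> z))"

definition ext_dz :: "real \<Rightarrow> complex \<Rightarrow> complex" where
  "ext_dz \<sigma> z = of_real stokes_coef * (ext1 gg' \<sigma> z - cnj (ext1 gg' \<sigma> z))"

definition ext_dzbar :: "real \<Rightarrow> complex \<Rightarrow> complex" where
  "ext_dzbar \<sigma> z = of_real stokes_coef * cnj (ext1 (\<lambda>s. cnj (gg' s)) \<sigma> z + ext2 gg' \<sigma> z)"

text \<open>The Goursat pressure - 4 \<mu> Re A' of the scaled A; the prefactor equals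
  \<open>\<sigma>0 / (2 * pi)\<close>.\<close>

definition ext_pressure :: "real \<Rightarrow> complex \<Rightarrow> real" where
  "ext_pressure \<sigma> z = - 4 * \<mu> * stokes_coef * Re (ext1 gg' \<sigma> z)"

context
  fixes \<sigma> :: real
  assumes \<sigma>: "\<sigma> = 1 \<or> \<sigma> = - 1"
begin

lemmas ext1_gZ' = ext1_properties[OF density_facts(1,2) \<sigma>]
lemmas ext1_commutator = ext1_properties[OF density_facts(5,6) \<sigma>]
lemmas ext2_gZ' = ext2_properties[OF density_facts(1,2) \<sigma>]
lemmas ext1_g' = ext1_properties[OF g' g'0 \<sigma>]
lemmas ext1_cnj_g' = ext1_properties[OF density_facts(3,4) \<sigma>]
lemmas ext2_g' = ext2_properties[OF g' g'0 \<sigma>]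

lemma extension_continuous:
  "continuous_on UNIV (ext_velocity \<sigma>)" "continuous_on UNIV (ext_dz \<sigma>)" "continuous_on UNIV (ext_dzbar \<sigma>)" "continuous_on UNIV (ext_pressure \<sigma>)"
  unfolding ext_velocity_def[abs_def] ext_dz_def[abs_def] ext_dzbar_def[abs_def] ext_pressure_def[abs_def]
  by (intro continuous_intros ext1_gZ' ext1_commutator ext2_gZ' ext1_g' ext1_cnj_g' ext2_g')+

lemma extension_decay:
  "(ext_velocity \<sigma> \<longlongrightarrow> 0) (inf at_infinity (principal (CS \<sigma>)))" "(ext_pressure \<sigma> \<longlongrightarrow> 0) (inf at_infinity (principal (CS \<sigma>)))"
proof -
  have "(ext_velocity \<sigma> \<longlongrightarrow> of_real stokes_coef * (0 + cnj (0 + 0))) (inf at_infinity (principal (Side \<sigma>)))"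
    "(ext_pressure \<sigma> \<longlongrightarrow> - 4 * \<mu> * stokes_coef * Re 0) (inf at_infinity (principal (Side \<sigma>)))"
    unfolding ext_velocity_def[abs_def] ext_pressure_def[abs_def] by (intro tendsto_intros ext1_gZ' ext1_commutator ext2_gZ' ext1_g' ext1_cnj_g' ext2_g')+
  thus "(ext_velocity \<sigma> \<longlongrightarrow> 0) (inf at_infinity (principal (CS \<sigma>)))" "(ext_pressure \<sigma> \<longlongrightarrow> 0) (inf at_infinity (principal (CS \<sigma>)))"
    by (auto intro!: decay_CS[OF \<sigma>] extension_continuous)
qed

lemma ext_velocity_Side: "z \<in> Side \<sigma> \<Longrightarrow> ext_velocity \<sigma> z = of_real stokes_coef * vel z"
  by (simp add: ext_velocity_def vel_def ext1_gZ'(2) ext1_commutator(2) ext2_gZ'(2))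

lemma ext_dz_Side: "z \<in> Side \<sigma> \<Longrightarrow> ext_dz \<sigma> z = of_real stokes_coef * (pot k1 gg' z - cnj (pot k1 gg' z))"
  by (simp add: ext_dz_def ext1_g'(2))

lemma ext_dzbar_Side: "z \<in> Side \<sigma> \<Longrightarrow> ext_dzbar \<sigma> z = of_real stokes_coef * cnj (vel_dbar z)"
  by (simp add: ext_dzbar_def vel_dbar_def ext1_cnj_g'(2) ext2_g'(2))

lemma ext_pressure_Side: "z \<in> Side \<sigma> \<Longrightarrow> ext_pressure \<sigma> z = - 4 * \<mu> * stokes_coef * Re (pot k1 gg' z)"
  by (simp add: ext_pressure_def ext1_g'(2))

text \<open>Inside the side, the Goursat functions of \<open>vel\<close> scaled by
  \<open>stokes_coef\<close> certify the Stokes system; regularity up to the graph is contributed by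
  the extensions.\<close>

lemma extension_solves:
  "stokes_data \<mu> \<sigma> (ext_velocity \<sigma>) (ext_dz \<sigma>) (ext_dzbar \<sigma>) (ext_pressure \<sigma>)"
  "stokes_regular (cx -` Side \<sigma>) (\<lambda>x. vc (ext_velocity \<sigma> (cx x))) (\<lambda>x. ext_pressure \<sigma> (cx x))"
  "stokes_equations \<mu> (cx -` Side \<sigma>) (\<lambda>x. vc (ext_velocity \<sigma> (cx x))) (\<lambda>x. ext_pressure \<sigma> (cx x))"
proof -
  obtain A B where hAB: "A holomorphic_on (Up \<union> Lo)" "B holomorphic_on (Up \<union> Lo)"
    and A: "\<And>z. z \<in> Up \<union> Lo \<Longrightarrow> deriv A z = pot k1 gg' z"
    and B: "\<And>z. z \<in> Up \<union> Lo \<Longrightarrow> deriv B z - cnj z * deriv (deriv A) z = vel_dbar z"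
    and AB: "\<And>z. z \<in> Up \<union> Lo \<Longrightarrow> vel z = A z + cnj (B z) - z * cnj (deriv A z)"
    using goursat_representation by metis
  note sub = subsetD[OF Side_subset[of \<sigma>]]
  note hs = hAB[THEN holomorphic_on_subset, OF Side_subset[of \<sigma>]]
  let ?A = "\<lambda>z. of_real stokes_coef * A z" and ?B = "\<lambda>z. of_real stokes_coef * B z"
  have dA: "deriv ?A z = of_real stokes_coef * deriv A z" and dB: "deriv ?B z = of_real stokes_coef * deriv B z" if "z \<in> Side \<sigma>" for z
    using hs that open_Side by (auto intro!: deriv_cmult holomorphic_on_imp_differentiable_at)
  have ddA: "deriv (deriv ?A) z = of_real stokes_coef * deriv (deriv A) z" if z: "z \<in> Side \<sigma>" for z
  proof -
    have "deriv (deriv ?A) z = deriv (\<lambda>z. of_real stokes_coef * deriv A z) z"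
      by (intro deriv_cong_ev refl eventually_mono[OF eventually_nhds_in_open[OF open_Side z]] dA)
    also have "\<dots> = of_real stokes_coef * deriv (deriv A) z"
      using holomorphic_deriv[OF hs(1) open_Side] z open_Side by (auto intro!: deriv_cmult holomorphic_on_imp_differentiable_at)
    finally show ?thesis .
  qed
  have hol: "?A holomorphic_on Side \<sigma>" "?B holomorphic_on Side \<sigma>" by (intro holomorphic_intros hs)+
  have c: "continuous_on (CS \<sigma>) (ext_velocity \<sigma>)" "continuous_on (CS \<sigma>) (ext_dz \<sigma>)" "continuous_on (CS \<sigma>) (ext_dzbar \<sigma>)" "continuous_on (CS \<sigma>) (ext_pressure \<sigma>)"
    by (rule continuous_on_subset[OF _ subset_UNIV], rule extension_continuous)+
  have V: "ext_velocity \<sigma> z = ?A z + cnj (?B z) - z * cnj (deriv ?A z)" if "z \<in> Side \<sigma>" for z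
    unfolding ext_velocity_Side[OF that] AB[OF sub[OF that]] dA[OF that] by (simp add: algebra_simps)
  have a: "ext_dz \<sigma> z = deriv ?A z - cnj (deriv ?A z)" if "z \<in> Side \<sigma>" for z
    unfolding ext_dz_Side[OF that] A[OF sub[OF that], symmetric] dA[OF that] by (simp add: algebra_simps)
  have b: "ext_dzbar \<sigma> z = cnj (deriv ?B z) - z * cnj (deriv (deriv ?A) z)" if "z \<in> Side \<sigma>" for z
    unfolding ext_dzbar_Side[OF that] B[OF sub[OF that], symmetric] dB[OF that] ddA[OF that] by (simp add: algebra_simps)
  have Q: "ext_pressure \<sigma> z = - 4 * \<mu> * Re (deriv ?A z)" if "z \<in> Side \<sigma>" for z
    unfolding ext_pressure_Side[OF that] A[OF sub[OF that], symmetric] dA[OF that] by simp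
  show "stokes_data \<mu> \<sigma> (ext_velocity \<sigma>) (ext_dz \<sigma>) (ext_dzbar \<sigma>) (ext_pressure \<sigma>)"
    by (rule goursat_stokes_data[OF \<sigma> hol c V a b Q extension_decay])
  show "stokes_regular (cx -` Side \<sigma>) (\<lambda>x. vc (ext_velocity \<sigma> (cx x))) (\<lambda>x. ext_pressure \<sigma> (cx x))"
    by (rule goursat_solves_stokes(1)[OF \<sigma> hol c V a b Q])
  show "stokes_equations \<mu> (cx -` Side \<sigma>) (\<lambda>x. vc (ext_velocity \<sigma> (cx x))) (\<lambda>x. ext_pressure \<sigma> (cx x))"
    by (rule goursat_solves_stokes(2)[OF \<sigma> hol c V a b Q])
qed

lemma extension_vanishes:
  "vanishes_at_infinity (closure (cx -` Side \<sigma>)) (\<lambda>x. vc (ext_velocity \<sigma> (cx x)))"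
  "vanishes_at_infinity (closure (cx -` Side \<sigma>)) (\<lambda>x. ext_pressure \<sigma> (cx x))"
proof -
  have "((\<lambda>z. vc (ext_velocity \<sigma> z)) \<longlongrightarrow> vc 0) (inf at_infinity (principal (CS \<sigma>)))"
    by (rule bounded_linear.tendsto[OF bounded_linear_vc extension_decay(1)])
  moreover have "vc 0 = 0" by (simp add: vec_eq_iff forall_2)
  ultimately show "vanishes_at_infinity (closure (cx -` Side \<sigma>)) (\<lambda>x. vc (ext_velocity \<sigma> (cx x)))"
    by (simp add: vanishes_at_infinity_def closure_domain[OF \<sigma>] decay_vimage_cx)
  show "vanishes_at_infinity (closure (cx -` Side \<sigma>)) (\<lambda>x. ext_pressure \<sigma> (cx x))"
    using extension_decay(2) by (simp add: vanishes_at_infinity_def closure_domain[OF \<sigma>] decay_vimage_cx)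
qed

lemma extension_potentials:
  assumes "x \<in> cx -` Side \<sigma>"
  shows "vc (ext_velocity \<sigma> (cx x)) = velocity_potential \<mu> \<sigma>0 f x" "ext_pressure \<sigma> (cx x) = pressure_potential \<sigma>0 f x"
proof -
  have x: "cx x \<in> Side \<sigma>" "cx x \<in> Up \<union> Lo" using assms Side_subset by auto
  have "cx (velocity_potential \<mu> \<sigma>0 f x) = ext_velocity \<sigma> (cx x)"
    unfolding velocity_potential_complex[OF x(2)] ext_velocity_Side[OF x(1)] stokes_coef_def ..
  thus "vc (ext_velocity \<sigma> (cx x)) = velocity_potential \<mu> \<sigma>0 f x" by (metis vc_cx)
  show "ext_pressure \<sigma> (cx x) = pressure_potential \<sigma>0 f x"
    unfolding pressure_potential_complex[OF x(2)] ext_pressure_Side[OF x(1)] stokes_coef_def using \<mu> by simp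
qed

end

text \<open>The first Cauchy term jumps by - 2 pi \<i> g. Under the conjugation the two
  contributions with g cnj \<open>Z'\<close> / \<open>Z'\<close> cancel, and what is left, the
  conjugate of - 2 pi \<i> cnj g, compensates the first jump.\<close>

lemma ext_velocity_jump: "ext_velocity 1 (Z s) = ext_velocity (- 1) (Z s)"
proof -
  have nz: "Z' s \<noteq> 0" using norm_Z'_ge[of s] by auto
  have "ext_velocity 1 (Z s) - ext_velocity (- 1) (Z s) = of_real stokes_coef *
    ((ext1 (\<lambda>s. gg s * Z' s) 1 (Z s) - ext1 (\<lambda>s. gg s * Z' s) (- 1) (Z s)) +
     cnj ((ext1 (\<lambda>s. cnj (gg s) * Z' s - gg s * cnj (Z' s)) 1 (Z s) - ext1 (\<lambda>s. cnj (gg s) * Z' s - gg s * cnj (Z' s)) (- 1) (Z s)) +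
      (ext2 (\<lambda>s. gg s * Z' s) 1 (Z s) - ext2 (\<lambda>s. gg s * Z' s) (- 1) (Z s))))"
    by (simp add: ext_velocity_def algebra_simps)
  also have "\<dots> = 0"
    unfolding ext1_jump ext2_jump using nz by (simp add: field_simps power2_eq_square)
  finally show ?thesis by simp
qed

text \<open>By Plemelj's formulas the terms with cnj \<open>gg'\<close> from the pressure and from
  the strain cancel, while those with \<open>gg'\<close> add up to 8 pi \<mu>
  \<open>stokes_coef\<close> \<open>gg'\<close>; the value of \<open>stokes_coef\<close> turns this
  into the surface tension.\<close>

lemma extension_stress_jump:
  "- of_real (ext_pressure 1 (Z s) - ext_pressure (- 1) (Z s)) * (\<i> * Z' s / of_real (om s)) +
     2 * of_real \<mu> * (ext_dzbar 1 (Z s) - ext_dzbar (- 1) (Z s)) * cnj (\<i> * Z' s / of_real (om s)) =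
   - of_real \<sigma>0 * (gg' s / of_real (om s))"
proof -
  have nz: "Z' s \<noteq> 0" "cnj (Z' s) \<noteq> 0" using norm_Z'_ge[of s] by auto
  \<comment> \<open>Conjugates receive letters of their own, so that the identity becomes rational
    in independent quantities.\<close>
  define P M C h h' z z' where "P = complex_of_real pi" and "M = complex_of_real \<mu>" and "C = complex_of_real stokes_coef"
    and "h = gg' s" and "h' = cnj (gg' s)" and "z = Z' s" and "z' = cnj (Z' s)"
  note defs = P_def M_def C_def h_def h'_def z_def z'_def
  have "ext_pressure 1 (Z s) - ext_pressure (- 1) (Z s) = - 4 * \<mu> * stokes_coef * Re (ext1 gg' 1 (Z s) - ext1 gg' (- 1) (Z s))"
    by (simp add: ext_pressure_def algebra_simps)
  hence "complex_of_real (ext_pressure 1 (Z s) - ext_pressure (- 1) (Z s)) = - 4 * M * C * complex_of_real (Re (- 2 * P * \<i> * h / z))"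
    by (simp add: ext1_jump defs)
  also have "complex_of_real (Re (- 2 * P * \<i> * h / z)) = (- 2 * P * \<i> * h / z + cnj (- 2 * P * \<i> * h / z)) / 2"
    using complex_add_cnj[of "- 2 * P * \<i> * h / z"] by simp
  also have "cnj (- 2 * P * \<i> * h / z) = 2 * P * \<i> * h' / z'" by (simp add: defs)
  finally have Q: "complex_of_real (ext_pressure 1 (Z s) - ext_pressure (- 1) (Z s)) = - 4 * M * C * ((- 2 * P * \<i> * h / z + 2 * P * \<i> * h' / z') / 2)" .
  have "ext_dzbar 1 (Z s) - ext_dzbar (- 1) (Z s) = C * cnj ((ext1 (\<lambda>s. cnj (gg' s)) 1 (Z s) - ext1 (\<lambda>s. cnj (gg' s)) (- 1) (Z s)) +
      (ext2 gg' 1 (Z s) - ext2 gg' (- 1) (Z s)))"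
    by (simp add: ext_dzbar_def C_def algebra_simps)
  also have "\<dots> = C * (2 * P * \<i> * h / z' + 2 * P * \<i> * h' * z / z'\<^sup>2)"
    unfolding ext1_jump ext2_jump by (simp add: defs)
  finally have b: "ext_dzbar 1 (Z s) - ext_dzbar (- 1) (Z s) = C * (2 * P * \<i> * h / z' + 2 * P * \<i> * h' * z / z'\<^sup>2)" .
  have n: "cnj (\<i> * z / complex_of_real (om s)) = - (\<i> * z') / complex_of_real (om s)" by (simp add: defs)
  have "- (- 4 * M * C * ((- 2 * P * \<i> * h / z + 2 * P * \<i> * h' / z') / 2)) * (\<i> * z) +
      2 * M * (C * (2 * P * \<i> * h / z' + 2 * P * \<i> * h' * z / z'\<^sup>2)) * - (\<i> * z') = 8 * P * M * C * h"
  proof -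
    have nz': "z \<noteq> 0" "z' \<noteq> 0" using nz by (simp_all add: defs)
    define X Y where "X = h / z" and "Y = h' / z'"
    have XY: "- 2 * P * \<i> * h / z = - 2 * P * \<i> * X" "2 * P * \<i> * h' / z' = 2 * P * \<i> * Y" "h = X * z"
      "2 * P * \<i> * h' * z / z'\<^sup>2 = 2 * P * \<i> * Y * z / z'"
      using nz' by (simp_all add: X_def Y_def power2_eq_square)
    have m: "2 * M * (C * (u / z' + v / z')) * - (\<i> * z') = - 2 * M * C * \<i> * (u + v)" for u v
      using nz' by (simp add: field_simps)
    have q: "- (- 4 * M * C * (u / 2)) = 2 * M * C * u" for u by simp
    show ?thesis unfolding XY m q using nz' by (simp add: algebra_simps)
  qed
  moreover have "8 * P * M * C = - complex_of_real \<sigma>0"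
  proof -
    have "8 * pi * \<mu> * stokes_coef = - \<sigma>0" using \<mu> by (simp add: stokes_coef_def)
    from arg_cong[where f = complex_of_real, OF this] show ?thesis by (simp add: defs)
  qed
  ultimately have key: "- (- 4 * M * C * ((- 2 * P * \<i> * h / z + 2 * P * \<i> * h' / z') / 2)) * (\<i> * z) +
      2 * M * (C * (2 * P * \<i> * h / z' + 2 * P * \<i> * h' * z / z'\<^sup>2)) * - (\<i> * z') = - complex_of_real \<sigma>0 * h"
    by (simp only:)
  have divide: "u * (x / r) + v * (y / r) = w * (t / r)" if "u * x + v * y = w * t" for u v w x y r t :: complex
    using arg_cong[OF that, of "\<lambda>c. c / r"] by (simp add: add_divide_distrib)
  show ?thesis
    unfolding Q b M_def[symmetric] z_def[symmetric] h_def[symmetric] n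
    using divide[OF key, of "complex_of_real (om s)"] by (simp only: minus_divide_left)
qed

lemma interface_param: "p \<in> interface f \<longleftrightarrow> (\<exists>s. p = vc (Z s))"
  by (auto simp: interface_def Xi_eq)

lemma stress_rhs: "cx (- \<sigma>0 *\<^sub>R ((\<lambda>\<xi>. curvature f \<xi> *\<^sub>R normal f \<xi>) \<circ> inv (Xi f)) (vc (Z s))) =
  - of_real \<sigma>0 * (gg' s / of_real (om s))"
proof -
  have lin: "cx (c *\<^sub>R v) = of_real c * cx v" for c v by (simp add: complex_eq_iff)
  have "cx (- \<sigma>0 *\<^sub>R ((\<lambda>\<xi>. curvature f \<xi> *\<^sub>R normal f \<xi>) \<circ> inv (Xi f)) (vc (Z s))) =
    of_real (- \<sigma>0) * (of_real (curvature f s) * (\<i> * Z' s / of_real (om s)))"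
    unfolding o_def inv_Xi lin normal_eq cx_vc ..
  thus ?thesis unfolding curvature_normal by simp
qed

lemma two_phase_extension:
  "two_phase_stokes_solution \<mu> \<sigma>0 f (\<lambda>x. vc (ext_velocity 1 (cx x))) (\<lambda>x. ext_pressure 1 (cx x)) (\<lambda>x. vc (ext_velocity (- 1) (cx x))) (\<lambda>x. ext_pressure (- 1) (cx x))"
proof -
  have p: "(1::real) = 1 \<or> (1::real) = - 1" and m: "- (1::real) = 1 \<or> - (1::real) = - 1" by simp_all
  have dp: "stokes_data \<mu> 1 (\<lambda>z. cx (vc (ext_velocity 1 (cx (vc z))))) (ext_dz 1) (ext_dzbar 1) (\<lambda>z. ext_pressure 1 (cx (vc z)))"
    and dm: "stokes_data \<mu> (- 1) (\<lambda>z. cx (vc (ext_velocity (- 1) (cx (vc z))))) (ext_dz (- 1)) (ext_dzbar (- 1)) (\<lambda>z. ext_pressure (- 1) (cx (vc z)))"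
    using extension_solves(1)[OF p] extension_solves(1)[OF m] by simp_all
  have "cx (jump f (stress \<mu> (\<lambda>x. vc (ext_velocity 1 (cx x))) (\<lambda>x. ext_pressure 1 (cx x))) (stress \<mu> (\<lambda>x. vc (ext_velocity (- 1) (cx x))) (\<lambda>x. ext_pressure (- 1) (cx x))) (vc (Z s)) *v
       (normal f \<circ> inv (Xi f)) (vc (Z s))) =
      cx (- \<sigma>0 *\<^sub>R ((\<lambda>\<xi>. curvature f \<xi> *\<^sub>R normal f \<xi>) \<circ> inv (Xi f)) (vc (Z s)))" for s
    unfolding stress_rhs unfolding o_def inv_Xi normal_eq stress_jump_mult[OF dp dm]
    using extension_stress_jump[of s] by simp
  thus ?thesis
    unfolding two_phase_stokes_solution_def domains
    using extension_solves(2,3)[OF p] extension_solves(2,3)[OF m] extension_vanishes[OF p] extension_vanishes[OF m]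
    by (auto simp: interface_param ext_velocity_jump cx_eq_iff)
qed

lemma two_phase_unique:
  assumes 1: "two_phase_stokes_solution \<mu> \<sigma>0 f vp qp vm qm" and 2: "two_phase_stokes_solution \<mu> \<sigma>0 f vp' qp' vm' qm'"
  shows "x \<in> closure (upper_domain f) \<Longrightarrow> vp' x = vp x \<and> qp' x = qp x"
    "x \<in> closure (lower_domain f) \<Longrightarrow> vm' x = vm x \<and> qm' x = qm x"
proof -
  have p: "(1::real) = 1 \<or> (1::real) = - 1" and m: "- (1::real) = 1 \<or> - (1::real) = - 1" by simp_all
  note sol = 1[unfolded two_phase_stokes_solution_def domains] 2[unfolded two_phase_stokes_solution_def domains]
  obtain ap bp where dp: "stokes_data \<mu> 1 (\<lambda>z. cx (vp (vc z))) ap bp (\<lambda>z. qp (vc z))"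
    using stokes_data_of_solution[OF p, of vp qp \<mu>] sol by blast
  obtain am bm where dm: "stokes_data \<mu> (- 1) (\<lambda>z. cx (vm (vc z))) am bm (\<lambda>z. qm (vc z))"
    using stokes_data_of_solution[OF m, of vm qm \<mu>] sol by blast
  obtain ap' bp' where dp': "stokes_data \<mu> 1 (\<lambda>z. cx (vp' (vc z))) ap' bp' (\<lambda>z. qp' (vc z))"
    using stokes_data_of_solution[OF p, of vp' qp' \<mu>] sol by blast
  obtain am' bm' where dm': "stokes_data \<mu> (- 1) (\<lambda>z. cx (vm' (vc z))) am' bm' (\<lambda>z. qm' (vc z))"
    using stokes_data_of_solution[OF m, of vm' qm' \<mu>] sol by blast
  note ep = stokes_data_diff[OF dp' dp] and em = stokes_data_diff[OF dm' dm]
  \<comment> \<open>The differences on the two sides are packed into families indexed by the sign,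
    the form that \<open>homogeneous_uniqueness\<close> expects.\<close>
  define V where "V \<sigma> = (if \<sigma> = 1 then (\<lambda>z. cx (vp' (vc z)) - cx (vp (vc z))) else (\<lambda>z. cx (vm' (vc z)) - cx (vm (vc z))))" for \<sigma> :: real
  define a where "a \<sigma> = (if \<sigma> = 1 then (\<lambda>z. ap' z - ap z) else (\<lambda>z. am' z - am z))" for \<sigma> :: real
  define b where "b \<sigma> = (if \<sigma> = 1 then (\<lambda>z. bp' z - bp z) else (\<lambda>z. bm' z - bm z))" for \<sigma> :: real
  define Q where "Q \<sigma> = (if \<sigma> = 1 then (\<lambda>z. qp' (vc z) - qp (vc z)) else (\<lambda>z. qm' (vc z) - qm (vc z)))" for \<sigma> :: real
  have d: "stokes_data \<mu> \<sigma> (V \<sigma>) (a \<sigma>) (b \<sigma>) (Q \<sigma>)" if "\<sigma> = 1 \<or> \<sigma> = - 1" for \<sigma>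
    using that ep em unfolding V_def a_def b_def Q_def by auto
  have iface: "vc (Z s) \<in> interface f" for s by (auto simp: interface_param)
  have T: "- of_real (Q 1 (Z s) - Q (-1) (Z s)) * (\<i> * Z' s) + 2 * of_real \<mu> * (b 1 (Z s) - b (-1) (Z s)) * cnj (\<i> * Z' s) = 0" for s
  proof -
    let ?n = "\<i> * Z' s / of_real (om s)"
    have o: "om s \<noteq> 0" using om_ge[of s] by auto
    have j: "cx (jump f (stress \<mu> vp qp) (stress \<mu> vm qm) (vc (Z s)) *v vc ?n) = - of_real \<sigma>0 * (gg' s / of_real (om s))"
      if "two_phase_stokes_solution \<mu> \<sigma>0 f vp qp vm qm" for vp qp vm qm
    proof -
      have "jump f (stress \<mu> vp qp) (stress \<mu> vm qm) (vc (Z s)) *v (normal f \<circ> inv (Xi f)) (vc (Z s))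
          = - \<sigma>0 *\<^sub>R ((\<lambda>\<xi>. curvature f \<xi> *\<^sub>R normal f \<xi>) \<circ> inv (Xi f)) (vc (Z s))"
        using that iface[of s] unfolding two_phase_stokes_solution_def by blast
      from arg_cong[where f = cx, OF this] show ?thesis
        unfolding stress_rhs unfolding o_def inv_Xi normal_eq .
    qed
    have "(- of_real (Q 1 (Z s) - Q (-1) (Z s)) * ?n + 2 * of_real \<mu> * (b 1 (Z s) - b (-1) (Z s)) * cnj ?n) = 0"
    proof -
      have "- of_real ((p' - p) - (m' - m)) * n + 2 * of_real \<mu> * ((x' - x) - (y' - y)) * c =
        (- of_real (p' - m') * n + 2 * of_real \<mu> * (x' - y') * c) - (- of_real (p - m) * n + 2 * of_real \<mu> * (x - y) * c)"
        for p p' m m' :: real and x x' y y' n c :: complex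
        by (simp add: algebra_simps)
      from this[of "qp' (vc (Z s))" "qp (vc (Z s))" "qm' (vc (Z s))" "qm (vc (Z s))" ?n "bp' (Z s)" "bp (Z s)" "bm' (Z s)" "bm (Z s)" "cnj ?n"]
      show ?thesis
        unfolding Q_def b_def
          j[OF 1, unfolded stress_jump_mult[OF dp dm]] j[OF 2, unfolded stress_jump_mult[OF dp' dm']] by simp
    qed
    \<comment> \<open>Multiplication by \<open>om\<close> removes the normalisation of the
      normal.\<close>
    hence "(- of_real (Q 1 (Z s) - Q (-1) (Z s)) * ?n + 2 * of_real \<mu> * (b 1 (Z s) - b (-1) (Z s)) * cnj ?n) * of_real (om s) = 0"
      by simp
    thus ?thesis using o by (simp add: distrib_right)
  qed
  have vj: "V 1 (Z s) = V (- 1) (Z s)" for s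
  proof -
    have "vp (vc (Z s)) = vm (vc (Z s))" "vp' (vc (Z s)) = vm' (vc (Z s))"
      using iface[of s] 1 2 unfolding two_phase_stokes_solution_def by blast+
    thus ?thesis by (simp add: V_def)
  qed
  have Z: "V \<sigma> z = 0 \<and> Q \<sigma> z = 0" if "\<sigma> = 1 \<or> \<sigma> = - 1" "z \<in> CS \<sigma>" for \<sigma> z
  proof (rule homogeneous_uniqueness[of \<mu> V a b Q, OF \<mu> _ _ _ _ vj T _ _ that])
    fix \<tau> :: real assume \<tau>: "\<tau> = 1 \<or> \<tau> = - 1"
    show "continuous_on (CS \<tau>) (V \<tau>) \<and> continuous_on (CS \<tau>) (a \<tau>) \<and> continuous_on (CS \<tau>) (b \<tau>) \<and> continuous_on (CS \<tau>) (Q \<tau>)"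
      "(\<lambda>z. of_real (Q \<tau> z) - 2 * of_real \<mu> * a \<tau> z) holomorphic_on Side \<tau>"
      "(V \<tau> \<longlongrightarrow> 0) (inf at_infinity (principal (CS \<tau>)))" "(Q \<tau> \<longlongrightarrow> 0) (inf at_infinity (principal (CS \<tau>)))"
      using d[OF \<tau>] unfolding stokes_data_def by blast+
    show "(V \<tau> has_derivative (\<lambda>h. a \<tau> z * h + b \<tau> z * cnj h)) (at z)" "Re (a \<tau> z) = 0" if "z \<in> Side \<tau>" for z
      using d[OF \<tau>] that unfolding stokes_data_def by blast+
  qed
  show "x \<in> closure (upper_domain f) \<Longrightarrow> vp' x = vp x \<and> qp' x = qp x"
    using Z[OF p, of "cx x"] by (simp add: domains closure_domain V_def Q_def cx_eq_iff)
  show "x \<in> closure (lower_domain f) \<Longrightarrow> vm' x = vm x \<and> qm' x = qm x"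
    using Z[OF m, of "cx x"] by (simp add: domains closure_domain V_def Q_def cx_eq_iff)
qed

end

end

section \<open>From Sobolev regularity to the theorem\<close>

lemma tendsto_at_infinity_bounded:
  fixes u :: "real \<Rightarrow> real"
  assumes "continuous_on UNIV u" "(u \<longlongrightarrow> 0) at_infinity"
  obtains M where "\<And>s. \<bar>u s\<bar> \<le> M"
proof -
  have "\<forall>\<^sub>F s in at_infinity. dist (u s) 0 < 1" using assms(2) by (rule tendstoD) simp
  then obtain b where b: "\<And>s. b \<le> norm s \<Longrightarrow> \<bar>u s\<bar> < 1" unfolding eventually_at_infinity by auto
  have "compact (u ` {-b..b})" by (intro compact_continuous_image continuous_on_subset[OF assms(1)]) auto
  hence "bounded (u ` {-b..b})" by (rule compact_imp_bounded)
  then obtain B where "\<forall>x\<in>u ` {-b..b}. norm x \<le> B" unfolding bounded_iff by blast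
  hence B: "\<bar>u s\<bar> \<le> B" if "s \<in> {-b..b}" for s using that by simp
  show ?thesis
  proof
    fix s
    consider "b \<le> norm s" | "s \<in> {-b..b}" by force
    thus "\<bar>u s\<bar> \<le> max 1 B"
    proof cases
      case 1 thus ?thesis using b[of s] by linarith
    next
      case 2 thus ?thesis using B[of s] by linarith
    qed
  qed
qed

text \<open>Hoelder continuity and square integrability make f' and f'' vanish at infinity; being
  continuous, they are bounded, and one M serves both.\<close>

lemma H3_graph_of_sobolev:
  assumes "f \<in> sobolev_H 3" "continuous_on UNIV f"
  obtains f1 M K f2 where "H3_graph f f1 M K f2"
proof -
  obtain f1 f2 K where f: "\<And>x. (f has_real_derivative f1 x) (at x)" "\<And>x. (f1 has_real_derivative f2 x) (at x)"
    "\<And>a b. \<bar>f1 a - f1 b\<bar> \<le> K * sqrt \<bar>a - b\<bar>" "\<And>a b. \<bar>f2 a - f2 b\<bar> \<le> K * sqrt \<bar>a - b\<bar>"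
    "integrable lborel (\<lambda>x. (f1 x)\<^sup>2)" "integrable lborel (\<lambda>x. (f2 x)\<^sup>2)"
    by (rule sobolev_H3_regularity[OF assms]) (rule that)
  have bounded: "\<exists>M. \<forall>s. \<bar>u s\<bar> \<le> M"
    if u: "\<And>a b. \<bar>u a - u b\<bar> \<le> K * sqrt \<bar>a - b\<bar>" "integrable lborel (\<lambda>x. (u x)\<^sup>2)" for u :: "real \<Rightarrow> real"
  proof -
    have c: "continuous_on UNIV u"
    proof (rule continuous_at_imp_continuous_on, intro ballI)
      fix s
      have "((\<lambda>t. u t - u s) \<longlongrightarrow> 0) (at s)"
      proof (rule Lim_null_comparison[where g = "\<lambda>t. K * sqrt \<bar>t - s\<bar>"])
        show "\<forall>\<^sub>F t in at s. norm (u t - u s) \<le> K * sqrt \<bar>t - s\<bar>"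
          unfolding real_norm_def by (intro always_eventually allI u(1))
        have "((\<lambda>t. K * sqrt \<bar>t - s\<bar>) \<longlongrightarrow> K * sqrt \<bar>s - s\<bar>) (at s)" by (intro tendsto_intros)
        thus "((\<lambda>t. K * sqrt \<bar>t - s\<bar>) \<longlongrightarrow> 0) (at s)" by simp
      qed
      thus "isCont u s" unfolding isCont_def by (rule LIM_zero_cancel)
    qed
    have [measurable]: "u \<in> borel_measurable borel" by (rule borel_measurable_continuous_onI[OF c])
    have "(u \<longlongrightarrow> 0) at_infinity" by (rule tendsto_0_of_holder_L2[of u K]) (simp_all add: u)
    then obtain M where "\<And>s. \<bar>u s\<bar> \<le> M" using tendsto_at_infinity_bounded[OF c] by blast
    thus ?thesis by blast
  qed
  obtain M1 where M1: "\<bar>f1 s\<bar> \<le> M1" for s using bounded[OF f(3,5)] by blast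
  obtain M2 where M2: "\<bar>f2 s\<bar> \<le> M2" for s using bounded[OF f(4,6)] by blast
  have "H3_graph f f1 (max M1 M2) K f2"
  proof
    show "\<bar>f1 s\<bar> \<le> max M1 M2" "\<bar>f2 s\<bar> \<le> max M1 M2" for s using M1[of s] M2[of s] by linarith+
  qed (rule f)+
  with that show ?thesis .
qed

theorem theorem2p1:
  fixes \<mu> \<sigma> :: real and f :: "real \<Rightarrow> real"
  assumes "\<mu> > 0" and "\<sigma> > 0"
    and "f \<in> sobolev_H 3" and "continuous_on UNIV f"
  shows
    "(\<forall>x k. x \<notin> interface f \<longrightarrow>
        integrable lborel (velocity_integrand \<mu> f x k) \<and>
        integrable lborel (pressure_integrand f x k)) \<and>
     (\<exists>vp qp vm qm.
        two_phase_stokes_solution \<mu> \<sigma> f vp qp vm qm \<and>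
        (\<forall>vp' qp' vm' qm'. two_phase_stokes_solution \<mu> \<sigma> f vp' qp' vm' qm' \<longrightarrow>
           (\<forall>x\<in>closure (upper_domain f). vp' x = vp x \<and> qp' x = qp x) \<and>
           (\<forall>x\<in>closure (lower_domain f). vm' x = vm x \<and> qm' x = qm x)) \<and>
        (\<forall>x\<in>upper_domain f.
           vp x = velocity_potential \<mu> \<sigma> f x \<and> qp x = pressure_potential \<sigma> f x) \<and>
        (\<forall>x\<in>lower_domain f.
           vm x = velocity_potential \<mu> \<sigma> f x \<and> qm x = pressure_potential \<sigma> f x))"
proof -
  obtain f1 M K f2 where "H3_graph f f1 M K f2"
    using H3_graph_of_sobolev[OF assms(3,4)] by metis
  then interpret H3_graph f f1 M K f2 .
  have p: "(1::real) = 1 \<or> (1::real) = - 1" and m: "- (1::real) = 1 \<or> - (1::real) = - 1" by simp_all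
  note ext = two_phase_extension[OF assms(1), of \<sigma>]
  note potentials = extension_potentials[OF assms(1) p, of _ \<sigma>, folded domains] extension_potentials[OF assms(1) m, of _ \<sigma>, folded domains]
  show ?thesis
  proof (intro conjI allI impI)
    fix x k assume "x \<notin> interface f"
    hence "cx x \<in> Up \<union> Lo" by (simp only: off_interface)
    thus "integrable lborel (velocity_integrand \<mu> f x k)" "integrable lborel (pressure_integrand f x k)"
      by (rule velocity_integrable, rule pressure_integrable)
  next
    show "\<exists>vp qp vm qm.
        two_phase_stokes_solution \<mu> \<sigma> f vp qp vm qm \<and>
        (\<forall>vp' qp' vm' qm'. two_phase_stokes_solution \<mu> \<sigma> f vp' qp' vm' qm' \<longrightarrow>
           (\<forall>x\<in>closure (upper_domain f). vp' x = vp x \<and> qp' x = qp x) \<and>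
           (\<forall>x\<in>closure (lower_domain f). vm' x = vm x \<and> qm' x = qm x)) \<and>
        (\<forall>x\<in>upper_domain f. vp x = velocity_potential \<mu> \<sigma> f x \<and> qp x = pressure_potential \<sigma> f x) \<and>
        (\<forall>x\<in>lower_domain f. vm x = velocity_potential \<mu> \<sigma> f x \<and> qm x = pressure_potential \<sigma> f x)"
    \<comment> \<open>The witnesses are the extensions, which have values on the graph; the
      integrals represent them off it.\<close>
    proof (intro exI conjI allI impI ballI)
      show "two_phase_stokes_solution \<mu> \<sigma> f (\<lambda>x. vc (ext_velocity \<mu> \<sigma> 1 (cx x))) (\<lambda>x. ext_pressure \<mu> \<sigma> 1 (cx x))
          (\<lambda>x. vc (ext_velocity \<mu> \<sigma> (- 1) (cx x))) (\<lambda>x. ext_pressure \<mu> \<sigma> (- 1) (cx x))"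
        by (rule ext)
    qed (use two_phase_unique[OF assms(1) ext] potentials in blast)+
  qed
qed

end
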